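(* (a) Let $F$ be an eternal solution for min-driven clustering. Then there is a divergent generating measure $H$ such that $G_t\to H$ as $t\downarrow0$, where $G_t(dx)=\dfrac{xF_t(dx)}{t\,\kappa^\#(t)}$. (b) Conversely, for every divergent generating measure $H$ there is a unique eternal solution $F$ such that $G_t\to H$ as $t\downarrow0$, with $G_t$ as in (a). (c) In either case, the Laplace exponent $\eta_H$ of $H$ is related to the min history $\ell(t)$ (the min of $F_t$) by $$\log\eta_H(q)=\int_0^1\big(1-e^{-q\ell(s)}\big)\frac{ds}{s}-\int_1^\infty e^{-q\ell(s)}\frac{ds}{s},\qquad q>0.$$
   Context: Fix $p_k\ge0$ ($k\ge1$) with $\sum_kp_k=1$ and $Q_1=\sum_kkp_k<\infty$; $Q(z)=\sum_kp_kz^k$. Probability measures $F$ on $\mathbb{R}_+=[0,\infty)$ are identified with distribution functions $F(x)=F([0,x])$; the min of $F$ is $\inf\{x:F(x)>0\}$. For an interval $J\subset(0,\infty)$, a weak solution for min-driven clustering on $J$ is a map $t\mapsto F_t$ from $J$ to probability measures on $\mathbb{R}_+$ such that: (1) $t\mapsto\int a\,dF_t$ is measurable for each $a\in C_0(\mathbb{R}_+)$ (continuous functions vanishing at infinity); (2) the min $\ell(t)$ of $F_t$ is positive and nondecreasing; (3) for each $a\in C_0(\mathbb{R}_+)$ and $t_0,t\in J$, $$\int a\,dF_t-\int a\,dF_{t_0}=\int_{t_0}^t\sum_{k\ge1}p_k\int_{\mathbb{R}_+^k}\Big[a\Big(\ell(s)+\sum_{i=1}^k y_i\Big)-a(\ell(s))\Big]\prod_{i=1}^kF_s(dy_i)\,\frac{ds}{Q_1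 s}.$$ An eternal solution is a weak solution defined on $J=(0,\infty)$. For $q\in(0,1)$ define $\kappa(q)>0$ by $-\log\kappa(q)=\int_0^{1-q}\big(\frac{Q_1}{1-Q(z)}-\frac1{1-z}\big)dz$ (slowly varying at $0$), and let $\kappa^\#$ be its de Bruijn conjugate: a function slowly varying at $0$ with $\kappa(q)\kappa^\#(q\kappa(q))\to1$ as $q\to0$. A generating measure is a measure $H$ on $[0,\infty)$ with $\int_{[0,\infty)}(1\wedge y^{-1})H(dy)<\infty$; write $H(x)=H([0,x])$. It is divergent if $H(\{0\})>0$ or $\int_{[0,\infty)}y^{-1}H(dy)=\infty$. Its Laplace exponent is $\eta_H(q)=\int_{[0,\infty)}\frac{1-e^{-qx}}{x}H(dx)$ (integrand equal to $q$ at $x=0$). Generating measures $H_n$ (or a family $G_t$) converge to a generating measure $H$ if at every point $x\in(0,\infty)$ of continuity of $H$, $H_n(x)\to H(x)$ and $\int_{[x,\infty)}y^{-1}H_n(dy)\to\int_{[x,\infty)}y^{-1}H(dy)$. *)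

theory Defs
  imports "HOL-Probability.Probability"
begin

definition Q1 :: "(nat \<Rightarrow> real) \<Rightarrow> real" where
  "Q1 p = infsum (\<lambda>k. real k * p k) {1..}"

definition Qgen :: "(nat \<Rightarrow> real) \<Rightarrow> real \<Rightarrow> real" where
  "Qgen p z = infsum (\<lambda>k. p k * z ^ k) {1..}"

definition admissible_p :: "(nat \<Rightarrow> real) \<Rightarrow> bool" where
  "admissible_p p \<longleftrightarrow> (\<forall>k\<ge>1. p k \<ge> 0) \<and> (p has_sum 1) {1..}
      \<and> (\<lambda>k. real k * p k) summable_on {1..}"

definition kappa :: "(nat \<Rightarrow> real) \<Rightarrow> real \<Rightarrow> real" where
  "kappa p q = exp (- (LBINT z=ereal 0..ereal (1 - q).
                         Q1 p / (1 - Qgen p z) - 1 / (1 - z)))"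

definition slowly_varying_at_0 :: "(real \<Rightarrow> real) \<Rightarrow> bool" where
  "slowly_varying_at_0 L \<longleftrightarrow>
     L \<in> borel_measurable (restrict_space borel {0<..})
   \<and> (\<forall>\<^sub>F x in at_right 0. L x > 0)
   \<and> (\<forall>c>0. ((\<lambda>x. L (c * x) / L x) \<longlongrightarrow> 1) (at_right 0))"

definition de_Bruijn_conjugate :: "(real \<Rightarrow> real) \<Rightarrow> (real \<Rightarrow> real) \<Rightarrow> bool" where
  "de_Bruijn_conjugate k ks \<longleftrightarrow> slowly_varying_at_0 ks
     \<and> ((\<lambda>q. k q * ks (q * k q)) \<longlongrightarrow> 1) (at_right 0)"

definition prob_Rplus :: "real measure \<Rightarrow> bool" where
  "prob_Rplus M \<longleftrightarrow> prob_space M \<and> sets M = sets borel \<and> emeasure M {..<0} = 0"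

definition min_of :: "real measure \<Rightarrow> real" where
  "min_of M = Inf {x. measure M {0..x} > 0}"

text \<open>C_0(R_+): functions on [0,oo) that are continuous and vanish at infinity.
  Represented as real functions on R that are 0 on the negative reals.\<close>
definition C0_Rplus :: "(real \<Rightarrow> real) set" where
  "C0_Rplus = {a. continuous_on {0..} a \<and> (a \<longlongrightarrow> 0) at_top \<and> (\<forall>x<0. a x = 0)}"

definition weak_solution ::
  "(nat \<Rightarrow> real) \<Rightarrow> real set \<Rightarrow> (real \<Rightarrow> real measure) \<Rightarrow> bool" where
  "weak_solution p J F \<longleftrightarrow>
     (\<forall>t\<in>J. prob_Rplus (F t))
   \<and> (\<forall>a\<in>C0_Rplus. (\<lambda>t. integral\<^sup>L (F t) a) \<in> borel_measurable (restrict_space borel J))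
   \<and> (\<forall>t\<in>J. min_of (F t) > 0)
   \<and> mono_on J (\<lambda>t. min_of (F t))
   \<and> (\<forall>a\<in>C0_Rplus. \<forall>t0\<in>J. \<forall>t\<in>J.
        integral\<^sup>L (F t) a - integral\<^sup>L (F t0) a =
        (LBINT s=ereal t0..ereal t.
           (\<Sum>k. p (Suc k) *
              (\<integral>y. a (min_of (F s) + (\<Sum>i<Suc k. y i)) - a (min_of (F s))
                 \<partial>(PiM {..<Suc k} (\<lambda>_. F s))))
           / (Q1 p * s)))"

definition eternal_solution :: "(nat \<Rightarrow> real) \<Rightarrow> (real \<Rightarrow> real measure) \<Rightarrow> bool" where
  "eternal_solution p F \<longleftrightarrow> weak_solution p {0<..} F"

definition generating_measure :: "real measure \<Rightarrow> bool" where
  "generating_measure H \<longleftrightarrow> sets H = sets borel \<and> emeasure H {..<0} = 0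
     \<and> (\<integral>\<^sup>+ y. min 1 (inverse (ennreal y)) \<partial>H) < \<top>"

definition divergent :: "real measure \<Rightarrow> bool" where
  "divergent H \<longleftrightarrow> emeasure H {0} > 0 \<or> (\<integral>\<^sup>+ y. inverse (ennreal y) \<partial>H) = \<top>"

definition laplace_exponent :: "real measure \<Rightarrow> real \<Rightarrow> real" where
  "laplace_exponent H q = (\<integral>x. (if x = 0 then q else (1 - exp (- q * x)) / x) \<partial>H)"

definition gm_converges ::
  "('i \<Rightarrow> real measure) \<Rightarrow> real measure \<Rightarrow> 'i filter \<Rightarrow> bool" where
  "gm_converges G H Fl \<longleftrightarrow>
     (\<forall>x>0. isCont (\<lambda>y. measure H {0..y}) x \<longrightarrow>
        ((\<lambda>t. emeasure (G t) {0..x}) \<longlongrightarrow> emeasure H {0..x}) Fl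
      \<and> ((\<lambda>t. \<integral>\<^sup>+ y\<in>{x..}. inverse (ennreal y) \<partial>(G t))
           \<longlongrightarrow> (\<integral>\<^sup>+ y\<in>{x..}. inverse (ennreal y) \<partial>H)) Fl)"

definition Gt :: "(real \<Rightarrow> real measure) \<Rightarrow> (real \<Rightarrow> real) \<Rightarrow> real \<Rightarrow> real measure" where
  "Gt F ks t = density (F t) (\<lambda>x. ennreal (x / (t * ks t)))"

end

theory Submission
  imports Defs "HOL-Real_Asymp.Real_Asymp"
begin

text \<open>Write \<open>f t q\<close> for the Laplace transform of \<open>F t\<close> and \<open>g z\<close> for the integral of \<open>Q1 / (1 - Q)\<close>
over \<open>[0, z]\<close>. The weak equation becomes \<open>(g (f t q))' = - exp (- q * l t) / t\<close>, so that \<open>g (f t q)\<close> is the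
integral of \<open>exp (- q * l s) / s\<close> over \<open>s > t\<close>, and hence \<open>- (g (f t q) + ln t)\<close> tends to the right-hand side
\<open>K q\<close> of (c) as \<open>t\<close> tends to 0. Since \<open>q * kappa q = exp (- g (1 - q))\<close>, this means that
\<open>(1 - f t q) / (t * ks t)\<close>, which is the Laplace exponent of \<open>Gt F ks t\<close>, tends to \<open>exp (K q)\<close>; the continuity
theorem for Laplace transforms, applied after an exponential tilt that makes everything a probability
measure, gives (a) and (c). Differences of \<open>K\<close> are Laplace transforms of the image of \<open>ds / s\<close> under \<open>l\<close>, so
\<open>H\<close> determines \<open>l\<close> almost everywhere and therefore \<open>F\<close>. For existence, \<open>1 - eta / N\<close> with \<open>N\<close> large is,
up to rounding to a lattice, the Laplace transform of a probability measure; started from it, an Euler scheme in which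
in each step a mass at most \<open>e\<close> of minimal clusters merges yields approximate histories, which are
compact by Helly's theorem because \<open>K\<close> controls their tails at both ends.\<close>

section \<open>Laplace transforms of probability measures on the half-line\<close>

text \<open>Why \<open>g\<close> is close to a logarithm: finiteness of \<open>Q1 p\<close> makes
  \<open>1 - Qgen p z\<close> asymptotic to \<open>Q1 p * (1 - z)\<close> at 1, hence
  \<open>g (1 - x) - g (1 - y)\<close> is \<open>ln (y / x)\<close> up to a small relative error.
  Convergence of differences of \<open>g\<close> is thus convergence of ratios, and with
  \<open>psi\<close> defined by \<open>g (1 - psi t) = - ln t\<close> the quantity
  \<open>t * ks t\<close> is asymptotic to \<open>psi t\<close>. Histories are monotone but may
  jump, so the chain rule for \<open>g\<close> is replaced by increments with an error quadratic in
  the time step. The function \<open>K\<close> is a difference of two nonnegative integrals, and a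
  bound on \<open>K q\<close> alone bounds neither; comparing \<open>q\<close> with
  \<open>2 * q\<close> is what separates them. In the existence proof a limit of histories could
  degenerate in three ways: it may become infinite, it may vanish on an initial interval, or a
  contribution to \<open>K\<close> may concentrate at time 0. These are excluded by the Laplace
  exponent tending to 0 at 0, by its being unbounded (divergence of \<open>H\<close>), and by its
  growing at most linearly.\<close>

definition lap :: "real measure \<Rightarrow> real \<Rightarrow> real" where
  "lap M q = (\<integral>x. exp (- q * x) \<partial>M)"

text \<open>Bernstein polynomials reduce everything to the functions
  \<open>x ^ k * (1 - x) ^ j\<close>, which lie in the span of the powers. The case
  \<open>m = 1\<close> serves test functions vanishing at infinity: under
  \<open>u = exp (- x)\<close> infinity becomes 0, and the exponentials \<open>exp (- k * x)\<close>
  with \<open>k \<ge> 1\<close> become the powers with \<open>k \<ge> 1\<close>.\<close>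

lemma continuous_induct_unit_interval [consumes 1, case_names bot pow add scale lim]:
  fixes h :: "real \<Rightarrow> real" and m :: nat
  assumes h: "continuous_on {0..1} h"
    and m: "m = 0 \<or> (m = 1 \<and> h 0 = 0)"
    and pow: "\<And>k. k \<ge> m \<Longrightarrow> P (\<lambda>x. x ^ k)"
    and add: "\<And>f g. P f \<Longrightarrow> P g \<Longrightarrow> P (\<lambda>x. f x + g x)"
    and scale: "\<And>c f. P f \<Longrightarrow> P (\<lambda>x. c * f x)"
    and lim: "\<And>h. continuous_on {0..1} h \<Longrightarrow> (\<And>e. e > 0 \<Longrightarrow> \<exists>f. P f \<and> (\<forall>x\<in>{0..1}. \<bar>h x - f x\<bar> < e)) \<Longrightarrow> P h"
  shows "P h"
proof (rule lim[OF h])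
  fix e :: real assume "e > 0"
  have kx: "P (\<lambda>x. x ^ k * (1 - x) ^ j)" if "k \<ge> m" for k j
    using that
  proof (induction j arbitrary: k)
    case 0 then show ?case using pow[of k] by simp
  next
    case (Suc j)
    have "P (\<lambda>x. x ^ k * (1 - x) ^ j + (-1) * (x ^ (Suc k) * (1 - x) ^ j))"
      using Suc by (intro add scale Suc.IH) auto
    also have "(\<lambda>x::real. x ^ k * (1 - x) ^ j + (-1) * (x ^ (Suc k) * (1 - x) ^ j)) = (\<lambda>x. x ^ k * (1 - x) ^ Suc j)"
      by (auto simp: algebra_simps)
    finally show ?case .
  qed
  have zero: "P (\<lambda>x. 0)" using scale[OF pow[of m], of 0] by simp
  obtain N where N: "\<And>n x. N \<le> n \<Longrightarrow> x \<in> {0..1} \<Longrightarrow> \<bar>h x - (\<Sum>k\<le>n. h (real k / real n) * Bernstein n k x)\<bar> < e"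
    using Bernstein_Weierstrass[OF h \<open>e > 0\<close>] by blast
  have "P (\<lambda>x. \<Sum>k\<le>j. h (real k / real N) * Bernstein N k x)" for j
  proof (induction j)
    case 0
    \<comment> \<open>The term of index 0 is not a combination of positive powers; for
      \<open>m = 1\<close> it disappears because \<open>h 0 = 0\<close>.\<close>
    have "P (\<lambda>x. h 0 * (x ^ 0 * (1 - x) ^ N))"
    proof (cases "m = 0")
      case True then show ?thesis by (intro scale kx) auto
    next
      case False then show ?thesis using m zero by simp
    qed
    then show ?case by (simp add: Bernstein_def)
  next
    case (Suc j)
    have "P (\<lambda>x. (h (real (Suc j) / real N) * real (N choose (Suc j))) * (x ^ Suc j * (1 - x) ^ (N - Suc j)))"
      using m by (intro scale kx) auto
    then have "P (\<lambda>x. h (real (Suc j) / real N) * Bernstein N (Suc j) x)"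
      by (simp add: Bernstein_def mult.assoc)
    from add[OF Suc.IH this] show ?case by simp
  qed
  then have "P (\<lambda>x. \<Sum>k\<le>N. h (real k / real N) * Bernstein N k x)" .
  then show "\<exists>f. P f \<and> (\<forall>x\<in>{0..1}. \<bar>h x - f x\<bar> < e)" using N[OF order_refl] by blast
qed

lemma prob_RplusD:
  assumes "prob_Rplus M"
  shows "prob_space M" "sets M = sets borel" "space M = UNIV" "AE x in M. 0 \<le> x" "real_distribution M"
proof -
  show p: "prob_space M" and s: "sets M = sets borel" using assms by (auto simp: prob_Rplus_def)
  show sp: "space M = UNIV" using sets_eq_imp_space_eq[OF s] by simp
  have "{..<0::real} \<in> null_sets M" using assms s by (auto simp: prob_Rplus_def null_sets_def)
  from AE_not_in[OF this] show "AE x in M. 0 \<le> x" by eventually_elim auto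
  show "real_distribution M" using p s by (simp add: real_distribution_def real_distribution_axioms_def)
qed

lemma prob_Rplus_integrable:
  assumes "prob_Rplus M" "h \<in> borel_measurable borel" "\<And>x. x \<ge> 0 \<Longrightarrow> \<bar>h x\<bar> \<le> B"
  shows "integrable M (h :: real \<Rightarrow> real)"
proof -
  interpret prob_space M using prob_RplusD[OF assms(1)] by simp
  show ?thesis
  proof (rule integrable_const_bound)
    show "h \<in> borel_measurable M" using assms(2) prob_RplusD(2)[OF assms(1)] measurable_cong_sets by blast
    show "AE x in M. norm (h x) \<le> B" using prob_RplusD(4)[OF assms(1)] by eventually_elim (use assms(3) in auto)
  qed
qed

lemma lap_integrable:
  assumes "prob_Rplus M" "q \<ge> 0"
  shows "integrable M (\<lambda>x. exp (- q * x))"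
  using assms by (intro prob_Rplus_integrable[where B=1]) auto

lemma prob_Rplus_integral_bounds:
  assumes M: "prob_Rplus M" and h: "h \<in> borel_measurable borel" and lo: "\<And>x. x \<ge> 0 \<Longrightarrow> a \<le> h x" and up: "\<And>x. x \<ge> 0 \<Longrightarrow> h x \<le> b"
  shows "a \<le> integral\<^sup>L M h" "integral\<^sup>L M h \<le> (b::real)"
proof -
  interpret prob_space M using prob_RplusD[OF M] by simp
  have i: "integrable M h"
    by (rule prob_Rplus_integrable[OF M h, where B="max \<bar>a\<bar> \<bar>b\<bar>"]) (use lo up in force)
  have "AE x in M. a \<le> h x \<and> h x \<le> b" using prob_RplusD(4)[OF M] by eventually_elim (use lo up in auto)
  then show "a \<le> integral\<^sup>L M h" "integral\<^sup>L M h \<le> b"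
    by (auto intro!: integral_ge_const integral_le_const i elim: eventually_mono)
qed

lemma lap_pos: assumes "prob_Rplus M" "q \<ge> 0" shows "lap M q > 0"
proof -
  interpret prob_space M using prob_RplusD[OF assms(1)] by simp
  have "lap M q \<ge> 0" unfolding lap_def by simp
  moreover have "lap M q \<noteq> 0"
  proof
    assume "lap M q = 0"
    then have "AE x in M. exp (- q * x) = 0" unfolding lap_def
      by (subst (asm) integral_nonneg_eq_0_iff_AE) (use lap_integrable[OF assms] in auto)
    then show False by simp
  qed
  ultimately show ?thesis by linarith
qed

lemma lap_le_1: assumes "prob_Rplus M" "q \<ge> 0" shows "lap M q \<le> 1"
  unfolding lap_def using assms by (intro prob_Rplus_integral_bounds(2)[where a=0]) auto

lemma lap_0: "prob_Rplus M \<Longrightarrow> lap M 0 = 1"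
  using prob_space.prob_space[of M] by (simp add: lap_def prob_RplusD)

lemma lap_antimono: assumes "prob_Rplus M" "0 \<le> q" "q \<le> r" shows "lap M r \<le> lap M q"
  unfolding lap_def
  by (intro integral_mono_AE lap_integrable assms eventually_mono[OF prob_RplusD(4)[OF assms(1)]])
     (use assms in \<open>auto intro!: mult_right_mono\<close>)

lemma lap_tendsto_1:
  assumes "prob_Rplus M" shows "(lap M \<longlongrightarrow> 1) (at_right 0)"
proof -
  interpret prob_space M using prob_RplusD[OF assms] by simp
  have "((\<lambda>q. \<integral>x. exp (- q * x) \<partial>M) \<longlongrightarrow> (\<integral>x. exp (- 0 * x) \<partial>M)) (at_right 0)"
  proof (rule tendsto_at_right_sequentially[where b=1])
    fix S :: "nat \<Rightarrow> real" assume S: "\<And>n. 0 < S n" "S \<longlonglongrightarrow> 0"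
    show "(\<lambda>n. \<integral>x. exp (- S n * x) \<partial>M) \<longlonglongrightarrow> (\<integral>x. exp (- 0 * x) \<partial>M)"
    proof (rule integral_dominated_convergence[where w="\<lambda>_. 1"])
      show "AE x in M. (\<lambda>n. exp (- S n * x)) \<longlonglongrightarrow> exp (- 0 * x)"
        by (intro AE_I2 tendsto_intros S)
      show "AE x in M. norm (exp (- S n * x)) \<le> 1" for n
        using prob_RplusD(4)[OF assms] by eventually_elim (use S(1)[of n] in auto)
    qed (auto simp: measurable_cong_sets[OF prob_RplusD(2)[OF assms] refl])
  qed auto
  then show ?thesis using prob_space unfolding lap_def[abs_def] by simp
qed

text \<open>The values at integers are the moments of \<open>exp (- x)\<close>, and by Weierstrass
  they determine the integral of every continuous function of it. Writing \<open>max 0 x\<close>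
  keeps the argument in the unit interval on the whole line and changes nothing almost
  everywhere.\<close>

lemma laplace_integral_eq:
  fixes h :: "real \<Rightarrow> real"
  assumes M: "prob_Rplus M" and N: "prob_Rplus N"
    and eq: "\<And>n::nat. n \<ge> 1 \<Longrightarrow> lap M (real n) = lap N (real n)"
    and h: "continuous_on {0..1} h"
  shows "(\<integral>x. h (exp (- max 0 x)) \<partial>M) = (\<integral>x. h (exp (- max 0 x)) \<partial>N)"
proof -
  have ms: "(\<lambda>x::real. f (exp (- max 0 x))) \<in> borel_measurable borel" if "continuous_on {0..1} f" for f :: "real \<Rightarrow> real"
    by (intro borel_measurable_continuous_onI continuous_on_compose2[OF that]) (auto intro!: continuous_intros)
  have int: "integrable L (\<lambda>x. f (exp (- max 0 x)))" if L: "prob_Rplus L" and "continuous_on {0..1} f" for L and f :: "real \<Rightarrow> real"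
  proof -
    have "bounded (f ` {0..1})" using that by (intro compact_imp_bounded compact_continuous_image) auto
    then obtain B where "\<And>x. x \<in> {0..1} \<Longrightarrow> norm (f x) \<le> B" unfolding bounded_iff by blast
    then show ?thesis by (intro prob_Rplus_integrable[OF L, where B=B] ms that) auto
  qed
  define P where "P f \<longleftrightarrow> continuous_on {0..1} f \<and> (\<integral>x. f (exp (- max 0 x)) \<partial>M) = (\<integral>x. f (exp (- max 0 x)) \<partial>N)" for f :: "real \<Rightarrow> real"
  have "P h"
    using h
  proof (rule continuous_induct_unit_interval[where m=0])
    fix k :: nat
    have a: "(\<integral>x. (exp (- max 0 x)) ^ k \<partial>L) = lap L (real k)" if L: "prob_Rplus L" for L
      unfolding lap_def
    proof (rule integral_cong_AE)
      show "AE x in L. exp (- max 0 x) ^ k = exp (- real k * x)"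
        using prob_RplusD(4)[OF L] by eventually_elim (auto simp: exp_of_nat_mult[symmetric])
    qed (auto simp: measurable_cong_sets[OF prob_RplusD(2)[OF L] refl])
    have "lap M (real k) = lap N (real k)" using eq[of k] lap_0 M N by (cases "k = 0") auto
    then show "P (\<lambda>x. x ^ k)" unfolding P_def a[OF M] a[OF N] by (auto intro!: continuous_intros)
  next
    fix f g assume "P f" "P g" then show "P (\<lambda>x. f x + g x)"
      unfolding P_def using int[OF M] int[OF N] by (auto intro!: continuous_intros)
  next
    fix c f assume "P f" then show "P (\<lambda>x. c * f x)"
      unfolding P_def by (auto intro!: continuous_intros)
  next
    fix h assume c: "continuous_on {0..1} h" and a: "\<And>e. e > 0 \<Longrightarrow> \<exists>f. P f \<and> (\<forall>x\<in>{0..1}. \<bar>h x - f x\<bar> < e)"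
    have "\<bar>(\<integral>x. h (exp (- max 0 x)) \<partial>M) - (\<integral>x. h (exp (- max 0 x)) \<partial>N)\<bar> \<le> 0 + e" if "e > 0" for e
    proof -
      obtain f where f: "P f" "\<And>x. x \<in> {0..1} \<Longrightarrow> \<bar>h x - f x\<bar> < e / 2" using a[of "e / 2"] \<open>e > 0\<close> by auto
      have cf: "continuous_on {0..1} f" using f(1) by (simp add: P_def)
      have d: "\<bar>(\<integral>x. h (exp (- max 0 x)) \<partial>L) - (\<integral>x. f (exp (- max 0 x)) \<partial>L)\<bar> \<le> e / 2" if L: "prob_Rplus L" for L
      proof -
        have "\<bar>(\<integral>x. h (exp (- max 0 x)) \<partial>L) - (\<integral>x. f (exp (- max 0 x)) \<partial>L)\<bar> = \<bar>(\<integral>x. h (exp (- max 0 x)) - f (exp (- max 0 x)) \<partial>L)\<bar>"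
          using int[OF L] c cf by simp
        also have "\<dots> \<le> e / 2"
        proof -
          have lo: "- (e/2) \<le> h (exp (- max 0 x)) - f (exp (- max 0 x))" and up: "h (exp (- max 0 x)) - f (exp (- max 0 x)) \<le> e/2" for x
          proof -
            have "\<bar>h (exp (- max 0 x)) - f (exp (- max 0 x))\<bar> < e / 2" by (rule f(2)) simp
            then show "- (e/2) \<le> h (exp (- max 0 x)) - f (exp (- max 0 x))" "h (exp (- max 0 x)) - f (exp (- max 0 x)) \<le> e/2"
              by linarith+
          qed
          have m: "(\<lambda>x. h (exp (- max 0 x)) - f (exp (- max 0 x))) \<in> borel_measurable borel" using ms[OF c] ms[OF cf] by simp
          show ?thesis using prob_Rplus_integral_bounds[OF L m lo up] by auto
        qed
        finally show ?thesis .
      qed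
      show ?thesis using d[OF M] d[OF N] f(1) unfolding P_def by linarith
    qed
    then have "\<bar>(\<integral>x. h (exp (- max 0 x)) \<partial>M) - (\<integral>x. h (exp (- max 0 x)) \<partial>N)\<bar> \<le> 0"
      by (rule field_le_epsilon)
    then show "P h" using c unfolding P_def by auto
  qed auto
  then show ?thesis by (simp add: P_def)
qed

text \<open>Cosine and sine of \<open>t * exp (- x)\<close> are covered by the preceding lemma, so
  the images under \<open>exp (- x)\<close> have equal characteristic functions; the measures are
  recovered from the images by \<open>- ln\<close>.\<close>

lemma laplace_uniqueness:
  assumes M: "prob_Rplus M" and N: "prob_Rplus N"
    and eq: "\<And>n::nat. n \<ge> 1 \<Longrightarrow> lap M (real n) = lap N (real n)"
  shows "M = N"
proof -
  let ?e = "\<lambda>x::real. exp (- max 0 x)"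
  have me: "?e \<in> borel_measurable L" if "prob_Rplus L" for L
    by (simp add: measurable_cong_sets[OF prob_RplusD(2)[OF that] refl])
  have rd: "real_distribution (distr L borel ?e)" if L: "prob_Rplus L" for L
  proof -
    interpret prob_space L using prob_RplusD[OF L] by simp
    show ?thesis using prob_space_distr[OF me[OF L]] by (simp add: real_distribution_def real_distribution_axioms_def)
  qed
  have ch: "char (distr L borel ?e) t = Complex (\<integral>x. cos (t * ?e x) \<partial>L) (\<integral>x. sin (t * ?e x) \<partial>L)" if L: "prob_Rplus L" for L t
  proof -
    interpret prob_space L using prob_RplusD[OF L] by simp
    have me': "?e \<in> measurable L borel" using me[OF L] .
    have m: "(\<lambda>x. iexp (t * ?e x)) \<in> borel_measurable L"
      using me[OF L] by measurable
    have i: "integrable L (\<lambda>x. iexp (t * ?e x))"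
      by (rule integrable_const_bound[where B=1]) (use m in auto)
    have "char (distr L borel ?e) t = (CLINT x|L. iexp (t * ?e x))"
      unfolding char_def by (subst integral_distr[OF me']) auto
    also have "\<dots> = Complex (\<integral>x. cos (t * ?e x) \<partial>L) (\<integral>x. sin (t * ?e x) \<partial>L)"
      using i by (intro complex_eqI) (simp_all del: integral_complex_of_real integral_Re integral_Im add: integral_Re[symmetric] integral_Im[symmetric] Re_exp Im_exp)
    finally show ?thesis .
  qed
  have "char (distr M borel ?e) = char (distr N borel ?e)"
  proof
    fix t
    have "(\<integral>x. cos (t * ?e x) \<partial>M) = (\<integral>x. cos (t * ?e x) \<partial>N)" "(\<integral>x. sin (t * ?e x) \<partial>M) = (\<integral>x. sin (t * ?e x) \<partial>N)"
      by (rule laplace_integral_eq[OF M N eq]; auto intro!: continuous_intros)+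
    then show "char (distr M borel ?e) t = char (distr N borel ?e) t" by (simp add: ch M N)
  qed
  then have eqd: "distr M borel ?e = distr N borel ?e" by (intro Levy_uniqueness rd M N)
  have inv: "distr (distr L borel ?e) borel (\<lambda>u. - ln u) = L" if L: "prob_Rplus L" for L
  proof -
    have "distr (distr L borel ?e) borel (\<lambda>u. - ln u) = distr L borel ((\<lambda>u. - ln u) \<circ> ?e)"
      using me[OF L] by (intro distr_distr) auto
    also have "\<dots> = distr L borel (\<lambda>x. max 0 x)" by (simp add: comp_def)
    also have "\<dots> = distr L L (\<lambda>x. x)"
    proof (rule distr_cong_AE)
      show "AE x in L. max 0 x = x" using prob_RplusD(4)[OF L] by eventually_elim auto
      show "(\<lambda>x. max 0 x) \<in> measurable L borel" by (simp add: measurable_cong_sets[OF prob_RplusD(2)[OF L] refl])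
      show "(\<lambda>x. x) \<in> measurable L L" by (rule measurable_ident_sets) simp
    qed (simp_all add: prob_RplusD(2)[OF L])
    also have "\<dots> = L" by (rule distr_id)
    finally show ?thesis .
  qed
  show ?thesis by (rule trans[OF inv[OF M, symmetric, unfolded eqd] inv[OF N]])
qed

section \<open>Weak convergence and Laplace transforms: the continuity theorem\<close>

lemma weak_conv_lap:
  assumes M: "\<And>n. prob_Rplus (\<mu> n)" and N: "real_distribution N" and w: "weak_conv_m \<mu> N"
  shows "prob_Rplus N" "q > 0 \<Longrightarrow> (\<lambda>n. lap (\<mu> n) q) \<longlonglongrightarrow> lap N q"
proof -
  interpret N: real_distribution N by (rule N)
  \<comment> \<open>A bounded continuous test function that is zero exactly on the half-line: its
    integrals vanish along the sequence, hence in the limit, which therefore has no mass on the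
    negative reals.\<close>
  let ?h = "\<lambda>x::real. max (-1) (min 0 x)"
  have "(\<lambda>n. integral\<^sup>L (\<mu> n) ?h) \<longlonglongrightarrow> integral\<^sup>L N ?h"
    by (rule weak_conv_imp_integral_bdd_continuous_conv[where B=1]) (use M prob_RplusD w N in \<open>auto intro!: continuous_intros\<close>)
  moreover have "integral\<^sup>L (\<mu> n) ?h = 0" for n
  proof -
    have "integral\<^sup>L (\<mu> n) ?h = integral\<^sup>L (\<mu> n) (\<lambda>x. 0)"
    proof (rule integral_cong_AE)
      show "AE x in \<mu> n. ?h x = 0" using prob_RplusD(4)[OF M[of n]] by eventually_elim auto
    qed (auto simp: measurable_cong_sets[OF prob_RplusD(2)[OF M[of n]] refl])
    then show ?thesis by simp
  qed
  ultimately have "(\<lambda>n::nat. 0) \<longlonglongrightarrow> integral\<^sup>L N ?h" by simp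
  then have z: "integral\<^sup>L N (\<lambda>x. - ?h x) = 0" by (simp add: LIMSEQ_const_iff)
  have "AE x in N. - ?h x = 0"
  proof (subst integral_nonneg_eq_0_iff_AE[symmetric])
    show "integrable N (\<lambda>x. - ?h x)" by (rule N.integrable_const_bound[where B=1]) auto
  qed (use z in auto)
  then have AE: "AE x in N. x \<ge> 0" by eventually_elim (auto simp: max_def min_def split: if_splits)
  then have "emeasure N {..<0} = 0" by (subst (asm) AE_iff_measurable[where N="{..<0}"]) auto
  then show N': "prob_Rplus N" unfolding prob_Rplus_def by (auto intro: N.prob_space_axioms)
  assume q: "q > 0"
  let ?k = "\<lambda>x::real. exp (- q * max 0 x)"
  have "(\<lambda>n. integral\<^sup>L (\<mu> n) ?k) \<longlonglongrightarrow> integral\<^sup>L N ?k"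
    by (rule weak_conv_imp_integral_bdd_continuous_conv[where B=1]) (use M prob_RplusD w N q in \<open>auto intro!: continuous_intros\<close>)
  moreover have "integral\<^sup>L L ?k = lap L q" if L: "prob_Rplus L" for L
    unfolding lap_def
  proof (rule integral_cong_AE)
    show "AE x in L. ?k x = exp (- q * x)" using prob_RplusD(4)[OF L] by eventually_elim auto
  qed (auto simp: measurable_cong_sets[OF prob_RplusD(2)[OF L] refl])
  ultimately show "(\<lambda>n. lap (\<mu> n) q) \<longlonglongrightarrow> lap N q" using M N' by simp
qed

text \<open>For \<open>x > b\<close> the quantity \<open>1 - exp (- x / b)\<close> is at least
  \<open>1 - exp (- 1)\<close>.\<close>

lemma lap_tail_bound:
  assumes M: "prob_Rplus M" and b: "b > 0"
  shows "measure M {b<..} * (1 - exp (-1)) \<le> 1 - lap M (1 / b)"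
proof -
  interpret prob_space M using prob_RplusD[OF M] by simp
  have s: "{b<..} \<in> sets M" using prob_RplusD[OF M] by simp
  have i: "integrable M (\<lambda>x. exp (- (1/b) * x))" using b by (intro lap_integrable[OF M]) auto
  have "measure M {b<..} * (1 - exp (-1)) = (\<integral>x. (1 - exp (-1)) * indicator {b<..} x \<partial>M)"
    using s by simp
  also have "\<dots> \<le> (\<integral>x. 1 - exp (- (1/b) * x) \<partial>M)"
  proof (rule integral_mono_AE)
    show "integrable M (\<lambda>x. (1 - exp (-1)) * indicator {b<..} x :: real)"
    proof (rule integrable_const_bound[where B=1])
      show "AE x in M. norm ((1 - exp (-1)) * indicator {b<..} x :: real) \<le> 1" by (intro AE_I2) (simp add: indicator_def)
      show "(\<lambda>x. (1 - exp (-1)) * indicator {b<..} x :: real) \<in> borel_measurable M" using s by (intro borel_measurable_times borel_measurable_indicator) auto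
    qed
    show "integrable M (\<lambda>x. 1 - exp (- (1/b) * x))" using i by auto
    show "AE x in M. (1 - exp (- 1)) * indicator {b<..} x \<le> 1 - exp (- (1 / b) * x)"
      using prob_RplusD(4)[OF M] by eventually_elim (use b in \<open>auto simp: indicator_def field_simps\<close>)
  qed
  also have "\<dots> = 1 - lap M (1/b)" using i prob_space by (simp add: lap_def)
  finally show ?thesis .
qed

text \<open>If the limit tends to 1 at 0, a single \<open>q\<close> bounds the tails of all but
  finitely many measures through \<open>lap_tail_bound\<close>; each remaining one has its own
  bound, since its transform tends to 1 as well.\<close>

lemma lap_tight:
  assumes M: "\<And>n. prob_Rplus (\<mu> n)" and w: "\<And>q. q > 0 \<Longrightarrow> (\<lambda>n. lap (\<mu> n) q) \<longlonglongrightarrow> w q"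
    and w1: "(w \<longlongrightarrow> 1) (at_right 0)"
  shows "tight \<mu>"
  unfolding tight_def
proof (intro conjI allI impI)
  show "real_distribution (\<mu> n)" for n using M prob_RplusD by blast
  fix \<epsilon> :: real assume e: "\<epsilon> > 0"
  let ?c = "1 - exp (-1) :: real"
  have c: "?c > 0" by simp
  have "\<forall>\<^sub>F q in at_right 0. w q > 1 - \<epsilon> * ?c"
    using w1 e c by (intro order_tendstoD(1)[OF w1]) auto
  then obtain q where q: "q > 0" "w q > 1 - \<epsilon> * ?c"
    unfolding eventually_at_right_field by (metis dense)
  from order_tendstoD(1)[OF w[OF q(1)] q(2)] obtain N where N: "\<And>n. n \<ge> N \<Longrightarrow> lap (\<mu> n) q > 1 - \<epsilon> * ?c"
    unfolding eventually_sequentially by blast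
  have "\<exists>b>0. lap (\<mu> n) (1/b) > 1 - \<epsilon> * ?c" for n
  proof -
    have "\<forall>\<^sub>F q in at_right 0. lap (\<mu> n) q > 1 - \<epsilon> * ?c"
      using e c by (intro order_tendstoD(1)[OF lap_tendsto_1[OF M]]) auto
    then obtain q where "q > 0" "lap (\<mu> n) q > 1 - \<epsilon> * ?c"
      unfolding eventually_at_right_field by (metis dense)
    then show ?thesis by (intro exI[of _ "1/q"]) auto
  qed
  then obtain b where b: "\<And>n. b n > 0" "\<And>n. lap (\<mu> n) (1 / b n) > 1 - \<epsilon> * ?c" by metis
  define B where "B = Max (insert (1/q) (b ` {..<N}))"
  have B: "B \<ge> 1/q" "\<And>n. n < N \<Longrightarrow> B \<ge> b n" unfolding B_def by auto
  have Bp: "B > 0" using B(1) q(1) by (meson less_le_trans zero_less_divide_1_iff)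
  have "1 - \<epsilon> < measure (\<mu> n) {-1<..B}" for n
  proof -
    interpret prob_space "\<mu> n" using prob_RplusD[OF M[of n]] by simp
    obtain r where r: "r > 0" "lap (\<mu> n) r > 1 - \<epsilon> * ?c" "1/B \<le> r"
    proof (cases "n < N")
      case True
      then have "1 / B \<le> 1 / b n" using B(2)[OF True] b(1)[of n] by (simp add: frac_le)
      then show ?thesis using b[of n] by (intro that[of "1/b n"]) auto
    next
      case False
      have "1 / B \<le> 1 / (1/q)" using B(1) q(1) by (intro frac_le) auto
      then show ?thesis using N[of n] False q by (intro that[of q]) auto
    qed
    have "lap (\<mu> n) r \<le> lap (\<mu> n) (1/B)" using r Bp by (intro lap_antimono M) auto
    then have "measure (\<mu> n) {B<..} * ?c < \<epsilon> * ?c"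
      using lap_tail_bound[OF M Bp, of n] r(2) by linarith
    then have t: "measure (\<mu> n) {B<..} < \<epsilon>" using c by (simp add: mult_less_cancel_right)
    have s: "sets (\<mu> n) = sets borel" "space (\<mu> n) = UNIV" using prob_RplusD[OF M[of n]] by auto
    have "measure (\<mu> n) ({-1<..B} \<union> {B<..}) = 1"
    proof (rule prob_eq_1[THEN iffD2])
      show "AE x in \<mu> n. x \<in> {-1<..B} \<union> {B<..}" using prob_RplusD(4)[OF M[of n]] by eventually_elim auto
    qed (simp add: s)
    moreover have "measure (\<mu> n) ({-1<..B} \<union> {B<..}) \<le> measure (\<mu> n) {-1<..B} + measure (\<mu> n) {B<..}"
      by (rule measure_Un_le) (auto simp: s)
    ultimately show ?thesis using t by linarith
  qed
  then show "\<exists>a b. a < b \<and> (\<forall>n. 1 - \<epsilon> < measure (\<mu> n) {a<..b})"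
    using Bp by (intro exI[of _ "-1"] exI[of _ B]) auto
qed

text \<open>By tightness it is enough to identify the subsequential limits, and their transforms at
  the integers determine them.\<close>

lemma laplace_weak_conv:
  assumes M: "\<And>n. prob_Rplus (\<mu> n)" and N: "prob_Rplus N"
    and w: "\<And>q. q > 0 \<Longrightarrow> (\<lambda>n. lap (\<mu> n) q) \<longlonglongrightarrow> lap N q"
  shows "weak_conv_m \<mu> N"
proof (rule tight_subseq_weak_converge)
  show "real_distribution (\<mu> n)" for n using M prob_RplusD by blast
  show "real_distribution N" using N prob_RplusD by blast
  show "tight \<mu>" by (rule lap_tight[OF M w lap_tendsto_1[OF N]])
  fix s \<nu> assume s: "strict_mono (s :: nat \<Rightarrow> nat)" and nu: "real_distribution \<nu>" "weak_conv_m (\<mu> \<circ> s) \<nu>"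
  have "prob_Rplus \<nu>" by (rule weak_conv_lap(1)[OF _ nu]) (use M in auto)
  moreover have "lap \<nu> (real n) = lap N (real n)" if "n \<ge> 1" for n
  proof (rule LIMSEQ_unique)
    show "(\<lambda>k. lap ((\<mu> \<circ> s) k) (real n)) \<longlonglongrightarrow> lap \<nu> (real n)" by (rule weak_conv_lap(2)[OF _ nu]) (use M that in auto)
    show "(\<lambda>k. lap ((\<mu> \<circ> s) k) (real n)) \<longlonglongrightarrow> lap N (real n)"
      using LIMSEQ_subseq_LIMSEQ[OF w[of "real n"] s] that by (simp add: comp_def)
  qed
  ultimately have "\<nu> = N" using N by (intro laplace_uniqueness) auto
  then show "weak_conv_m (\<mu> \<circ> s) N" using nu by simp
qed

text \<open>The limit need not be recognised as a transform beforehand: its value 1 at 0 rules out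
  escape of mass, and any subsequential limit law has the transform \<open>w\<close>.\<close>

lemma laplace_limit_exists:
  assumes M: "\<And>n. prob_Rplus (\<mu> n)"
    and w: "\<And>q. q > 0 \<Longrightarrow> (\<lambda>n. lap (\<mu> n) q) \<longlonglongrightarrow> w q"
    and w1: "(w \<longlongrightarrow> 1) (at_right 0)"
  obtains N where "prob_Rplus N" "\<And>q. q > 0 \<Longrightarrow> lap N q = w q"
proof -
  have "tight \<mu>" by (rule lap_tight[OF M w w1])
  from tight_imp_convergent_subsubsequence[OF this strict_mono_id] obtain r N where
    r: "strict_mono r" and N: "real_distribution N" "weak_conv_m (\<mu> \<circ> id \<circ> r) N" by blast
  have N': "weak_conv_m (\<mu> \<circ> r) N" using N(2) by (simp add: comp_def)
  have "prob_Rplus N" by (rule weak_conv_lap(1)[OF _ N(1) N']) (use M in auto)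
  moreover have "lap N q = w q" if "q > 0" for q
  proof (rule LIMSEQ_unique)
    show "(\<lambda>k. lap ((\<mu> \<circ> r) k) q) \<longlonglongrightarrow> lap N q" by (rule weak_conv_lap(2)[OF _ N(1) N']) (use M that in auto)
    show "(\<lambda>k. lap ((\<mu> \<circ> r) k) q) \<longlonglongrightarrow> w q"
      using LIMSEQ_subseq_LIMSEQ[OF w[OF that] r] by (simp add: comp_def)
  qed
  ultimately show ?thesis using that by blast
qed

section \<open>The linearising function of the clustering kernel\<close>

lemma eventually_unit_at_right: "\<forall>\<^sub>F t in at_right (0::real). 0 < t \<and> t < 1"
  unfolding eventually_at_right_field by (intro exI[of _ 1]) auto

locale clustering =
  fixes p :: "nat \<Rightarrow> real"
  assumes adm: "admissible_p p"
begin

definition g :: "real \<Rightarrow> real" where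
  "g z = integral {0..z} (\<lambda>x. Q1 p / (1 - Qgen p x))"

text \<open>Meaningful for \<open>v \<ge> 0\<close> only; there \<open>g\<close> is a bijection from
  the half-open unit interval onto the half-line.\<close>

definition ginv :: "real \<Rightarrow> real" where
  "ginv v = (THE z. 0 \<le> z \<and> z < 1 \<and> g z = v)"

text \<open>The size of \<open>1 - lap (F t) q\<close> for small \<open>t\<close>: at
  \<open>1 - psi t\<close> the function \<open>g\<close> equals \<open>- ln t\<close>, and
  \<open>psi t\<close> will turn out to be asymptotic to \<open>t * ks t\<close>.\<close>

definition psi :: "real \<Rightarrow> real" where
  "psi t = 1 - ginv (- ln t)"

lemma p_nonneg: "p (Suc k) \<ge> 0" using adm by (simp add: admissible_p_def)

text \<open>The hypotheses index by \<open>k \<ge> 1\<close> and leave \<open>p 0\<close>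
  unconstrained; all series below run over \<open>Suc k\<close>.\<close>

lemma has_sum_Suc_iff: "(f has_sum s) {1..} \<longleftrightarrow> ((\<lambda>k. f (Suc k)) has_sum (s::real)) UNIV"
proof -
  have "bij_betw Suc UNIV {1..}" by (auto simp: bij_betw_def image_def intro!: Suc_pred[symmetric]) (metis Suc_le_D)
  from has_sum_reindex_bij_betw[OF this, of f s] show ?thesis by simp
qed

lemma p_sums: "(\<lambda>k. p (Suc k)) sums 1"
proof -
  have "(p has_sum 1) {1..}" using adm by (simp add: admissible_p_def)
  then show ?thesis unfolding has_sum_Suc_iff by (rule has_sum_imp_sums)
qed

lemma Q1_sums: "(\<lambda>k. real (Suc k) * p (Suc k)) sums Q1 p"
proof -
  have "((\<lambda>k. real k * p k) has_sum Q1 p) {1..}"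
    unfolding Q1_def using adm by (intro has_sum_infsum) (simp add: admissible_p_def)
  then show ?thesis unfolding has_sum_Suc_iff by (rule has_sum_imp_sums)
qed

lemma Q_sums: assumes "0 \<le> z" "z \<le> 1" shows "(\<lambda>k. p (Suc k) * z ^ Suc k) sums Qgen p z"
proof -
  have s: "summable (\<lambda>k. p (Suc k) * z ^ Suc k)"
    by (rule summable_comparison_test'[OF sums_summable[OF p_sums], of 0])
       (use assms p_nonneg in \<open>auto intro!: mult_left_le power_le_one simp: abs_mult simp del: power_Suc\<close>)
  have "((\<lambda>k. p (Suc k) * z ^ Suc k) has_sum (\<Sum>k. p (Suc k) * z ^ Suc k)) UNIV"
  proof (rule norm_summable_imp_has_sum)
    show "summable (\<lambda>n. norm (p (Suc n) * z ^ Suc n))" using s assms p_nonneg by (simp add: abs_mult)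
  qed (use s in \<open>simp add: summable_sums\<close>)
  then have "((\<lambda>k. p k * z ^ k) has_sum (\<Sum>k. p (Suc k) * z ^ Suc k)) {1..}" by (simp only: has_sum_Suc_iff)
  then have "Qgen p z = (\<Sum>k. p (Suc k) * z ^ Suc k)" unfolding Qgen_def by (rule infsumI)
  then show ?thesis using summable_sums[OF s] by simp
qed

lemma Q1_ge_1: "Q1 p \<ge> 1"
proof (rule sums_le[OF _ p_sums Q1_sums])
  fix n show "p (Suc n) \<le> real (Suc n) * p (Suc n)" using p_nonneg[of n] by (simp add: algebra_simps)
qed

lemma Q_0: "Qgen p 0 = 0" using Q_sums[of 0] sums_unique2[OF _ sums_zero] by simp

lemma Q_1: "Qgen p 1 = 1" using Q_sums[of 1] sums_unique2[OF p_sums] by simp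

lemma power_diff_le: assumes "0 \<le> x" "x \<le> y" "y \<le> (1::real)" shows "y ^ n - x ^ n \<le> real n * (y - x)"
proof (induction n)
  case (Suc n)
  have "y ^ Suc n - x ^ Suc n = y * (y ^ n - x ^ n) + x ^ n * (y - x)" by (simp add: algebra_simps)
  also have "\<dots> \<le> 1 * (y ^ n - x ^ n) + 1 * (y - x)"
    using assms by (intro add_mono mult_right_mono power_le_one) (auto intro: power_mono)
  finally show ?case using Suc by (simp add: algebra_simps)
qed simp

lemma Q_mono: assumes "0 \<le> x" "x \<le> y" "y \<le> 1" shows "Qgen p x \<le> Qgen p y"
  by (rule sums_le[OF _ Q_sums Q_sums]) (use assms p_nonneg in \<open>auto intro!: mult_left_mono power_mono simp del: power_Suc\<close>)

lemma Q_diff_le: assumes "0 \<le> x" "x \<le> y" "y \<le> 1" shows "Qgen p y - Qgen p x \<le> Q1 p * (y - x)"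
proof (rule sums_le[OF _ sums_diff[OF Q_sums Q_sums] sums_mult2[OF Q1_sums]])
  fix n
  have "p (Suc n) * (y ^ Suc n - x ^ Suc n) \<le> p (Suc n) * (real (Suc n) * (y - x))"
    using assms by (intro mult_left_mono p_nonneg power_diff_le)
  then show "p (Suc n) * y ^ Suc n - p (Suc n) * x ^ Suc n \<le> real (Suc n) * p (Suc n) * (y - x)"
    by (simp add: algebra_simps del: power_Suc of_nat_Suc)
qed (use assms in auto)

lemma Q_le_self: assumes "0 \<le> x" "x \<le> 1" shows "Qgen p x \<le> x"
proof (rule sums_le[OF _ Q_sums])
  fix n show "p (Suc n) * x ^ Suc n \<le> p (Suc n) * x"
    using assms p_nonneg by (intro mult_left_mono) (auto intro: mult_left_le power_le_one)
  show "(\<lambda>n. p (Suc n) * x) sums x" using sums_mult2[OF p_sums, of x] by simp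
qed (use assms in auto)

lemma Q_nonneg: "0 \<le> x \<Longrightarrow> x \<le> 1 \<Longrightarrow> 0 \<le> Qgen p x" using Q_mono[of 0 x] Q_0 by simp

lemma Q_lt_1: "0 \<le> x \<Longrightarrow> x < 1 \<Longrightarrow> Qgen p x < 1" using Q_le_self[of x] by simp

lemma one_minus_Q_le: "0 \<le> x \<Longrightarrow> x \<le> 1 \<Longrightarrow> 1 - Qgen p x \<le> Q1 p * (1 - x)" using Q_diff_le[of x 1] Q_1 by simp

lemma Q_continuous: "continuous_on {0..1} (Qgen p)"
proof (rule continuous_on_iff[THEN iffD2], intro ballI allI impI)
  fix x e :: real assume x: "x \<in> {0..1}" and e: "e > 0"
  have L: "\<bar>Qgen p y - Qgen p x\<bar> \<le> Q1 p * \<bar>y - x\<bar>" if "y \<in> {0..1}" for y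
    using Q_diff_le[of x y] Q_diff_le[of y x] Q_mono[of x y] Q_mono[of y x] x that
    by (cases "x \<le> y") (auto simp: abs_if)
  show "\<exists>d>0. \<forall>x'\<in>{0..1}. dist x' x < d \<longrightarrow> dist (Qgen p x') (Qgen p x) < e"
  proof (intro exI[of _ "e / Q1 p"] conjI ballI impI)
    fix y assume y: "y \<in> {0..1}" "dist y x < e / Q1 p"
    then have "Q1 p * \<bar>y - x\<bar> < e" using Q1_ge_1 by (simp add: dist_real_def field_simps)
    then show "dist (Qgen p y) (Qgen p x) < e" using L[OF y(1)] by (simp add: dist_real_def)
  qed (use e Q1_ge_1 in auto)
qed

lemma g_integrand_continuous: assumes "b < 1" shows "continuous_on {0..b} (\<lambda>x. Q1 p / (1 - Qgen p x))"
proof (intro continuous_intros ballI)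
  show "continuous_on {0..b} (Qgen p)" by (rule continuous_on_subset[OF Q_continuous]) (use assms in auto)
  fix x assume "x \<in> {0..b}" then show "1 - Qgen p x \<noteq> 0" using Q_lt_1[of x] assms by auto
qed

lemma g_0: "g 0 = 0" by (simp add: g_def)

lemma g_has_derivative:
  assumes "0 \<le> z" "z \<le> b" "b < 1"
  shows "(g has_real_derivative Q1 p / (1 - Qgen p z)) (at z within {0..b})"
  unfolding g_def using assms by (intro integral_has_real_derivative g_integrand_continuous) auto

lemma g_diff:
  assumes "0 \<le> y" "y \<le> x" "x < 1"
  shows "g x - g y = integral {y..x} (\<lambda>x. Q1 p / (1 - Qgen p x))"
    and "(\<lambda>x. Q1 p / (1 - Qgen p x)) integrable_on {y..x}"
proof -
  have c: "(\<lambda>x. Q1 p / (1 - Qgen p x)) integrable_on {0..x}"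
    by (rule integrable_continuous_interval[OF g_integrand_continuous[OF assms(3)]])
  show "g x - g y = integral {y..x} (\<lambda>x. Q1 p / (1 - Qgen p x))"
    using Henstock_Kurzweil_Integration.integral_combine[OF assms(1,2) c] by (simp add: g_def)
  show "(\<lambda>x. Q1 p / (1 - Qgen p x)) integrable_on {y..x}"
    by (rule integrable_subinterval_real[OF c]) (use assms in auto)
qed

section \<open>Growth of \<open>g\<close> and continuity of its inverse\<close>

lemma integral_inverse_one_minus:
  fixes x y C :: real
  assumes "0 \<le> y" "y \<le> x" "x < 1"
  shows "((\<lambda>z. C / (1 - z)) has_integral C * ln ((1 - y) / (1 - x))) {y..x}"
proof -
  have *: "((\<lambda>z. C / (1 - z)) has_integral (- C * ln (1 - x)) - (- C * ln (1 - y))) {y..x}"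
  proof (rule fundamental_theorem_of_calculus[OF assms(2)])
    fix z assume "z \<in> {y..x}"
    then show "((\<lambda>x. - C * ln (1 - x)) has_vector_derivative C / (1 - z)) (at z within {y..x})"
      using assms by (auto intro!: derivative_eq_intros simp: has_real_derivative_iff_has_vector_derivative[symmetric])
  qed
  have ld: "ln ((1 - y) / (1 - x)) = ln (1 - y) - ln (1 - x)" using assms by (simp add: ln_div)
  have "(- C * ln (1 - x)) - (- C * ln (1 - y)) = C * ln ((1 - y) / (1 - x))" unfolding ld by (simp add: algebra_simps)
  with * show ?thesis by simp
qed

text \<open>Since \<open>1 - Qgen p z \<le> Q1 p * (1 - z)\<close>, the integrand dominates
  \<open>1 / (1 - z)\<close>. In particular \<open>g\<close> is unbounded at 1.\<close>

lemma g_diff_ge_ln: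
  assumes "0 \<le> y" "y \<le> x" "x < 1"
  shows "ln ((1 - y) / (1 - x)) \<le> g x - g y"
proof -
  have "1 * ln ((1 - y) / (1 - x)) = integral {y..x} (\<lambda>z. 1 / (1 - z))"
    by (rule integral_unique[OF integral_inverse_one_minus[OF assms], symmetric])
  also have "\<dots> \<le> integral {y..x} (\<lambda>x. Q1 p / (1 - Qgen p x))"
  proof (rule integral_le)
    show "(\<lambda>z. 1 / (1 - z)) integrable_on {y..x}" using integral_inverse_one_minus[OF assms] by (auto simp: integrable_on_def)
    show "(\<lambda>x. Q1 p / (1 - Qgen p x)) integrable_on {y..x}" by (rule g_diff[OF assms])
    fix z assume "z \<in> {y..x}"
    then show "1 / (1 - z) \<le> Q1 p / (1 - Qgen p z)"
      using one_minus_Q_le[of z] Q_lt_1[of z] assms by (auto simp: field_simps)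
  qed
  finally show ?thesis using g_diff[OF assms] by simp
qed

text \<open>Applied with \<open>C = 1 + e\<close> close to 1, and with \<open>C = Q1 p\<close>
  everywhere, where the hypothesis on \<open>C\<close> amounts to
  \<open>Qgen p z \<le> z\<close>.\<close>

lemma g_diff_le_ln:
  assumes "0 \<le> y" "y \<le> x" "x < 1" and C: "\<And>z. y \<le> z \<Longrightarrow> z \<le> x \<Longrightarrow> Q1 p * (1 - z) \<le> C * (1 - Qgen p z)"
  shows "g x - g y \<le> C * ln ((1 - y) / (1 - x))"
proof -
  have "integral {y..x} (\<lambda>x. Q1 p / (1 - Qgen p x)) \<le> integral {y..x} (\<lambda>z. C / (1 - z))"
  proof (rule integral_le)
    show "(\<lambda>z. C / (1 - z)) integrable_on {y..x}" using integral_inverse_one_minus[OF assms(1-3)] by (auto simp: integrable_on_def)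
    show "(\<lambda>x. Q1 p / (1 - Qgen p x)) integrable_on {y..x}" by (rule g_diff[OF assms(1-3)])
    fix z assume "z \<in> {y..x}"
    then show "Q1 p / (1 - Qgen p z) \<le> C / (1 - z)"
      using C[of z] Q_lt_1[of z] assms by (auto simp: field_simps)
  qed
  also have "\<dots> = C * ln ((1 - y) / (1 - x))" by (rule integral_unique[OF integral_inverse_one_minus[OF assms(1-3)]])
  finally show ?thesis using g_diff[OF assms(1-3)] by simp
qed

text \<open>The integrand is increasing, so its endpoint values bound the increment. These
  mean-value estimates are used whenever increments of \<open>g\<close> are compared with increments
  of its argument, both for solutions and for single steps of the scheme.\<close>

lemma g_diff_bounds:
  assumes "0 \<le> y" "y \<le> x" "x < 1"
  shows "(x - y) * Q1 p / (1 - Qgen p y) \<le> g x - g y"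
    and "g x - g y \<le> (x - y) * Q1 p / (1 - Qgen p x)"
proof -
  have "integral {y..x} (\<lambda>_. Q1 p / (1 - Qgen p y)) \<le> integral {y..x} (\<lambda>x. Q1 p / (1 - Qgen p x))"
  proof (rule integral_le)
    show "(\<lambda>x. Q1 p / (1 - Qgen p x)) integrable_on {y..x}" by (rule g_diff[OF assms])
    fix z assume "z \<in> {y..x}"
    then show "Q1 p / (1 - Qgen p y) \<le> Q1 p / (1 - Qgen p z)"
      using Q_mono[of y z] Q_lt_1[of z] Q_lt_1[of y] Q1_ge_1 assms by (intro divide_left_mono) auto
  qed auto
  then show "(x - y) * Q1 p / (1 - Qgen p y) \<le> g x - g y" using g_diff[OF assms] assms by simp
  have "integral {y..x} (\<lambda>x. Q1 p / (1 - Qgen p x)) \<le> integral {y..x} (\<lambda>_. Q1 p / (1 - Qgen p x))"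
  proof (rule integral_le)
    show "(\<lambda>x. Q1 p / (1 - Qgen p x)) integrable_on {y..x}" by (rule g_diff[OF assms])
    fix z assume "z \<in> {y..x}"
    then show "Q1 p / (1 - Qgen p z) \<le> Q1 p / (1 - Qgen p x)"
      using Q_mono[of z x] Q_lt_1[of z] Q_lt_1[of x] Q1_ge_1 assms by (intro divide_left_mono) auto
  qed auto
  then show "g x - g y \<le> (x - y) * Q1 p / (1 - Qgen p x)" using g_diff[OF assms] assms by simp
qed

lemma g_diff_ge:
  assumes "0 \<le> y" "y \<le> x" "x < 1" shows "(x - y) * Q1 p \<le> g x - g y"
proof -
  have "(x - y) * Q1 p * 1 \<le> (x - y) * Q1 p * (1 / (1 - Qgen p y))"
    using assms Q1_ge_1 Q_lt_1[of y] Q_nonneg[of y] by (intro mult_left_mono) auto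
  then show ?thesis using g_diff_bounds(1)[OF assms] by simp
qed

lemma g_strict_mono: "0 \<le> y \<Longrightarrow> y < x \<Longrightarrow> x < 1 \<Longrightarrow> g y < g x"
  using g_diff_ge[of y x] Q1_ge_1 mult_pos_pos[of "x - y" "Q1 p"] by linarith

lemma g_mono: "0 \<le> y \<Longrightarrow> y \<le> x \<Longrightarrow> x < 1 \<Longrightarrow> g y \<le> g x"
  using g_strict_mono[of y x] by (cases "y = x") auto

lemma g_nonneg: "0 \<le> x \<Longrightarrow> x < 1 \<Longrightarrow> 0 \<le> g x" using g_mono[of 0 x] g_0 by simp

lemma g_continuous: "b < 1 \<Longrightarrow> continuous_on {0..b} g"
  using g_has_derivative[of _ b] by (intro DERIV_continuous_on) auto

lemma ginv_ex1: assumes "v \<ge> 0" shows "\<exists>!z. 0 \<le> z \<and> z < 1 \<and> g z = v"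
proof -
  \<comment> \<open>At this point the logarithmic lower bound for \<open>g\<close> already equals
    \<open>v\<close>.\<close>
  define b where "b = 1 - exp (- v)"
  have b: "0 \<le> b" "b < 1" using assms by (auto simp: b_def)
  have "ln ((1 - 0) / (1 - b)) = v" by (simp add: b_def ln_div)
  then have "v \<le> g b" using g_diff_ge_ln[of 0 b] b g_0 by simp
  then obtain z where "0 \<le> z" "z \<le> b" "g z = v"
    using IVT'[of g 0 v b] g_0 assms b g_continuous[OF b(2)] by auto
  then have z: "0 \<le> z \<and> z < 1 \<and> g z = v" using b by auto
  show ?thesis
  proof (intro ex1I[of _ z])
    show "0 \<le> z \<and> z < 1 \<and> g z = v" by (rule z)
    fix y assume y: "0 \<le> y \<and> y < 1 \<and> g y = v"
    then show "y = z" using z g_strict_mono[of y z] g_strict_mono[of z y] by (cases y z rule: linorder_cases) auto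
  qed
qed

lemma ginv: assumes "v \<ge> 0" shows "0 \<le> ginv v" "ginv v < 1" "g (ginv v) = v"
  using theI'[OF ginv_ex1[OF assms]] unfolding ginv_def by auto

lemma ginv_g: assumes "0 \<le> z" "z < 1" shows "ginv (g z) = z"
  using ginv_ex1[OF g_nonneg[OF assms]] ginv[OF g_nonneg[OF assms]] assms by blast

lemma ginv_mono: assumes "0 \<le> u" "u \<le> v" shows "ginv u \<le> ginv v"
  using g_strict_mono[of "ginv v" "ginv u"] ginv[of u] ginv[of v] assms by (cases "ginv v < ginv u") auto

text \<open>The derivative of \<open>g\<close> is at least \<open>Q1 p\<close>, which is at least
  1.\<close>

lemma ginv_lipschitz: assumes "0 \<le> u" "u \<le> v" shows "ginv v - ginv u \<le> v - u"
proof -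
  have "(ginv v - ginv u) * 1 \<le> (ginv v - ginv u) * Q1 p"
    using ginv_mono[OF assms] Q1_ge_1 by (intro mult_left_mono) auto
  also have "\<dots> \<le> v - u" using g_diff_ge[of "ginv u" "ginv v"] ginv_mono[OF assms] ginv[of u] ginv[of v] assms by auto
  finally show ?thesis by simp
qed

lemma ginv_continuous: "continuous_on {0..} ginv"
proof (rule continuous_on_iff[THEN iffD2], intro ballI allI impI)
  fix x e :: real assume x: "x \<in> {0..}" and e: "e > 0"
  show "\<exists>d>0. \<forall>x'\<in>{0..}. dist x' x < d \<longrightarrow> dist (ginv x') (ginv x) < e"
  proof (intro exI[of _ e] conjI ballI impI e)
    fix y assume "y \<in> {0..}" "dist y x < e"
    then show "dist (ginv y) (ginv x) < e"
      using ginv_lipschitz[of x y] ginv_lipschitz[of y x] ginv_mono[of x y] ginv_mono[of y x] x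
      by (cases "x \<le> y") (auto simp: dist_real_def abs_if split: if_splits)
  qed
qed

lemma ginv_at_top: "(ginv \<longlongrightarrow> 1) at_top"
proof (rule order_tendstoI)
  fix a :: real assume a: "a < 1"
  let ?z = "max 0 a"
  have "\<forall>\<^sub>F v in at_top. v > max 0 (g ?z)" by (rule eventually_gt_at_top)
  then show "\<forall>\<^sub>F v in at_top. a < ginv v"
  proof eventually_elim
    case (elim v)
    then have "g ?z < g (ginv v)" using ginv[of v] by simp
    then have "\<not> ginv v \<le> ?z" using g_mono[of "ginv v" ?z] ginv[of v] elim a by auto
    then show ?case by simp
  qed
next
  fix a :: real assume a: "1 < a"
  have "\<forall>\<^sub>F v in at_top. v > (0::real)" by (rule eventually_gt_at_top)
  then show "\<forall>\<^sub>F v in at_top. ginv v < a" by eventually_elim (metis ginv(2) a less_imp_le less_trans)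
qed

text \<open>The left derivative of \<open>Qgen p\<close> at 1 is \<open>Q1 p\<close>, in
  quantitative form: finitely many terms already carry almost all of \<open>Q1 p\<close>, and for
  these \<open>1 - z ^ Suc k\<close> is at least \<open>z ^ N * Suc k * (1 - z)\<close> with
  \<open>z ^ N\<close> near 1.\<close>

lemma Q1_ratio:
  assumes "e > 0" shows "\<exists>d>0. d \<le> 1 \<and> (\<forall>z. 1 - d \<le> z \<and> z < 1 \<longrightarrow> Q1 p * (1 - z) \<le> (1 + e) * (1 - Qgen p z))"
proof -
  define S where "S N = (\<Sum>k<N. real (Suc k) * p (Suc k))" for N
  have "S \<longlonglongrightarrow> Q1 p" using Q1_sums by (simp add: S_def[abs_def] sums_def)
  moreover have "Q1 p / (1 + e) < Q1 p" using assms Q1_ge_1 by (simp add: field_simps)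
  ultimately have "\<forall>\<^sub>F N in sequentially. S N > Q1 p / (1 + e)" by (intro order_tendstoD(1))
  then obtain N where N: "S N > Q1 p / (1 + e)" by (auto simp: eventually_sequentially)
  have "((\<lambda>z. z ^ N * S N) \<longlongrightarrow> 1 ^ N * S N) (at_left (1::real))" by (intro tendsto_intros)
  then have "\<forall>\<^sub>F z in at_left 1. z ^ N * S N > Q1 p / (1 + e)" using N by (intro order_tendstoD(1)) auto
  then obtain b where b: "b < 1" "\<And>z. b < z \<Longrightarrow> z < 1 \<Longrightarrow> z ^ N * S N > Q1 p / (1 + e)"
    unfolding eventually_at_left_field by blast
  define d where "d = min 1 ((1 - b) / 2)"
  have "Q1 p * (1 - z) \<le> (1 + e) * (1 - Qgen p z)" if z: "1 - d \<le> z" "z < 1" for z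
  proof -
    have "b < z" using z b(1) by (auto simp: d_def min_def field_simps split: if_splits)
    note zz = b(2)[OF this z(2)]
    have z0: "0 \<le> z" using z by (auto simp: d_def)
    have sm: "(\<lambda>k. p (Suc k) - p (Suc k) * z ^ Suc k) sums (1 - Qgen p z)"
      using z0 z by (intro sums_diff p_sums Q_sums) auto
    have pw: "z ^ k * real (Suc k) * (1 - z) \<le> 1 - z ^ Suc k" for k
    proof -
      have "(\<Sum>i<Suc k. z ^ k) \<le> (\<Sum>i<Suc k. z ^ i)" using z0 z by (intro sum_mono power_decreasing) auto
      then have "(1 - z) * (\<Sum>i<Suc k. z ^ k) \<le> (1 - z) * (\<Sum>i<Suc k. z ^ i)" using z by (intro mult_left_mono) auto
      also have "\<dots> = 1 - z ^ Suc k" by (rule one_diff_power_eq[symmetric])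
      finally show ?thesis by (simp add: algebra_simps)
    qed
    have "z ^ N * S N * (1 - z) = (\<Sum>k<N. p (Suc k) * (z ^ N * real (Suc k) * (1 - z)))"
      by (simp add: S_def sum_distrib_left sum_distrib_right algebra_simps)
    also have "\<dots> \<le> (\<Sum>k<N. p (Suc k) - p (Suc k) * z ^ Suc k)"
    proof (rule sum_mono)
      fix k assume "k \<in> {..<N}"
      then have "z ^ N * real (Suc k) * (1 - z) \<le> z ^ k * real (Suc k) * (1 - z)"
        using z0 z by (intro mult_right_mono power_decreasing) auto
      then have "z ^ N * real (Suc k) * (1 - z) \<le> 1 - z ^ Suc k" using pw[of k] by linarith
      from mult_left_mono[OF this p_nonneg[of k]]
      show "p (Suc k) * (z ^ N * real (Suc k) * (1 - z)) \<le> p (Suc k) - p (Suc k) * z ^ Suc k" by (simp add: algebra_simps)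
    qed
    also have "\<dots> \<le> 1 - Qgen p z"
      unfolding sums_unique[OF sm] using z0 z p_nonneg
      by (intro sum_le_suminf sums_summable[OF sm]) (auto simp: mult_left_le power_le_one simp del: power_Suc)
    finally have "z ^ N * S N * (1 - z) \<le> 1 - Qgen p z" .
    moreover have "Q1 p / (1 + e) * (1 - z) \<le> z ^ N * S N * (1 - z)" using zz z by (intro mult_right_mono) auto
    ultimately have "Q1 p / (1 + e) * (1 - z) \<le> 1 - Qgen p z" by linarith
    then show ?thesis using assms by (simp add: field_simps)
  qed
  then show ?thesis using b(1) by (intro exI[of _ d]) (auto simp: d_def)
qed

text \<open>The error is relative to \<open>ln (y / x)\<close>, so \<open>x\<close> and
  \<open>y\<close> need not be comparable. The second inequality lets boundedness of the difference
  of \<open>g\<close> control the logarithm in \<open>g_ratio_iff\<close>.\<close>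

lemma g_log_asymp:
  assumes "e > 0" shows "\<exists>d>0. d \<le> 1 \<and> (\<forall>x y. 0 < x \<and> x < d \<and> 0 < y \<and> y < d \<longrightarrow>
      \<bar>g (1 - x) - g (1 - y) - ln (y / x)\<bar> \<le> e * \<bar>ln (y / x)\<bar> \<and> \<bar>ln (y / x)\<bar> \<le> \<bar>g (1 - x) - g (1 - y)\<bar>)"
proof -
  obtain d where d: "d > 0" "d \<le> 1" "\<And>z. 1 - d \<le> z \<Longrightarrow> z < 1 \<Longrightarrow> Q1 p * (1 - z) \<le> (1 + e) * (1 - Qgen p z)"
    using Q1_ratio[OF assms] by blast
  have *: "0 \<le> ln (y / x) \<and> ln (y / x) \<le> g (1 - x) - g (1 - y) \<and> g (1 - x) - g (1 - y) \<le> (1 + e) * ln (y / x)"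
    if "0 < x" "x \<le> y" "y < d" for x y
  proof -
    have "g (1 - x) - g (1 - y) \<le> (1 + e) * ln ((1 - (1 - y)) / (1 - (1 - x)))"
      by (rule g_diff_le_ln) (use that d in auto)
    moreover have "ln ((1 - (1 - y)) / (1 - (1 - x))) \<le> g (1 - x) - g (1 - y)"
      by (rule g_diff_ge_ln) (use that d in auto)
    ultimately show ?thesis using that by (auto simp: ln_ge_zero)
  qed
  show ?thesis
  proof (intro exI[of _ d] conjI allI impI d)
    fix x y assume "0 < x \<and> x < d \<and> 0 < y \<and> y < d"
    then have xy: "0 < x" "x < d" "0 < y" "y < d" by auto
    have "\<bar>g (1 - x) - g (1 - y) - ln (y / x)\<bar> \<le> e * \<bar>ln (y / x)\<bar> \<and> \<bar>ln (y / x)\<bar> \<le> \<bar>g (1 - x) - g (1 - y)\<bar>"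
    proof (cases "x \<le> y")
      case True
      then show ?thesis using *[of x y] xy by (auto simp: algebra_simps)
    next
      case False
      have "ln (x / y) = - ln (y / x)" using xy by (simp add: ln_div)
      then show ?thesis using *[of y x] xy False by (auto simp: algebra_simps)
    qed
    then show "\<bar>g (1 - x) - g (1 - y) - ln (y / x)\<bar> \<le> e * \<bar>ln (y / x)\<bar>" "\<bar>ln (y / x)\<bar> \<le> \<bar>g (1 - x) - g (1 - y)\<bar>" by auto
  qed
qed

text \<open>As soon as one of the two quantities converges, the logarithm is bounded, and an
  arbitrarily small relative error becomes an error tending to 0.\<close>

lemma g_ratio_iff:
  assumes X: "(X \<longlongrightarrow> 0) F" and Y: "(Y \<longlongrightarrow> 0) F"
    and Xp: "\<forall>\<^sub>F t in F. X t > 0" and Yp: "\<forall>\<^sub>F t in F. Y t > (0::real)"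
  shows "((\<lambda>t. g (1 - X t) - g (1 - Y t)) \<longlongrightarrow> L) F \<longleftrightarrow> ((\<lambda>t. ln (Y t / X t)) \<longlongrightarrow> L) F"
proof -
  let ?D = "\<lambda>t. g (1 - X t) - g (1 - Y t)" and ?R = "\<lambda>t. ln (Y t / X t)"
  have ev: "\<forall>\<^sub>F t in F. \<bar>?D t - ?R t\<bar> \<le> e * \<bar>?R t\<bar> \<and> \<bar>?R t\<bar> \<le> \<bar>?D t\<bar>" if "0 < e" for e :: real
  proof -
    obtain d where d: "d > 0" "\<And>x y. 0 < x \<Longrightarrow> x < d \<Longrightarrow> 0 < y \<Longrightarrow> y < d \<Longrightarrow>
      \<bar>g (1 - x) - g (1 - y) - ln (y / x)\<bar> \<le> e * \<bar>ln (y / x)\<bar> \<and> \<bar>ln (y / x)\<bar> \<le> \<bar>g (1 - x) - g (1 - y)\<bar>"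
      using g_log_asymp[OF \<open>e > 0\<close>] by blast
    show ?thesis using order_tendstoD(2)[OF X d(1)] order_tendstoD(2)[OF Y d(1)] Xp Yp
      by eventually_elim (use d in auto)
  qed
  have zero: "((\<lambda>t. ?D t - ?R t) \<longlongrightarrow> 0) F" if B: "\<forall>\<^sub>F t in F. \<bar>?R t\<bar> \<le> B" "B > 0" for B
  proof (rule tendstoI)
    fix e :: real assume "e > 0"
    then have "e / (2 * B) > 0" using B by simp
    from ev[OF this] B(1) show "\<forall>\<^sub>F t in F. dist (?D t - ?R t) 0 < e"
    proof eventually_elim
      case (elim t)
      have "e / (2 * B) * \<bar>?R t\<bar> \<le> e / (2 * B) * B" using elim \<open>e / (2 * B) > 0\<close> by (intro mult_left_mono) auto
      also have "\<dots> < e" using B(2) \<open>e > 0\<close> by simp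
      finally show ?case using elim by (simp add: dist_real_def)
    qed
  qed
  show ?thesis
  proof
    assume L: "(?D \<longlongrightarrow> L) F"
    have "\<forall>\<^sub>F t in F. \<bar>?D t\<bar> < \<bar>L\<bar> + 1" using tendsto_rabs[OF L] by (intro order_tendstoD(2)) auto
    then have "\<forall>\<^sub>F t in F. \<bar>?R t\<bar> \<le> \<bar>L\<bar> + 1" using ev[OF zero_less_one] by eventually_elim auto
    from tendsto_diff[OF L zero[OF this]] show "(?R \<longlongrightarrow> L) F" by simp
  next
    assume L: "(?R \<longlongrightarrow> L) F"
    have "\<forall>\<^sub>F t in F. \<bar>?R t\<bar> < \<bar>L\<bar> + 1" using tendsto_rabs[OF L] by (intro order_tendstoD(2)) auto
    then have "\<forall>\<^sub>F t in F. \<bar>?R t\<bar> \<le> \<bar>L\<bar> + 1" by eventually_elim auto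
    from tendsto_add[OF L zero[OF this]] show "(?D \<longlongrightarrow> L) F" by simp
  qed
qed

section \<open>The scale \<open>psi\<close> and the de Bruijn conjugate\<close>

lemma kappa_eq: assumes "0 < q" "q \<le> 1" shows "kappa p q = exp (- g (1 - q)) / q"
proof -
  have "(LBINT z=ereal 0..ereal (1 - q). Q1 p / (1 - Qgen p z) - 1 / (1 - z)) = (g (1 - q) + ln (1 - (1 - q))) - (g 0 + ln (1 - 0))"
  proof (rule interval_integral_FTC_finite)
    have m: "{min 0 (1 - q)..max 0 (1 - q)} = {0..1 - q}" using assms by (auto simp: min_def max_def)
    show "continuous_on {min 0 (1 - q)..max 0 (1 - q)} (\<lambda>z. Q1 p / (1 - Qgen p z) - 1 / (1 - z))"
      unfolding m using assms by (intro continuous_on_diff g_integrand_continuous) (auto intro!: continuous_intros)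
    fix x assume "min 0 (1 - q) \<le> x" "x \<le> max 0 (1 - q)"
    then have x: "0 \<le> x" "x \<le> 1 - q" using assms by auto
    have "((\<lambda>x. g x + ln (1 - x)) has_real_derivative Q1 p / (1 - Qgen p x) + (-1) / (1 - x)) (at x within {0..1 - q})"
      using assms x by (auto intro!: derivative_eq_intros g_has_derivative)
    then show "((\<lambda>x. g x + ln (1 - x)) has_vector_derivative Q1 p / (1 - Qgen p x) - 1 / (1 - x))
        (at x within {min 0 (1 - q)..max 0 (1 - q)})"
      unfolding m by (simp add: has_real_derivative_iff_has_vector_derivative)
  qed
  then show ?thesis using assms by (simp add: kappa_def g_0 exp_minus exp_add exp_diff field_simps)
qed

lemma psi: assumes "0 < t" "t < 1" shows "0 < psi t" "psi t < 1" "g (1 - psi t) = - ln t"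
proof -
  have l: "- ln t > 0" using assms by simp
  show "0 < psi t" "g (1 - psi t) = - ln t" using ginv[of "- ln t"] l by (auto simp: psi_def)
  have "ginv (- ln t) \<noteq> 0" using ginv[of "- ln t"] l g_0 by auto
  then show "psi t < 1" using ginv[of "- ln t"] l by (auto simp: psi_def)
qed

lemma psi_tendsto: "(psi \<longlongrightarrow> 0) (at_right 0)"
proof -
  have "filterlim (\<lambda>t::real. - ln t) at_top (at_right 0)"
    using ln_at_0 by (simp add: filterlim_uminus_at_bot)
  from filterlim_compose[OF ginv_at_top this] have "((\<lambda>t. 1 - ginv (- ln t)) \<longlongrightarrow> 1 - 1) (at_right 0)"
    by (intro tendsto_intros)
  then show ?thesis by (simp add: psi_def[abs_def])
qed

text \<open>Insert \<open>q = psi t\<close> into the defining limit: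
  \<open>kappa p (psi t) = t / psi t\<close>, so the argument of \<open>ks\<close> becomes exactly
  \<open>t\<close>.\<close>

lemma ks_asymp:
  assumes "de_Bruijn_conjugate (kappa p) ks"
  shows "((\<lambda>t. t * ks t / psi t) \<longlongrightarrow> 1) (at_right 0)"
proof -
  have "filterlim psi (at_right 0) (at_right 0)"
    unfolding filterlim_at using psi_tendsto
    by (intro conjI eventually_mono[OF eventually_unit_at_right]) (use psi(1) in force)+
  moreover have "((\<lambda>q. kappa p q * ks (q * kappa p q)) \<longlongrightarrow> 1) (at_right 0)"
    using assms by (simp add: de_Bruijn_conjugate_def)
  ultimately have "((\<lambda>t. kappa p (psi t) * ks (psi t * kappa p (psi t))) \<longlongrightarrow> 1) (at_right 0)"
    using filterlim_compose by blast
  then show ?thesis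
  proof (rule Lim_transform_eventually)
    show "\<forall>\<^sub>F t in at_right 0. kappa p (psi t) * ks (psi t * kappa p (psi t)) = t * ks t / psi t"
      using eventually_unit_at_right
    proof eventually_elim
      case (elim t)
      then have "kappa p (psi t) = t / psi t" using kappa_eq[of "psi t"] psi[of t] by simp
      then show ?case using psi[of t] elim by simp
    qed
  qed
qed

end

section \<open>Min histories\<close>

text \<open>For a solution this is \<open>g (lap (F t) q)\<close>. The integral of a non-integrable
  function is 0 by convention, so integrability is carried along separately.\<close>

definition Lam :: "(real \<Rightarrow> real) \<Rightarrow> real \<Rightarrow> real \<Rightarrow> real" where
  "Lam l q t = (LBINT s:{t<..}. exp (- q * l s) / s)"

definition Wint :: "(real \<Rightarrow> real) \<Rightarrow> real \<Rightarrow> real \<Rightarrow> real \<Rightarrow> real" where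
  "Wint l q s t = (LBINT r:{s<..t}. exp (- q * l r) / r)"

text \<open>Substitute for differentiating an integral: the integrands involve a history that may
  jump, but increments that vanish up to a quadratic error still force a zero derivative.\<close>

lemma const_of_quadratic:
  fixes D :: "real \<Rightarrow> real"
  assumes ab: "a \<le> b" and D: "\<And>s t. a \<le> s \<Longrightarrow> s \<le> t \<Longrightarrow> t \<le> b \<Longrightarrow> \<bar>D t - D s\<bar> \<le> C * (t - s)\<^sup>2"
  shows "D a = D b"
proof -
  have D': "\<bar>D y - D x\<bar> \<le> C * (y - x)\<^sup>2" if "x \<in> {a..b}" "y \<in> {a..b}" for x y
    using D[of x y] D[of y x] that by (cases "x \<le> y") (auto simp: abs_minus_commute power2_commute)
  have "\<exists>c. \<forall>x\<in>{a..b}. D x = c"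
  proof (rule has_derivative_zero_constant)
    fix x assume x: "x \<in> {a..b}"
    show "(D has_derivative (\<lambda>h. 0)) (at x within {a..b})"
    proof (rule has_derivativeI_sandwich[of 1])
      fix y assume "y \<in> {a..b}" "y \<noteq> x"
      then show "norm (D y - D x - 0) / norm (y - x) \<le> C * \<bar>y - x\<bar>"
        using D'[OF x, of y] by (simp add: divide_le_eq power2_eq_square mult.assoc abs_mult_self_eq)
    next
      have "((\<lambda>y. C * \<bar>y - x\<bar>) \<longlongrightarrow> C * \<bar>x - x\<bar>) (at x within {a..b})" by (intro tendsto_intros)
      then show "((\<lambda>y. C * \<bar>y - x\<bar>) \<longlongrightarrow> 0) (at x within {a..b})" by simp
    qed auto
  qed auto
  then show ?thesis using ab by auto
qed

lemma history_measurable: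
  assumes "mono_on {0<..} (l :: real \<Rightarrow> real)"
  shows "(\<lambda>s. if s > 0 then l s else 0) \<in> borel_measurable borel"
proof -
  have "l \<in> borel_measurable (restrict_space borel {0<..})" by (rule borel_measurable_mono_on_fnc[OF assms])
  then have "(\<lambda>s. indicator {0<..} s *\<^sub>R l s) \<in> borel_measurable borel"
    by (subst (asm) borel_measurable_restrict_space_iff) auto
  also have "(\<lambda>s. indicator {0<..} s *\<^sub>R l s) = (\<lambda>s. if s > 0 then l s else 0)" by (auto simp: indicator_def)
  finally show ?thesis .
qed

lemma history_set_measurable:
  assumes l: "mono_on {0<..} (l :: real \<Rightarrow> real)" and A: "A \<in> sets borel" "A \<subseteq> {0<..}" and f: "f \<in> borel_measurable borel"
  shows "set_borel_measurable lborel A (\<lambda>s. f (l s) / s :: real)"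
proof -
  have "(\<lambda>s. indicator A s *\<^sub>R (f (if s > 0 then l s else 0) / s)) \<in> borel_measurable borel"
    using history_measurable[OF l] f A by measurable
  also have "(\<lambda>s. indicator A s *\<^sub>R (f (if s > 0 then l s else 0) / s)) = (\<lambda>s. indicator A s *\<^sub>R (f (l s) / s))"
    using A by (intro ext) (auto simp: indicator_def subset_iff)
  finally show ?thesis by (simp add: set_borel_measurable_def)
qed

lemma integral_inverse_Ioc:
  assumes "0 < s" "s \<le> t"
  shows "set_integrable lborel {s<..t} (\<lambda>r. 1 / r :: real)" "(LBINT r:{s<..t}. 1 / r :: real) = ln (t / s)"
proof -
  have c: "continuous_on {s..t} (\<lambda>r. 1 / r :: real)" using assms by (auto intro!: continuous_intros)
  have "set_integrable lborel {s..t} (\<lambda>r. 1 / r :: real)"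
    unfolding set_integrable_def by (rule borel_integrable_compact[OF _ c]) simp
  then show i: "set_integrable lborel {s<..t} (\<lambda>r. 1 / r :: real)" by (rule set_integrable_subset) auto
  have "(LBINT r=ereal s..ereal t. 1 / r) = ln t - ln s"
  proof (rule interval_integral_FTC_finite)
    have m: "min s t = s" "max s t = t" using assms by auto
    show "continuous_on {min s t..max s t} (\<lambda>r. 1 / r :: real)" using c m by simp
    fix x assume "min s t \<le> x" "x \<le> max s t"
    then have x: "0 < x" using assms by auto
    show "(ln has_vector_derivative 1 / x) (at x within {min s t..max s t})"
      unfolding has_real_derivative_iff_has_vector_derivative[symmetric] using x by (auto intro!: derivative_eq_intros)
  qed
  then show "(LBINT r:{s<..t}. 1 / r :: real) = ln (t / s)"
    using interval_integral_Ioc[of s t "\<lambda>r. 1 / r"] assms by (simp add: ln_div)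
qed

lemma set_integrable_bounded_over_id:
  assumes s: "0 < s" "s \<le> t" and m: "set_borel_measurable lborel {s<..t} (\<lambda>r. f r / r :: real)"
    and B: "\<And>r. s < r \<Longrightarrow> r \<le> t \<Longrightarrow> \<bar>f r\<bar> \<le> B"
  shows "set_integrable lborel {s<..t} (\<lambda>r. f r / r)" "\<bar>LBINT r:{s<..t}. f r / r\<bar> \<le> B * ln (t / s)"
proof -
  have i1: "set_integrable lborel {s<..t} (\<lambda>r. B * (1 / r))"
    using integral_inverse_Ioc(1)[OF s] set_integrable_mult_right by blast
  show i: "set_integrable lborel {s<..t} (\<lambda>r. f r / r)"
  proof (rule set_integrable_bound[OF i1])
    have "\<bar>f r / r\<bar> \<le> \<bar>B * (1 / r)\<bar>" if "r \<in> {s<..t}" for r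
    proof -
      have "\<bar>f r\<bar> / r \<le> B / r" using B[of r] that s by (intro divide_right_mono) auto
      also have "\<dots> \<le> \<bar>B\<bar> / r" using that s by (intro divide_right_mono) auto
      finally show ?thesis using that s by (simp add: abs_div abs_mult)
    qed
    then show "AE x in lborel. x \<in> {s<..t} \<longrightarrow> norm (f x / x) \<le> norm (B * (1 / x))" by auto
  qed (use m in auto)
  have "\<bar>LBINT r:{s<..t}. f r / r\<bar> \<le> (LBINT r:{s<..t}. \<bar>f r / r\<bar>)"
    using set_integral_norm_bound[OF i] by simp
  also have "\<dots> \<le> (LBINT r:{s<..t}. B * (1 / r))"
  proof (rule set_integral_mono)
    show "set_integrable lborel {s<..t} (\<lambda>r. \<bar>f r / r\<bar>)" by (rule set_integrable_abs[OF i])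
    fix r assume "r \<in> {s<..t}"
    then show "\<bar>f r / r\<bar> \<le> B * (1 / r)" using B[of r] s by (simp add: abs_div divide_right_mono)
  qed (rule i1)
  also have "\<dots> = B * ln (t / s)" by (simp only: set_integral_mult_right integral_inverse_Ioc(2)[OF s])
  finally show "\<bar>LBINT r:{s<..t}. f r / r\<bar> \<le> B * ln (t / s)" .
qed

lemma set_integral_over_id_between:
  assumes s: "0 < s" "s \<le> t" and m: "set_borel_measurable lborel {s<..t} (\<lambda>r. f r / r :: real)"
    and A: "\<And>r. s < r \<Longrightarrow> r \<le> t \<Longrightarrow> A \<le> f r" and B: "\<And>r. s < r \<Longrightarrow> r \<le> t \<Longrightarrow> f r \<le> B"
  shows "A * ln (t / s) \<le> (LBINT r:{s<..t}. f r / r)" "(LBINT r:{s<..t}. f r / r) \<le> B * ln (t / s)"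
proof -
  have i: "set_integrable lborel {s<..t} (\<lambda>r. f r / r)"
    by (rule set_integrable_bounded_over_id(1)[OF s m, of "max \<bar>A\<bar> \<bar>B\<bar>"]) (use A B in force)
  have i1: "set_integrable lborel {s<..t} (\<lambda>r. C * (1 / r))" for C :: real
    using integral_inverse_Ioc(1)[OF s] set_integrable_mult_right by blast
  have e: "(LBINT r:{s<..t}. C * (1 / r)) = C * ln (t / s)" for C :: real
    by (simp only: set_integral_mult_right integral_inverse_Ioc(2)[OF s])
  have "(LBINT r:{s<..t}. A * (1 / r)) \<le> (LBINT r:{s<..t}. f r / r)"
    by (rule set_integral_mono[OF i1 i]) (use A s in \<open>auto simp: divide_right_mono\<close>)
  then show "A * ln (t / s) \<le> (LBINT r:{s<..t}. f r / r)" by (simp only: e)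
  have "(LBINT r:{s<..t}. f r / r) \<le> (LBINT r:{s<..t}. B * (1 / r))"
    by (rule set_integral_mono[OF i i1]) (use B s in \<open>auto simp: divide_right_mono\<close>)
  then show "(LBINT r:{s<..t}. f r / r) \<le> B * ln (t / s)" by (simp only: e)
qed

lemma Wint_measurable:
  assumes "mono_on {0<..} (l :: real \<Rightarrow> real)" "0 < s"
  shows "set_borel_measurable lborel {s<..t} (\<lambda>r. exp (- q * l r) / r)" "set_borel_measurable lborel {s<..} (\<lambda>r. exp (- q * l r) / r)"
  by (rule history_set_measurable[OF assms(1), where f="\<lambda>x. exp (- q * x)"]; use assms in auto)+

lemma Wint_bounds:
  assumes l: "mono_on {0<..} (l :: real \<Rightarrow> real)" and s: "0 < s" "s \<le> t" and q: "0 \<le> q"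
  shows "set_integrable lborel {s<..t} (\<lambda>r. exp (- q * l r) / r)"
    "exp (- q * l t) * ln (t / s) \<le> Wint l q s t" "Wint l q s t \<le> exp (- q * l s) * ln (t / s)"
proof -
  have lo: "exp (- q * l t) \<le> exp (- q * l r)" and up: "exp (- q * l r) \<le> exp (- q * l s)" if "s < r" "r \<le> t" for r
    using mono_onD[OF l, of r t] mono_onD[OF l, of s r] that s q by (auto intro!: mult_left_mono)
  note m = Wint_measurable(1)[OF l s(1)]
  show "exp (- q * l t) * ln (t / s) \<le> Wint l q s t" "Wint l q s t \<le> exp (- q * l s) * ln (t / s)"
    unfolding Wint_def
    by (rule set_integral_over_id_between(1)[OF s m, where B="exp (- q * l s)"] set_integral_over_id_between(2)[OF s m, where A="exp (- q * l t)"];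
        use lo up in auto)+
  show "set_integrable lborel {s<..t} (\<lambda>r. exp (- q * l r) / r)"
    by (rule set_integrable_bounded_over_id(1)[OF s m, where B="exp (- q * l s)"]) (use up in auto)
qed

lemma Wint_nonneg: "0 < s \<Longrightarrow> Wint l q s t \<ge> 0"
  unfolding Wint_def set_lebesgue_integral_def by (intro integral_nonneg_AE AE_I2) (auto simp: indicator_def)

lemma Wint_add:
  assumes "mono_on {0<..} (l :: real \<Rightarrow> real)" "0 < r" "r \<le> s" "s \<le> t" "0 \<le> q"
  shows "Wint l q r t = Wint l q r s + Wint l q s t"
proof -
  have "{r<..t} = {r<..s} \<union> {s<..t}" using assms by auto
  then show ?thesis unfolding Wint_def using assms Wint_bounds(1) by (simp add: set_integral_Un)
qed

lemma Lam_split: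
  assumes l: "mono_on {0<..} (l :: real \<Rightarrow> real)" and s: "0 < s" "s \<le> t" and q: "0 \<le> q" and i: "set_integrable lborel {t<..} (\<lambda>r. exp (- q * l r) / r)"
  shows "set_integrable lborel {s<..} (\<lambda>r. exp (- q * l r) / r)" "Lam l q s = Wint l q s t + Lam l q t"
proof -
  have e: "{s<..} = {s<..t} \<union> {t<..}" using s by auto
  note w = Wint_bounds(1)[OF l s q]
  show "set_integrable lborel {s<..} (\<lambda>r. exp (- q * l r) / r)" unfolding e by (rule set_integrable_Un[OF w i]) auto
  show "Lam l q s = Wint l q s t + Lam l q t" unfolding Lam_def Wint_def e by (rule set_integral_Un[OF _ w i]) auto
qed

lemma Lam_integrable:
  assumes l: "mono_on {0<..} (l :: real \<Rightarrow> real)" and s: "0 < s" "0 < t" and q: "0 \<le> q" and i: "set_integrable lborel {t<..} (\<lambda>r. exp (- q * l r) / r)"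
  shows "set_integrable lborel {s<..} (\<lambda>r. exp (- q * l r) / r)"
proof (cases "s \<le> t")
  case True then show ?thesis using Lam_split(1)[OF l s(1) True q i] by simp
next
  case False then show ?thesis by (intro set_integrable_subset[OF i]) auto
qed

lemma Lam_nonneg: "0 \<le> t \<Longrightarrow> Lam l q t \<ge> 0"
  unfolding Lam_def set_lebesgue_integral_def by (intro integral_nonneg_AE AE_I2) (auto simp: indicator_def)

text \<open>Monotone convergence: a finite limit over growing horizons yields both integrability and
  the value.\<close>

lemma Lam_from_limit:
  assumes l: "mono_on {0<..} (l :: real \<Rightarrow> real)" and t: "0 < t" and q: "0 \<le> q" and lim: "(\<lambda>n. Wint l q t (t + real n)) \<longlonglongrightarrow> x"
  shows "set_integrable lborel {t<..} (\<lambda>r. exp (- q * l r) / r)" "Lam l q t = x"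
proof -
  let ?f = "\<lambda>n r. indicator {t<..t + real n} r *\<^sub>R (exp (- q * l r) / r)"
  let ?u = "\<lambda>r. indicator {t<..} r *\<^sub>R (exp (- q * l r) / r)"
  have a: "integrable lborel (?f n)" for n
    using Wint_bounds(1)[OF l t, of "t + real n" q] q by (simp add: set_integrable_def)
  have b: "AE r in lborel. mono (\<lambda>n. ?f n r)"
    using t by (intro AE_I2 monoI) (auto simp: indicator_def)
  have c: "AE r in lborel. (\<lambda>n. ?f n r) \<longlonglongrightarrow> ?u r"
  proof (intro AE_I2 tendsto_eventually)
    fix r
    obtain N where N: "r - t \<le> real N" using real_arch_simple by blast
    show "\<forall>\<^sub>F n in sequentially. ?f n r = ?u r"
      using eventually_ge_at_top[of N]
    proof eventually_elim
      case (elim n)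
      then have "real N \<le> real n" by simp
      then show ?case using N by (auto simp: indicator_def)
    qed
  qed
  have d: "(\<lambda>n. integral\<^sup>L lborel (?f n)) \<longlonglongrightarrow> x" using lim by (simp add: Wint_def set_lebesgue_integral_def)
  have e: "?u \<in> borel_measurable lborel" using Wint_measurable(2)[OF l t, of q] by (simp add: set_borel_measurable_def)
  show "set_integrable lborel {t<..} (\<lambda>r. exp (- q * l r) / r)"
    unfolding set_integrable_def by (rule integrable_monotone_convergence[OF a b c d e])
  show "Lam l q t = x"
    unfolding Lam_def set_lebesgue_integral_def by (rule integral_monotone_convergence[OF a b c d e])
qed

section \<open>The minimum of a probability measure\<close>

lemma min_of_AE: assumes M: "prob_Rplus M" shows "AE x in M. min_of M \<le> x"
proof -
  interpret prob_space M using prob_RplusD[OF M] by simp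
  note sM = prob_RplusD(2)[OF M]
  let ?S = "{x. measure M {0..x} > 0}"
  have bb: "bdd_below ?S" by (rule bdd_belowI[of _ 0]) (auto intro: ccontr)
  have nz: "measure M {0..x} = 0" if "x < min_of M" for x
    using cInf_lower[OF _ bb, of x] that unfolding min_of_def by (auto simp: not_less zero_less_measure_iff)
  \<comment> \<open>Every interval ending strictly below the minimum is null; countably many of them
    exhaust what lies below it.\<close>
  have "AE x in M. x \<notin> {0..min_of M - 1 / real (Suc n)}" for n
    by (rule AE_not_in) (auto simp: null_sets_def sM emeasure_eq_measure nz)
  then have "AE x in M. \<forall>n. x \<notin> {0..min_of M - 1 / real (Suc n)}" by (subst AE_all_countable) blast
  with prob_RplusD(4)[OF M] show ?thesis
  proof eventually_elim
    case (elim x)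
    show ?case
    proof (rule ccontr)
      assume "\<not> min_of M \<le> x"
      then obtain n where "1 / real (Suc n) < min_of M - x" using reals_Archimedean[of "min_of M - x"] by (auto simp: inverse_eq_divide)
      then show False using elim by (auto simp del: of_nat_Suc dest!: spec[of _ n])
    qed
  qed
qed

lemma min_ofI:
  assumes m: "0 \<le> m" and null: "\<And>x. 0 \<le> x \<Longrightarrow> x < m \<Longrightarrow> measure M {0..x} = 0" and pos: "\<And>x. x > m \<Longrightarrow> measure M {0..x} > 0"
  shows "min_of M = m"
  unfolding min_of_def
proof (rule cInf_eq_non_empty)
  show "{x. 0 < measure M {0..x}} \<noteq> {}" using pos[of "m + 1"] by auto
  fix x assume "x \<in> {x. 0 < measure M {0..x}}"
  then show "m \<le> x" using null[of x] by (cases "0 \<le> x") (auto simp: not_le[symmetric])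
next
  fix y assume y: "\<And>x. x \<in> {x. 0 < measure M {0..x}} \<Longrightarrow> y \<le> x"
  show "y \<le> m" by (rule dense_ge) (use y pos in auto)
qed

lemma lap_le_exp:
  assumes M: "prob_Rplus M" and m: "AE x in M. m \<le> x" and q: "0 \<le> q"
  shows "lap M q \<le> exp (- q * m)"
proof -
  interpret prob_space M using prob_RplusD[OF M] by simp
  show ?thesis unfolding lap_def
    by (intro integral_le_const lap_integrable[OF M q] eventually_mono[OF m]) (use q in \<open>auto intro!: mult_left_mono\<close>)
qed

section \<open>Eternal solutions and their min history\<close>

context clustering
begin

definition gen :: "(real \<Rightarrow> real) \<Rightarrow> real measure \<Rightarrow> real \<Rightarrow> real" where
  "gen a M m = (\<Sum>k. p (Suc k) * (\<integral>y. a (m + (\<Sum>i<Suc k. y i)) - a m \<partial>(PiM {..<Suc k} (\<lambda>_. M))))"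

text \<open>The solved form of the weak equation. The history \<open>l\<close> is a parameter and
  not the minimum of \<open>F t\<close>: the two are shown to agree where \<open>l\<close> is
  right-continuous, whereas \<open>F t\<close> depends on \<open>l\<close> only through integrals,
  hence up to null sets.\<close>

definition solves :: "(real \<Rightarrow> real) \<Rightarrow> (real \<Rightarrow> real measure) \<Rightarrow> bool" where
  "solves l F \<longleftrightarrow> (\<forall>s>0. 0 < l s) \<and> mono_on {0<..} l \<and>
     (\<forall>t>0. prob_Rplus (F t) \<and> (\<forall>q>0. set_integrable lborel {t<..} (\<lambda>s. exp (- q * l s) / s) \<and> lap (F t) q = ginv (Lam l q t)))"

text \<open>Cut off on the negative reals to match the representation chosen in
  \<open>C0_Rplus\<close>.\<close>

definition exp0 :: "real \<Rightarrow> real \<Rightarrow> real" where "exp0 q x = (if x < 0 then 0 else exp (- q * x))"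

lemma exp0_C0: assumes "q > 0" shows "exp0 q \<in> C0_Rplus"
proof -
  have "continuous_on {0..} (exp0 q) \<longleftrightarrow> continuous_on {0..} (\<lambda>x. exp (- q * x))"
    by (intro continuous_on_cong) (auto simp: exp0_def)
  moreover have "continuous_on {0..} (\<lambda>x. exp (- q * x))" by (auto intro!: continuous_intros)
  moreover have "((\<lambda>x. exp (- q * x)) \<longlongrightarrow> 0) at_top" using assms by real_asymp
  then have "(exp0 q \<longlongrightarrow> 0) at_top"
    by (rule Lim_transform_eventually) (auto intro!: eventually_mono[OF eventually_ge_at_top[of 0]] simp: exp0_def)
  ultimately show ?thesis by (simp add: C0_Rplus_def exp0_def)
qed

lemma PiM_sum_nonneg:
  assumes M: "prob_Rplus M"
  shows "AE y in PiM {..<n::nat} (\<lambda>_. M). \<forall>i<n. 0 \<le> y i"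
proof -
  have "AE y in PiM {..<n} (\<lambda>_. M). 0 \<le> y i" if "i < n" for i
    by (rule AE_PiM_component) (use that prob_RplusD[OF M] in auto)
  then have "AE y in PiM {..<n} (\<lambda>_. M). \<forall>i\<in>{..<n}. 0 \<le> y i" by (intro eventually_ball_finite) auto
  then show ?thesis by eventually_elim auto
qed

lemma exp0_PiM_integral:
  assumes M: "prob_Rplus M" and m: "m \<ge> 0" and q: "q \<ge> 0"
  shows "(\<integral>y. exp0 q (m + (\<Sum>i<n. y i)) \<partial>(PiM {..<n} (\<lambda>_. M))) = exp (- q * m) * lap M q ^ n"
proof -
  interpret M: prob_space M using prob_RplusD[OF M] by simp
  interpret P: product_sigma_finite "\<lambda>_::nat. M" by (simp add: product_sigma_finite_def M.sigma_finite_measure_axioms)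
  have sM: "sets M = sets borel" using prob_RplusD[OF M] by simp
  have comp: "(\<lambda>y. y i) \<in> borel_measurable (PiM {..<n} (\<lambda>_. M))" if "i < n" for i
  proof -
    have "(\<lambda>y. y i) \<in> measurable (PiM {..<n} (\<lambda>_. M)) M" using that by (intro measurable_component_singleton) auto
    then show ?thesis using measurable_cong_sets[OF refl sM] by blast
  qed
  have "(\<integral>y. exp0 q (m + (\<Sum>i<n. y i)) \<partial>(PiM {..<n} (\<lambda>_. M))) = (\<integral>y. exp (- q * m) * (\<Prod>i<n. exp (- q * y i)) \<partial>(PiM {..<n} (\<lambda>_. M)))"
  proof (rule integral_cong_AE)
    have ms: "(\<lambda>y. m + (\<Sum>i<n. y i)) \<in> borel_measurable (PiM {..<n} (\<lambda>_. M))" by (intro borel_measurable_add borel_measurable_sum comp) auto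
    have me: "exp0 q \<in> borel_measurable borel" unfolding exp0_def[abs_def] by measurable
    show "(\<lambda>y. exp0 q (m + (\<Sum>i<n. y i))) \<in> borel_measurable (PiM {..<n} (\<lambda>_. M))" using measurable_compose[OF ms me] .
    show "(\<lambda>y. exp (- q * m) * (\<Prod>i<n. exp (- q * y i))) \<in> borel_measurable (PiM {..<n} (\<lambda>_. M))"
      using comp by (intro borel_measurable_times borel_measurable_prod borel_measurable_const) (auto intro!: borel_measurable_exp borel_measurable_times)
    show "AE y in PiM {..<n} (\<lambda>_. M). exp0 q (m + (\<Sum>i<n. y i)) = exp (- q * m) * (\<Prod>i<n. exp (- q * y i))"
      using PiM_sum_nonneg[OF M, of n]
    proof eventually_elim
      case (elim y)
      then have "0 \<le> m + (\<Sum>i<n. y i)" using m by (intro add_nonneg_nonneg sum_nonneg) auto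
      moreover have "(\<Prod>i<n. exp (- q * y i)) = exp (\<Sum>i<n. - q * y i)" by (simp add: exp_sum)
      moreover have "- q * (m + (\<Sum>i<n. y i)) = - q * m + (\<Sum>i<n. - q * y i)" by (simp add: distrib_left sum_distrib_left sum_negf)
      then have "exp (- q * (m + (\<Sum>i<n. y i))) = exp (- q * m) * exp (\<Sum>i<n. - q * y i)" by (simp only: exp_add)
      ultimately show ?case by (simp add: exp0_def)
    qed
  qed
  also have "\<dots> = exp (- q * m) * (\<integral>y. (\<Prod>i<n. exp (- q * y i)) \<partial>(PiM {..<n} (\<lambda>_. M)))" by simp
  also have "(\<integral>y. (\<Prod>i<n. exp (- q * y i)) \<partial>(PiM {..<n} (\<lambda>_. M))) = (\<Prod>i<n. lap M q)"
    unfolding lap_def by (rule P.product_integral_prod) (use lap_integrable[OF M q] in auto)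
  finally show ?thesis by simp
qed

lemma PiM_component_measurable:
  assumes M: "prob_Rplus M" and "i < n"
  shows "(\<lambda>y. y i) \<in> borel_measurable (PiM {..<n::nat} (\<lambda>_. M))"
proof -
  have "(\<lambda>y. y i) \<in> measurable (PiM {..<n} (\<lambda>_. M)) M" using assms by (intro measurable_component_singleton) auto
  then show ?thesis using measurable_cong_sets[OF refl prob_RplusD(2)[OF M]] by blast
qed

lemma PiM_bounded_integrable:
  assumes M: "prob_Rplus M" and a: "a \<in> borel_measurable borel" and B: "\<And>x. \<bar>a x\<bar> \<le> (B::real)"
  shows "integrable (PiM {..<n::nat} (\<lambda>_. M)) (\<lambda>y. a (m + (\<Sum>i<n. y i)))"
proof -
  interpret P: prob_space "PiM {..<n} (\<lambda>_. M)" by (intro prob_space_PiM) (use prob_RplusD[OF M] in auto)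
  have "(\<lambda>y. m + (\<Sum>i<n. y i)) \<in> borel_measurable (PiM {..<n} (\<lambda>_. M))"
    by (intro borel_measurable_add borel_measurable_sum PiM_component_measurable[OF M]) auto
  from measurable_compose[OF this a] show ?thesis by (intro P.integrable_const_bound[where B=B]) (use B in auto)
qed

text \<open>On exponentials, independence turns the sum of \<open>k\<close> clusters into the power
  \<open>lap M q ^ k\<close>, and summation over \<open>k\<close> produces \<open>Qgen p\<close>.
  The weak equation therefore closes up in the transform, separately for each
  \<open>q\<close>.\<close>

lemma gen_exp0:
  assumes M: "prob_Rplus M" and m: "m \<ge> 0" and q: "q \<ge> 0"
  shows "gen (exp0 q) M m = - exp (- q * m) * (1 - Qgen p (lap M q))"
proof -
  have *: "(\<integral>y. exp0 q (m + (\<Sum>i<Suc k. y i)) - exp0 q m \<partial>(PiM {..<Suc k} (\<lambda>_. M))) = exp (- q * m) * lap M q ^ Suc k - exp (- q * m)" for k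
  proof -
    interpret P: prob_space "PiM {..<Suc k} (\<lambda>_. M)" by (intro prob_space_PiM) (use prob_RplusD[OF M] in auto)
    have "integrable (PiM {..<Suc k} (\<lambda>_. M)) (\<lambda>y. exp0 q (m + (\<Sum>i<Suc k. y i)))"
    proof (rule integrable_cong_AE_imp)
      show "integrable (PiM {..<Suc k} (\<lambda>_. M)) (\<lambda>y. exp (- q * max 0 (m + (\<Sum>i<Suc k. y i))))"
        by (rule PiM_bounded_integrable[OF M, where a="\<lambda>x. exp (- q * max 0 x)" and B=1]) (use q in auto)
      have me: "exp0 q \<in> borel_measurable borel" unfolding exp0_def[abs_def] by measurable
      have "(\<lambda>y. m + (\<Sum>i<Suc k. y i)) \<in> borel_measurable (PiM {..<Suc k} (\<lambda>_. M))"
        by (intro borel_measurable_add borel_measurable_sum PiM_component_measurable[OF M]) auto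
      from measurable_compose[OF this me]
      show "(\<lambda>y. exp0 q (m + (\<Sum>i<Suc k. y i))) \<in> borel_measurable (PiM {..<Suc k} (\<lambda>_. M))" .
      show "AE y in PiM {..<Suc k} (\<lambda>_. M). exp (- q * max 0 (m + (\<Sum>i<Suc k. y i))) = exp0 q (m + (\<Sum>i<Suc k. y i))"
        using PiM_sum_nonneg[OF M, of "Suc k"]
      proof eventually_elim
        case (elim y)
        then have "0 \<le> m + (\<Sum>i<Suc k. y i)" using m by (intro add_nonneg_nonneg sum_nonneg) auto
        then show ?case by (simp add: exp0_def)
      qed
    qed
    then show ?thesis using exp0_PiM_integral[OF M m q, of "Suc k"] m P.prob_space by (simp add: exp0_def)
  qed
  have "gen (exp0 q) M m = (\<Sum>k. exp (- q * m) * (p (Suc k) * lap M q ^ Suc k - p (Suc k)))"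
    unfolding gen_def by (rule suminf_cong, simp only: *, simp add: algebra_simps)
  also have "\<dots> = exp (- q * m) * (Qgen p (lap M q) - 1)"
    by (intro sums_unique[symmetric] sums_mult sums_diff Q_sums p_sums lap_le_1 less_imp_le[OF lap_pos] M q)
  finally show ?thesis by (simp add: algebra_simps)
qed

lemma lap_exp0: assumes M: "prob_Rplus M" shows "integral\<^sup>L M (exp0 q) = lap M q"
  unfolding lap_def
proof (rule integral_cong_AE)
  show "AE x in M. exp0 q x = exp (- q * x)" using prob_RplusD(4)[OF M] by eventually_elim (auto simp: exp0_def)
  have "exp0 q \<in> borel_measurable borel" unfolding exp0_def[abs_def] by measurable
  then show "exp0 q \<in> borel_measurable M" by (simp add: measurable_cong_sets[OF prob_RplusD(2)[OF M] refl])
qed (simp add: measurable_cong_sets[OF prob_RplusD(2)[OF M] refl])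

text \<open>Tested on \<open>exp (- q * x)\<close>, the equation makes \<open>?f s - ?f t\<close>
  the integral of \<open>w r / r\<close>, where \<open>w\<close> is \<open>exp (- q * l r)\<close>
  times \<open>(1 - Qgen p (?f r)) / Q1 p\<close>. Composition with \<open>g\<close> cancels the
  second factor, and decay of \<open>?f\<close> to 0 at infinity permits integration over all later
  times.\<close>

lemma eternal_solves:
  assumes F: "eternal_solution p F"
  shows "solves (\<lambda>t. min_of (F t)) F"
proof -
  define l where "l t = min_of (F t)" for t
  have PR: "prob_Rplus (F t)" if "t > 0" for t using F that by (auto simp: eternal_solution_def weak_solution_def)
  have lp: "l t > 0" if "t > 0" for t using F that by (auto simp: eternal_solution_def weak_solution_def l_def)
  have lm: "mono_on {0<..} l" using F by (auto simp: eternal_solution_def weak_solution_def l_def[abs_def])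
  have ub: "lap (F t) q \<le> exp (- q * l t)" if "t > 0" "q \<ge> 0" for t q
    using lap_le_exp[OF PR min_of_AE[OF PR]] that by (simp add: l_def)
  have "set_integrable lborel {t<..} (\<lambda>s. exp (- q * l s) / s) \<and> lap (F t) q = ginv (Lam l q t)" if t: "t > 0" and q: "q > 0" for t q
  proof -
    let ?f = "\<lambda>s. lap (F s) q"
    have f0: "0 < ?f s" if "s > 0" for s using lap_pos[OF PR[OF that]] q by simp
    have f1: "?f s < 1" if "s > 0" for s
    proof -
      have "exp (- q * l s) < 1" using lp[OF that] q by simp
      then show ?thesis using ub[OF that, of q] q by linarith
    qed
    have meas: "(\<lambda>s. ?f s) \<in> borel_measurable (restrict_space borel {0<..})"
    proof -
      have "(\<lambda>t. integral\<^sup>L (F t) (exp0 q)) \<in> borel_measurable (restrict_space borel {0<..})"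
        using F exp0_C0[OF q] by (auto simp: eternal_solution_def weak_solution_def)
      then show ?thesis by (rule measurable_cong[THEN iffD1, rotated]) (auto simp: space_restrict_space lap_exp0 PR)
    qed
    define w where "w s = exp (- q * l s) * (1 - Qgen p (?f s)) / Q1 p" for s
    have w_meas: "set_borel_measurable lborel A (\<lambda>s. w s / s)" if A: "A \<in> sets borel" "A \<subseteq> {0<..}" for A
    proof -
      have Qm: "(\<lambda>x. indicator {0..1} x *\<^sub>R Qgen p x) \<in> borel_measurable borel"
        by (rule borel_measurable_continuous_on_indicator[OF _ Q_continuous]) auto
      have m1: "(\<lambda>s. indicator {0<..} s *\<^sub>R ?f s) \<in> borel_measurable borel"
        using meas by (subst (asm) borel_measurable_restrict_space_iff) auto
      have "(\<lambda>s. indicator A s *\<^sub>R (exp (- q * (if s > 0 then l s else 0)) * (1 - (\<lambda>x. indicator {0..1} x *\<^sub>R Qgen p x) (indicator {0<..} s *\<^sub>R ?f s)) / Q1 p / s)) \<in> borel_measurable borel"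
        using history_measurable[OF lm] measurable_compose[OF m1 Qm] A(1) by measurable
      also have "(\<lambda>s. indicator A s *\<^sub>R (exp (- q * (if s > 0 then l s else 0)) * (1 - (\<lambda>x. indicator {0..1} x *\<^sub>R Qgen p x) (indicator {0<..} s *\<^sub>R ?f s)) / Q1 p / s)) = (\<lambda>s. indicator A s *\<^sub>R (w s / s))"
      proof
        fix s
        show "indicator A s *\<^sub>R (exp (- q * (if s > 0 then l s else 0)) * (1 - (\<lambda>x. indicator {0..1} x *\<^sub>R Qgen p x) (indicator {0<..} s *\<^sub>R ?f s)) / Q1 p / s) = indicator A s *\<^sub>R (w s / s)"
        proof (cases "s \<in> A")
          case True
          then have "s > 0" using A by auto
          moreover have "0 \<le> ?f s" "?f s \<le> 1" using f0[OF \<open>s > 0\<close>] f1[OF \<open>s > 0\<close>] by auto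
          ultimately show ?thesis by (simp add: w_def)
        qed simp
      qed
      finally show ?thesis by (simp add: set_borel_measurable_def)
    qed
    have w_nonneg: "0 \<le> w s" if "s > 0" for s
      unfolding w_def using Q_lt_1[of "?f s"] f0[OF that] f1[OF that] Q1_ge_1 by auto
    have w_le: "w s \<le> 1" if "s > 0" for s
    proof -
      have "exp (- q * l s) * (1 - Qgen p (?f s)) \<le> 1 * 1"
        using Q_lt_1[of "?f s"] Q_nonneg[of "?f s"] f0[OF that] f1[OF that] lp[OF that] q by (intro mult_mono) auto
      then show ?thesis using Q1_ge_1 by (simp add: w_def)
    qed
    have eq: "?f s - ?f t = (LBINT r:{s<..t}. w r / r)" if st: "0 < s" "s \<le> t" for s t
    proof -
      have "?f t - ?f s = (LBINT r=ereal s..ereal t. gen (exp0 q) (F r) (l r) / (Q1 p * r))"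
      proof -
        have "\<forall>a\<in>C0_Rplus. \<forall>t0\<in>{0<..}. \<forall>t\<in>{0<..}. integral\<^sup>L (F t) a - integral\<^sup>L (F t0) a
          = (LBINT s=ereal t0..ereal t. gen a (F s) (l s) / (Q1 p * s))"
          using F unfolding eternal_solution_def weak_solution_def gen_def l_def by blast
        from this[rule_format, OF exp0_C0[OF q], of s t] show ?thesis using st lap_exp0[OF PR] by simp
      qed
      also have "\<dots> = (LBINT r:{s<..t}. gen (exp0 q) (F r) (l r) / (Q1 p * r))"
        using st by (intro interval_integral_Ioc) auto
      also have "\<dots> = (LBINT r:{s<..t}. - (w r / r))"
      proof (rule set_lebesgue_integral_cong)
        show "\<forall>r. r \<in> {s<..t} \<longrightarrow> gen (exp0 q) (F r) (l r) / (Q1 p * r) = - (w r / r)"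
          using st q lp PR by (auto simp: gen_exp0 less_imp_le w_def)
      qed simp
      also have "\<dots> = - (LBINT r:{s<..t}. w r / r)" by (simp add: set_lebesgue_integral_def)
      finally show ?thesis by simp
    qed
    have fmono: "?f t \<le> ?f s" if st: "0 < s" "s \<le> t" for s t
    proof -
      have "0 * ln (t / s) \<le> (LBINT r:{s<..t}. w r / r)"
        by (rule set_integral_over_id_between(1)[OF st w_meas, where B="1"])
           (use st w_nonneg w_le in auto)
      then show ?thesis using eq[OF st] by simp
    qed
    \<comment> \<open>The transform decreases in time, so the factor \<open>1 - Qgen p\<close> lies
      between its endpoint values and can be taken out of the integral.\<close>
    have bnd: "Wint l q s t * (1 - Qgen p (?f s)) / Q1 p \<le> ?f s - ?f t \<and> ?f s - ?f t \<le> Wint l q s t * (1 - Qgen p (?f t)) / Q1 p"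
      if st: "0 < s" "s \<le> t" for s t
    proof -
      have iW: "set_integrable lborel {s<..t} (\<lambda>r. c * (exp (- q * l r) / r))" for c :: real
        by (rule set_integrable_mult_right, rule Wint_bounds(1)[OF lm st]) (use q in auto)
      have iw: "set_integrable lborel {s<..t} (\<lambda>r. w r / r)"
        by (rule set_integrable_bounded_over_id(1)[OF st w_meas, where B=1])
           (use st w_nonneg w_le in auto)
      have c: "(LBINT r:{s<..t}. c * (exp (- q * l r) / r)) = Wint l q s t * c" for c :: real unfolding Wint_def set_integral_mult_right by (rule mult.commute)
      have "(LBINT r:{s<..t}. (1 - Qgen p (?f s)) / Q1 p * (exp (- q * l r) / r)) \<le> (LBINT r:{s<..t}. w r / r)"
      proof (rule set_integral_mono[OF iW iw])
        fix r assume r: "r \<in> {s<..t}"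
        have "Qgen p (?f r) \<le> Qgen p (?f s)" using r st f0[of r] f1[of s] fmono[of s r] by (intro Q_mono) auto
        then have "exp (- q * l r) * (1 - Qgen p (?f s)) / Q1 p / r \<le> w r / r"
          unfolding w_def using r st Q1_ge_1 by (intro divide_right_mono mult_left_mono) auto
        then show "(1 - Qgen p (?f s)) / Q1 p * (exp (- q * l r) / r) \<le> w r / r" by (simp add: field_simps)
      qed
      moreover have "(LBINT r:{s<..t}. w r / r) \<le> (LBINT r:{s<..t}. (1 - Qgen p (?f t)) / Q1 p * (exp (- q * l r) / r))"
      proof (rule set_integral_mono[OF iw iW])
        fix r assume r: "r \<in> {s<..t}"
        have "Qgen p (?f t) \<le> Qgen p (?f r)" using r st f0[of t] f1[of r] fmono[of r t] by (intro Q_mono) auto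
        then have "w r / r \<le> exp (- q * l r) * (1 - Qgen p (?f t)) / Q1 p / r"
          unfolding w_def using r st Q1_ge_1 by (intro divide_right_mono mult_left_mono) auto
        then show "w r / r \<le> (1 - Qgen p (?f t)) / Q1 p * (exp (- q * l r) / r)" by (simp add: field_simps)
      qed
      ultimately show ?thesis using eq[OF st] unfolding c by simp
    qed
    \<comment> \<open>Chain rule without differentiability: on a short interval the increment of
      \<open>g\<close> lies between \<open>?W * ?a / ?b\<close> and \<open>?W * ?b / ?a\<close>,
      while \<open>?b - ?a\<close> is at most \<open>?W\<close>; the error is of second order in the
      length.\<close>
    have gW: "g (?f s) - g (?f t) = Wint l q s t" if st: "0 < s" "s \<le> t" for s t
    proof -
      define D where "D r = g (?f r) + Wint l q s r" for r
      have "D s = D t"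
      proof (rule const_of_quadratic[OF st(2)])
        fix u v assume uv: "s \<le> u" "u \<le> v" "v \<le> t"
        have u0: "0 < u" using uv st by simp
        have v0: "0 < v" using uv u0 by simp
        let ?W = "Wint l q u v"
        let ?a = "1 - Qgen p (?f u)" and ?b = "1 - Qgen p (?f v)"
        have W0: "0 \<le> ?W" by (rule Wint_nonneg[OF u0])
        have fu: "0 \<le> ?f u" "?f u < 1" "0 \<le> ?f v" "?f v < 1" "?f v \<le> ?f u" using f0 f1 fmono u0 v0 uv by (auto simp: less_imp_le)
        have a: "0 < ?a" "?a \<le> ?b" "?b \<le> 1" using Q_lt_1[of "?f u"] Q_mono[of "?f v" "?f u"] Q_nonneg[of "?f v"] fu by auto
        have a0: "1 - Qgen p (?f s) \<le> ?a" using Q_mono[of "?f u" "?f s"] fu f1[OF st(1)] fmono[OF st(1) uv(1)] by auto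
        have as: "0 < 1 - Qgen p (?f s)" using Q_lt_1[of "?f s"] f0[OF st(1)] f1[OF st(1)] by simp
        have b1: "?W * ?a \<le> (?f u - ?f v) * Q1 p" "(?f u - ?f v) * Q1 p \<le> ?W * ?b"
          using bnd[OF u0 uv(2)] Q1_ge_1 by (auto simp: field_simps)
        have g1: "(?f u - ?f v) * Q1 p / ?b \<le> g (?f u) - g (?f v)" "g (?f u) - g (?f v) \<le> (?f u - ?f v) * Q1 p / ?a"
          using g_diff_bounds[OF fu(3,5,2)] by auto
        have Wl: "?W \<le> ln (v / u)"
        proof -
          have "?W \<le> exp (- q * l u) * ln (v / u)" by (rule Wint_bounds(3)[OF lm u0 uv(2)]) (use q in auto)
          also have "\<dots> \<le> 1 * ln (v / u)" using lp[OF u0] q uv u0 by (intro mult_right_mono) auto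
          finally show ?thesis by simp
        qed
        have lnb: "ln (v / u) \<le> (v - u) / s"
        proof -
          have "ln (v / u) \<le> v / u - 1" using u0 v0 by (intro ln_le_minus_one) auto
          also have "\<dots> = (v - u) / u" using u0 by (simp add: field_simps)
          also have "\<dots> \<le> (v - u) / s" using uv st by (intro divide_left_mono) auto
          finally show ?thesis .
        qed
        have dQ: "?b - ?a \<le> ?W"
        proof -
          have "?b - ?a \<le> Q1 p * (?f u - ?f v)" using Q_diff_le[of "?f v" "?f u"] fu by simp
          also have "\<dots> \<le> ?W * ?b" using b1 by (simp add: mult.commute)
          also have "\<dots> \<le> ?W" using W0 a by (simp add: mult_left_le)
          finally show ?thesis .
        qed
        have "\<bar>g (?f u) - g (?f v) - ?W\<bar> \<le> ?W * (?b - ?a) / ?a"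
        proof -
          have "g (?f u) - g (?f v) \<le> ?W * ?b / ?a" using g1(2) b1(2) a by (meson divide_right_mono less_imp_le order_trans)
          moreover have "?W * ?a / ?b \<le> g (?f u) - g (?f v)"
            using g1(1) divide_right_mono[OF b1(1), of ?b] a by linarith
          moreover have "?W * ?b / ?a = ?W + ?W * (?b - ?a) / ?a" using a by (simp add: field_simps)
          moreover have "?W * ?a / ?b = ?W - ?W * (?b - ?a) / ?b" using a by (simp add: field_simps)
          moreover have "?W * (?b - ?a) / ?b \<le> ?W * (?b - ?a) / ?a" using a W0 by (intro divide_left_mono) auto
          ultimately show ?thesis by linarith
        qed
        also have "\<dots> \<le> ?W * ?W / ?a" using dQ W0 a by (intro divide_right_mono mult_left_mono) auto
        also have "\<dots> \<le> ((v - u) / s) * ((v - u) / s) / (1 - Qgen p (?f s))"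
          using Wl lnb W0 as a0 uv st by (intro frac_le mult_mono) auto
        finally have "\<bar>g (?f u) - g (?f v) - ?W\<bar> \<le> 1 / (s\<^sup>2 * (1 - Qgen p (?f s))) * (v - u)\<^sup>2"
          by (simp add: power2_eq_square)
        moreover have "Wint l q s v = Wint l q s u + ?W" by (rule Wint_add[OF lm st(1) uv(1,2)]) (use q in auto)
        ultimately show "\<bar>D v - D u\<bar> \<le> 1 / (s\<^sup>2 * (1 - Qgen p (?f s))) * (v - u)\<^sup>2" unfolding D_def by linarith
      qed
      moreover have "Wint l q s s = 0" by (simp add: Wint_def set_lebesgue_integral_def)
      ultimately show ?thesis by (simp add: D_def)
    qed
    \<comment> \<open>A bounded history would make the integral of
      \<open>exp (- q * l s) / s\<close> diverge logarithmically, whereas \<open>Wint\<close> is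
      bounded by \<open>g (?f t)\<close>. So \<open>exp (- q * l s)\<close> tends to 0, and it
      dominates the transform.\<close>
    have lap0: "(\<lambda>n. ?f (t + real n)) \<longlonglongrightarrow> 0"
    proof -
      have b: "?f (t + real n) \<le> g (?f t) / ln ((t + real n) / t)" if "n \<ge> 1" for n
      proof -
        have T: "t < t + real n" using that by simp
        have lnp: "ln ((t + real n) / t) > 0" using T t by simp
        have "exp (- q * l (t + real n)) * ln ((t + real n) / t) \<le> Wint l q t (t + real n)"
          by (rule Wint_bounds(2)[OF lm t]) (use q in auto)
        also have "\<dots> \<le> g (?f t)" using gW[OF t, of "t + real n"] g_nonneg[of "?f (t + real n)"] f0[of "t + real n"] f1[of "t + real n"] t by simp
        finally have "exp (- q * l (t + real n)) \<le> g (?f t) / ln ((t + real n) / t)" using lnp by (simp add: field_simps)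
        then show ?thesis using ub[of "t + real n" q] t q by simp
      qed
      have "filterlim (\<lambda>n. ln ((t + real n) / t)) at_top sequentially"
        using t by real_asymp
      then have "(\<lambda>n. g (?f t) / ln ((t + real n) / t)) \<longlonglongrightarrow> 0" by (rule tendsto_divide_0[OF tendsto_const filterlim_at_top_imp_at_infinity])
      then show ?thesis
      proof (rule tendsto_sandwich[OF _ _ tendsto_const, rotated 2])
        show "\<forall>\<^sub>F n in sequentially. 0 \<le> ?f (t + real n)" using f0 t by (intro always_eventually allI less_imp_le) simp
        show "\<forall>\<^sub>F n in sequentially. ?f (t + real n) \<le> g (?f t) / ln ((t + real n) / t)"
          using b by (rule eventually_sequentiallyI)
      qed
    qed
    have "(\<lambda>n. g (?f (t + real n))) \<longlonglongrightarrow> g 0"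
    proof (rule continuous_on_tendsto_compose[OF g_continuous[of "?f t"] lap0])
      show "\<forall>\<^sub>F n in sequentially. ?f (t + real n) \<in> {0..?f t}"
        using f0 t fmono[OF t] by (auto simp: less_imp_le)
    qed (use f1[OF t] f0[OF t] in auto)
    then have "(\<lambda>n. g (?f t) - g (?f (t + real n))) \<longlonglongrightarrow> g (?f t) - 0" unfolding g_0 by (intro tendsto_intros)
    moreover have "g (?f t) - g (?f (t + real n)) = Wint l q t (t + real n)" for n by (rule gW) (use t in auto)
    ultimately have lim: "(\<lambda>n. Wint l q t (t + real n)) \<longlonglongrightarrow> g (?f t)" by simp
    have "Lam l q t = g (?f t)" "set_integrable lborel {t<..} (\<lambda>s. exp (- q * l s) / s)"
      using Lam_from_limit[OF lm t _ lim] q by auto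
    then show ?thesis using ginv_g[of "?f t"] f0[OF t] f1[OF t] by simp
  qed
  then show ?thesis using PR lp lm unfolding solves_def l_def[abs_def] by blast
qed

end

section \<open>From a min history to an eternal solution\<close>

text \<open>Functions on the half-line in the variable \<open>u = exp (- x)\<close>; by
  \<open>C0_on_exp\<close> those with \<open>h 0 = 0\<close> exhaust
  \<open>C0_Rplus\<close>.\<close>

definition on_exp :: "(real \<Rightarrow> real) \<Rightarrow> real \<Rightarrow> real" where
  "on_exp h x = (if x < 0 then 0 else h (exp (- x)))"

lemma on_exp_measurable: assumes "continuous_on {0..1} h" shows "on_exp h \<in> borel_measurable borel"
proof -
  have "continuous_on {0..} (\<lambda>x. h (exp (- x)))"
    by (intro continuous_on_compose2[OF assms]) (auto intro!: continuous_intros)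
  then have "(\<lambda>x. indicator {0..} x *\<^sub>R h (exp (- x))) \<in> borel_measurable borel"
    by (intro borel_measurable_continuous_on_indicator) auto
  also have "(\<lambda>x. indicator {0..} x *\<^sub>R h (exp (- x))) = on_exp h" by (auto simp: on_exp_def indicator_def)
  finally show ?thesis .
qed

lemma on_exp_bound: assumes "\<And>u. u \<in> {0..1} \<Longrightarrow> \<bar>h u\<bar> \<le> B" shows "\<bar>on_exp h x\<bar> \<le> B"
  using assms[of "exp (- x)"] order_trans[OF abs_ge_zero assms[of 0]] by (auto simp: on_exp_def)

lemma on_exp_bounded: assumes "continuous_on {0..1} h" obtains B where "\<And>x. \<bar>on_exp h x\<bar> \<le> B"
proof -
  have "bounded (h ` {0..1})" using assms by (intro compact_imp_bounded compact_continuous_image) auto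
  then obtain B where "\<And>x. x \<in> {0..1} \<Longrightarrow> norm (h x) \<le> B" unfolding bounded_iff by blast
  then show ?thesis using that on_exp_bound[of h B] by auto
qed

lemma exp_decay: "d > 0 \<Longrightarrow> (\<lambda>n. C * exp (- d * real n)) \<longlonglongrightarrow> 0" for C d :: real
  by real_asymp

context clustering
begin

lemma gen_term_bound:
  assumes M: "prob_Rplus M" and a: "a \<in> borel_measurable borel" and B: "\<And>x. \<bar>a x\<bar> \<le> (B::real)"
  shows "\<bar>p (Suc k) * (\<integral>y. a (m + (\<Sum>i<Suc k. y i)) - a m \<partial>(PiM {..<Suc k} (\<lambda>_. M)))\<bar> \<le> p (Suc k) * (2 * B)"
proof -
  interpret P: prob_space "PiM {..<Suc k} (\<lambda>_. M)" by (intro prob_space_PiM) (use prob_RplusD[OF M] in auto)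
  have i: "integrable (PiM {..<Suc k} (\<lambda>_. M)) (\<lambda>y. a (m + (\<Sum>i<Suc k. y i)) - a m)"
    by (intro Bochner_Integration.integrable_diff PiM_bounded_integrable[OF M a B]) auto
  have "\<bar>\<integral>y. a (m + (\<Sum>i<Suc k. y i)) - a m \<partial>(PiM {..<Suc k} (\<lambda>_. M))\<bar> \<le> (\<integral>y. \<bar>a (m + (\<Sum>i<Suc k. y i)) - a m\<bar> \<partial>(PiM {..<Suc k} (\<lambda>_. M)))"
    by (rule integral_abs_bound)
  also have "\<dots> \<le> 2 * B"
  proof (rule P.integral_le_const)
    show "AE y in PiM {..<Suc k} (\<lambda>_. M). \<bar>a (m + (\<Sum>i<Suc k. y i)) - a m\<bar> \<le> 2 * B"
    proof (rule AE_I2)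
      fix y show "\<bar>a (m + (\<Sum>i<Suc k. y i)) - a m\<bar> \<le> 2 * B" using B[of "m + (\<Sum>i<Suc k. y i)"] B[of m] by linarith
    qed
  qed (use i in auto)
  finally show ?thesis using p_nonneg[of k] by (simp add: abs_mult mult_left_mono del: sum.lessThan_Suc)
qed

lemma gen_summable:
  assumes M: "prob_Rplus M" and a: "a \<in> borel_measurable borel" and B: "\<And>x. \<bar>a x\<bar> \<le> (B::real)"
  shows "summable (\<lambda>k. p (Suc k) * (\<integral>y. a (m + (\<Sum>i<Suc k. y i)) - a m \<partial>(PiM {..<Suc k} (\<lambda>_. M))))"
  by (rule summable_comparison_test'[OF summable_mult2[OF sums_summable[OF p_sums], of "2 * B"], of 0])
     (use gen_term_bound[OF M a B] in auto)

text \<open>Uniform in the measure and the minimum, as the weights sum to 1. This lets the weak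
  equation pass to uniform limits of test functions.\<close>

lemma gen_bound:
  assumes M: "prob_Rplus M" and a: "a \<in> borel_measurable borel" and B: "\<And>x. \<bar>a x\<bar> \<le> (B::real)"
  shows "\<bar>gen a M m\<bar> \<le> 2 * B"
proof -
  have s: "(\<lambda>k. p (Suc k) * (2 * B)) sums (2 * B)" using sums_mult2[OF p_sums, of "2 * B"] by simp
  have "norm (gen a M m) \<le> (\<Sum>k. p (Suc k) * (2 * B))"
    unfolding gen_def by (rule norm_suminf_le[OF _ sums_summable[OF s]])
      (use gen_term_bound[OF M a B] in auto)
  then show ?thesis using sums_unique[OF s] by simp
qed

lemma gen_add:
  assumes M: "prob_Rplus M" and a: "a \<in> borel_measurable borel" "\<And>x. \<bar>a x\<bar> \<le> (A::real)"
    and b: "b \<in> borel_measurable borel" "\<And>x. \<bar>b x\<bar> \<le> (B::real)"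
  shows "gen (\<lambda>x. a x + b x) M m = gen a M m + gen b M m"
proof -
  have "gen a M m + gen b M m = (\<Sum>k. p (Suc k) * (\<integral>y. a (m + (\<Sum>i<Suc k. y i)) - a m \<partial>(PiM {..<Suc k} (\<lambda>_. M)))
     + p (Suc k) * (\<integral>y. b (m + (\<Sum>i<Suc k. y i)) - b m \<partial>(PiM {..<Suc k} (\<lambda>_. M))))"
    unfolding gen_def by (rule suminf_add[OF gen_summable[OF M a] gen_summable[OF M b]])
  also have "\<dots> = gen (\<lambda>x. a x + b x) M m"
    unfolding gen_def
  proof (rule suminf_cong)
    fix k
    interpret P: prob_space "PiM {..<Suc k} (\<lambda>_. M)" by (intro prob_space_PiM) (use prob_RplusD[OF M] in auto)
    note ia = PiM_bounded_integrable[OF M a, of "Suc k" m] and ib = PiM_bounded_integrable[OF M b, of "Suc k" m]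
    show "p (Suc k) * (\<integral>y. a (m + (\<Sum>i<Suc k. y i)) - a m \<partial>(PiM {..<Suc k} (\<lambda>_. M)))
     + p (Suc k) * (\<integral>y. b (m + (\<Sum>i<Suc k. y i)) - b m \<partial>(PiM {..<Suc k} (\<lambda>_. M)))
     = p (Suc k) * (\<integral>y. (a (m + (\<Sum>i<Suc k. y i)) + b (m + (\<Sum>i<Suc k. y i))) - (a m + b m) \<partial>(PiM {..<Suc k} (\<lambda>_. M)))"
      using ia ib by (simp add: P.prob_space algebra_simps del: sum.lessThan_Suc)
  qed
  finally show ?thesis by simp
qed

lemma gen_scale:
  assumes M: "prob_Rplus M" and a: "a \<in> borel_measurable borel" "\<And>x. \<bar>a x\<bar> \<le> (A::real)"
  shows "gen (\<lambda>x. c * a x) M m = c * gen a M m"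
proof -
  have "c * gen a M m = (\<Sum>k. c * (p (Suc k) * (\<integral>y. a (m + (\<Sum>i<Suc k. y i)) - a m \<partial>(PiM {..<Suc k} (\<lambda>_. M)))))"
    unfolding gen_def by (rule suminf_mult[OF gen_summable[OF M a], symmetric])
  also have "\<dots> = gen (\<lambda>x. c * a x) M m"
    unfolding gen_def by (intro suminf_cong) (simp add: right_diff_distrib[symmetric] del: sum.lessThan_Suc)
  finally show ?thesis by simp
qed

lemma solvesD:
  assumes "solves l F"
  shows "t > 0 \<Longrightarrow> prob_Rplus (F t)" "mono_on {0<..} l" "t > 0 \<Longrightarrow> 0 < l t"
    "t > 0 \<Longrightarrow> q > 0 \<Longrightarrow> set_integrable lborel {t<..} (\<lambda>s. exp (- q * l s) / s)"
    "t > 0 \<Longrightarrow> q > 0 \<Longrightarrow> lap (F t) q = ginv (Lam l q t)"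
    "t > 0 \<Longrightarrow> q > 0 \<Longrightarrow> g (lap (F t) q) = Lam l q t"
    "t > 0 \<Longrightarrow> q > 0 \<Longrightarrow> lap (F t) q < 1"
    "t > 0 \<Longrightarrow> q > 0 \<Longrightarrow> 0 < lap (F t) q"
    "t > 0 \<Longrightarrow> q > 0 \<Longrightarrow> lap (F t) q \<le> Lam l q t"
  using assms ginv(2,3)[of "Lam l q t"] Lam_nonneg[of t l q] lap_pos[of "F t" q] g_0 ginv_g[of 0]
    ginv_lipschitz[of 0 "Lam l q t"]
  unfolding solves_def by (auto simp: less_imp_le)

text \<open>Both halves come from large \<open>q\<close>. Below \<open>l t\<close> the transform
  decays like \<open>exp (- q * l t)\<close>, which leaves no mass there. If there were no mass up
  to some \<open>x > l t\<close>, the transform would be at most \<open>exp (- q * x)\<close>,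
  although right-continuity keeps \<open>l\<close> below some \<open>y < x\<close> for a while and
  forces decay no faster than \<open>exp (- q * y)\<close>.\<close>

lemma solves_min_of:
  assumes S: "solves l F" and rc: "continuous (at_right t) l" and t: "t > 0"
  shows "min_of (F t) = l t"
proof (rule min_ofI)
  note M = solvesD(1)[OF S t] and lm = solvesD(2)[OF S]
  interpret prob_space "F t" using prob_RplusD[OF M] by simp
  note sM = prob_RplusD(2)[OF M]
  show "0 \<le> l t" using solvesD(3)[OF S t] by simp
  fix x :: real
  {
    assume x: "0 \<le> x" "x < l t"
    \<comment> \<open>Chernoff bound; splitting off one unit of \<open>q\<close> leaves the
      convergent integral \<open>Lam l 1 t\<close> as a constant.\<close>
    have b: "measure (F t) {0..x} \<le> exp (l t) * Lam l 1 t * exp (- (l t - x) * real n)" if n: "n \<ge> 1" for n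
    proof -
      let ?q = "real n"
      have q: "?q \<ge> 1" using n by simp
      have "measure (F t) {0..x} * exp (- ?q * x) = (\<integral>y. indicator {0..x} y * exp (- ?q * x) \<partial>F t)"
        by (simp add: sM)
      also have "\<dots> \<le> lap (F t) ?q" unfolding lap_def
      proof (rule integral_mono_AE)
        show "integrable (F t) (\<lambda>y. indicator {0..x} y * exp (- ?q * x))" by (intro integrable_mult_left integrable_real_indicator) (auto simp: sM emeasure_eq_measure)
        show "integrable (F t) (\<lambda>y. exp (- ?q * y))" by (rule lap_integrable[OF M]) auto
        show "AE y in F t. indicator {0..x} y * exp (- ?q * x) \<le> exp (- ?q * y)"
          using q by (intro AE_I2) (auto simp: indicator_def mult_left_mono)
      qed
      also have "\<dots> \<le> Lam l ?q t" using solvesD(9)[OF S t, of ?q] q by simp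
      also have "\<dots> \<le> (LBINT s:{t<..}. exp (- (?q - 1) * l t) * (exp (- 1 * l s) / s))"
        unfolding Lam_def
      proof (rule set_integral_mono)
        show "set_integrable lborel {t<..} (\<lambda>s. exp (- ?q * l s) / s)" by (rule solvesD(4)[OF S t]) (use q in auto)
        show "set_integrable lborel {t<..} (\<lambda>s. exp (- (?q - 1) * l t) * (exp (- 1 * l s) / s))"
          by (rule set_integrable_mult_right, rule solvesD(4)[OF S t]) auto
        fix s assume s: "s \<in> {t<..}"
        have "l t \<le> l s" using mono_onD[OF lm, of t s] s t by auto
        then have "(?q - 1) * l t \<le> (?q - 1) * l s" using q by (intro mult_left_mono) auto
        then have "exp (- ?q * l s) \<le> exp (- (?q - 1) * l t) * exp (- 1 * l s)"
          by (simp add: exp_add[symmetric] algebra_simps)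
        then have "exp (- ?q * l s) / s \<le> exp (- (?q - 1) * l t) * exp (- 1 * l s) / s" using s t by (intro divide_right_mono) auto
        then show "exp (- ?q * l s) / s \<le> exp (- (?q - 1) * l t) * (exp (- 1 * l s) / s)" by simp
      qed
      also have "\<dots> = exp (- (?q - 1) * l t) * Lam l 1 t" by (simp only: Lam_def set_integral_mult_right)
      finally have "measure (F t) {0..x} \<le> exp (- (?q - 1) * l t) * Lam l 1 t / exp (- ?q * x)" by (simp add: pos_le_divide_eq)
      also have "\<dots> = exp (l t) * Lam l 1 t * exp (- (l t - x) * real n)" by (simp add: exp_add[symmetric] exp_diff[symmetric] exp_minus field_simps)
      finally show ?thesis .
    qed
    have "(\<lambda>n. exp (l t) * Lam l 1 t * exp (- (l t - x) * real n)) \<longlonglongrightarrow> 0"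
      by (rule exp_decay) (use x in simp)
    then have "measure (F t) {0..x} \<le> 0"
      by (rule LIMSEQ_le_const) (use b in auto)
    then show "measure (F t) {0..x} = 0" by (simp add: measure_le_0_iff)
  }
  {
    assume x: "l t < x"
    show "0 < measure (F t) {0..x}"
    proof (rule ccontr)
      assume "\<not> 0 < measure (F t) {0..x}"
      then have "{0..x} \<in> null_sets (F t)" by (auto simp: null_sets_def sM emeasure_eq_measure zero_less_measure_iff)
      from AE_not_in[OF this] prob_RplusD(4)[OF M] have AE: "AE y in F t. x \<le> y" by eventually_elim auto
      define y where "y = (l t + x) / 2"
      have y: "l t < y" "y < x" using x by (auto simp: y_def)
      have "(l \<longlongrightarrow> l t) (at_right t)" using rc by (simp add: continuous_within)
      then have "\<forall>\<^sub>F s in at_right t. l s < y" using y by (intro order_tendstoD(2))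
      then obtain b where b: "b > t" "\<And>s. t < s \<Longrightarrow> s < b \<Longrightarrow> l s < y" unfolding eventually_at_right_field by blast
      define u where "u = (t + b) / 2"
      have u: "t < u" "l u < y" using b by (auto simp: u_def)
      define c where "c = ln (u / t)"
      have c: "c > 0" using u t by (simp add: c_def)
      \<comment> \<open>The condition on the transform keeps \<open>1 - Qgen p\<close> at least
        \<open>1/2\<close>, so \<open>g\<close> of the transform is at most \<open>2 * Q1 p\<close>
        times the transform.\<close>
      have bound: "c \<le> 2 * Q1 p * exp (- (x - y) * real n)" if n: "n \<ge> 1" "lap (F t) (real n) \<le> 1/2" for n
      proof -
        let ?q = "real n"
        have q: "?q > 0" using n by simp
        let ?f = "lap (F t) ?q"
        have f: "0 \<le> ?f" "?f < 1" using solvesD(7,8)[OF S t q] by auto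
        have "exp (- ?q * y) * c \<le> exp (- ?q * l u) * c" using u q c by (intro mult_right_mono) auto
        also have "\<dots> \<le> Wint l ?q t u" unfolding c_def by (rule Wint_bounds(2)[OF lm t]) (use u q in auto)
        also have "\<dots> \<le> Lam l ?q t"
          using Lam_split(2)[OF lm t less_imp_le[OF u(1)], of ?q] solvesD(4)[OF S, of u ?q] Lam_nonneg[of u l ?q] u t q by simp
        also have "\<dots> = g ?f" using solvesD(6)[OF S t q] by simp
        also have "\<dots> \<le> ?f * Q1 p / (1 - Qgen p ?f)" using g_diff_bounds(2)[of 0 ?f] g_0 f by simp
        also have "\<dots> \<le> ?f * Q1 p / (1/2)" using Q_le_self[of ?f] f n Q1_ge_1 by (intro divide_left_mono) auto
        also have "\<dots> \<le> exp (- ?q * x) * Q1 p / (1/2)"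
          using lap_le_exp[OF M AE, of ?q] q Q1_ge_1 by (intro divide_right_mono mult_right_mono) auto
        finally have "exp (- ?q * y) * c \<le> 2 * Q1 p * exp (- ?q * x)" by (simp add: mult_ac)
        then have "c \<le> 2 * Q1 p * exp (- ?q * x) / exp (- ?q * y)" by (subst pos_le_divide_eq) (simp_all add: mult.commute[of c])
        also have "\<dots> = 2 * Q1 p * exp (- (x - y) * ?q)"
        proof -
          have "exp (- (x - y) * ?q) = exp (- ?q * x - (- ?q * y))" by (simp add: algebra_simps)
          also have "\<dots> = exp (- ?q * x) / exp (- ?q * y)" by (rule exp_diff)
          finally show ?thesis by simp
        qed
        finally show ?thesis .
      qed
      have x0: "x > 0" using x solvesD(3)[OF S t] by simp
      have "(\<lambda>n. exp (- x * real n)) \<longlonglongrightarrow> 0" using exp_decay[OF x0, of 1] by simp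
      then have "\<forall>\<^sub>F n in sequentially. exp (- x * real n) < 1/2" by (intro order_tendstoD(2)) auto
      then have ev: "\<forall>\<^sub>F n in sequentially. c \<le> 2 * Q1 p * exp (- (x - y) * real n)"
        using eventually_ge_at_top[of 1]
      proof eventually_elim
        case (elim n)
        show ?case by (rule bound) (use elim lap_le_exp[OF M AE, of "real n"] in \<open>auto simp: mult.commute\<close>)
      qed
      have "(\<lambda>n. 2 * Q1 p * exp (- (x - y) * real n)) \<longlonglongrightarrow> 0" by (rule exp_decay) (use y in simp)
      from tendsto_lowerbound[OF this ev] c show False by simp
    qed
  }
qed

text \<open>The computation of \<open>eternal_solves\<close> run backwards: the increments of
  \<open>g (?f)\<close> are known to be \<open>Wint\<close>, and those of \<open>?f\<close> are
  recovered from them, again up to a quadratic error.\<close>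

lemma solves_exp_equation:
  assumes S: "solves l F" and q: "q > 0"
  shows "(\<lambda>t. integral\<^sup>L (F t) (exp0 q)) \<in> borel_measurable (restrict_space borel {0<..})"
    and "(\<lambda>s. gen (exp0 q) (F s) (l s)) \<in> borel_measurable (restrict_space borel {0<..})"
    and "0 < s \<Longrightarrow> s \<le> t \<Longrightarrow> integral\<^sup>L (F t) (exp0 q) - integral\<^sup>L (F s) (exp0 q)
      = (LBINT r:{s<..t}. gen (exp0 q) (F r) (l r) / (Q1 p * r))"
proof -
  note lm = solvesD(2)[OF S]
  let ?f = "\<lambda>s. lap (F s) q"
  note f0 = solvesD(8)[OF S _ q] and f1 = solvesD(7)[OF S _ q] and gL = solvesD(6)[OF S _ q]
  have gW: "g (?f s) - g (?f t) = Wint l q s t" if st: "0 < s" "s \<le> t" for s t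
    using Lam_split(2)[OF lm st _ solvesD(4)[OF S]] gL[of s] gL[of t] st q by simp
  have fmono: "?f t \<le> ?f s" if st: "0 < s" "s \<le> t" for s t
  proof (rule ccontr)
    assume "\<not> ?f t \<le> ?f s"
    then have "g (?f s) < g (?f t)" using f0[of s] f1[of t] st by (intro g_strict_mono) auto
    then show False using gW[OF st] Wint_nonneg[OF st(1), of l q t] by simp
  qed
  have "mono_on {0<..} (\<lambda>s. - ?f s)" using fmono by (auto intro!: mono_onI)
  from borel_measurable_uminus[OF borel_measurable_mono_on_fnc[OF this]]
  have meas: "?f \<in> borel_measurable (restrict_space borel {0<..})" by simp
  then show "(\<lambda>t. integral\<^sup>L (F t) (exp0 q)) \<in> borel_measurable (restrict_space borel {0<..})"
    by (rule measurable_cong[THEN iffD1, rotated]) (auto simp: space_restrict_space lap_exp0 solvesD(1)[OF S])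
  define w where "w s = exp (- q * l s) * (1 - Qgen p (?f s)) / Q1 p" for s
  have gw: "gen (exp0 q) (F s) (l s) = - (w s * Q1 p)" if "s > 0" for s
    using gen_exp0[OF solvesD(1)[OF S that], of "l s" q] solvesD(3)[OF S that] q Q1_ge_1 by (simp add: w_def)
  have wm: "w \<in> borel_measurable (restrict_space borel {0<..})"
  proof -
    have Qm: "(\<lambda>x. indicator {0..1} x *\<^sub>R Qgen p x) \<in> borel_measurable borel"
      by (rule borel_measurable_continuous_on_indicator[OF _ Q_continuous]) auto
    have "l \<in> borel_measurable (restrict_space borel {0<..})" by (rule borel_measurable_mono_on_fnc[OF lm])
    then have "(\<lambda>s. exp (- q * l s) * (1 - (\<lambda>x. indicator {0..1} x *\<^sub>R Qgen p x) (?f s)) / Q1 p) \<in> borel_measurable (restrict_space borel {0<..})"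
      using measurable_compose[OF meas Qm] by measurable
    then show ?thesis
    proof (rule measurable_cong[THEN iffD1, rotated])
      fix s :: real assume "s \<in> space (restrict_space borel {0<..})"
      then have "s > 0" by (simp add: space_restrict_space)
      then have "0 \<le> ?f s" "?f s \<le> 1" using f0[of s] f1[of s] by auto
      then show "exp (- q * l s) * (1 - indicator {0..1} (?f s) *\<^sub>R Qgen p (?f s)) / Q1 p = w s" by (simp add: w_def)
    qed
  qed
  then have "(\<lambda>s. - (w s * Q1 p)) \<in> borel_measurable (restrict_space borel {0<..})" by measurable
  then show "(\<lambda>s. gen (exp0 q) (F s) (l s)) \<in> borel_measurable (restrict_space borel {0<..})"
    by (rule measurable_cong[THEN iffD1, rotated]) (auto simp: space_restrict_space gw)
  have w_meas: "set_borel_measurable lborel {s<..t} (\<lambda>s. w s / s)" if "0 < s" for s t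
  proof -
    have "(\<lambda>s. indicator {0<..} s *\<^sub>R w s) \<in> borel_measurable borel"
      using wm by (subst (asm) borel_measurable_restrict_space_iff) auto
    then have "(\<lambda>r. indicator {s<..t} r *\<^sub>R ((indicator {0<..} r *\<^sub>R w r) / r)) \<in> borel_measurable borel" by measurable
    also have "(\<lambda>r. indicator {s<..t} r *\<^sub>R ((indicator {0<..} r *\<^sub>R w r) / r)) = (\<lambda>r. indicator {s<..t} r *\<^sub>R (w r / r))"
      using that by (intro ext) (auto simp: indicator_def)
    finally show ?thesis by (simp add: set_borel_measurable_def)
  qed
  have w01: "0 \<le> w s" "w s \<le> 1" if "s > 0" for s
  proof -
    have Q: "0 \<le> 1 - Qgen p (?f s)" "1 - Qgen p (?f s) \<le> 1"
      using Q_lt_1[of "?f s"] Q_nonneg[of "?f s"] f0[OF that] f1[OF that] by auto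
    then show "0 \<le> w s" using Q1_ge_1 by (simp add: w_def)
    have "exp (- q * l s) * (1 - Qgen p (?f s)) \<le> 1 * 1"
      using Q solvesD(3)[OF S that] q by (intro mult_mono) auto
    then show "w s \<le> 1" using Q1_ge_1 by (simp add: w_def)
  qed
  have iw: "set_integrable lborel {s<..t} (\<lambda>r. w r / r)" if st: "0 < s" "s \<le> t" for s t
    by (rule set_integrable_bounded_over_id(1)[OF st w_meas, where B=1]) (use st w01 in auto)
  have bnd: "Wint l q s t * (1 - Qgen p (?f s)) / Q1 p \<le> (LBINT r:{s<..t}. w r / r) \<and> (LBINT r:{s<..t}. w r / r) \<le> Wint l q s t * (1 - Qgen p (?f t)) / Q1 p"
    if st: "0 < s" "s \<le> t" for s t
  proof -
    have iW: "set_integrable lborel {s<..t} (\<lambda>r. c * (exp (- q * l r) / r))" for c :: real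
      by (rule set_integrable_mult_right, rule Wint_bounds(1)[OF lm st]) (use q in auto)
    have c: "(LBINT r:{s<..t}. c * (exp (- q * l r) / r)) = Wint l q s t * c" for c :: real
      unfolding Wint_def set_integral_mult_right by (rule mult.commute)
    have "(LBINT r:{s<..t}. (1 - Qgen p (?f s)) / Q1 p * (exp (- q * l r) / r)) \<le> (LBINT r:{s<..t}. w r / r)"
    proof (rule set_integral_mono[OF iW iw[OF st]])
      fix r assume r: "r \<in> {s<..t}"
      have "Qgen p (?f r) \<le> Qgen p (?f s)" using r st f0[of r] f1[of s] fmono[of s r] by (intro Q_mono) auto
      then have "exp (- q * l r) * (1 - Qgen p (?f s)) / Q1 p / r \<le> w r / r"
        unfolding w_def using r st Q1_ge_1 by (intro divide_right_mono mult_left_mono) auto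
      then show "(1 - Qgen p (?f s)) / Q1 p * (exp (- q * l r) / r) \<le> w r / r" by (simp add: field_simps)
    qed
    moreover have "(LBINT r:{s<..t}. w r / r) \<le> (LBINT r:{s<..t}. (1 - Qgen p (?f t)) / Q1 p * (exp (- q * l r) / r))"
    proof (rule set_integral_mono[OF iw[OF st] iW])
      fix r assume r: "r \<in> {s<..t}"
      have "Qgen p (?f t) \<le> Qgen p (?f r)" using r st f0[of t] f1[of r] fmono[of r t] by (intro Q_mono) auto
      then have "w r / r \<le> exp (- q * l r) * (1 - Qgen p (?f t)) / Q1 p / r"
        unfolding w_def using r st Q1_ge_1 by (intro divide_right_mono mult_left_mono) auto
      then show "w r / r \<le> (1 - Qgen p (?f t)) / Q1 p * (exp (- q * l r) / r)" by (simp add: field_simps)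
    qed
    ultimately show ?thesis unfolding c by simp
  qed
  have eq: "?f s - ?f t = (LBINT r:{s<..t}. w r / r)" if st: "0 < s" "s \<le> t" for s t
  proof -
    define D where "D r = ?f r + (LBINT r:{s<..r}. w r / r)" for r
    have "D s = D t"
    proof (rule const_of_quadratic[OF st(2)])
      fix u v assume uv: "s \<le> u" "u \<le> v" "v \<le> t"
      have u0: "0 < u" using uv st by simp
      have v0: "0 < v" using uv u0 by simp
      let ?W = "Wint l q u v" and ?I = "LBINT r:{u<..v}. w r / r"
      let ?a = "1 - Qgen p (?f u)" and ?b = "1 - Qgen p (?f v)"
      have W0: "0 \<le> ?W" by (rule Wint_nonneg[OF u0])
      have fu: "0 \<le> ?f u" "?f u < 1" "0 \<le> ?f v" "?f v < 1" "?f v \<le> ?f u" using f0 f1 fmono u0 v0 uv by (auto simp: less_imp_le)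
      have a: "0 < ?a" "?a \<le> ?b" "?b \<le> 1" using Q_lt_1[of "?f u"] Q_mono[of "?f v" "?f u"] Q_nonneg[of "?f v"] fu by auto
      have g1: "(?f u - ?f v) * Q1 p / ?b \<le> ?W" "?W \<le> (?f u - ?f v) * Q1 p / ?a"
        using g_diff_bounds[OF fu(3,5,2)] gW[OF u0 uv(2)] by auto
      then have f2: "?f u - ?f v \<le> ?W * ?b / Q1 p" "?W * ?a / Q1 p \<le> ?f u - ?f v"
        using a Q1_ge_1 by (auto simp: field_simps)
      have Wl: "?W \<le> (v - u) / s"
      proof -
        have "?W \<le> exp (- q * l u) * ln (v / u)" by (rule Wint_bounds(3)[OF lm u0 uv(2)]) (use q in auto)
        also have "\<dots> \<le> 1 * ln (v / u)" using solvesD(3)[OF S u0] q uv u0 by (intro mult_right_mono) auto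
        also have "1 * ln (v / u) \<le> v / u - 1" using u0 v0 ln_le_minus_one[of "v / u"] by auto
        also have "\<dots> = (v - u) / u" using u0 by (simp add: field_simps)
        also have "\<dots> \<le> (v - u) / s" using uv st by (intro divide_left_mono) auto
        finally show ?thesis .
      qed
      have dQ: "?b - ?a \<le> Q1 p * ?W"
      proof -
        have "?b - ?a \<le> Q1 p * (?f u - ?f v)" using Q_diff_le[of "?f v" "?f u"] fu by simp
        also have "\<dots> \<le> ?W * ?b" using f2(1) Q1_ge_1 by (simp add: field_simps)
        also have "\<dots> \<le> ?W * Q1 p" using W0 a Q1_ge_1 by (intro mult_left_mono) auto
        finally show ?thesis by (simp add: mult.commute)
      qed
      have "\<bar>(?f u - ?f v) - ?I\<bar> \<le> ?W * ?b / Q1 p - ?W * ?a / Q1 p" using f2 bnd[OF u0 uv(2)] by linarith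
      also have "\<dots> = ?W * (?b - ?a) / Q1 p" by (simp add: diff_divide_distrib right_diff_distrib)
      also have "\<dots> \<le> ?W * (Q1 p * ?W) / Q1 p" using dQ W0 Q1_ge_1 by (intro divide_right_mono mult_left_mono) auto
      also have "\<dots> = ?W * ?W" using Q1_ge_1 by simp
      also have "\<dots> \<le> ((v - u) / s) * ((v - u) / s)" using Wl W0 uv st by (intro mult_mono) auto
      finally have "\<bar>(?f u - ?f v) - ?I\<bar> \<le> 1 / s\<^sup>2 * (v - u)\<^sup>2" by (simp add: power2_eq_square)
      moreover have "(LBINT r:{s<..v}. w r / r) = (LBINT r:{s<..u}. w r / r) + ?I"
      proof -
        have "{s<..v} = {s<..u} \<union> {u<..v}" using uv by auto
        then show ?thesis using iw[OF st(1) uv(1)] iw[OF u0 uv(2)] by (simp add: set_integral_Un)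
      qed
      ultimately show "\<bar>D v - D u\<bar> \<le> 1 / s\<^sup>2 * (v - u)\<^sup>2" unfolding D_def by linarith
    qed
    then show ?thesis by (simp add: D_def set_lebesgue_integral_def)
  qed
  assume st: "0 < s" "s \<le> t"
  have "(LBINT r:{s<..t}. gen (exp0 q) (F r) (l r) / (Q1 p * r)) = (LBINT r:{s<..t}. - (w r / r))"
    by (rule set_lebesgue_integral_cong) (use st gw Q1_ge_1 in auto)
  also have "\<dots> = - (LBINT r:{s<..t}. w r / r)" by (simp add: set_lebesgue_integral_def)
  also have "\<dots> = ?f t - ?f s" using eq[OF st] by simp
  finally show "integral\<^sup>L (F t) (exp0 q) - integral\<^sup>L (F s) (exp0 q)
      = (LBINT r:{s<..t}. gen (exp0 q) (F r) (l r) / (Q1 p * r))"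
    using st by (simp add: lap_exp0 solvesD(1)[OF S])
qed

text \<open>For a fixed solution both sides are linear in the test function and stable under uniform
  limits. The equation for the powers \<open>u ^ k\<close>, that is for
  \<open>exp (- k * x)\<close>, thus implies it for all \<open>h\<close> with
  \<open>h 0 = 0\<close>. Measurability is part of the induction because the sum and limit steps
  need it.\<close>

lemma solves_equation:
  assumes S: "solves l F" and h: "continuous_on {0..1} h" and h0: "h 0 = 0"
  shows "(\<lambda>t. integral\<^sup>L (F t) (on_exp h)) \<in> borel_measurable (restrict_space borel {0<..})
    \<and> (\<lambda>s. gen (on_exp h) (F s) (l s)) \<in> borel_measurable (restrict_space borel {0<..})
    \<and> (\<forall>s t. 0 < s \<longrightarrow> s \<le> t \<longrightarrow> integral\<^sup>L (F t) (on_exp h) - integral\<^sup>L (F s) (on_exp h)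
      = (LBINT r:{s<..t}. gen (on_exp h) (F r) (l r) / (Q1 p * r)))"
proof -
  let ?R = "restrict_space borel {0<..} :: real measure"
  define I where "I h t = integral\<^sup>L (F t) (on_exp h)" for h t
  define G where "G h s = gen (on_exp h) (F s) (l s)" for h s
  define P where "P h \<longleftrightarrow> continuous_on {0..1} h \<and> I h \<in> borel_measurable ?R \<and> G h \<in> borel_measurable ?R
    \<and> (\<forall>s t. 0 < s \<longrightarrow> s \<le> t \<longrightarrow> I h t - I h s = (LBINT r:{s<..t}. G h r / (Q1 p * r)))" for h
  have PR: "prob_Rplus (F t)" if "t > 0" for t by (rule solvesD(1)[OF S that])
  have int: "integrable (F t) (on_exp h)" if "t > 0" "continuous_on {0..1} h" for t h
  proof -
    obtain B where "\<And>x. \<bar>on_exp h x\<bar> \<le> B" using on_exp_bounded[OF \<open>continuous_on {0..1} h\<close>] by blast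
    then show ?thesis by (intro prob_Rplus_integrable[OF PR] on_exp_measurable that) auto
  qed
  have Gm: "set_borel_measurable lborel {s<..t} (\<lambda>r. (G h r / Q1 p) / r)" if "G h \<in> borel_measurable ?R" "0 < s" for h s t
  proof -
    have "(\<lambda>s. indicator {0<..} s *\<^sub>R G h s) \<in> borel_measurable borel"
      using that(1) by (subst (asm) borel_measurable_restrict_space_iff) auto
    then have "(\<lambda>r. indicator {s<..t} r *\<^sub>R ((indicator {0<..} r *\<^sub>R G h r) / Q1 p / r)) \<in> borel_measurable borel" by measurable
    also have "(\<lambda>r. indicator {s<..t} r *\<^sub>R ((indicator {0<..} r *\<^sub>R G h r) / Q1 p / r)) = (\<lambda>r. indicator {s<..t} r *\<^sub>R (G h r / Q1 p / r))"
      using that by (intro ext) (auto simp: indicator_def)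
    finally show ?thesis by (simp add: set_borel_measurable_def)
  qed
  have Gi: "set_integrable lborel {s<..t} (\<lambda>r. (G h r / Q1 p) / r)" if G: "G h \<in> borel_measurable ?R" and st: "0 < s" "s \<le> t" and h: "continuous_on {0..1} h" for h s t
  proof -
    obtain B where B: "\<And>x. \<bar>on_exp h x\<bar> \<le> B" using on_exp_bounded[OF h] by blast
    show ?thesis
    proof (rule set_integrable_bounded_over_id(1)[OF st Gm[OF G st(1)]])
      fix r assume "s < r"
      then have "\<bar>G h r\<bar> \<le> 2 * B" unfolding G_def using st by (intro gen_bound PR on_exp_measurable h B) auto
      then show "\<bar>G h r / Q1 p\<bar> \<le> 2 * B / Q1 p" using Q1_ge_1 by (simp add: divide_right_mono)
    qed
  qed
  have "P h"
    using h
  proof (rule continuous_induct_unit_interval[where m=1])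
    show "(1::nat) = 0 \<or> (1::nat) = 1 \<and> h 0 = 0" using h0 by simp
  next
    fix k :: nat assume "k \<ge> 1"
    then have k: "real k > 0" by simp
    have "on_exp (\<lambda>x. x ^ k) = exp0 (real k)"
      by (auto simp: on_exp_def exp0_def exp_of_nat_mult[symmetric])
    then show "P (\<lambda>x. x ^ k)" unfolding P_def I_def[abs_def] G_def[abs_def]
      using solves_exp_equation[OF S k] by (auto intro!: continuous_intros)
  next
    fix f1 f2 assume P: "P f1" "P f2"
    then have c: "continuous_on {0..1} f1" "continuous_on {0..1} f2" by (auto simp: P_def)
    obtain B1 where B1: "\<And>x. \<bar>on_exp f1 x\<bar> \<le> B1" using on_exp_bounded[OF c(1)] by blast
    obtain B2 where B2: "\<And>x. \<bar>on_exp f2 x\<bar> \<le> B2" using on_exp_bounded[OF c(2)] by blast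
    have o: "on_exp (\<lambda>x. f1 x + f2 x) = (\<lambda>x. on_exp f1 x + on_exp f2 x)" by (auto simp: on_exp_def)
    have I: "I (\<lambda>x. f1 x + f2 x) t = I f1 t + I f2 t" if "t > 0" for t
      unfolding I_def o using int[OF that] c by simp
    have G: "G (\<lambda>x. f1 x + f2 x) t = G f1 t + G f2 t" if "t > 0" for t
      unfolding G_def o by (rule gen_add[OF PR[OF that] on_exp_measurable[OF c(1)] B1 on_exp_measurable[OF c(2)] B2])
    have "(\<lambda>t. I f1 t + I f2 t) \<in> borel_measurable ?R" "(\<lambda>t. G f1 t + G f2 t) \<in> borel_measurable ?R"
      using P by (auto simp: P_def)
    then have "I (\<lambda>x. f1 x + f2 x) \<in> borel_measurable ?R" "G (\<lambda>x. f1 x + f2 x) \<in> borel_measurable ?R"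
      using measurable_cong[of ?R "I (\<lambda>x. f1 x + f2 x)" "\<lambda>t. I f1 t + I f2 t" borel] measurable_cong[of ?R "G (\<lambda>x. f1 x + f2 x)" "\<lambda>t. G f1 t + G f2 t" borel] I G
      by (auto simp: space_restrict_space)
    moreover have "I (\<lambda>x. f1 x + f2 x) t - I (\<lambda>x. f1 x + f2 x) s = (LBINT r:{s<..t}. G (\<lambda>x. f1 x + f2 x) r / (Q1 p * r))" if st: "0 < s" "s \<le> t" for s t
    proof -
      have "(LBINT r:{s<..t}. G (\<lambda>x. f1 x + f2 x) r / (Q1 p * r)) = (LBINT r:{s<..t}. G f1 r / Q1 p / r + G f2 r / Q1 p / r)"
        by (rule set_lebesgue_integral_cong) (use st G in \<open>auto simp: add_divide_distrib\<close>)
      also have "\<dots> = (LBINT r:{s<..t}. G f1 r / Q1 p / r) + (LBINT r:{s<..t}. G f2 r / Q1 p / r)"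
        by (intro set_integral_add(2) Gi) (use P c st in \<open>simp_all add: P_def\<close>)
      finally have "(LBINT r:{s<..t}. G (\<lambda>x. f1 x + f2 x) r / (Q1 p * r)) = (I f1 t - I f1 s) + (I f2 t - I f2 s)"
        using P st by (simp add: P_def)
      then show ?thesis using st I[of s] I[of t] by simp
    qed
    ultimately show "P (\<lambda>x. f1 x + f2 x)" using c unfolding P_def by (auto intro!: continuous_intros)
  next
    fix c f assume P: "P f"
    then have cf: "continuous_on {0..1} f" by (auto simp: P_def)
    obtain B where B: "\<And>x. \<bar>on_exp f x\<bar> \<le> B" using on_exp_bounded[OF cf] by blast
    have o: "on_exp (\<lambda>x. c * f x) = (\<lambda>x. c * on_exp f x)" by (auto simp: on_exp_def)
    have I: "I (\<lambda>x. c * f x) t = c * I f t" for t unfolding I_def o by simp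
    have G: "G (\<lambda>x. c * f x) t = c * G f t" if "t > 0" for t
      unfolding G_def o by (rule gen_scale[OF PR[OF that] on_exp_measurable[OF cf] B])
    have "(\<lambda>t. c * I f t) \<in> borel_measurable ?R" "(\<lambda>t. c * G f t) \<in> borel_measurable ?R"
      using P by (auto simp: P_def)
    then have "I (\<lambda>x. c * f x) \<in> borel_measurable ?R" "G (\<lambda>x. c * f x) \<in> borel_measurable ?R"
      using measurable_cong[of ?R "I (\<lambda>x. c * f x)" "\<lambda>t. c * I f t" borel] measurable_cong[of ?R "G (\<lambda>x. c * f x)" "\<lambda>t. c * G f t" borel] I G
      by (auto simp: space_restrict_space)
    moreover have "I (\<lambda>x. c * f x) t - I (\<lambda>x. c * f x) s = (LBINT r:{s<..t}. G (\<lambda>x. c * f x) r / (Q1 p * r))" if st: "0 < s" "s \<le> t" for s t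
    proof -
      have "(LBINT r:{s<..t}. G (\<lambda>x. c * f x) r / (Q1 p * r)) = (LBINT r:{s<..t}. c * (G f r / (Q1 p * r)))"
        by (rule set_lebesgue_integral_cong) (use st G in auto)
      also have "\<dots> = c * (LBINT r:{s<..t}. G f r / (Q1 p * r))" by (rule set_integral_mult_right)
      also have "\<dots> = c * (I f t - I f s)" using P st by (simp add: P_def)
      finally show ?thesis using I[of s] I[of t] by (simp add: right_diff_distrib)
    qed
    ultimately show "P (\<lambda>x. c * f x)" using cf unfolding P_def by (auto intro!: continuous_intros)
  next
    fix h assume c: "continuous_on {0..1} h" and ap: "\<And>e. e > 0 \<Longrightarrow> \<exists>f. P f \<and> (\<forall>x\<in>{0..1}. \<bar>h x - f x\<bar> < e)"
    obtain B where B: "\<And>x. \<bar>on_exp h x\<bar> \<le> B" using on_exp_bounded[OF c] by blast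
    have "\<exists>f. P f \<and> (\<forall>x\<in>{0..1}. \<bar>h x - f x\<bar> < 1 / real (Suc n))" for n by (rule ap) simp
    then obtain f where f: "\<And>n. P (f n)" "\<And>n x. x \<in> {0..1} \<Longrightarrow> \<bar>h x - f n x\<bar> < 1 / real (Suc n)" by metis
    have cf: "continuous_on {0..1} (f n)" for n using f(1)[of n] by (simp add: P_def)
    have dc: "continuous_on {0..1} (\<lambda>x. f n x + (-1) * h x)" for n using cf[of n] c by (intro continuous_intros)
    have db: "\<bar>on_exp (\<lambda>x. f n x + (-1) * h x) x\<bar> \<le> 1 / real (Suc n)" for n x
    proof (rule on_exp_bound)
      fix u :: real assume "u \<in> {0..1}"
      from f(2)[OF this, of n] show "\<bar>f n u + (-1) * h u\<bar> \<le> 1 / real (Suc n)" by linarith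
    qed
    \<comment> \<open>The approximant is written as \<open>h\<close> plus an error:
      \<open>gen_add\<close> then isolates the error term and \<open>gen_bound\<close> estimates
      it.\<close>
    have o: "on_exp (f n) = (\<lambda>x. on_exp h x + on_exp (\<lambda>x. f n x + (-1) * h x) x)" for n by (auto simp: on_exp_def)
    have Id: "\<bar>I (f n) t - I h t\<bar> \<le> 1 / real (Suc n)" if "t > 0" for n t
    proof -
      have "I (f n) t - I h t = integral\<^sup>L (F t) (on_exp (\<lambda>x. f n x + (-1) * h x))"
        unfolding I_def o[of n] using int[OF that c] int[OF that dc] by simp
      moreover have "\<bar>integral\<^sup>L (F t) (on_exp (\<lambda>x. f n x + (-1) * h x))\<bar> \<le> 1 / real (Suc n)"
      proof -
        have lo: "- (1 / real (Suc n)) \<le> on_exp (\<lambda>x. f n x + (-1) * h x) x" and up: "on_exp (\<lambda>x. f n x + (-1) * h x) x \<le> 1 / real (Suc n)" for x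
          using db[of n x] by linarith+
        show ?thesis using prob_Rplus_integral_bounds[OF PR[OF that] on_exp_measurable[OF dc[of n]] lo up] by linarith
      qed
      ultimately show ?thesis by simp
    qed
    have Gd: "\<bar>G (f n) t - G h t\<bar> \<le> 2 * (1 / real (Suc n))" if "t > 0" for n t
    proof -
      have "G (f n) t = G h t + gen (on_exp (\<lambda>x. f n x + (-1) * h x)) (F t) (l t)"
        unfolding G_def o[of n] by (rule gen_add[OF PR[OF that] on_exp_measurable[OF c] B on_exp_measurable[OF dc] db])
      moreover have "\<bar>gen (on_exp (\<lambda>x. f n x + (-1) * h x)) (F t) (l t)\<bar> \<le> 2 * (1 / real (Suc n))"
        by (rule gen_bound[OF PR[OF that] on_exp_measurable[OF dc] db])
      ultimately show ?thesis by linarith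
    qed
    have inv0: "(\<lambda>n. 1 / real (Suc n)) \<longlonglongrightarrow> 0" using LIMSEQ_inverse_real_of_nat by (simp add: inverse_eq_divide)
    have inv2: "(\<lambda>n. 2 * (1 / real (Suc n))) \<longlonglongrightarrow> 0" using tendsto_mult_left[OF inv0, of 2] by simp
    have Il: "(\<lambda>n. I (f n) t) \<longlonglongrightarrow> I h t" if "t > 0" for t
      by (rule Lim_transform_eventually[OF _ always_eventually]) (use LIM_zero_cancel[OF Lim_null_comparison[OF always_eventually inv0, of "\<lambda>n. I (f n) t - I h t"]] Id[OF that] in auto)
    have Gl: "(\<lambda>n. G (f n) t) \<longlonglongrightarrow> G h t" if "t > 0" for t
      by (rule Lim_transform_eventually[OF _ always_eventually]) (use LIM_zero_cancel[OF Lim_null_comparison[OF always_eventually inv2, of "\<lambda>n. G (f n) t - G h t"]] Gd[OF that] in auto)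
    have Im: "I h \<in> borel_measurable ?R"
      by (rule borel_measurable_LIMSEQ_real[where u="\<lambda>n. I (f n)"]) (use Il f(1) in \<open>auto simp: space_restrict_space P_def\<close>)
    have Gmm: "G h \<in> borel_measurable ?R"
      by (rule borel_measurable_LIMSEQ_real[where u="\<lambda>n. G (f n)"]) (use Gl f(1) in \<open>auto simp: space_restrict_space P_def\<close>)
    moreover have "I h t - I h s = (LBINT r:{s<..t}. G h r / (Q1 p * r))" if st: "0 < s" "s \<le> t" for s t
    proof -
      have t0: "t > 0" using st by simp
      have d: "\<bar>(I (f n) t - I (f n) s) - (LBINT r:{s<..t}. G h r / Q1 p / r)\<bar> \<le> 2 * (1 / real (Suc n)) * ln (t / s)" for n
      proof -
        have "I (f n) t - I (f n) s = (LBINT r:{s<..t}. G (f n) r / Q1 p / r)" using f(1)[of n] st by (simp add: P_def)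
        moreover have Gfm: "G (f n) \<in> borel_measurable ?R" using f(1)[of n] by (simp add: P_def)
        moreover have "(LBINT r:{s<..t}. G (f n) r / Q1 p / r) - (LBINT r:{s<..t}. G h r / Q1 p / r)
           = (LBINT r:{s<..t}. G (f n) r / Q1 p / r - G h r / Q1 p / r)"
          by (rule set_integral_diff(2)[symmetric]) (intro Gi Gfm Gmm st cf c)+
        moreover have "\<dots> = (LBINT r:{s<..t}. (G (f n) r - G h r) / Q1 p / r)" by (simp add: diff_divide_distrib)
        moreover have "\<bar>LBINT r:{s<..t}. (G (f n) r - G h r) / Q1 p / r\<bar> \<le> 2 * (1 / real (Suc n)) * ln (t / s)"
        proof (rule set_integrable_bounded_over_id(2)[OF st])
          have "set_integrable lborel {s<..t} (\<lambda>r. G (f n) r / Q1 p / r - G h r / Q1 p / r)"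
            by (rule set_integral_diff(1)) (intro Gi Gfm Gmm st cf c)+
          then have "set_integrable lborel {s<..t} (\<lambda>r. (G (f n) r - G h r) / Q1 p / r)" by (simp add: diff_divide_distrib)
          then show "set_borel_measurable lborel {s<..t} (\<lambda>r. (G (f n) r - G h r) / Q1 p / r)"
            by (simp add: set_integrable_def set_borel_measurable_def)
          fix r assume r: "s < r"
          have "\<bar>G (f n) r - G h r\<bar> / Q1 p \<le> \<bar>G (f n) r - G h r\<bar> / 1" using Q1_ge_1 by (intro divide_left_mono) auto
          then show "\<bar>(G (f n) r - G h r) / Q1 p\<bar> \<le> 2 * (1 / real (Suc n))" using Gd[of r n] r st Q1_ge_1 by simp
        qed
        ultimately show ?thesis by simp
      qed
      have "(\<lambda>n. (I (f n) t - I (f n) s) - (LBINT r:{s<..t}. G h r / Q1 p / r)) \<longlonglongrightarrow> 0"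
      proof (rule Lim_null_comparison[OF always_eventually])
        show "\<forall>n. norm (I (f n) t - I (f n) s - (LBINT r:{s<..t}. G h r / Q1 p / r)) \<le> 2 * (1 / real (Suc n)) * ln (t / s)" using d by simp
        show "(\<lambda>n. 2 * (1 / real (Suc n)) * ln (t / s)) \<longlonglongrightarrow> 0" using tendsto_mult_right[OF inv2, of "ln (t / s)"] by simp
      qed
      moreover have "(\<lambda>n. (I (f n) t - I (f n) s) - (LBINT r:{s<..t}. G h r / Q1 p / r)) \<longlonglongrightarrow> (I h t - I h s) - (LBINT r:{s<..t}. G h r / Q1 p / r)"
        by (intro tendsto_intros Il st t0)
      ultimately have "(I h t - I h s) - (LBINT r:{s<..t}. G h r / Q1 p / r) = 0" using LIMSEQ_unique by blast
      then show ?thesis by simp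
    qed
    ultimately show "P h" using c Im unfolding P_def by auto
  qed
  then show ?thesis unfolding P_def I_def[abs_def] G_def[abs_def] by auto
qed

text \<open>The witness is \<open>a\<close> composed with \<open>- ln\<close>, extended by 0; its
  continuity at 0 is the vanishing of \<open>a\<close> at infinity.\<close>

lemma C0_on_exp:
  assumes "a \<in> C0_Rplus"
  obtains h where "continuous_on {0..1} h" "h 0 = 0" "a = on_exp h"
proof -
  define h where "h u = (if u \<le> 0 then 0 else a (- ln u))" for u :: real
  have ca: "continuous_on {0..} a" and la: "(a \<longlongrightarrow> 0) at_top" and na: "\<And>x. x < 0 \<Longrightarrow> a x = 0"
    using assms by (auto simp: C0_Rplus_def)
  have "continuous_on {0..1} h"
    unfolding continuous_on_def
  proof
    fix u :: real assume u: "u \<in> {0..1}"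
    show "(h \<longlongrightarrow> h u) (at u within {0..1})"
    proof (cases "u = 0")
      case True
      have "filterlim (\<lambda>u::real. - ln u) at_top (at_right 0)" using ln_at_0 by (simp add: filterlim_uminus_at_bot)
      from filterlim_compose[OF la this] have "((\<lambda>u. a (- ln u)) \<longlongrightarrow> 0) (at_right 0)" .
      then have "(h \<longlongrightarrow> 0) (at_right 0)"
        by (rule Lim_transform_eventually) (auto simp: h_def eventually_at_filter)
      then have "(h \<longlongrightarrow> 0) (at 0 within {0..1})" by (simp add: at_within_Icc_at_right)
      then show ?thesis using True by (simp add: h_def)
    next
      case False
      have "continuous_on {0<..1} (\<lambda>u. a (- ln u))"
        by (intro continuous_on_compose2[OF ca]) (auto intro!: continuous_intros simp: ln_le_zero_iff)
      then have "((\<lambda>u. a (- ln u)) \<longlongrightarrow> a (- ln u)) (at u within {0<..1})" using u False by (auto simp: continuous_on_def)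
      moreover have "at u within {0<..1} = at u within {0..1}"
        by (rule at_within_nhd[of u "{0<..}"]) (use u False in auto)
      ultimately have "((\<lambda>u. a (- ln u)) \<longlongrightarrow> a (- ln u)) (at u within {0..1})" by simp
      then have "(h \<longlongrightarrow> a (- ln u)) (at u within {0..1})"
      proof (rule Lim_transform_eventually)
        have "\<forall>\<^sub>F v in nhds u. 0 < v" using u False by (intro order_tendstoD(1)[OF tendsto_ident_at, of _ _ UNIV, simplified] eventually_nhds_in_open[of "{0<..}", simplified]) auto
        then show "\<forall>\<^sub>F v in at u within {0..1}. a (- ln v) = h v"
          unfolding eventually_at_filter by eventually_elim (auto simp: h_def)
      qed
      then show ?thesis using u False by (simp add: h_def)
    qed
  qed
  moreover have "a = on_exp h" using na by (auto simp: on_exp_def h_def)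
  ultimately show ?thesis using that[of h] by (simp add: h_def)
qed

theorem solves_eternal:
  assumes S: "solves l F" and rc: "\<And>t. t > 0 \<Longrightarrow> continuous (at_right t) l"
  shows "eternal_solution p F" "t > 0 \<Longrightarrow> min_of (F t) = l t"
proof -
  have mn: "min_of (F t) = l t" if "t > 0" for t by (rule solves_min_of[OF S rc[OF that] that])
  then show "t > 0 \<Longrightarrow> min_of (F t) = l t" .
  show "eternal_solution p F"
    unfolding eternal_solution_def weak_solution_def gen_def[symmetric]
  proof (intro conjI ballI)
    fix t :: real assume "t \<in> {0<..}" then show "prob_Rplus (F t)" "0 < min_of (F t)" using solvesD(1,3)[OF S] mn by auto
  next
    show "mono_on {0<..} (\<lambda>t. min_of (F t))" using solvesD(2)[OF S] mn by (auto simp: mono_on_def)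
  next
    fix a assume "a \<in> C0_Rplus"
    then obtain h where h: "continuous_on {0..1} h" "h 0 = 0" "a = on_exp h" using C0_on_exp by blast
    note E = solves_equation[OF S h(1,2), folded h(3)]
    show "(\<lambda>t. integral\<^sup>L (F t) a) \<in> borel_measurable (restrict_space borel {0<..})" using E by simp
    fix s t :: real assume st: "s \<in> {0<..}" "t \<in> {0<..}"
    have *: "integral\<^sup>L (F t) a - integral\<^sup>L (F s) a = (LBINT r=ereal s..ereal t. gen a (F r) (min_of (F r)) / (Q1 p * r))" if "0 < s" "s \<le> t" for s t
    proof -
      have "(LBINT r=ereal s..ereal t. gen a (F r) (min_of (F r)) / (Q1 p * r)) = (LBINT r:{s<..t}. gen a (F r) (min_of (F r)) / (Q1 p * r))"
        by (rule interval_integral_Ioc[OF that(2)])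
      also have "\<dots> = (LBINT r:{s<..t}. gen a (F r) (l r) / (Q1 p * r))"
        by (rule set_lebesgue_integral_cong) (use that mn in auto)
      finally show ?thesis using E that by simp
    qed
    show "integral\<^sup>L (F t) a - integral\<^sup>L (F s) a = (LBINT r=ereal s..ereal t. gen a (F r) (min_of (F r)) / (Q1 p * r))"
    proof (cases "s \<le> t")
      case True then show ?thesis using *[of s t] st by simp
    next
      case False
      then show ?thesis using *[of t s] st
        by (subst interval_integral_endpoints_reverse) simp
    qed
  qed
qed

end

section \<open>Generating measures and exponential tilting\<close>

text \<open>Reciprocal of \<open>(1 - exp (- x)) / x\<close>, the kernel of the Laplace exponent at
  1. The value 1 for \<open>x \<le> 0\<close> is the limit at 0 and keeps \<open>wt\<close>
  continuous and positive on the whole line.\<close>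

definition wt :: "real \<Rightarrow> real" where
  "wt x = (if x \<le> 0 then 1 else x / (1 - exp (- x)))"

text \<open>Quotient of the Laplace-exponent kernels at \<open>q\<close> and at 1. It is continuous,
  and bounded on the half-line and beyond, so weak convergence of tilted laws passes to Laplace
  exponents.\<close>

definition rq :: "real \<Rightarrow> real \<Rightarrow> real" where
  "rq q x = (if x \<le> 0 then q else (1 - exp (- q * x)) / (1 - exp (- x)))"

lemma wt_pos: "wt x > 0" by (simp add: wt_def)

text \<open>Removable singularity: to the left of 0 the function is constant, so the limit from the
  right decides continuity at 0.\<close>

lemma isCont_glue:
  fixes f :: "real \<Rightarrow> real"
  assumes "\<And>x. x > 0 \<Longrightarrow> isCont f x" "(f \<longlongrightarrow> c) (at_right 0)"
  shows "isCont (\<lambda>x. if x \<le> 0 then c else f x) x"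
proof -
  let ?h = "\<lambda>x. if x \<le> 0 then c else f x"
  consider "x < 0" | "x = 0" | "x > 0" by linarith
  then show ?thesis
  proof cases
    case 1
    have "\<forall>\<^sub>F y in nhds x. y < 0" using 1 eventually_nhds_in_open[of "{..<0::real}" x] by simp
    then have "\<forall>\<^sub>F y in nhds x. ?h y = c" by eventually_elim auto
    then show ?thesis by (subst isCont_cong) auto
  next
    case 2
    have l: "(?h \<longlongrightarrow> c) (at_left 0)"
      by (rule tendsto_eventually) (auto simp: eventually_at_filter)
    have r: "(?h \<longlongrightarrow> c) (at_right 0)"
      by (rule Lim_transform_eventually[OF assms(2)]) (auto simp: eventually_at_filter)
    have "(?h \<longlongrightarrow> c) (at 0)" using l r by (simp add: filterlim_at_split)
    then show ?thesis using 2 by (simp add: isCont_def)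
  next
    case 3
    have "\<forall>\<^sub>F y in nhds x. 0 < y" using 3 eventually_nhds_in_open[of "{0::real<..}" x] by simp
    then have "\<forall>\<^sub>F y in nhds x. ?h y = f y" by eventually_elim auto
    then show ?thesis using assms(1)[OF 3] by (subst isCont_cong) auto
  qed
qed

lemma wt_isCont: "isCont wt x"
  unfolding wt_def[abs_def]
proof (rule isCont_glue)
  show "((\<lambda>x. x / (1 - exp (- x))) \<longlongrightarrow> (1::real)) (at_right 0)" by real_asymp
qed (auto intro!: continuous_intros)

lemma rq_isCont: "isCont (rq q) x"
  unfolding rq_def[abs_def]
proof (rule isCont_glue)
  show "((\<lambda>x. (1 - exp (- q * x)) / (1 - exp (- x))) \<longlongrightarrow> q) (at_right (0::real))"
  proof (cases "q = 0")
    case False then show ?thesis by real_asymp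
  qed simp
qed (auto intro!: continuous_intros)

lemma wt_measurable [measurable]: "wt \<in> borel_measurable borel"
  by (intro borel_measurable_continuous_onI continuous_at_imp_continuous_on ballI wt_isCont)

lemma rq_measurable [measurable]: "rq q \<in> borel_measurable borel"
  by (intro borel_measurable_continuous_onI continuous_at_imp_continuous_on ballI rq_isCont)

text \<open>Bernoulli's inequality for \<open>y = exp (- x)\<close>:
  \<open>1 - y powr (1 + q) \<le> (1 + q) * (1 - y)\<close>.\<close>

lemma one_minus_exp_mult_le:
  assumes "x \<ge> 0" "q \<ge> (0::real)" shows "1 - exp (- (1 + q) * x) \<le> (1 + q) * (1 - exp (- x))"
proof -
  have "1 - exp (- q * x) \<le> q * x" using exp_ge_add_one_self[of "- q * x"] by simp
  then have "exp (- x) * (1 - exp (- q * x)) \<le> exp (- x) * (q * x)" by (intro mult_left_mono) auto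
  moreover have "exp (- x) * (1 + x) \<le> exp (- x) * exp x" by (intro mult_left_mono) (auto simp: exp_ge_add_one_self)
  then have "exp (- x) * (1 + x) \<le> 1" by (simp add: exp_minus)
  then have "q * (exp (- x) * x) \<le> q * (1 - exp (- x))" using assms by (intro mult_left_mono) (auto simp: algebra_simps)
  moreover have "exp (- (1 + q) * x) = exp (- x) * exp (- q * x)" by (simp add: exp_add[symmetric] algebra_simps)
  ultimately show ?thesis by (simp add: algebra_simps)
qed

lemma rq_bounds: assumes "q \<ge> 0" shows "0 \<le> rq q x" "rq q x \<le> max 1 q"
proof -
  show "0 \<le> rq q x" using assms by (simp add: rq_def)
  show "rq q x \<le> max 1 q"
  proof (cases "x \<le> 0")
    case False
    then have x: "x > 0" by simp
    have "1 - exp (- q * x) \<le> max 1 q * (1 - exp (- x))"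
    proof (cases "q \<le> 1")
      case True
      then have "q * x \<le> 1 * x" using x by (intro mult_right_mono) auto
      then have "exp (- x) \<le> exp (- q * x)" by simp
      then show ?thesis using True by (simp add: max_def)
    next
      case False
      then show ?thesis using one_minus_exp_mult_le[of x "q - 1"] x by (simp add: max_def)
    qed
    then show ?thesis using x by (simp add: rq_def pos_divide_le_eq)
  qed (simp add: rq_def)
qed

section \<open>Integrability with respect to generating measures\<close>

lemma generatingD:
  assumes "generating_measure H"
  shows "sets H = sets borel" "space H = UNIV" "AE x in H. 0 \<le> x"
proof -
  show s: "sets H = sets borel" using assms by (simp add: generating_measure_def)
  show "space H = UNIV" using sets_eq_imp_space_eq[OF s] by simp
  have "{..<0::real} \<in> null_sets H" using assms s by (auto simp: generating_measure_def null_sets_def)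
  from AE_not_in[OF this] show "AE x in H. 0 \<le> x" by eventually_elim auto
qed

text \<open>Real-valued form of the integrand in \<open>generating_measure\<close>. For
  \<open>y \<le> 0\<close> the value is 1, because \<open>ennreal y\<close> is then 0 and its
  inverse is infinite.\<close>

definition mn :: "real \<Rightarrow> real" where "mn y = (if y \<le> 1 then 1 else 1 / y)"

lemma mn_measurable [measurable]: "mn \<in> borel_measurable borel" unfolding mn_def[abs_def] by measurable

lemma inverse_ennreal_divide: "y > 0 \<Longrightarrow> inverse (ennreal y) = ennreal (1 / y)"
  by (simp add: inverse_ennreal divide_inverse)

lemma mn_eq: "min 1 (inverse (ennreal y)) = ennreal (mn y)"
proof (cases "y \<le> 0")
  case True then show ?thesis by (simp add: mn_def ennreal_neg)
next
  case False
  then have "inverse (ennreal y) = ennreal (1 / y)" by (simp add: inverse_ennreal_divide)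
  moreover have "min (ennreal 1) (ennreal (1 / y)) = ennreal (mn y)"
  proof (cases "y \<le> 1")
    case True
    then have "ennreal 1 \<le> ennreal (1 / y)" using False by (intro ennreal_leI) simp
    then show ?thesis using True by (simp add: min_absorb1 mn_def)
  next
    case False
    then have "ennreal (1 / y) \<le> ennreal 1" by (intro ennreal_leI) simp
    then show ?thesis using False by (simp add: min_absorb2 mn_def)
  qed
  ultimately show ?thesis by simp
qed

lemma generating_iff:
  "generating_measure H \<longleftrightarrow> sets H = sets borel \<and> emeasure H {..<0} = 0 \<and> integrable H mn"
proof -
  have "integrable H mn \<longleftrightarrow> (\<integral>\<^sup>+ y. ennreal (mn y) \<partial>H) < \<top>" if "sets H = sets borel"
  proof -
    have m: "mn \<in> borel_measurable H" using mn_measurable by (simp add: measurable_cong_sets[OF that refl])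
    have "norm (mn y) = mn y" for y by (simp add: mn_def)
    then show ?thesis using m by (simp add: integrable_iff_bounded)
  qed
  then show ?thesis by (auto simp: generating_measure_def mn_eq)
qed

lemma generating_integrable:
  assumes H: "generating_measure H" and f: "f \<in> borel_measurable borel" and B: "\<And>x. x \<ge> 0 \<Longrightarrow> \<bar>f x\<bar> \<le> B * mn x"
  shows "integrable H (f :: real \<Rightarrow> real)"
proof (rule Bochner_Integration.integrable_bound)
  show "integrable H (\<lambda>x. B * mn x)" using H by (auto simp: generating_iff)
  show "f \<in> borel_measurable H" using f by (simp add: measurable_cong_sets[OF generatingD(1)[OF H] refl])
  show "AE x in H. norm (f x) \<le> norm (B * mn x)" using generatingD(3)[OF H]
  proof eventually_elim
    case (elim x)
    from B[OF this] show ?case using abs_ge_self[of "B * mn x"] unfolding real_norm_def by linarith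
  qed
qed

definition kq :: "real \<Rightarrow> real \<Rightarrow> real" where "kq q x = (if x = 0 then q else (1 - exp (- q * x)) / x)"

lemma laplace_exponent_kq: "laplace_exponent H q = (\<integral>x. kq q x \<partial>H)"
  by (simp add: laplace_exponent_def kq_def[abs_def])

lemma kq_measurable [measurable]: "kq q \<in> borel_measurable borel" unfolding kq_def[abs_def] by measurable

lemma kq_rq: "x \<ge> 0 \<Longrightarrow> kq q x * wt x = rq q x" by (auto simp: kq_def wt_def rq_def)

lemma kq_bound: assumes "q \<ge> 0" "x \<ge> 0" shows "0 \<le> kq q x" "kq q x \<le> max 1 q * mn x"
proof -
  show "0 \<le> kq q x" using assms by (simp add: kq_def)
  show "kq q x \<le> max 1 q * mn x"
  proof (cases "x = 0")
    case False
    then have x: "x > 0" using assms by simp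
    have "1 - exp (- q * x) \<le> q * x" using exp_ge_add_one_self[of "- q * x"] by simp
    then have 1: "kq q x \<le> q" using x by (simp add: kq_def pos_divide_le_eq)
    have 2: "kq q x \<le> 1 / x" using x by (simp add: kq_def divide_right_mono)
    show ?thesis
    proof (cases "x \<le> 1")
      case True then show ?thesis using 1 by (simp add: mn_def)
    next
      case False
      have "1 / x \<le> max 1 q / x" using x by (intro divide_right_mono) auto
      then show ?thesis using 2 False by (simp add: mn_def)
    qed
  qed (simp add: kq_def mn_def)
qed

lemma kq_integrable: assumes "generating_measure H" "q \<ge> 0" shows "integrable H (kq q)"
  by (rule generating_integrable[OF assms(1), where B="max 1 q"]) (use kq_bound[OF assms(2)] in auto)

lemma prob_Rplus_density:
  assumes s: "sets M = sets borel" and M: "AE x in M. 0 \<le> x" and w: "w \<in> borel_measurable borel" "AE x in M. 0 \<le> w x"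
    and i: "integrable M w" and e: "integral\<^sup>L M w = 1"
  shows "prob_Rplus (density M (\<lambda>x. ennreal (w x)))"
proof -
  have wm: "w \<in> borel_measurable M" using w(1) by (simp add: measurable_cong_sets[OF s refl])
  have sp: "space M = UNIV" using sets_eq_imp_space_eq[OF s] by simp
  have "emeasure (density M (\<lambda>x. ennreal (w x))) UNIV = (\<integral>\<^sup>+x. ennreal (w x) \<partial>M)"
    using wm s by (subst emeasure_density) (auto simp: sp)
  also have "\<dots> = 1" using nn_integral_eq_integral[OF i w(2)] e by simp
  finally have p: "prob_space (density M (\<lambda>x. ennreal (w x)))" by (intro prob_spaceI) (simp add: sp)
  have "emeasure (density M (\<lambda>x. ennreal (w x))) {..<0} = (\<integral>\<^sup>+x. ennreal (w x) * indicator {..<0} x \<partial>M)"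
    using wm s by (subst emeasure_density) auto
  also have "\<dots> = (\<integral>\<^sup>+x. 0 \<partial>M)"
    by (rule nn_integral_cong_AE) (use M in \<open>eventually_elim, auto\<close>)
  finally show ?thesis using p s by (simp add: prob_Rplus_def)
qed

text \<open>As \<open>t\<close> tends to 0 the laws \<open>F t\<close> collapse to the point mass at
  0. Reweighting by \<open>1 - exp (- x)\<close> and normalising leaves laws that converge to a tilt
  of \<open>H\<close>.\<close>

definition tilt :: "real measure \<Rightarrow> real measure" where
  "tilt M = density M (\<lambda>x. ennreal ((1 - exp (- x)) / (1 - lap M 1)))"

lemma tilt:
  assumes M: "prob_Rplus M" and L: "lap M 1 < 1"
  shows "prob_Rplus (tilt M)"
    "h \<in> borel_measurable borel \<Longrightarrow> integral\<^sup>L (tilt M) h = (\<integral>x. (1 - exp (- x)) * h x \<partial>M) / (1 - lap M 1)"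
    "q \<ge> 0 \<Longrightarrow> lap (tilt M) q = (lap M q - lap M (q + 1)) / (1 - lap M 1)"
    "q \<ge> 0 \<Longrightarrow> integral\<^sup>L (tilt M) (rq q) = (1 - lap M q) / (1 - lap M 1)"
proof -
  interpret prob_space M using prob_RplusD[OF M] by simp
  let ?w = "\<lambda>x. (1 - exp (- x)) / (1 - lap M 1)"
  note sM = prob_RplusD(2)[OF M]
  have nn: "AE x in M. 0 \<le> ?w x" using prob_RplusD(4)[OF M] by eventually_elim (use L in auto)
  have i: "integrable M (\<lambda>x. exp (- q * x))" if "q \<ge> 0" for q by (rule lap_integrable[OF M that])
  have iw: "integrable M ?w" using i[of 1] by auto
  show "prob_Rplus (tilt M)" unfolding tilt_def
  proof (rule prob_Rplus_density[OF sM prob_RplusD(4)[OF M] _ nn iw])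
    have "(\<integral>x. 1 - exp (- x) \<partial>M) = 1 - lap M 1" using i[of 1] prob_space by (simp add: lap_def)
    then show "integral\<^sup>L M ?w = 1" using L by simp
  qed auto
  show D: "integral\<^sup>L (tilt M) h = (\<integral>x. (1 - exp (- x)) * h x \<partial>M) / (1 - lap M 1)" if "h \<in> borel_measurable borel" for h
  proof -
    have "h \<in> borel_measurable M" "?w \<in> borel_measurable M" using that by (auto simp: measurable_cong_sets[OF sM refl])
    then have "integral\<^sup>L (tilt M) h = (\<integral>x. ?w x *\<^sub>R h x \<partial>M)" unfolding tilt_def by (intro integral_density nn)
    then show ?thesis by simp
  qed
  show "lap (tilt M) q = (lap M q - lap M (q + 1)) / (1 - lap M 1)" if "q \<ge> 0"
  proof -
    have "(\<integral>x. (1 - exp (- x)) * exp (- q * x) \<partial>M) = (\<integral>x. exp (- q * x) - exp (- (q + 1) * x) \<partial>M)"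
      by (intro Bochner_Integration.integral_cong refl) (simp add: algebra_simps exp_add[symmetric])
    also have "\<dots> = lap M q - lap M (q + 1)" unfolding lap_def using i[of q] i[of "q + 1"] that by simp
    finally show ?thesis by (simp add: lap_def[of "tilt M"] D)
  qed
  show "integral\<^sup>L (tilt M) (rq q) = (1 - lap M q) / (1 - lap M 1)" if "q \<ge> 0"
  proof -
    have "(\<integral>x. (1 - exp (- x)) * rq q x \<partial>M) = (\<integral>x. 1 - exp (- q * x) \<partial>M)"
    proof (rule integral_cong_AE)
      show "AE x in M. (1 - exp (- x)) * rq q x = 1 - exp (- q * x)"
        using prob_RplusD(4)[OF M] by eventually_elim (auto simp: rq_def)
    qed (auto simp: measurable_cong_sets[OF sM refl])
    also have "\<dots> = 1 - lap M q" unfolding lap_def using i[OF that] prob_space by simp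
    finally show ?thesis by (simp add: D)
  qed
qed

text \<open>Inverse of the tilt. The factor \<open>c\<close> becomes the Laplace exponent at 1, so
  generating measures with exponent \<open>c\<close> at 1 correspond to probability measures
  \<open>N\<close>.\<close>

definition untilt :: "real \<Rightarrow> real measure \<Rightarrow> real measure" where
  "untilt c N = density N (\<lambda>x. ennreal (c * wt x))"

lemma wt_le: "x \<ge> 0 \<Longrightarrow> wt x * mn x \<le> 1 / (1 - exp (-1))"
proof -
  assume x: "x \<ge> 0"
  have c: "0 < 1 - exp (- 1 :: real)" by simp
  consider "x = 0" | "0 < x" "x \<le> 1" | "x > 1" using x by linarith
  then show ?thesis
  proof cases
    case 1 then show ?thesis using c by (simp add: wt_def mn_def)
  next
    case 2
    have "1 - exp (- (1 / x) * x) \<le> max 1 (1 / x) * (1 - exp (- x))"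
      using rq_bounds(2)[of "1 / x" x] 2 by (simp add: rq_def pos_divide_le_eq)
    then have "x * (1 - exp (- 1)) \<le> x * (max 1 (1 / x) * (1 - exp (- x)))" using 2 by (intro mult_left_mono) auto
    also have "\<dots> = 1 - exp (- x)" using 2 by (simp add: max_def)
    finally show ?thesis using 2 by (simp add: wt_def mn_def field_simps)
  next
    case 3
    then show ?thesis by (simp add: wt_def mn_def) (intro divide_left_mono, auto)
  qed
qed

text \<open>The last two formulas express the quantities tested by \<open>gm_converges\<close> as
  integrals against \<open>N\<close> of functions that are bounded on the half-line.\<close>

lemma untilt:
  assumes N: "prob_Rplus N" and c: "c > 0"
  shows "generating_measure (untilt c N)"
    "q \<ge> 0 \<Longrightarrow> laplace_exponent (untilt c N) q = c * integral\<^sup>L N (rq q)"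
    "x > 0 \<Longrightarrow> emeasure (untilt c N) {0..x} = ennreal (c * (\<integral>y. (if y \<le> x then wt y else 0) \<partial>N))"
    "x > 0 \<Longrightarrow> (\<integral>\<^sup>+ y\<in>{x..}. inverse (ennreal y) \<partial>(untilt c N)) = ennreal (c * (\<integral>y. (if x \<le> y then 1 / (1 - exp (- y)) else 0) \<partial>N))"
proof -
  note sN = prob_RplusD(2)[OF N]
  have mN: "f \<in> borel_measurable N" if "f \<in> borel_measurable borel" for f :: "real \<Rightarrow> real"
    using that by (simp add: measurable_cong_sets[OF sN refl])
  have sU: "sets (untilt c N) = sets borel" by (simp add: untilt_def sN)
  have em: "emeasure (untilt c N) A = (\<integral>\<^sup>+x. ennreal (c * wt x) * indicator A x \<partial>N)" if "A \<in> sets borel" for A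
    unfolding untilt_def using that mN[of "\<lambda>x. c * wt x"] sN by (intro emeasure_density) auto
  have nn: "AE x in N. 0 \<le> c * wt x" using c wt_pos by (auto simp: less_imp_le)
  show "generating_measure (untilt c N)" unfolding generating_iff
  proof (intro conjI sU)
    have "emeasure (untilt c N) {..<0} = (\<integral>\<^sup>+x. 0 \<partial>N)"
      unfolding em[OF borel_open[OF open_lessThan]] by (rule nn_integral_cong_AE) (use prob_RplusD(4)[OF N] in \<open>eventually_elim, auto\<close>)
    then show "emeasure (untilt c N) {..<0} = 0" by simp
    have "integrable N (\<lambda>x. (c * wt x) *\<^sub>R mn x)"
    proof (rule prob_Rplus_integrable[OF N])
      fix x :: real assume x: "x \<ge> 0"
      have "c * (wt x * mn x) \<le> c * (1 / (1 - exp (-1)))" using c wt_le[OF x] by (intro mult_left_mono) auto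
      moreover have "0 \<le> c * (wt x * mn x)" using c wt_pos[of x] by (intro mult_nonneg_nonneg) (auto simp: mn_def)
      ultimately show "\<bar>(c * wt x) *\<^sub>R mn x\<bar> \<le> c * (1 / (1 - exp (-1)))" by (simp add: mult.assoc)
    qed auto
    then show "integrable (untilt c N) mn" unfolding untilt_def
      using mN[of "\<lambda>x. c * wt x"] mN[of mn] nn by (subst integrable_density) auto
  qed
  show "laplace_exponent (untilt c N) q = c * integral\<^sup>L N (rq q)" if "q \<ge> 0"
  proof -
    have "laplace_exponent (untilt c N) q = (\<integral>x. (c * wt x) *\<^sub>R kq q x \<partial>N)"
      unfolding laplace_exponent_kq untilt_def using mN[of "\<lambda>x. c * wt x"] mN[of "kq q"] nn by (intro integral_density) auto
    also have "\<dots> = (\<integral>x. c * rq q x \<partial>N)"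
    proof (rule integral_cong_AE)
      show "AE x in N. (c * wt x) *\<^sub>R kq q x = c * rq q x"
        using prob_RplusD(4)[OF N]
      proof eventually_elim
        case (elim x) then show ?case using kq_rq[of x q] by (simp add: algebra_simps)
      qed
    qed (simp_all add: measurable_cong_sets[OF sN refl])
    finally show ?thesis by simp
  qed
  fix x :: real assume x: "x > 0"
  have wb: "\<bar>if y \<le> x then wt y else 0\<bar> \<le> max 1 x * (1 / (1 - exp (-1)))" if "y \<ge> 0" for y
  proof (cases "y \<le> x")
    case True
    have m: "1 \<le> max 1 x * mn y" using True that by (auto simp: mn_def max_def field_simps)
    have "wt y * 1 \<le> wt y * (max 1 x * mn y)" using m wt_pos[of y] by (intro mult_left_mono) auto
    also have "\<dots> = max 1 x * (wt y * mn y)" by simp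
    also have "\<dots> \<le> max 1 x * (1 / (1 - exp (-1)))" using wt_le[OF that] by (intro mult_left_mono) auto
    finally show ?thesis using True wt_pos[of y] by simp
  qed auto
  have "emeasure (untilt c N) {0..x} = (\<integral>\<^sup>+y. ennreal (c * (if y \<le> x then wt y else 0)) \<partial>N)"
    unfolding em[OF borel_closed[OF closed_atLeastAtMost]]
  proof (rule nn_integral_cong_AE)
    show "AE y in N. ennreal (c * wt y) * indicator {0..x} y = ennreal (c * (if y \<le> x then wt y else 0))"
      using prob_RplusD(4)[OF N] by eventually_elim (auto simp: indicator_def)
  qed
  also have "\<dots> = ennreal (\<integral>y. c * (if y \<le> x then wt y else 0) \<partial>N)"
  proof (rule nn_integral_eq_integral)
    show "integrable N (\<lambda>y. c * (if y \<le> x then wt y else 0))"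
      by (intro integrable_mult_right prob_Rplus_integrable[OF N, where B="max 1 x * (1 / (1 - exp (-1)))"] wb) measurable
    show "AE y in N. 0 \<le> c * (if y \<le> x then wt y else 0)" using c wt_pos by (auto simp: less_imp_le)
  qed
  finally show "emeasure (untilt c N) {0..x} = ennreal (c * (\<integral>y. (if y \<le> x then wt y else 0) \<partial>N))" by simp
  have "(\<integral>\<^sup>+ y\<in>{x..}. inverse (ennreal y) \<partial>(untilt c N)) = (\<integral>\<^sup>+ y. ennreal (c * wt y) * (inverse (ennreal y) * indicator {x..} y) \<partial>N)"
    unfolding untilt_def using mN[of "\<lambda>x. c * wt x"] by (intro nn_integral_density) (auto simp: measurable_cong_sets[OF sN refl])
  also have "\<dots> = (\<integral>\<^sup>+ y. ennreal (c * (if x \<le> y then 1 / (1 - exp (- y)) else 0)) \<partial>N)"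
  proof (rule nn_integral_cong)
    fix y
    show "ennreal (c * wt y) * (inverse (ennreal y) * indicator {x..} y) = ennreal (c * (if x \<le> y then 1 / (1 - exp (- y)) else 0))"
    proof (cases "x \<le> y")
      case True
      then have y: "y > 0" using x by simp
      then have "ennreal (c * wt y) * inverse (ennreal y) = ennreal (c * wt y * (1 / y))"
        using c wt_pos[of y] by (simp only: inverse_ennreal_divide) (rule ennreal_mult'[symmetric], simp add: less_imp_le)
      also have "c * wt y * (1 / y) = c * (1 / (1 - exp (- y)))" using y by (simp add: wt_def)
      finally show ?thesis using True by simp
    qed simp
  qed
  also have "\<dots> = ennreal (\<integral>y. c * (if x \<le> y then 1 / (1 - exp (- y)) else 0) \<partial>N)"
  proof (rule nn_integral_eq_integral)
    show "integrable N (\<lambda>y. c * (if x \<le> y then 1 / (1 - exp (- y)) else 0))"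
    proof (intro integrable_mult_right prob_Rplus_integrable[OF N, where B="1 / (1 - exp (- x))"])
      fix y :: real
      show "\<bar>if x \<le> y then 1 / (1 - exp (- y)) else 0\<bar> \<le> 1 / (1 - exp (- x))"
        using x by (auto intro!: divide_left_mono)
    qed measurable
    show "AE y in N. 0 \<le> c * (if x \<le> y then 1 / (1 - exp (- y)) else 0)" using c x by (intro AE_I2) auto
  qed
  finally show "(\<integral>\<^sup>+ y\<in>{x..}. inverse (ennreal y) \<partial>(untilt c N)) = ennreal (c * (\<integral>y. (if x \<le> y then 1 / (1 - exp (- y)) else 0) \<partial>N))" by simp
qed

text \<open>The density of \<open>N\<close> is \<open>(1 - exp (- x)) / x\<close> divided by its
  integral. Multiplication by \<open>exp (- q * x)\<close> turns this kernel into the difference of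
  the kernels at \<open>q + 1\<close> and \<open>q\<close>, whence the formula for
  \<open>lap N q\<close>.\<close>

lemma generating_tilt:
  assumes H: "generating_measure H" and pos: "laplace_exponent H 1 > 0"
  obtains N where "prob_Rplus N" "H = untilt (laplace_exponent H 1) N"
    "\<And>q. q \<ge> 0 \<Longrightarrow> lap N q = (laplace_exponent H (q + 1) - laplace_exponent H q) / laplace_exponent H 1"
proof
  let ?c = "laplace_exponent H 1"
  define w where "w x = 1 / (?c * wt x)" for x
  define N where "N = density H (\<lambda>x. ennreal (w x))"
  note sH = generatingD(1)[OF H]
  have mH: "f \<in> borel_measurable H" if "f \<in> borel_measurable borel" for f :: "real \<Rightarrow> real"
    using that by (simp add: measurable_cong_sets[OF sH refl])
  have wm [measurable]: "w \<in> borel_measurable borel" unfolding w_def[abs_def] by measurable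
  have wk: "w x = kq 1 x / ?c" if "x \<ge> 0" for x using that by (auto simp: w_def wt_def kq_def)
  have nn: "0 \<le> w x" for x using pos wt_pos[of x] by (simp add: w_def less_imp_le)
  have i: "integrable H w" and e: "integral\<^sup>L H w = 1"
  proof -
    have AE: "AE x in H. kq 1 x / ?c = w x" using generatingD(3)[OF H] by eventually_elim (simp add: wk)
    have ik: "integrable H (\<lambda>x. kq 1 x / ?c)" using kq_integrable[OF H, of 1] by simp
    show "integrable H w" by (rule integrable_cong_AE_imp[OF ik mH[OF wm]]) (use AE in \<open>auto elim: eventually_mono\<close>)
    have "integral\<^sup>L H w = (\<integral>x. kq 1 x / ?c \<partial>H)"
      by (rule integral_cong_AE) (use AE in \<open>auto simp: measurable_cong_sets[OF sH refl] elim: eventually_mono\<close>)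
    also have "\<dots> = 1" using pos by (simp add: laplace_exponent_kq[symmetric])
    finally show "integral\<^sup>L H w = 1" .
  qed
  show N: "prob_Rplus N" unfolding N_def
    by (rule prob_Rplus_density[OF sH generatingD(3)[OF H] wm _ i e]) (use nn in auto)
  have "untilt ?c N = density H (\<lambda>x. ennreal (w x) * ennreal (?c * wt x))"
    unfolding untilt_def N_def by (rule density_density_eq) (simp_all add: measurable_cong_sets[OF sH refl])
  also have "\<dots> = density H (\<lambda>x. 1)"
  proof (rule density_cong)
    have "ennreal (w x) * ennreal (?c * wt x) = 1" for x
    proof -
      have "ennreal (w x) * ennreal (?c * wt x) = ennreal (w x * (?c * wt x))" using nn by (simp add: ennreal_mult')
      also have "w x * (?c * wt x) = 1" using pos wt_pos[of x] by (simp add: w_def)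
      finally show ?thesis by simp
    qed
    then show "AE x in H. ennreal (w x) * ennreal (?c * wt x) = 1" by simp
  qed (simp_all add: measurable_cong_sets[OF sH refl] nn)
  also have "\<dots> = H" by (rule density_1)
  finally show "H = untilt ?c N" by simp
  fix q :: real assume q: "q \<ge> 0"
  have "lap N q = (\<integral>x. w x *\<^sub>R exp (- q * x) \<partial>H)"
    unfolding lap_def N_def using nn by (intro integral_density) (simp_all add: measurable_cong_sets[OF sH refl] nn)
  also have "\<dots> = (\<integral>x. (kq (q + 1) x - kq q x) / ?c \<partial>H)"
  proof (rule integral_cong_AE)
    show "AE x in H. w x *\<^sub>R exp (- q * x) = (kq (q + 1) x - kq q x) / ?c"
      using generatingD(3)[OF H]
    proof eventually_elim
      case (elim x)
      have "exp (- (q + 1) * x) = exp (- q * x) * exp (- x)" by (simp add: exp_add[symmetric] algebra_simps)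
      then have "kq 1 x * exp (- q * x) = kq (q + 1) x - kq q x"
        using elim by (cases "x = 0") (simp_all add: kq_def field_simps)
      then show ?case using wk[OF elim] by simp
    qed
  qed (simp_all add: measurable_cong_sets[OF sH refl] nn)
  also have "\<dots> = (laplace_exponent H (q + 1) - laplace_exponent H q) / ?c"
    using kq_integrable[OF H, of q] kq_integrable[OF H, of "q + 1"] q by (simp add: laplace_exponent_kq)
  finally show "lap N q = (laplace_exponent H (q + 1) - laplace_exponent H q) / ?c" .
qed

text \<open>Continuity of the distribution function excludes an atom of \<open>untilt c N\<close> at
  \<open>x\<close>, hence one of \<open>N\<close>, as the density is positive.\<close>

lemma untilt_null:
  assumes N: "prob_Rplus N" and c: "c > 0" and x: "x > 0" and cont: "isCont (\<lambda>y. measure (untilt c N) {0..y}) x"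
  shows "emeasure N {x} = 0"
proof -
  let ?H = "untilt c N"
  interpret N: prob_space N using prob_RplusD[OF N] by simp
  note sN = prob_RplusD(2)[OF N]
  have sH: "sets ?H = sets borel" by (simp add: untilt_def sN)
  have fin: "emeasure ?H {0..y} < \<infinity>" if "y > 0" for y using untilt(3)[OF N c that] by simp
  have le: "measure ?H {x} \<le> measure ?H {0..x} - measure ?H {0..y}" if y: "0 < y" "y < x" for y
  proof -
    have f1: "{x} \<in> fmeasurable ?H" "{0..y} \<in> fmeasurable ?H" "{0..x} \<in> fmeasurable ?H"
    proof -
      have "emeasure ?H {x} \<le> emeasure ?H {0..x}" using x sH by (intro emeasure_mono) auto
      then have "emeasure ?H {x} < \<infinity>" using fin[OF x] by (rule order_le_less_trans)
      then show "{x} \<in> fmeasurable ?H" by (intro fmeasurableI) (simp_all add: sH)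
      show "{0..y} \<in> fmeasurable ?H" using fin[OF y(1)] by (intro fmeasurableI) (simp_all add: sH)
      show "{0..x} \<in> fmeasurable ?H" using fin[OF x] by (intro fmeasurableI) (simp_all add: sH)
    qed
    have "measure ?H ({0..y} \<union> {x}) = measure ?H {0..y} + measure ?H {x}"
      using y f1 by (intro measure_Union) (auto simp: fmeasurable_def top.not_eq_extremum)
    moreover have "measure ?H ({0..y} \<union> {x}) \<le> measure ?H {0..x}" using y x f1 sH by (intro measure_mono_fmeasurable) auto
    ultimately show ?thesis by simp
  qed
  have "((\<lambda>y. measure ?H {0..y}) \<longlongrightarrow> measure ?H {0..x}) (at x)" using cont by (simp add: isCont_def)
  then have "((\<lambda>y. measure ?H {0..y}) \<longlongrightarrow> measure ?H {0..x}) (at_left x)"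
    by (rule tendsto_mono[OF at_le[OF subset_UNIV]])
  then have "((\<lambda>y. measure ?H {0..x} - measure ?H {0..y}) \<longlongrightarrow> measure ?H {0..x} - measure ?H {0..x}) (at_left x)"
    by (intro tendsto_diff tendsto_const)
  then have "((\<lambda>y. measure ?H {0..x} - measure ?H {0..y}) \<longlongrightarrow> 0) (at_left x)" by simp
  moreover have "\<forall>\<^sub>F y in at_left x. measure ?H {x} \<le> measure ?H {0..x} - measure ?H {0..y}"
    unfolding eventually_at_left_field using x le by (intro exI[of _ 0]) auto
  ultimately have "measure ?H {x} \<le> 0" by (intro tendsto_lowerbound) auto
  moreover have fx: "emeasure ?H {x} \<noteq> \<infinity>"
    using order_le_less_trans[OF emeasure_mono[of "{x}" "{0..x}" ?H] fin[OF x]] x sH by auto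
  ultimately have "emeasure ?H {x} = 0" by (simp add: emeasure_eq_ennreal_measure measure_le_0_iff)
  moreover have "emeasure ?H {x} = ennreal (c * wt x) * emeasure N {x}"
  proof -
    have "emeasure ?H {x} = (\<integral>\<^sup>+y. ennreal (c * wt y) * indicator {x} y \<partial>N)"
      unfolding untilt_def by (intro emeasure_density) (auto simp: sN measurable_cong_sets[OF sN refl])
    also have "\<dots> = (\<integral>\<^sup>+y. ennreal (c * wt x) * indicator {x} y \<partial>N)"
      by (intro nn_integral_cong) (auto simp: indicator_def)
    also have "\<dots> = ennreal (c * wt x) * emeasure N {x}" using sN by (simp add: nn_integral_cmult)
    finally show ?thesis .
  qed
  ultimately show ?thesis using c wt_pos[of x] by (simp add: ennreal_eq_0_iff mult_le_0_iff)
qed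

text \<open>At a continuity point the two test functions are bounded and discontinuous only at
  \<open>x\<close>, a null point of the limit law, so weak convergence applies to them.\<close>

lemma untilt_gm_conv_seq:
  assumes mu: "\<And>n. prob_Rplus (\<mu> n)" and N: "prob_Rplus N" and w: "weak_conv_m \<mu> N"
    and c: "c \<longlonglongrightarrow> d" "d > 0" "\<And>n. c n > 0" and x: "x > 0" and cont: "isCont (\<lambda>y. measure (untilt d N) {0..y}) x"
  shows "(\<lambda>n. emeasure (untilt (c n) (\<mu> n)) {0..x}) \<longlonglongrightarrow> emeasure (untilt d N) {0..x}"
    "(\<lambda>n. \<integral>\<^sup>+ y\<in>{x..}. inverse (ennreal y) \<partial>(untilt (c n) (\<mu> n))) \<longlonglongrightarrow> (\<integral>\<^sup>+ y\<in>{x..}. inverse (ennreal y) \<partial>(untilt d N))"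
proof -
  note sN = prob_RplusD(2)[OF N]
  have null: "emeasure N {x} = 0" by (rule untilt_null[OF N c(2) x cont])
  have conv: "(\<lambda>n. integral\<^sup>L (\<mu> n) h) \<longlonglongrightarrow> integral\<^sup>L N h"
    if h: "h \<in> borel_measurable borel" "\<And>y. \<bar>h y\<bar> \<le> B" "\<And>y. y \<noteq> x \<Longrightarrow> isCont h y" for h :: "real \<Rightarrow> real" and B :: real
  proof (rule weak_conv_imp_bdd_ae_continuous_conv[where B=B])
    show "real_distribution (\<mu> n)" for n using mu prob_RplusD by blast
    show "real_distribution N" using N prob_RplusD by blast
    have "y = x" if "\<not> isCont h y" for y using h(3)[of y] that by blast
    then have "{y. \<not> isCont h y} \<subseteq> {x}" by blast
    then have "emeasure N {y. \<not> isCont h y} \<le> emeasure N {x}" by (rule emeasure_mono) (simp add: sN)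
    then show "emeasure N {y. \<not> isCont h y} = 0" using null by simp
  qed (use h w in auto)
  have "(\<lambda>n. integral\<^sup>L (\<mu> n) (\<lambda>y. if y \<le> x then wt y else 0)) \<longlonglongrightarrow> integral\<^sup>L N (\<lambda>y. if y \<le> x then wt y else 0)"
  proof (rule conv)
    fix y
    show "\<bar>if y \<le> x then wt y else 0\<bar> \<le> max 1 x * (1 / (1 - exp (-1)))"
    proof (cases "0 \<le> y \<and> y \<le> x")
      case True
      have m: "1 \<le> max 1 x * mn y" using True by (auto simp: mn_def max_def field_simps)
      have "wt y * 1 \<le> wt y * (max 1 x * mn y)" using m wt_pos[of y] by (intro mult_left_mono) auto
      also have "\<dots> = max 1 x * (wt y * mn y)" by simp
      also have "\<dots> \<le> max 1 x * (1 / (1 - exp (-1)))" using wt_le[of y] True by (intro mult_left_mono) auto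
      finally show ?thesis using True wt_pos[of y] by simp
    next
      case False
      have "1 * 1 \<le> max 1 x * (1 / (1 - exp (-1)))" by (intro mult_mono) auto
      then show ?thesis using False by (auto simp: wt_def)
    qed
    assume y: "y \<noteq> x"
    show "isCont (\<lambda>y. if y \<le> x then wt y else 0) y"
    proof (cases "y < x")
      case True
      have "\<forall>\<^sub>F z in nhds y. z < x" using True eventually_nhds_in_open[of "{..<x}" y] by simp
      then have "\<forall>\<^sub>F z in nhds y. (if z \<le> x then wt z else 0) = wt z" by eventually_elim auto
      then show ?thesis using wt_isCont[of y] by (subst isCont_cong) auto
    next
      case False
      then have "\<forall>\<^sub>F z in nhds y. x < z" using y eventually_nhds_in_open[of "{x<..}" y] by simp
      then have "\<forall>\<^sub>F z in nhds y. (if z \<le> x then wt z else 0) = 0" by eventually_elim auto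
      then show ?thesis by (subst isCont_cong) auto
    qed
  qed measurable
  from tendsto_ennrealI[OF tendsto_mult[OF c(1) this]]
  show "(\<lambda>n. emeasure (untilt (c n) (\<mu> n)) {0..x}) \<longlonglongrightarrow> emeasure (untilt d N) {0..x}"
    by (simp add: untilt(3) mu N c x)
  have "(\<lambda>n. integral\<^sup>L (\<mu> n) (\<lambda>y. if x \<le> y then 1 / (1 - exp (- y)) else 0)) \<longlonglongrightarrow> integral\<^sup>L N (\<lambda>y. if x \<le> y then 1 / (1 - exp (- y)) else 0)"
  proof (rule conv)
    fix y
    show "\<bar>if x \<le> y then 1 / (1 - exp (- y)) else 0\<bar> \<le> 1 / (1 - exp (- x))"
      using x by (auto intro!: divide_left_mono)
    assume y: "y \<noteq> x"
    show "isCont (\<lambda>y. if x \<le> y then 1 / (1 - exp (- y)) else 0) y"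
    proof (cases "x < y")
      case True
      have "\<forall>\<^sub>F z in nhds y. x < z" using True eventually_nhds_in_open[of "{x<..}" y] by simp
      then have "\<forall>\<^sub>F z in nhds y. (if x \<le> z then 1 / (1 - exp (- z)) else 0) = 1 / (1 - exp (- z))" by eventually_elim auto
      moreover have "isCont (\<lambda>z. 1 / (1 - exp (- z))) y" using True x by (auto intro!: continuous_intros)
      ultimately show ?thesis by (subst isCont_cong) auto
    next
      case False
      then have "\<forall>\<^sub>F z in nhds y. z < x" using y eventually_nhds_in_open[of "{..<x}" y] by simp
      then have "\<forall>\<^sub>F z in nhds y. (if x \<le> z then 1 / (1 - exp (- z)) else 0) = 0" by eventually_elim auto
      then show ?thesis by (subst isCont_cong) auto
    qed
  qed measurable
  from tendsto_ennrealI[OF tendsto_mult[OF c(1) this]]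
  show "(\<lambda>n. \<integral>\<^sup>+ y\<in>{x..}. inverse (ennreal y) \<partial>(untilt (c n) (\<mu> n))) \<longlonglongrightarrow> (\<integral>\<^sup>+ y\<in>{x..}. inverse (ennreal y) \<partial>(untilt d N))"
    by (simp add: untilt(4) mu N c x)
qed

text \<open>The factor \<open>1 - exp (- x)\<close> of the tilt cancels against \<open>wt\<close>,
  leaving \<open>x\<close> as density; the constant is the Laplace exponent of
  \<open>Gt F ks t\<close> at 1.\<close>

lemma Gt_eq_untilt:
  assumes M: "prob_Rplus (F t)" and L: "lap (F t) 1 < 1" and k: "t * ks t > 0"
  shows "Gt F ks t = untilt ((1 - lap (F t) 1) / (t * ks t)) (tilt (F t))"
proof -
  note sM = prob_RplusD(2)[OF M]
  have m: "f \<in> borel_measurable (F t)" if "f \<in> borel_measurable borel" for f :: "real \<Rightarrow> real"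
    using that by (simp add: measurable_cong_sets[OF sM refl])
  let ?Y = "1 - lap (F t) 1"
  have "untilt (?Y / (t * ks t)) (tilt (F t)) = density (F t) (\<lambda>x. ennreal ((1 - exp (- x)) / ?Y) * ennreal (?Y / (t * ks t) * wt x))"
    unfolding untilt_def tilt_def by (rule density_density_eq) (simp_all add: measurable_cong_sets[OF sM refl])
  also have "\<dots> = Gt F ks t" unfolding Gt_def
  proof (rule density_cong)
    show "AE x in F t. ennreal ((1 - exp (- x)) / ?Y) * ennreal (?Y / (t * ks t) * wt x) = ennreal (x / (t * ks t))"
      using prob_RplusD(4)[OF M]
    proof eventually_elim
      case (elim x)
      then have "ennreal ((1 - exp (- x)) / ?Y) * ennreal (?Y / (t * ks t) * wt x) = ennreal ((1 - exp (- x)) / ?Y * (?Y / (t * ks t) * wt x))"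
        using L by (intro ennreal_mult'[symmetric]) auto
      also have "(1 - exp (- x)) / ?Y * (?Y / (t * ks t) * wt x) = x / (t * ks t)" using elim L by (auto simp: wt_def)
      finally show ?case .
    qed
  qed (simp_all add: measurable_cong_sets[OF sM refl])
  finally show ?thesis by simp
qed

lemma cdf_right_cont:
  assumes H: "generating_measure H" and x: "x \<ge> 0"
  shows "((\<lambda>y. measure H {0..y}) \<longlongrightarrow> measure H {0..x}) (at_right x)"
    "y \<ge> 0 \<Longrightarrow> emeasure H {0..y} < \<infinity>"
proof -
  note sH = generatingD(1)[OF H]
  show fin: "emeasure H {0..y} < \<infinity>" if "y \<ge> 0" for y
  proof -
    have "emeasure H {0..y} = (\<integral>\<^sup>+z. indicator {0..y} z \<partial>H)" using sH by simp
    also have "\<dots> \<le> (\<integral>\<^sup>+z. ennreal (max 1 y * mn z) \<partial>H)"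
      by (rule nn_integral_mono) (auto simp: indicator_def mn_def max_def field_simps)
    also have "\<dots> = ennreal (\<integral>z. max 1 y * mn z \<partial>H)"
    proof (rule nn_integral_eq_integral)
      show "integrable H (\<lambda>z. max 1 y * mn z)" using H by (simp add: generating_iff)
      show "AE z in H. 0 \<le> max 1 y * mn z" by (simp add: mn_def)
    qed
    also have "\<dots> < \<infinity>" by simp
    finally show ?thesis .
  qed
  \<comment> \<open>\<open>H\<close> may be infinite, so right-continuity is obtained for its
    restriction to \<open>{0..x + 1}\<close>, which has the same distribution function near
    \<open>x\<close>.\<close>
  define M where "M = density H (indicator {0..x + 1})"
  have em: "emeasure M A = emeasure H ({0..x + 1} \<inter> A)" if "A \<in> sets borel" for A
    unfolding M_def using that sH by (subst emeasure_density) (auto simp: indicator_inter_arith[symmetric] Int_commute)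
  have "finite_borel_measure M"
  proof (intro finite_borel_measure.intro finite_measureI finite_borel_measure_axioms.intro)
    show "sets M = sets borel" by (simp add: M_def sH)
    show "emeasure M (space M) \<noteq> \<infinity>" using em[of UNIV] fin[of "x + 1"] x generatingD(2)[OF H] by (auto simp: M_def)
  qed
  then interpret finite_borel_measure M .
  have c: "cdf M y = measure H {0..y}" if "y \<le> x + 1" for y
  proof -
    have e: "{0..x + 1} \<inter> {..y} = {0..y}" using that by auto
    show ?thesis using em[of "{..y}"] unfolding e by (simp add: cdf_def measure_def)
  qed
  have "(cdf M \<longlongrightarrow> cdf M x) (at_right x)" using cdf_is_right_cont[of x] by (simp add: continuous_within)
  then have "(cdf M \<longlongrightarrow> measure H {0..x}) (at_right x)" by (simp add: c)
  then show "((\<lambda>y. measure H {0..y}) \<longlongrightarrow> measure H {0..x}) (at_right x)"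
  proof (rule Lim_transform_eventually)
    show "\<forall>\<^sub>F y in at_right x. cdf M y = measure H {0..y}"
      unfolding eventually_at_right_field by (intro exI[of _ "x + 1"]) (auto simp: c)
  qed
qed

text \<open>The distribution functions agree off a countable set of discontinuities;
  right-continuity extends this to every \<open>x \<ge> 0\<close>, including 0, where the definition
  of convergence does not test.\<close>

lemma gm_converges_unique:
  assumes H1: "generating_measure H1" and H2: "generating_measure H2"
    and c1: "gm_converges G H1 F" and c2: "gm_converges G H2 F" and F: "F \<noteq> bot"
  shows "H1 = H2"
proof -
  define f1 where "f1 y = measure H1 {0..y}" for y
  define f2 where "f2 y = measure H2 {0..y}" for y
  have mono: "mono (\<lambda>y. measure H {0..y})" if H: "generating_measure H" for H
  proof (rule monoI)
    fix x y :: real assume "x \<le> y"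
    show "measure H {0..x} \<le> measure H {0..y}"
    proof (cases "y \<ge> 0")
      case True
      have "{0..y} \<in> fmeasurable H" using cdf_right_cont(2)[OF H order_refl True] generatingD(1)[OF H] by (intro fmeasurableI) auto
      then show ?thesis using \<open>x \<le> y\<close> generatingD(1)[OF H] by (intro measure_mono_fmeasurable) auto
    next
      case False then show ?thesis using \<open>x \<le> y\<close> by simp
    qed
  qed
  define C where "C = {x. \<not> isCont f1 x} \<union> {x. \<not> isCont f2 x}"
  have C: "countable C" unfolding C_def f1_def f2_def using mono_ctble_discont mono H1 H2 by (intro countable_Un) auto
  have eq: "f1 x = f2 x" if "x > 0" "x \<notin> C" for x
  proof -
    have "((\<lambda>t. emeasure (G t) {0..x}) \<longlongrightarrow> emeasure H1 {0..x}) F" "((\<lambda>t. emeasure (G t) {0..x}) \<longlongrightarrow> emeasure H2 {0..x}) F"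
      using c1 c2 that unfolding gm_converges_def C_def f1_def[abs_def] f2_def[abs_def] by auto
    then have "emeasure H1 {0..x} = emeasure H2 {0..x}" using tendsto_unique[OF F] by blast
    then show ?thesis by (simp add: f1_def f2_def measure_def)
  qed
  have eq': "f1 x = f2 x" if x: "x \<ge> 0" for x
  proof (rule ccontr)
    assume ne: "f1 x \<noteq> f2 x"
    have "((\<lambda>y. f1 y - f2 y) \<longlongrightarrow> f1 x - f2 x) (at_right x)"
      unfolding f1_def f2_def by (intro tendsto_diff cdf_right_cont H1 H2 x)
    then have "\<forall>\<^sub>F y in at_right x. f1 y - f2 y \<noteq> 0" using ne by (intro tendsto_imp_eventually_ne) auto
    then obtain b where b: "b > x" "\<And>y. x < y \<Longrightarrow> y < b \<Longrightarrow> f1 y \<noteq> f2 y" unfolding eventually_at_right_field by auto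
    have "uncountable {x<..<b}" using b(1) by (simp add: uncountable_open_interval)
    then have "\<not> {x<..<b} \<subseteq> C" using C countable_subset by blast
    then obtain y where "y \<in> {x<..<b}" "y \<notin> C" by blast
    then have "x < y" "y < b" "y \<notin> C" by auto
    then show False using eq[of y] b(2)[of y] x by auto
  qed
  have E: "emeasure H {..y} = emeasure H {0..y}" if H: "generating_measure H" for H y
  proof (rule emeasure_eq_AE)
    show "AE x in H. (x \<in> {..y}) = (x \<in> {0..y})" using generatingD(3)[OF H] by eventually_elim auto
  qed (use generatingD(1)[OF H] in auto)
  have EE: "emeasure H1 {..y} = emeasure H2 {..y}" for y
  proof (cases "y \<ge> 0")
    case True
    have "measure H1 {0..y} = measure H2 {0..y}" using eq'[OF True] by (simp add: f1_def f2_def)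
    then show ?thesis unfolding E[OF H1] E[OF H2]
      using cdf_right_cont(2)[OF H1 order_refl True] cdf_right_cont(2)[OF H2 order_refl True]
      by (simp add: emeasure_eq_ennreal_measure)
  qed (simp add: E H1 H2)
  show ?thesis
  proof (rule measure_eqI_generator_eq[where \<Omega>=UNIV and E="range (\<lambda>y. {..y::real})" and A="\<lambda>n. {..real n}"])
    show "Int_stable (range (\<lambda>y. {..y::real}))" by (auto simp: Int_stable_def)
    show "sets H1 = sigma_sets UNIV (range (\<lambda>y. {..y}))" "sets H2 = sigma_sets UNIV (range (\<lambda>y. {..y}))"
      using generatingD(1)[OF H1] generatingD(1)[OF H2] by (simp_all add: borel_eq_atMost)
    show "(\<Union>n. {..real n}) = UNIV" using real_arch_simple by auto
    show "emeasure H1 {..real n} \<noteq> \<infinity>" for n using cdf_right_cont(2)[OF H1 order_refl, of "real n"] E[OF H1] by auto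
  qed (use EE in auto)
qed

section \<open>Behaviour at time zero\<close>

definition Kf :: "(real \<Rightarrow> real) \<Rightarrow> real \<Rightarrow> real" where
  "Kf l q = (LBINT s:{0<..1}. (1 - exp (- q * l s)) / s) - (LBINT s:{1..}. exp (- q * l s) / s)"

text \<open>Requires \<open>0 \<le> l s\<close> and not positivity, since the approximating
  histories are 0 up to their starting time. The two integrability conditions make \<open>Kf\<close>
  meaningful.\<close>

definition hist :: "(real \<Rightarrow> real) \<Rightarrow> bool" where
  "hist l \<longleftrightarrow> mono_on {0<..} l \<and> (\<forall>s>0. 0 \<le> l s) \<and>
    (\<forall>q>0. set_integrable lborel {1<..} (\<lambda>s. exp (- q * l s) / s) \<and> set_integrable lborel {0<..1} (\<lambda>s. (1 - exp (- q * l s)) / s))"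

lemma set_integral_subset_le:
  fixes f :: "real \<Rightarrow> real"
  assumes i: "set_integrable lborel B f" and A: "A \<in> sets lborel" "A \<subseteq> B" and nn: "\<And>x. x \<in> B \<Longrightarrow> 0 \<le> f x"
  shows "(LBINT x:A. f x) \<le> (LBINT x:B. f x)"
  unfolding set_lebesgue_integral_def
proof (rule integral_mono)
  show "integrable lborel (\<lambda>x. indicator A x *\<^sub>R f x)"
    using set_integrable_subset[OF i A] by (simp add: set_integrable_def)
  show "integrable lborel (\<lambda>x. indicator B x *\<^sub>R f x)" using i by (simp add: set_integrable_def)
  show "indicator A x *\<^sub>R f x \<le> indicator B x *\<^sub>R f x" for x using nn[of x] A(2) by (auto simp: indicator_def)
qed

lemma small_integral_limit:
  fixes f :: "real \<Rightarrow> real"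
  assumes i: "set_integrable lborel {0<..1} f"
  shows "((\<lambda>t. LBINT s:{t<..1}. f s) \<longlongrightarrow> (LBINT s:{0<..1}. f s)) (at_right 0)"
proof (rule tendsto_at_right_sequentially[where b=1])
  fix S :: "nat \<Rightarrow> real" assume S: "\<And>n. 0 < S n" "S \<longlonglongrightarrow> 0"
  show "(\<lambda>n. LBINT s:{S n<..1}. f s) \<longlonglongrightarrow> (LBINT s:{0<..1}. f s)"
    unfolding set_lebesgue_integral_def
  proof (rule integral_dominated_convergence[where w="\<lambda>s. norm (indicator {0<..1} s *\<^sub>R f s)"])
    show "(\<lambda>s. indicator {0<..1} s *\<^sub>R f s) \<in> borel_measurable lborel" using i by (simp add: set_integrable_def)
    show "(\<lambda>s. indicator {S n<..1} s *\<^sub>R f s) \<in> borel_measurable lborel" for n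
    proof -
      have "set_integrable lborel {S n<..1} f" by (rule set_integrable_subset[OF i]) (use S(1)[of n] in auto)
      then show ?thesis by (simp add: set_integrable_def)
    qed
    show "integrable lborel (\<lambda>s. norm (indicator {0<..1} s *\<^sub>R f s))" using i by (simp add: set_integrable_def)
    show "AE s in lborel. (\<lambda>n. indicator {S n<..1} s *\<^sub>R f s) \<longlonglongrightarrow> indicator {0<..1} s *\<^sub>R f s"
    proof (intro AE_I2 tendsto_eventually)
      fix s
      show "\<forall>\<^sub>F n in sequentially. indicator {S n<..1} s *\<^sub>R f s = indicator {0<..1} s *\<^sub>R f s"
      proof (cases "s > 0")
        case True
        have "\<forall>\<^sub>F n in sequentially. S n < s" by (rule order_tendstoD(2)[OF S(2) True])
        then show ?thesis by eventually_elim (use True in \<open>auto simp: indicator_def\<close>)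
      next
        case False
        have "indicator {S n<..1} s *\<^sub>R f s = indicator {0<..1} s *\<^sub>R f s" for n
          using False S(1)[of n] by (simp add: indicator_def)
        then show ?thesis by simp
      qed
    qed
    show "AE s in lborel. norm (indicator {S n<..1} s *\<^sub>R f s) \<le> norm (indicator {0<..1} s *\<^sub>R f s)" for n
      using S(1)[of n] by (intro AE_I2) (auto simp: indicator_def)
  qed
qed auto

lemma small_integrable_from_bound:
  fixes f :: "real \<Rightarrow> real"
  assumes m: "set_borel_measurable lborel {0<..1} f" and i: "\<And>t. 0 < t \<Longrightarrow> set_integrable lborel {t<..1} f"
    and nn: "\<And>s. 0 < s \<Longrightarrow> s \<le> 1 \<Longrightarrow> 0 \<le> f s" and B: "\<And>t. 0 < t \<Longrightarrow> (LBINT s:{t<..1}. f s) \<le> B"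
  shows "set_integrable lborel {0<..1} f"
proof -
  define t :: "nat \<Rightarrow> real" where "t n = 1 / real (Suc n)" for n
  have t0: "0 < t n" for n by (simp add: t_def)
  have tl: "t \<longlonglongrightarrow> 0" unfolding t_def[abs_def] using LIMSEQ_inverse_real_of_nat by (simp add: inverse_eq_divide)
  have tm: "t n \<le> t m" if "m \<le> n" for m n unfolding t_def using that by (intro divide_left_mono) auto
  let ?f = "\<lambda>n s. indicator {t n<..1} s *\<^sub>R f s"
  have a: "integrable lborel (?f n)" for n using i[OF t0[of n]] by (simp add: set_integrable_def)
  have f0: "0 \<le> ?f n s" for n s using nn[of s] t0[of n] by (auto simp: indicator_def)
  have fm: "?f m s \<le> ?f n s" if "m \<le> n" for m n s
    using tm[OF that] f0[of n s] by (auto simp: indicator_def)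
  then have b: "AE s in lborel. mono (\<lambda>n. ?f n s)" by (intro AE_I2 monoI)
  have c: "AE s in lborel. (\<lambda>n. ?f n s) \<longlonglongrightarrow> indicator {0<..1} s *\<^sub>R f s"
  proof (intro AE_I2 tendsto_eventually)
    fix s :: real
    show "\<forall>\<^sub>F n in sequentially. ?f n s = indicator {0<..1} s *\<^sub>R f s"
    proof (cases "s > 0")
      case True
      have "\<forall>\<^sub>F n in sequentially. t n < s" by (rule order_tendstoD(2)[OF tl True])
      then show ?thesis by eventually_elim (use True in \<open>auto simp: indicator_def\<close>)
    next
      case False
      have "?f n s = indicator {0<..1} s *\<^sub>R f s" for n
        using False t0[of n] by (simp add: indicator_def)
      then show ?thesis by (intro always_eventually allI)
    qed
  qed
  have mono: "mono (\<lambda>n. integral\<^sup>L lborel (?f n))"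
    by (intro monoI integral_mono a fm)
  moreover have "Bseq (\<lambda>n. integral\<^sup>L lborel (?f n))"
  proof (rule BseqI')
    fix n
    have "0 \<le> integral\<^sup>L lborel (?f n)" by (intro integral_nonneg_AE AE_I2 f0)
    then show "norm (integral\<^sup>L lborel (?f n)) \<le> B" using B[OF t0[of n]] by (simp add: set_lebesgue_integral_def)
  qed
  ultimately obtain x where x: "(\<lambda>n. integral\<^sup>L lborel (?f n)) \<longlonglongrightarrow> x"
    using Bseq_mono_convergent[of "\<lambda>n. integral\<^sup>L lborel (?f n)"] by (auto simp: mono_def convergent_def)
  show ?thesis unfolding set_integrable_def
    by (rule integrable_monotone_convergence[OF a b c x]) (use m in \<open>simp add: set_borel_measurable_def\<close>)
qed

lemma history_small_measurable:
  assumes "mono_on {0<..} (l :: real \<Rightarrow> real)" "0 \<le> s"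
  shows "set_borel_measurable lborel {s<..t} (\<lambda>r. (1 - exp (- q * l r)) / r)"
  by (rule history_set_measurable[OF assms(1), where f="\<lambda>x. 1 - exp (- q * x)"]) (use assms(2) in auto)

lemma history_small_integrable:
  assumes l: "mono_on {0<..} (l :: real \<Rightarrow> real)" and p: "\<And>s. s > 0 \<Longrightarrow> 0 \<le> l s" and q: "0 \<le> q" and st: "0 < s"
  shows "set_integrable lborel {s<..t} (\<lambda>r. (1 - exp (- q * l r)) / r)"
proof (cases "s \<le> t")
  case True
  show ?thesis
    by (rule set_integrable_bounded_over_id(1)[OF st True history_small_measurable[OF l], where B=1])
      (use st p q in auto)
next
  case False
  then have "{s<..t} = {}" by auto
  then show ?thesis by (simp only: set_integrable_def) simp
qed

lemma Wint_small:
  assumes l: "mono_on {0<..} (l :: real \<Rightarrow> real)" and p: "\<And>s. s > 0 \<Longrightarrow> 0 \<le> l s" and q: "0 \<le> q" and t: "0 < t" "t \<le> 1"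
  shows "Wint l q t 1 = - ln t - (LBINT s:{t<..1}. (1 - exp (- q * l s)) / s)"
proof -
  have "Wint l q t 1 = (LBINT s:{t<..1}. 1 / s - (1 - exp (- q * l s)) / s)"
    unfolding Wint_def by (simp add: diff_divide_distrib)
  also have "\<dots> = (LBINT s:{t<..1}. 1 / s) - (LBINT s:{t<..1}. (1 - exp (- q * l s)) / s)"
    by (rule set_integral_diff(2)) (use integral_inverse_Ioc(1)[OF t] history_small_integrable[OF l p q t(1)] in auto)
  also have "(LBINT s:{t<..1}. 1 / s) = - ln t" using integral_inverse_Ioc(2)[OF t] t by (simp add: ln_div)
  finally show ?thesis .
qed

lemma histD:
  assumes h: "hist l"
  shows "mono_on {0<..} l" "s > 0 \<Longrightarrow> 0 \<le> l s"
    "q > 0 \<Longrightarrow> t > 0 \<Longrightarrow> set_integrable lborel {t<..} (\<lambda>s. exp (- q * l s) / s)"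
    "q > 0 \<Longrightarrow> set_integrable lborel {0<..1} (\<lambda>s. (1 - exp (- q * l s)) / s)"
proof -
  note h' = h[unfolded hist_def]
  show 1: "mono_on {0<..} l" using h' by (rule conjunct1)
  show "s > 0 \<Longrightarrow> 0 \<le> l s" using h' by blast
  show "q > 0 \<Longrightarrow> set_integrable lborel {0<..1} (\<lambda>s. (1 - exp (- q * l s)) / s)" using h' by blast
  have 2: "set_integrable lborel {1<..} (\<lambda>s. exp (- q * l s) / s)" if "q > 0" using h' that by blast
  show "set_integrable lborel {t<..} (\<lambda>s. exp (- q * l s) / s)" if "q > 0" "t > 0"
    by (rule Lam_integrable[OF 1 that(2) zero_less_one less_imp_le[OF that(1)] 2[OF that(1)]])
qed

text \<open>\<open>Kf\<close> integrates over the closed ray from 1 and \<open>Lam\<close> over the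
  open one; the endpoint is a null set.\<close>

lemma Kf_eq: assumes "hist l" "q > 0"
  shows "Kf l q = (LBINT s:{0<..1}. (1 - exp (- q * l s)) / s) - Lam l q 1"
    "set_integrable lborel {1..} (\<lambda>s. exp (- q * l s) / s)"
proof -
  have AE: "AE x in lborel. x \<in> {1::real<..} \<longleftrightarrow> x \<in> {1..}"
    using AE_lborel_singleton[of "1::real"] by eventually_elim auto
  have m: "set_borel_measurable lborel {1<..} (\<lambda>s. exp (- q * l s) / s)" "set_borel_measurable lborel {1..} (\<lambda>s. exp (- q * l s) / s)"
    by (rule history_set_measurable[OF histD(1)[OF assms(1)], where f="\<lambda>x. exp (- q * x)"]; auto)+
  have "(LBINT s:{1..}. exp (- q * l s) / s) = Lam l q 1"
    unfolding Lam_def by (rule set_integral_cong_set[OF m AE])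
  then show "Kf l q = (LBINT s:{0<..1}. (1 - exp (- q * l s)) / s) - Lam l q 1" by (simp add: Kf_def)
  have "integrable lborel (\<lambda>s. indicator {1<..} s *\<^sub>R (exp (- q * l s) / s))"
    using histD(3)[OF assms(1,2), of 1] by (simp add: set_integrable_def)
  then show "set_integrable lborel {1..} (\<lambda>s. exp (- q * l s) / s)"
    unfolding set_integrable_def
  proof (rule integrable_cong_AE_imp)
    show "(\<lambda>s. indicator {1..} s *\<^sub>R (exp (- q * l s) / s)) \<in> borel_measurable lborel" using m(2) by (simp add: set_borel_measurable_def)
    show "AE x in lborel. indicator {1<..} x *\<^sub>R (exp (- q * l x) / x) = indicator {1..} x *\<^sub>R (exp (- q * l x) / x)"
      using AE by eventually_elim (auto simp: indicator_def)
  qed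
qed

text \<open>The integral of \<open>1 / s\<close> over \<open>{t<..1}\<close> is
  \<open>- ln t\<close>; adding \<open>ln t\<close> cancels it and leaves the convergent integral of
  \<open>(1 - exp (- q * l s)) / s\<close>.\<close>

lemma Lam_Kf_limit:
  assumes h: "hist l" and q: "q > 0"
  shows "((\<lambda>t. Lam l q t + ln t) \<longlongrightarrow> - Kf l q) (at_right 0)"
proof -
  note l = histD(1)[OF h] and p = histD(2)[OF h]
  have "((\<lambda>t. Lam l q 1 - (LBINT s:{t<..1}. (1 - exp (- q * l s)) / s)) \<longlongrightarrow> Lam l q 1 - (LBINT s:{0<..1}. (1 - exp (- q * l s)) / s)) (at_right 0)"
    by (intro tendsto_diff tendsto_const small_integral_limit histD(4)[OF h q])
  moreover have "Lam l q 1 - (LBINT s:{0<..1}. (1 - exp (- q * l s)) / s) = - Kf l q" using Kf_eq(1)[OF h q] by simp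
  ultimately have "((\<lambda>t. Lam l q 1 - (LBINT s:{t<..1}. (1 - exp (- q * l s)) / s)) \<longlongrightarrow> - Kf l q) (at_right 0)" by simp
  then show ?thesis
  proof (rule Lim_transform_eventually)
    show "\<forall>\<^sub>F t in at_right 0. Lam l q 1 - (LBINT s:{t<..1}. (1 - exp (- q * l s)) / s) = Lam l q t + ln t"
      unfolding eventually_at_right_field
    proof (intro exI[of _ 1] conjI allI impI)
      fix t :: real assume t: "0 < t" "t < 1"
      have "Lam l q t = Wint l q t 1 + Lam l q 1"
        by (rule Lam_split(2)[OF l t(1)]) (use t q histD(3)[OF h q] in auto)
      then show "Lam l q 1 - (LBINT s:{t<..1}. (1 - exp (- q * l s)) / s) = Lam l q t + ln t"
        using Wint_small[OF l p, of q t] t q by simp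
    qed simp
  qed
qed

lemma Lam_antimono_q:
  assumes h: "mono_on {0<..} (l :: real \<Rightarrow> real)" "\<And>s. s > 0 \<Longrightarrow> 0 \<le> l s" and q: "q \<le> r" and t: "0 < t"
    and i: "set_integrable lborel {t<..} (\<lambda>s. exp (- q * l s) / s)" "set_integrable lborel {t<..} (\<lambda>s. exp (- r * l s) / s)"
  shows "Lam l r t \<le> Lam l q t"
  unfolding Lam_def
proof (rule set_integral_mono[OF i(2,1)])
  fix s assume "s \<in> {t<..}"
  then show "exp (- r * l s) / s \<le> exp (- q * l s) / s" using t mult_right_mono[OF q h(2)[of s]] by (intro divide_right_mono) auto
qed

lemma Kf_at_bot: assumes h: "hist l" shows "filterlim (Kf l) at_bot (at_right 0)"
  unfolding filterlim_at_bot
proof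
  fix Z :: real
  note l = histD(1)[OF h] and p = histD(2)[OF h]
  define A where "A = (LBINT s:{0<..1}. (1 - exp (- 1 * l s)) / s)"
  \<comment> \<open>Late enough that half of \<open>ln T\<close> exceeds
    \<open>\<bar>A - Z\<bar>\<close>. Once \<open>exp (- q * l T) > 1/2\<close>, the times between 1
    and \<open>T\<close> alone make \<open>Lam l q 1\<close> that large.\<close>
  define T where "T = exp (2 * \<bar>A - Z\<bar> + 1)"
  have "0 < 2 * \<bar>A - Z\<bar> + 1" by (intro add_nonneg_pos) auto
  then have T: "T > 1" by (simp add: T_def)
  have "((\<lambda>q. exp (- q * l T)) \<longlongrightarrow> exp (- 0 * l T)) (at_right 0)" by (intro tendsto_intros)
  then have "\<forall>\<^sub>F q in at_right 0. exp (- q * l T) > 1/2" by (intro order_tendstoD(1)) auto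
  then show "\<forall>\<^sub>F q in at_right 0. Kf l q \<le> Z" using eventually_unit_at_right
  proof eventually_elim
    case (elim q)
    have "(LBINT s:{0<..1}. (1 - exp (- q * l s)) / s) \<le> A" unfolding A_def
    proof (rule set_integral_mono)
      show "set_integrable lborel {0<..1} (\<lambda>s. (1 - exp (- q * l s)) / s)" by (rule histD(4)[OF h]) (use elim in auto)
      show "set_integrable lborel {0<..1} (\<lambda>s. (1 - exp (- 1 * l s)) / s)" by (rule histD(4)[OF h]) auto
      fix s :: real assume s: "s \<in> {0<..1}"
      have "q * l s \<le> 1 * l s" using elim p[of s] s by (intro mult_right_mono) auto
      then show "(1 - exp (- q * l s)) / s \<le> (1 - exp (- 1 * l s)) / s" using s by (intro divide_right_mono) auto
    qed
    moreover have "\<bar>A - Z\<bar> \<le> Lam l q 1"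
    proof -
      have "\<bar>A - Z\<bar> \<le> 1/2 * ln T" by (simp add: T_def)
      also have "\<dots> \<le> exp (- q * l T) * ln T" using elim T by (intro mult_right_mono) auto
      also have "\<dots> = exp (- q * l T) * ln (T / 1)" by simp
      also have "\<dots> \<le> Wint l q 1 T" by (rule Wint_bounds(2)[OF l]) (use T elim in auto)
      also have "\<dots> \<le> Lam l q 1"
        using Lam_split(2)[OF l, of 1 T q] histD(3)[OF h, of q T] Lam_nonneg[of T l q] T elim by simp
      finally show ?thesis .
    qed
    ultimately show ?case using Kf_eq(1)[OF h, of q] elim by simp
  qed
qed

lemma Kf_at_top: assumes h: "hist l" and pos: "\<And>s. s > 0 \<Longrightarrow> 0 < l s" shows "filterlim (Kf l) at_top at_top"
  unfolding filterlim_at_top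
proof
  fix Z :: real
  note l = histD(1)[OF h] and p = histD(2)[OF h]
  \<comment> \<open>Mirror image of the choice of \<open>T\<close> in \<open>Kf_at_bot\<close>:
    positivity of \<open>l d\<close> makes \<open>exp (- q * l d)\<close> small for large
    \<open>q\<close>, and then the times between \<open>d\<close> and 1 contribute at least half of
    \<open>ln (1 / d)\<close>.\<close>
  define d where "d = exp (- (2 * \<bar>Z + Lam l 1 1\<bar> + 1))"
  have "0 < 2 * \<bar>Z + Lam l 1 1\<bar> + 1" by (intro add_nonneg_pos) auto
  then have d: "0 < d" "d < 1" unfolding d_def exp_less_one_iff by (simp, linarith)
  have "((\<lambda>q. exp (- q * l d)) \<longlongrightarrow> 0) at_top" using pos[OF d(1)] by real_asymp
  then have "\<forall>\<^sub>F q in at_top. exp (- q * l d) < 1/2" by (intro order_tendstoD(2)) auto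
  then show "\<forall>\<^sub>F q in at_top. Z \<le> Kf l q" using eventually_ge_at_top[of 1]
  proof eventually_elim
    case (elim q)
    have i: "set_integrable lborel {0<..1} (\<lambda>s. (1 - exp (- q * l s)) / s)" by (rule histD(4)[OF h]) (use elim in auto)
    have "\<bar>Z + Lam l 1 1\<bar> \<le> 1/2 * ln (1 / d)" by (simp add: d_def ln_div)
    also have "\<dots> \<le> (1 - exp (- q * l d)) * ln (1 / d)" using elim d by (intro mult_right_mono) auto
    also have "\<dots> \<le> (LBINT s:{d<..1}. (1 - exp (- q * l s)) / s)"
    proof (rule set_integral_over_id_between(1)[OF d(1) less_imp_le[OF d(2)] history_small_measurable[OF l], where B=1])
      fix r :: real assume "d < r"
      then have "l d \<le> l r" using mono_onD[OF l, of d r] d by auto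
      then have "q * l d \<le> q * l r" using elim by (intro mult_left_mono) auto
      then show "1 - exp (- q * l d) \<le> 1 - exp (- q * l r)" by simp
    qed (use d in auto)
    also have "\<dots> \<le> (LBINT s:{0<..1}. (1 - exp (- q * l s)) / s)"
      by (rule set_integral_subset_le[OF i]) (use p elim d in auto)
    finally have "\<bar>Z + Lam l 1 1\<bar> \<le> (LBINT s:{0<..1}. (1 - exp (- q * l s)) / s)" .
    moreover have "Lam l q 1 \<le> Lam l 1 1"
      by (rule Lam_antimono_q[OF l p _ _ histD(3)[OF h] histD(3)[OF h]]) (use elim in auto)
    ultimately show ?case using Kf_eq(1)[OF h, of q] elim by simp
  qed
qed

context clustering
begin

text \<open>The behaviour at 0 is what needs an argument. From
  \<open>1 - lap (F t) (2 * q) \<le> 2 * (1 - lap (F t) q)\<close> the difference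
  \<open>Lam l q t - Lam l (2 * q) t\<close> is at most \<open>Q1 p * ln 2\<close>, uniformly in
  \<open>t\<close>. Its integrand is the wanted one times \<open>exp (- q * l s)\<close>, and that
  factor is at least \<open>exp (- q * l 1)\<close> up to time 1.\<close>

lemma solves_hist: assumes S: "solves l F" shows "hist l"
proof -
  note l = solvesD(2)[OF S] and p = less_imp_le[OF solvesD(3)[OF S]]
  have "set_integrable lborel {0<..1} (\<lambda>s. (1 - exp (- q * l s)) / s)" if q: "q > 0" for q
  proof (rule small_integrable_from_bound[where B="Q1 p * ln 2 * exp (q * l 1)"])
    show "set_borel_measurable lborel {0<..1} (\<lambda>s. (1 - exp (- q * l s)) / s)" by (rule history_small_measurable[OF l]) simp
    show int: "set_integrable lborel {t<..1} (\<lambda>s. (1 - exp (- q * l s)) / s)" if "0 < t" for t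
      by (rule history_small_integrable[OF l p _ that]) (use q in auto)
    show "0 \<le> (1 - exp (- q * l s)) / s" if "0 < s" for s using p[OF that] q that by auto
    fix t :: real assume t: "0 < t"
    let ?U = "LBINT s:{t<..1}. (1 - exp (- q * l s)) / s"
    show "?U \<le> Q1 p * ln 2 * exp (q * l 1)"
    proof (cases "t \<le> 1")
      case True
      have M: "prob_Rplus (F t)" by (rule solvesD(1)[OF S t])
      interpret prob_space "F t" using prob_RplusD[OF M] by simp
      let ?x = "lap (F t) q" and ?y = "lap (F t) (2 * q)"
      have q2: "2 * q > 0" using q by simp
      have xy: "0 \<le> ?y" "?y \<le> ?x" "?x < 1" "?y < 1"
        using solvesD(7,8)[OF S t q] solvesD(7,8)[OF S t q2] lap_antimono[OF M, of q "2 * q"] q by auto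
      have "1 - ?y \<le> 2 * (1 - ?x)"
      proof -
        have "1 - ?y = (\<integral>x. 1 - exp (- (2 * q) * x) \<partial>F t)" using lap_integrable[OF M, of "2 * q"] q prob_space by (simp add: lap_def)
        also have "\<dots> \<le> (\<integral>x. 2 * (1 - exp (- q * x)) \<partial>F t)"
        proof (rule integral_mono_AE)
          show "integrable (F t) (\<lambda>x. 1 - exp (- (2 * q) * x))" "integrable (F t) (\<lambda>x. 2 * (1 - exp (- q * x)))"
            using lap_integrable[OF M, of "2 * q"] lap_integrable[OF M, of q] q by auto
          show "AE x in F t. 1 - exp (- (2 * q) * x) \<le> 2 * (1 - exp (- q * x))"
          proof (rule AE_I2)
            fix x
            have "exp (- (2 * q) * x) = exp (- q * x) ^ 2" by (simp add: power2_eq_square exp_add[symmetric])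
            then show "1 - exp (- (2 * q) * x) \<le> 2 * (1 - exp (- q * x))"
              using zero_le_power2[of "1 - exp (- q * x)"] by (simp add: power2_diff)
          qed
        qed
        also have "\<dots> = 2 * (1 - ?x)" using lap_integrable[OF M, of q] q prob_space by (simp add: lap_def)
        finally show ?thesis .
      qed
      then have r: "(1 - ?y) / (1 - ?x) \<le> 2" using xy by (simp add: pos_divide_le_eq)
      have "g ?x - g ?y \<le> Q1 p * ln ((1 - ?y) / (1 - ?x))"
      proof (rule g_diff_le_ln)
        fix z assume "?y \<le> z" "z \<le> ?x"
        then have "1 - z \<le> 1 - Qgen p z" using Q_le_self[of z] xy by simp
        then show "Q1 p * (1 - z) \<le> Q1 p * (1 - Qgen p z)" using Q1_ge_1 by (intro mult_left_mono) auto
      qed (use xy in auto)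
      also have "\<dots> \<le> Q1 p * ln 2" using r xy Q1_ge_1 by (intro mult_left_mono) (auto simp: divide_pos_pos)
      finally have 1: "Lam l q t - Lam l (2 * q) t \<le> Q1 p * ln 2" using solvesD(6)[OF S t q] solvesD(6)[OF S t q2] by simp
      have i1: "set_integrable lborel {1<..} (\<lambda>s. exp (- r * l s) / s)" if "r > 0" for r by (rule solvesD(4)[OF S _ that]) simp
      have sp: "Lam l r t = Wint l r t 1 + Lam l r 1" if "r > 0" for r
        by (rule Lam_split(2)[OF l t True]) (use that i1 in auto)
      have "Lam l (2 * q) 1 \<le> Lam l q 1" by (rule Lam_antimono_q[OF l p _ _ i1 i1]) (use q in auto)
      then have 2: "Wint l q t 1 - Wint l (2 * q) t 1 \<le> Q1 p * ln 2" using 1 sp[OF q] sp[OF q2] by simp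
      have iW: "set_integrable lborel {t<..1} (\<lambda>s. exp (- r * l s) / s)" if "r > 0" for r
        by (rule Wint_bounds(1)[OF l t True]) (use that in auto)
      have "exp (- q * l 1) * ?U = (LBINT s:{t<..1}. exp (- q * l 1) * ((1 - exp (- q * l s)) / s))" by (rule set_integral_mult_right[symmetric])
      also have "\<dots> \<le> (LBINT s:{t<..1}. exp (- q * l s) / s - exp (- (2 * q) * l s) / s)"
      proof (rule set_integral_mono)
        show "set_integrable lborel {t<..1} (\<lambda>s. exp (- q * l 1) * ((1 - exp (- q * l s)) / s))" by (rule set_integrable_mult_right, rule int[OF t])
        show "set_integrable lborel {t<..1} (\<lambda>s. exp (- q * l s) / s - exp (- (2 * q) * l s) / s)"
          by (rule set_integral_diff(1)[OF iW iW]) (use q in auto)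
        fix s assume s: "s \<in> {t<..1}"
        have "l s \<le> l 1" using mono_onD[OF l, of s 1] s t by auto
        then have "exp (- q * l 1) \<le> exp (- q * l s)" using q by (simp add: mult_left_mono)
        then have "exp (- q * l 1) * (1 - exp (- q * l s)) \<le> exp (- q * l s) * (1 - exp (- q * l s))"
          using p[of s] s t q by (intro mult_right_mono) auto
        also have "\<dots> = exp (- q * l s) - exp (- (2 * q) * l s)" by (simp add: right_diff_distrib exp_add[symmetric])
        finally have "exp (- q * l 1) * (1 - exp (- q * l s)) / s \<le> (exp (- q * l s) - exp (- (2 * q) * l s)) / s"
          using s t by (intro divide_right_mono) auto
        then show "exp (- q * l 1) * ((1 - exp (- q * l s)) / s) \<le> exp (- q * l s) / s - exp (- (2 * q) * l s) / s"
          by (simp only: diff_divide_distrib[symmetric] times_divide_eq_right)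
      qed
      also have "\<dots> = Wint l q t 1 - Wint l (2 * q) t 1" unfolding Wint_def
        by (rule set_integral_diff(2)[OF iW iW]) (use q in auto)
      also have "\<dots> \<le> Q1 p * ln 2" by (rule 2)
      finally have "exp (- q * l 1) * ?U \<le> Q1 p * ln 2" .
      then have "exp (q * l 1) * (exp (- q * l 1) * ?U) \<le> exp (q * l 1) * (Q1 p * ln 2)" by (intro mult_left_mono) auto
      moreover have "exp (q * l 1) * exp (- q * l 1) = 1" by (simp add: exp_add[symmetric])
      then have "exp (q * l 1) * (exp (- q * l 1) * ?U) = ?U" by (simp only: mult.assoc[symmetric] mult_1_left)
      ultimately have "?U \<le> exp (q * l 1) * (Q1 p * ln 2)" by linarith
      then show ?thesis by (simp only: mult_ac)
    next
      case False
      then have "{t<..1} = {}" by auto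
      then show ?thesis using Q1_ge_1 by (simp add: set_lebesgue_integral_def)
    qed
  qed
  then show ?thesis using l p solvesD(4)[OF S, of 1] by (auto simp: hist_def)
qed

text \<open>\<open>g (1 - psi t) - g (lap (F t) q)\<close> equals
  \<open>- (Lam l q t + ln t)\<close>, which tends to \<open>Kf l q\<close>;
  \<open>g_ratio_iff\<close> turns this difference into a ratio, and \<open>ks_asymp\<close>
  replaces \<open>psi t\<close> by \<open>t * ks t\<close>.\<close>

lemma solves_lap_ratio:
  assumes S: "solves l F" and ks: "de_Bruijn_conjugate (kappa p) ks" and q: "q > 0"
  shows "((\<lambda>t. (1 - lap (F t) q) / (t * ks t)) \<longlongrightarrow> exp (Kf l q)) (at_right 0)"
proof -
  note h = solves_hist[OF S]
  have t0: "\<forall>\<^sub>F t in at_right (0::real). 0 < t \<and> t < 1" by (rule eventually_unit_at_right)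
  let ?Y = "\<lambda>t. 1 - lap (F t) q"
  have lim: "((\<lambda>t. Lam l q t + ln t) \<longlongrightarrow> - Kf l q) (at_right 0)" by (rule Lam_Kf_limit[OF h q])
  have "filterlim (\<lambda>t::real. - ln t) at_top (at_right 0)" using ln_at_0 by (simp add: filterlim_uminus_at_bot)
  from filterlim_tendsto_add_at_top[OF lim this] have Ltop: "filterlim (\<lambda>t. Lam l q t) at_top (at_right 0)" by simp
  have "((\<lambda>t. 1 - ginv (Lam l q t)) \<longlongrightarrow> 1 - 1) (at_right 0)"
    by (intro tendsto_intros filterlim_compose[OF ginv_at_top Ltop])
  then have "((\<lambda>t. 1 - ginv (Lam l q t)) \<longlongrightarrow> 0) (at_right 0)" by simp
  then have Y0: "(?Y \<longlongrightarrow> 0) (at_right 0)"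
  proof (rule Lim_transform_eventually)
    show "\<forall>\<^sub>F t in at_right 0. 1 - ginv (Lam l q t) = ?Y t" using t0 by eventually_elim (use solvesD(5)[OF S _ q] in simp)
  qed
  have Yp: "\<forall>\<^sub>F t in at_right 0. ?Y t > 0" using t0 by eventually_elim (use solvesD(7)[OF S _ q] in auto)
  have Xp: "\<forall>\<^sub>F t in at_right 0. psi t > 0" using t0 by eventually_elim (use psi in auto)
  have "((\<lambda>t. - (Lam l q t + ln t)) \<longlongrightarrow> - (- Kf l q)) (at_right 0)" by (intro tendsto_minus lim)
  then have "((\<lambda>t. - (Lam l q t + ln t)) \<longlongrightarrow> Kf l q) (at_right 0)" by simp
  then have "((\<lambda>t. g (1 - psi t) - g (1 - ?Y t)) \<longlongrightarrow> Kf l q) (at_right 0)"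
  proof (rule Lim_transform_eventually)
    show "\<forall>\<^sub>F t in at_right 0. - (Lam l q t + ln t) = g (1 - psi t) - g (1 - ?Y t)"
      using t0 by eventually_elim (use psi(3) solvesD(6)[OF S _ q] in simp)
  qed
  then have "((\<lambda>t. ln (?Y t / psi t)) \<longlongrightarrow> Kf l q) (at_right 0)"
    by (subst (asm) g_ratio_iff[OF psi_tendsto Y0 Xp Yp])
  then have "((\<lambda>t. exp (ln (?Y t / psi t))) \<longlongrightarrow> exp (Kf l q)) (at_right 0)" by (rule tendsto_exp)
  then have "((\<lambda>t. ?Y t / psi t) \<longlongrightarrow> exp (Kf l q)) (at_right 0)"
    by (rule Lim_transform_eventually) (use Xp Yp in \<open>eventually_elim, auto\<close>)
  from tendsto_divide[OF this ks_asymp[OF ks]]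
  have "((\<lambda>t. ?Y t / psi t / (t * ks t / psi t)) \<longlongrightarrow> exp (Kf l q)) (at_right 0)" by simp
  then show ?thesis
    by (rule Lim_transform_eventually) (use Xp in \<open>eventually_elim, auto\<close>)
qed

text \<open>The conjugate is controlled near 0 only, so positivity holds on some initial
  interval.\<close>

lemma ks_pos:
  assumes ks: "de_Bruijn_conjugate (kappa p) ks"
  obtains b where "0 < b" "b \<le> 1" "\<And>t. 0 < t \<Longrightarrow> t < b \<Longrightarrow> 0 < t * ks t"
proof -
  have "\<forall>\<^sub>F t in at_right 0. t * ks t / psi t > 1/2" by (rule order_tendstoD(1)[OF ks_asymp[OF ks]]) simp
  with eventually_unit_at_right have "\<forall>\<^sub>F t in at_right 0. 0 < t * ks t"
  proof eventually_elim
    case (elim t)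
    then have "0 < t * ks t / psi t" by linarith
    then show ?case using psi(1)[of t] elim by (simp only: zero_less_divide_iff) auto
  qed
  then obtain b where "b > 0" "\<And>t. 0 < t \<Longrightarrow> t < b \<Longrightarrow> 0 < t * ks t" unfolding eventually_at_right_field by auto
  then show ?thesis by (intro that[of "min b 1"]) auto
qed

text \<open>The normalisation \<open>t * ks t\<close> cancels from the tilted quantities, so their
  limits are formed from \<open>exp (Kf l q)\<close> at \<open>q\<close>, \<open>q + 1\<close> and
  1.\<close>

lemma solves_tilt_lap:
  assumes S: "solves l F" and ks: "de_Bruijn_conjugate (kappa p) ks"
  shows "((\<lambda>t. (1 - lap (F t) 1) / (t * ks t)) \<longlongrightarrow> exp (Kf l 1)) (at_right 0)"
    "q > 0 \<Longrightarrow> ((\<lambda>t. lap (tilt (F t)) q) \<longlongrightarrow> (exp (Kf l (q + 1)) - exp (Kf l q)) / exp (Kf l 1)) (at_right 0)"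
    "q > 0 \<Longrightarrow> ((\<lambda>t. integral\<^sup>L (tilt (F t)) (rq q)) \<longlongrightarrow> exp (Kf l q) / exp (Kf l 1)) (at_right 0)"
proof -
  obtain b where b: "0 < b" "\<And>t. 0 < t \<Longrightarrow> t < b \<Longrightarrow> 0 < t * ks t" using ks_pos[OF ks] by blast
  have ev: "\<forall>\<^sub>F t in at_right 0. 0 < t \<and> 0 < t * ks t"
    unfolding eventually_at_right_field using b by (intro exI[of _ b]) auto
  note R = solves_lap_ratio[OF S ks]
  show R1: "((\<lambda>t. (1 - lap (F t) 1) / (t * ks t)) \<longlongrightarrow> exp (Kf l 1)) (at_right 0)" by (rule R) simp
  assume q: "q > 0"
  have "((\<lambda>t. ((1 - lap (F t) (q + 1)) / (t * ks t) - (1 - lap (F t) q) / (t * ks t)) / ((1 - lap (F t) 1) / (t * ks t))) \<longlongrightarrow> (exp (Kf l (q + 1)) - exp (Kf l q)) / exp (Kf l 1)) (at_right 0)"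
    by (intro tendsto_intros R R1) (use q in auto)
  then show "((\<lambda>t. lap (tilt (F t)) q) \<longlongrightarrow> (exp (Kf l (q + 1)) - exp (Kf l q)) / exp (Kf l 1)) (at_right 0)"
  proof (rule Lim_transform_eventually)
    show "\<forall>\<^sub>F t in at_right 0. ((1 - lap (F t) (q + 1)) / (t * ks t) - (1 - lap (F t) q) / (t * ks t)) / ((1 - lap (F t) 1) / (t * ks t)) = lap (tilt (F t)) q"
      using ev
    proof eventually_elim
      case (elim t)
      have "lap (tilt (F t)) q = (lap (F t) q - lap (F t) (q + 1)) / (1 - lap (F t) 1)"
        by (rule tilt(3)) (use solvesD(1,7)[OF S] elim q in auto)
      moreover have "ks t \<noteq> 0" using elim by auto
      ultimately show ?case using elim by (simp add: diff_divide_distrib[symmetric])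
    qed
  qed
  have "((\<lambda>t. ((1 - lap (F t) q) / (t * ks t)) / ((1 - lap (F t) 1) / (t * ks t))) \<longlongrightarrow> exp (Kf l q) / exp (Kf l 1)) (at_right 0)"
    by (intro tendsto_intros R R1) (use q in auto)
  then show "((\<lambda>t. integral\<^sup>L (tilt (F t)) (rq q)) \<longlongrightarrow> exp (Kf l q) / exp (Kf l 1)) (at_right 0)"
  proof (rule Lim_transform_eventually)
    show "\<forall>\<^sub>F t in at_right 0. ((1 - lap (F t) q) / (t * ks t)) / ((1 - lap (F t) 1) / (t * ks t)) = integral\<^sup>L (tilt (F t)) (rq q)"
      using ev
    proof eventually_elim
      case (elim t)
      have "integral\<^sup>L (tilt (F t)) (rq q) = (1 - lap (F t) q) / (1 - lap (F t) 1)"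
        by (rule tilt(4)) (use solvesD(1,7)[OF S] elim q in auto)
      moreover have "ks t \<noteq> 0" using elim by auto
      ultimately show ?case using elim by simp
    qed
  qed
qed

text \<open>The transforms of the tilted laws of \<open>F t\<close> tend to that of the tilt of
  \<open>H\<close>, as both are the same expression in the exponents at \<open>q\<close>,
  \<open>q + 1\<close> and 1. The constants of the untilt tend to the exponent at 1.\<close>

lemma solves_gm_converges:
  assumes S: "solves l F" and ks: "de_Bruijn_conjugate (kappa p) ks" and H: "generating_measure H"
    and eta: "\<And>q. q > 0 \<Longrightarrow> laplace_exponent H q = exp (Kf l q)"
  shows "gm_converges (Gt F ks) H (at_right 0)"
proof -
  obtain b where b: "0 < b" "\<And>t. 0 < t \<Longrightarrow> t < b \<Longrightarrow> 0 < t * ks t" using ks_pos[OF ks] by blast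
  have pos: "laplace_exponent H 1 > 0" using eta[of 1] by simp
  obtain N where N: "prob_Rplus N" and HN: "H = untilt (laplace_exponent H 1) N"
    and lapN: "\<And>q. q \<ge> 0 \<Longrightarrow> lap N q = (laplace_exponent H (q + 1) - laplace_exponent H q) / laplace_exponent H 1"
    by (rule generating_tilt[OF H pos], rule that)
  have HN': "H = untilt (exp (Kf l 1)) N" using HN unfolding eta[OF zero_less_one] .
  have seq: "(\<lambda>n. emeasure (Gt F ks (s n)) {0..x}) \<longlonglongrightarrow> emeasure H {0..x} \<and>
     (\<lambda>n. \<integral>\<^sup>+ y\<in>{x..}. inverse (ennreal y) \<partial>(Gt F ks (s n))) \<longlonglongrightarrow> (\<integral>\<^sup>+ y\<in>{x..}. inverse (ennreal y) \<partial>H)"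
    if s: "\<And>n. 0 < s n" "\<And>n. s n < b" "s \<longlonglongrightarrow> 0" and x: "x > 0" "isCont (\<lambda>y. measure H {0..y}) x" for s x
  proof -
    have fl: "filterlim s (at_right 0) sequentially" unfolding filterlim_at using s(1,3) by (auto intro!: always_eventually simp: less_imp_neq[symmetric])
    define c where "c n = (1 - lap (F (s n)) 1) / (s n * ks (s n))" for n
    have c: "c \<longlonglongrightarrow> exp (Kf l 1)" unfolding c_def by (rule filterlim_compose[OF solves_tilt_lap(1)[OF S ks] fl])
    have cp: "c n > 0" for n unfolding c_def using solvesD(7)[OF S s(1)[of n], of 1] b(2)[OF s(1,2)] by simp
    have mu: "prob_Rplus (tilt (F (s n)))" for n
      by (rule tilt(1)) (use solvesD(1,7)[OF S s(1)[of n]] in auto)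
    have G: "Gt F ks (s n) = untilt (c n) (tilt (F (s n)))" for n unfolding c_def
      by (rule Gt_eq_untilt) (use solvesD(1,7)[OF S s(1)[of n]] b(2)[OF s(1,2)] in auto)
    have w: "weak_conv_m (\<lambda>n. tilt (F (s n))) N"
    proof (rule laplace_weak_conv[OF mu N])
      fix q :: real assume q: "q > 0"
      have "lap N q = (exp (Kf l (q + 1)) - exp (Kf l q)) / exp (Kf l 1)" using lapN[of q] eta[of q] eta[of 1] eta[of "q + 1"] q by simp
      then show "(\<lambda>n. lap (tilt (F (s n))) q) \<longlonglongrightarrow> lap N q" using filterlim_compose[OF solves_tilt_lap(2)[OF S ks q] fl] by simp
    qed
    show ?thesis unfolding G
      using untilt_gm_conv_seq[OF mu N w c _ cp x(1)] x(2) HN' by auto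
  qed
  show ?thesis unfolding gm_converges_def
    by (intro allI impI conjI tendsto_at_right_sequentially[OF b(1)]) (use seq in blast)+
qed

text \<open>\<open>H\<close> is the untilt of a limit law of \<open>tilt (F (s n))\<close> along a
  sequence of times tending to 0. For no mass to escape, the limiting transform must tend to 1 at 0:
  \<open>exp (Kf l q)\<close> tends to 0 there and \<open>exp (Kf l (q + 1))\<close> to
  \<open>exp (Kf l 1)\<close>.\<close>

lemma solves_generating_exists:
  assumes S: "solves l F" and ks: "de_Bruijn_conjugate (kappa p) ks"
  obtains H where "generating_measure H" "divergent H" "\<And>q. q > 0 \<Longrightarrow> laplace_exponent H q = exp (Kf l q)"
proof -
  let ?E = "\<lambda>q. exp (Kf l q)"
  note h = solves_hist[OF S]
  have E0: "(?E \<longlongrightarrow> 0) (at_right 0)" by (rule filterlim_compose[OF exp_at_bot Kf_at_bot[OF h]])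
  \<comment> \<open>Right-continuity of the exponent at 1 is inherited from \<open>F t\<close>, for
    which \<open>1 - lap (F t) (1 + q)\<close> lies between \<open>1 - lap (F t) 1\<close> and
    \<open>1 + q\<close> times that.\<close>
  have E1: "?E 1 \<le> ?E (q + 1) \<and> ?E (q + 1) \<le> (1 + q) * ?E 1" if q: "q > 0" for q
  proof -
    obtain b where b: "0 < b" "\<And>t. 0 < t \<Longrightarrow> t < b \<Longrightarrow> 0 < t * ks t" using ks_pos[OF ks] by blast
    have ev: "\<forall>\<^sub>F t in at_right 0. 0 < t \<and> 0 < t * ks t"
      unfolding eventually_at_right_field using b by (intro exI[of _ b]) auto
    have R: "((\<lambda>t. (1 - lap (F t) (q + 1)) / (t * ks t)) \<longlongrightarrow> ?E (q + 1)) (at_right 0)" by (rule solves_lap_ratio[OF S ks]) (use q in auto)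
    have R1: "((\<lambda>t. (1 - lap (F t) 1) / (t * ks t)) \<longlongrightarrow> ?E 1) (at_right 0)" by (rule solves_lap_ratio[OF S ks]) auto
    have R2: "((\<lambda>t. (1 + q) * ((1 - lap (F t) 1) / (t * ks t))) \<longlongrightarrow> (1 + q) * ?E 1) (at_right 0)" by (intro tendsto_intros R1)
    have "?E 1 \<le> ?E (q + 1)"
    proof (rule tendsto_le[OF _ R R1])
      show "\<forall>\<^sub>F t in at_right 0. (1 - lap (F t) 1) / (t * ks t) \<le> (1 - lap (F t) (q + 1)) / (t * ks t)"
        using ev by eventually_elim (use solvesD(1)[OF S] lap_antimono q in \<open>auto intro!: divide_right_mono\<close>)
    qed simp
    moreover have "?E (q + 1) \<le> (1 + q) * ?E 1"
    proof (rule tendsto_le[OF _ R2 R])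
      show "\<forall>\<^sub>F t in at_right 0. (1 - lap (F t) (q + 1)) / (t * ks t) \<le> (1 + q) * ((1 - lap (F t) 1) / (t * ks t))"
        using ev
      proof eventually_elim
        case (elim t)
        have M: "prob_Rplus (F t)" using solvesD(1)[OF S] elim by simp
        interpret prob_space "F t" using prob_RplusD[OF M] by simp
        have i: "integrable (F t) (\<lambda>x. exp (- r * x))" if "r \<ge> 0" for r by (rule lap_integrable[OF M that])
        have "1 - lap (F t) (q + 1) = (\<integral>x. 1 - exp (- (1 + q) * x) \<partial>F t)" using i[of "1 + q"] q prob_space by (simp add: lap_def add.commute)
        also have "\<dots> \<le> (\<integral>x. (1 + q) * (1 - exp (- 1 * x)) \<partial>F t)"
        proof (rule integral_mono_AE)
          show "integrable (F t) (\<lambda>x. 1 - exp (- (1 + q) * x))" using i[of "1 + q"] q by auto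
          show "integrable (F t) (\<lambda>x. (1 + q) * (1 - exp (- 1 * x)))" using i[of 1] by (intro integrable_mult_right) auto
          show "AE x in F t. 1 - exp (- (1 + q) * x) \<le> (1 + q) * (1 - exp (- 1 * x))"
            using prob_RplusD(4)[OF M] by eventually_elim (use one_minus_exp_mult_le[of _ q] q in auto)
        qed
        also have "\<dots> = (1 + q) * (1 - lap (F t) 1)" using i[of 1] prob_space by (simp add: lap_def)
        finally have "(1 - lap (F t) (q + 1)) / (t * ks t) \<le> (1 + q) * (1 - lap (F t) 1) / (t * ks t)" using elim by (intro divide_right_mono) auto
        then show ?case by simp
      qed
    qed simp
    ultimately show ?thesis by simp
  qed
  have w1: "((\<lambda>q. (?E (q + 1) - ?E q) / ?E 1) \<longlongrightarrow> 1) (at_right 0)"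
  proof -
    have e: "\<forall>\<^sub>F q in at_right (0::real). 0 < q" using eventually_unit_at_right by eventually_elim simp
    have "((\<lambda>q. ?E (q + 1)) \<longlongrightarrow> ?E 1) (at_right 0)"
    proof (rule tendsto_sandwich[OF _ _ tendsto_const])
      show "\<forall>\<^sub>F q in at_right 0. ?E 1 \<le> ?E (q + 1)" "\<forall>\<^sub>F q in at_right 0. ?E (q + 1) \<le> (1 + q) * ?E 1"
        using e by (eventually_elim, use E1 in blast)+
      have "((\<lambda>q. (1 + q) * ?E 1) \<longlongrightarrow> (1 + 0) * ?E 1) (at_right 0)" by (intro tendsto_intros)
      then show "((\<lambda>q. (1 + q) * ?E 1) \<longlongrightarrow> ?E 1) (at_right 0)" by simp
    qed
    from tendsto_divide[OF tendsto_diff[OF this E0] tendsto_const[of "?E 1"]]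
    have "((\<lambda>q. (?E (q + 1) - ?E q) / ?E 1) \<longlongrightarrow> (?E 1 - 0) / ?E 1) (at_right 0)" by simp
    moreover have "(?E 1 - 0) / ?E 1 = 1" by simp
    ultimately show ?thesis by (simp only:)
  qed
  define s where "s n = 1 / real (Suc n)" for n
  have s: "s n > 0" for n by (simp add: s_def)
  have "s \<longlonglongrightarrow> 0" unfolding s_def[abs_def] using LIMSEQ_inverse_real_of_nat by (simp add: inverse_eq_divide)
  then have fl: "filterlim s (at_right 0) sequentially" unfolding filterlim_at using s by (auto intro!: always_eventually simp: less_imp_neq[symmetric])
  have mu: "prob_Rplus (tilt (F (s n)))" for n by (rule tilt(1)) (use solvesD(1,7)[OF S s[of n]] in auto)
  have w: "(\<lambda>n. lap (tilt (F (s n))) q) \<longlonglongrightarrow> (?E (q + 1) - ?E q) / ?E 1" if "q > 0" for q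
    by (rule filterlim_compose[OF solves_tilt_lap(2)[OF S ks that] fl])
  obtain N where N: "prob_Rplus N" "\<And>q. q > 0 \<Longrightarrow> lap N q = (?E (q + 1) - ?E q) / ?E 1"
    by (rule laplace_limit_exists[OF mu w w1], assumption, rule that)
  have wc: "weak_conv_m (\<lambda>n. tilt (F (s n))) N" by (rule laplace_weak_conv[OF mu N(1)]) (use w N(2) in auto)
  define H where "H = untilt (?E 1) N"
  have genH: "generating_measure H" unfolding H_def by (rule untilt(1)[OF N(1)]) simp
  moreover have eta: "laplace_exponent H q = ?E q" if q: "q > 0" for q
  proof -
    have "(\<lambda>n. integral\<^sup>L (tilt (F (s n))) (rq q)) \<longlonglongrightarrow> integral\<^sup>L N (rq q)"
    proof (rule weak_conv_imp_integral_bdd_continuous_conv[where B="max 1 q"])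
      show "real_distribution (tilt (F (s n)))" for n using mu prob_RplusD by blast
      show "real_distribution N" using N prob_RplusD by blast
      show "norm (rq q x) \<le> max 1 q" for x using rq_bounds[of q x] q by simp
    qed (use wc rq_isCont in auto)
    moreover have "(\<lambda>n. integral\<^sup>L (tilt (F (s n))) (rq q)) \<longlonglongrightarrow> ?E q / ?E 1"
      by (rule filterlim_compose[OF solves_tilt_lap(3)[OF S ks q] fl])
    ultimately have "integral\<^sup>L N (rq q) = ?E q / ?E 1" by (rule LIMSEQ_unique)
    then show ?thesis unfolding H_def using untilt(2)[OF N(1), of "?E 1" q] q by simp
  qed
  \<comment> \<open>Otherwise the exponent would be bounded by the integral of \<open>1 / y\<close>,
    but \<open>Kf l\<close> is unbounded because \<open>l\<close> is positive.\<close>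
  moreover have "divergent H"
  proof (rule ccontr)
    assume "\<not> divergent H"
    then have fin: "(\<integral>\<^sup>+ y. inverse (ennreal y) \<partial>H) \<noteq> \<top>" by (simp add: divergent_def)
    define C where "C = enn2real (\<integral>\<^sup>+ y. inverse (ennreal y) \<partial>H)"
    have bound: "?E q \<le> C" if q: "q > 0" for q
    proof -
      have "ennreal (laplace_exponent H q) = (\<integral>\<^sup>+ y. ennreal (kq q y) \<partial>H)"
        unfolding laplace_exponent_kq
        by (rule nn_integral_eq_integral[symmetric, OF kq_integrable[OF genH]])
           (use generatingD(3)[OF genH] kq_bound(1)[of q] q in \<open>auto elim: eventually_mono\<close>)
      also have "\<dots> \<le> (\<integral>\<^sup>+ y. inverse (ennreal y) \<partial>H)"
      proof (rule nn_integral_mono_AE)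
        show "AE y in H. ennreal (kq q y) \<le> inverse (ennreal y)"
          using generatingD(3)[OF genH]
        proof eventually_elim
          case (elim y)
          show ?case
          proof (cases "y = 0")
            case False
            then have y: "y > 0" using elim by simp
            then have "kq q y \<le> 1 / y" by (simp add: kq_def divide_right_mono)
            then show ?thesis using y by (simp add: inverse_ennreal_divide ennreal_leI)
          qed simp
        qed
      qed
      also have "\<dots> = ennreal C" using fin by (simp add: C_def less_top[symmetric] ennreal_enn2real)
      finally show ?thesis unfolding eta[OF q] by (subst (asm) ennreal_le_iff) (auto simp: C_def)
    qed
    have "\<forall>\<^sub>F q in at_top. C + 1 \<le> ?E q"
      using filterlim_compose[OF exp_at_top Kf_at_top[OF h solvesD(3)[OF S]]] by (auto simp: filterlim_at_top)
    from eventually_happens'[OF _ eventually_conj[OF this eventually_gt_at_top[of 0]]]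
    obtain q where "C + 1 \<le> ?E q" "0 < q" by auto
    then show False using bound[of q] by simp
  qed
  ultimately show ?thesis using that by blast
qed

end

section \<open>The min history is determined by the Laplace exponent\<close>

text \<open>The integrand of \<open>Kf l 2 - Kf l 1\<close>: the measure \<open>ds / s\<close> with
  a weight that makes it finite at both ends.\<close>

definition vden :: "(real \<Rightarrow> real) \<Rightarrow> real \<Rightarrow> real" where
  "vden l s = (if s > 0 then exp (- l s) * (1 - exp (- l s)) / s else 0)"

definition posp :: "(real \<Rightarrow> real) \<Rightarrow> real \<Rightarrow> real" where "posp l s = (if s > 0 then l s else 0)"

lemma posp_measurable: "hist l \<Longrightarrow> posp l \<in> borel_measurable borel"
  unfolding posp_def[abs_def] by (rule history_measurable[OF histD(1)])

lemma vden_measurable: assumes "hist l" shows "vden l \<in> borel_measurable borel"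
proof -
  have "vden l = (\<lambda>s. if s > 0 then exp (- posp l s) * (1 - exp (- posp l s)) / s else 0)" by (auto simp: vden_def posp_def)
  then show ?thesis using posp_measurable[OF assms] by simp
qed

lemma vden_nonneg: "hist l \<Longrightarrow> 0 \<le> vden l s"
  using histD(2)[of l s] by (simp add: vden_def)

text \<open>The two ranges of \<open>Kf\<close> are renormalised differently; in a difference this
  cancels, and they merge into one absolutely convergent integral.\<close>

lemma Kf_difference:
  assumes h: "hist l" and q: "q > 0"
  shows "integrable lborel (\<lambda>s. if s > 0 then exp (- q * l s) * (1 - exp (- l s)) / s else 0)"
    "(\<integral>s. (if s > 0 then exp (- q * l s) * (1 - exp (- l s)) / s else 0) \<partial>lborel) = Kf l (q + 1) - Kf l q"
proof -
  let ?f = "\<lambda>s. exp (- q * l s) * (1 - exp (- l s)) / s"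
  have q1: "q + 1 > 0" using q by simp
  have e1: "?f s = (1 - exp (- (q + 1) * l s)) / s - (1 - exp (- q * l s)) / s" for s
  proof -
    have "exp (- (q + 1) * l s) = exp (- q * l s) * exp (- l s)" by (simp add: exp_add[symmetric] algebra_simps)
    then show ?thesis by (simp add: diff_divide_distrib[symmetric] algebra_simps)
  qed
  have e2: "?f s = exp (- q * l s) / s - exp (- (q + 1) * l s) / s" for s
    unfolding e1 by (simp add: diff_divide_distrib)
  note i1 = histD(4)[OF h q1] histD(4)[OF h q] and i2 = histD(3)[OF h q zero_less_one] histD(3)[OF h q1 zero_less_one]
  have f1: "set_integrable lborel {0<..1} ?f" unfolding e1 by (rule set_integral_diff(1)[OF i1])
  have f2: "set_integrable lborel {1<..} ?f" unfolding e2 by (rule set_integral_diff(1)[OF i2])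
  have U: "{0<..} = {0<..1} \<union> {1::real<..}" by auto
  have s: "(\<lambda>s. if s > 0 then ?f s else 0) = (\<lambda>s. indicator {0<..} s *\<^sub>R ?f s)" by (auto simp: indicator_def)
  have f: "set_integrable lborel {0<..} ?f" unfolding U by (rule set_integrable_Un[OF f1 f2]) auto
  then show "integrable lborel (\<lambda>s. if s > 0 then ?f s else 0)" unfolding s by (simp add: set_integrable_def)
  have "(\<integral>s. (if s > 0 then ?f s else 0) \<partial>lborel) = (LBINT s:{0<..}. ?f s)" unfolding s by (simp add: set_lebesgue_integral_def)
  also have "\<dots> = (LBINT s:{0<..1}. ?f s) + (LBINT s:{1<..}. ?f s)" unfolding U by (rule set_integral_Un[OF _ f1 f2]) auto
  also have "(LBINT s:{0<..1}. ?f s) = (LBINT s:{0<..1}. (1 - exp (- (q + 1) * l s)) / s) - (LBINT s:{0<..1}. (1 - exp (- q * l s)) / s)"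
    unfolding e1 by (rule set_integral_diff(2)[OF i1])
  also have "(LBINT s:{1<..}. ?f s) = Lam l q 1 - Lam l (q + 1) 1"
    unfolding e2 Lam_def by (rule set_integral_diff(2)[OF i2])
  finally show "(\<integral>s. (if s > 0 then ?f s else 0) \<partial>lborel) = Kf l (q + 1) - Kf l q"
    using Kf_eq(1)[OF h q] Kf_eq(1)[OF h q1] by simp
qed

text \<open>Normalised image of \<open>ds / s\<close> under the history, with the weight of
  \<open>vden\<close>. It sees the values of \<open>l\<close> but not the scale of time, since
  \<open>ds / s\<close> is invariant under scaling.\<close>

definition wlaw :: "(real \<Rightarrow> real) \<Rightarrow> real measure" where
  "wlaw l = distr (density lborel (\<lambda>s. ennreal (vden l s / (Kf l 2 - Kf l 1)))) borel (posp l)"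

lemma vden_integral:
  assumes h: "hist l"
  shows "integrable lborel (vden l)" "integral\<^sup>L lborel (vden l) = Kf l 2 - Kf l 1"
proof -
  have e: "vden l = (\<lambda>s. if s > 0 then exp (- 1 * l s) * (1 - exp (- l s)) / s else 0)" by (auto simp: vden_def)
  show "integrable lborel (vden l)" unfolding e by (rule Kf_difference(1)[OF h zero_less_one])
  show "integral\<^sup>L lborel (vden l) = Kf l 2 - Kf l 1" unfolding e Kf_difference(2)[OF h zero_less_one] by simp
qed

lemma wlaw:
  assumes h: "hist l" and c: "Kf l 2 - Kf l 1 > 0"
  shows "prob_Rplus (wlaw l)"
    "f \<in> borel_measurable borel \<Longrightarrow> integral\<^sup>L (wlaw l) f = (\<integral>s. vden l s * f (posp l s) \<partial>lborel) / (Kf l 2 - Kf l 1)"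
    "lap (wlaw l) (real n) = (Kf l (real n + 2) - Kf l (real n + 1)) / (Kf l 2 - Kf l 1)"
proof -
  let ?c = "Kf l 2 - Kf l 1"
  let ?D = "density lborel (\<lambda>s. ennreal (vden l s / ?c))"
  note vm = vden_measurable[OF h] and pm = posp_measurable[OF h]
  have nn: "0 \<le> vden l s / ?c" for s using vden_nonneg[OF h, of s] c by simp
  have "emeasure ?D UNIV = (\<integral>\<^sup>+s. ennreal (vden l s / ?c) \<partial>lborel)" using vm by (subst emeasure_density) auto
  also have "\<dots> = ennreal (\<integral>s. vden l s / ?c \<partial>lborel)"
    using vden_integral(1)[OF h] nn by (intro nn_integral_eq_integral) auto
  also have "\<dots> = 1" using vden_integral(2)[OF h] c by simp
  finally have pD: "prob_space ?D" by (intro prob_spaceI) simp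
  have pm': "posp l \<in> measurable ?D borel" using pm by simp
  have "prob_space (wlaw l)" unfolding wlaw_def by (rule prob_space.prob_space_distr[OF pD pm'])
  moreover have "emeasure (wlaw l) {..<0} = 0"
  proof -
    have "0 \<le> posp l s" for s using histD(2)[OF h, of s] by (simp add: posp_def)
    then have "posp l -` {..<0} \<inter> space ?D = {}" by (auto simp: not_less[symmetric])
    then show ?thesis unfolding wlaw_def using pm' by (subst emeasure_distr) auto
  qed
  ultimately show W: "prob_Rplus (wlaw l)" by (simp add: prob_Rplus_def wlaw_def)
  show I: "integral\<^sup>L (wlaw l) f = (\<integral>s. vden l s * f (posp l s) \<partial>lborel) / ?c" if f: "f \<in> borel_measurable borel" for f
  proof -
    have fp: "(\<lambda>s. f (posp l s)) \<in> borel_measurable lborel" using measurable_compose[OF pm f] by simp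
    have "integral\<^sup>L (wlaw l) f = (\<integral>s. f (posp l s) \<partial>?D)" unfolding wlaw_def by (rule integral_distr[OF pm' f])
    also have "\<dots> = (\<integral>s. (vden l s / ?c) *\<^sub>R f (posp l s) \<partial>lborel)"
      using fp vm nn by (intro integral_density) auto
    also have "\<dots> = (\<integral>s. vden l s * f (posp l s) / ?c \<partial>lborel)" by (intro Bochner_Integration.integral_cong) auto
    finally show ?thesis by simp
  qed
  have "(\<integral>s. vden l s * exp (- real n * posp l s) \<partial>lborel) = (\<integral>s. (if s > 0 then exp (- (real n + 1) * l s) * (1 - exp (- l s)) / s else 0) \<partial>lborel)"
  proof (intro Bochner_Integration.integral_cong refl)
    fix s
    have "exp (- (real n + 1) * l s) = exp (- real n * l s) * exp (- l s)" by (simp add: exp_add[symmetric] algebra_simps)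
    then show "vden l s * exp (- real n * posp l s) = (if s > 0 then exp (- (real n + 1) * l s) * (1 - exp (- l s)) / s else 0)"
      by (simp add: vden_def posp_def)
  qed
  also have "\<dots> = Kf l (real n + 1 + 1) - Kf l (real n + 1)" by (rule Kf_difference(2)[OF h]) simp
  finally have "(\<integral>s. vden l s * exp (- real n * posp l s) \<partial>lborel) = Kf l (real n + 2) - Kf l (real n + 1)" by (simp add: add_ac)
  then show "lap (wlaw l) (real n) = (Kf l (real n + 2) - Kf l (real n + 1)) / ?c"
    unfolding lap_def by (subst I) auto
qed

text \<open>Differences of \<open>Kf\<close> determine a history only up to a rescaling of time; the
  value \<open>Kf l 1\<close> fixes the scale. The integral of \<open>r\<close> is minus the
  logarithm of the time at which \<open>l\<close> passes the level \<open>a\<close>. The functions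
  \<open>h1\<close> and \<open>h2\<close> are chosen so that multiplication by \<open>vden\<close>
  gives \<open>(1 - exp (- l s)) / s\<close> up to level \<open>a\<close> and
  \<open>exp (- l s) / s\<close> above it; correcting the integrand of \<open>Kf l 1\<close> by
  these leaves \<open>r\<close>.\<close>

lemma Kf_decomposition:
  assumes h: "hist l" and pos: "\<And>s. s > 0 \<Longrightarrow> 0 < l s" and c: "Kf l 2 - Kf l 1 > 0" and a: "a > 0"
  defines "r \<equiv> \<lambda>s. if s > 0 then (indicator {..1} s - indicator {s. l s \<le> a} s) / s else 0"
    and "h1 \<equiv> \<lambda>y. if y \<le> a then exp y else 0" and "h2 \<equiv> \<lambda>y. if y \<le> a then 0 else 1 / (1 - exp (- y))"
  shows "integrable lborel r"
    "integral\<^sup>L lborel r = Kf l 1 - (Kf l 2 - Kf l 1) * integral\<^sup>L (wlaw l) h1 + (Kf l 2 - Kf l 1) * integral\<^sup>L (wlaw l) h2"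
proof -
  let ?c = "Kf l 2 - Kf l 1"
  define k where "k s = indicator {0<..1} s *\<^sub>R ((1 - exp (- 1 * l s)) / s) - indicator {1<..} s *\<^sub>R (exp (- 1 * l s) / s)" for s
  have ik1: "integrable lborel (\<lambda>s. indicator {0<..1} s *\<^sub>R ((1 - exp (- 1 * l s)) / s))" using histD(4)[OF h, of 1] by (simp add: set_integrable_def)
  have ik2: "integrable lborel (\<lambda>s. indicator {1<..} s *\<^sub>R (exp (- 1 * l s) / s))" using histD(3)[OF h, of 1 1] by (simp add: set_integrable_def)
  have ik: "integrable lborel k" unfolding k_def[abs_def] by (rule Bochner_Integration.integrable_diff[OF ik1 ik2])
  have Ik: "integral\<^sup>L lborel k = Kf l 1"
    unfolding k_def[abs_def] Bochner_Integration.integral_diff[OF ik1 ik2] Kf_eq(1)[OF h zero_less_one] by (simp add: set_lebesgue_integral_def Lam_def)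
  have m1: "h1 \<in> borel_measurable borel" and m2: "h2 \<in> borel_measurable borel" unfolding h1_def h2_def by measurable
  note vm = vden_measurable[OF h] and pm = posp_measurable[OF h]
  have iv: "integrable lborel (\<lambda>s. vden l s * f (posp l s))" if f: "f \<in> borel_measurable borel" and B: "\<And>y. \<bar>f y\<bar> \<le> B" for f :: "real \<Rightarrow> real" and B
  proof (rule Bochner_Integration.integrable_bound)
    show "integrable lborel (\<lambda>s. vden l s * B)" by (rule integrable_mult_left, rule vden_integral(1)[OF h])
    show "(\<lambda>s. vden l s * f (posp l s)) \<in> borel_measurable lborel" using vm measurable_compose[OF pm f] by simp
    show "AE s in lborel. norm (vden l s * f (posp l s)) \<le> norm (vden l s * B)"
    proof (rule AE_I2)
      fix s
      have "\<bar>f (posp l s)\<bar> \<le> \<bar>B\<bar>" using B[of "posp l s"] abs_ge_self[of B] by (rule order_trans)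
      then show "norm (vden l s * f (posp l s)) \<le> norm (vden l s * B)" by (simp add: abs_mult mult_left_mono)
    qed
  qed
  have b1: "\<bar>h1 y\<bar> \<le> exp a" for y by (simp add: h1_def)
  have b2: "\<bar>h2 y\<bar> \<le> 1 / (1 - exp (- a))" for y using a by (auto simp: h2_def intro!: divide_left_mono)
  note i1 = iv[OF m1 b1] and i2 = iv[OF m2 b2]
  have req: "r = (\<lambda>s. k s - vden l s * h1 (posp l s) + vden l s * h2 (posp l s))"
  proof
    fix s
    show "r s = k s - vden l s * h1 (posp l s) + vden l s * h2 (posp l s)"
    proof (cases "s > 0")
      case True
      have ne: "1 - exp (- l s) \<noteq> 0" using pos[OF True] by simp
      have ee: "exp (- l s) * exp (l s) = 1" by (simp add: exp_minus)
      have v1: "vden l s * h1 (posp l s) = (if l s \<le> a then (1 - exp (- l s)) / s else 0)"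
      proof (cases "l s \<le> a")
        case le: True
        have "exp (- l s) * (1 - exp (- l s)) / s * exp (l s) = (exp (- l s) * exp (l s)) * (1 - exp (- l s)) / s" by simp
        then show ?thesis using True le unfolding ee by (simp add: vden_def posp_def h1_def)
      qed (use True in \<open>simp add: posp_def h1_def\<close>)
      have v2: "vden l s * h2 (posp l s) = (if l s \<le> a then 0 else exp (- l s) / s)"
        using True ne by (simp add: vden_def posp_def h2_def)
      show ?thesis unfolding v1 v2 using True by (auto simp: r_def k_def indicator_def diff_divide_distrib)
    qed (simp add: r_def k_def vden_def)
  qed
  show "integrable lborel r" unfolding req by (intro Bochner_Integration.integrable_add Bochner_Integration.integrable_diff ik i1 i2)
  have "integral\<^sup>L lborel r = Kf l 1 - (\<integral>s. vden l s * h1 (posp l s) \<partial>lborel) + (\<integral>s. vden l s * h2 (posp l s) \<partial>lborel)"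
    unfolding req using ik i1 i2 by (simp add: Ik)
  then show "integral\<^sup>L lborel r = Kf l 1 - ?c * integral\<^sup>L (wlaw l) h1 + ?c * integral\<^sup>L (wlaw l) h2"
    unfolding wlaw(2)[OF h c m1] wlaw(2)[OF h c m2] using c by simp
qed

lemma Kf_strict: assumes h: "hist l" and pos: "\<And>s. s > 0 \<Longrightarrow> 0 < l s" shows "Kf l 2 - Kf l 1 > 0"
proof -
  have "integral\<^sup>L lborel (vden l) \<noteq> 0"
  proof
    assume "integral\<^sup>L lborel (vden l) = 0"
    then have "AE s in lborel. vden l s = 0"
      using vden_nonneg[OF h] vden_integral(1)[OF h] by (subst (asm) integral_nonneg_eq_0_iff_AE) auto
    then have "AE s in lborel. s \<notin> {0<..(1::real)}"
    proof eventually_elim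
      case (elim s)
      show ?case
      proof
        assume "s \<in> {0<..1}"
        then have "vden l s > 0" using pos[of s] by (simp add: vden_def)
        then show False using elim by simp
      qed
    qed
    then have "emeasure lborel {0<..(1::real)} = 0" by (subst (asm) AE_iff_measurable[where N="{0<..(1::real)}"]) auto
    then show False by simp
  qed
  moreover have "integral\<^sup>L lborel (vden l) \<ge> 0" by (intro integral_nonneg_AE AE_I2 vden_nonneg[OF h])
  ultimately show ?thesis using vden_integral(2)[OF h] by simp
qed

text \<open>Comparison of passage times: by monotonicity the sets where \<open>l\<close> and
  \<open>l'\<close> are at most \<open>a\<close> are nested, and equality of the integrals of
  \<open>r\<close> makes their difference null. Rational levels then separate the two
  functions.\<close>

lemma history_unique:
  assumes h: "hist l" "hist l'" and pos: "\<And>s. s > 0 \<Longrightarrow> 0 < l s" "\<And>s. s > 0 \<Longrightarrow> 0 < l' s"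
    and K: "\<And>q. q > 0 \<Longrightarrow> Kf l q = Kf l' q"
  shows "AE s in lborel. s > 0 \<longrightarrow> l s = l' s"
proof -
  have K12: "Kf l' 2 = Kf l 2" "Kf l' 1 = Kf l 1" using K[of 1] K[of 2] by auto
  note c = Kf_strict[OF h(1) pos(1)] and c' = Kf_strict[OF h(2) pos(2)]
  have W: "wlaw l = wlaw l'"
  proof (rule laplace_uniqueness[OF wlaw(1)[OF h(1) c] wlaw(1)[OF h(2) c']])
    fix n :: nat
    show "lap (wlaw l) (real n) = lap (wlaw l') (real n)"
      using wlaw(3)[OF h(1) c, of n] wlaw(3)[OF h(2) c', of n] K[of "real n + 2"] K[of "real n + 1"] K12 by simp
  qed
  have AEa: "AE s in lborel. s > 0 \<longrightarrow> (l s \<le> a \<longleftrightarrow> l' s \<le> a)" if a: "a > 0" for a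
  proof -
    let ?r = "\<lambda>l s. if s > 0 then (indicator {..1} s - indicator {s. l s \<le> a} s) / s else (0::real)"
    note d = Kf_decomposition[OF h(1) pos(1) c a] and d' = Kf_decomposition[OF h(2) pos(2) c' a]
    have I: "integral\<^sup>L lborel (?r l) = integral\<^sup>L lborel (?r l')" using d(2) d'(2) unfolding W K12 by (rule trans[OF _ sym])
    have D: "(\<integral>s. ?r l s - ?r l' s \<partial>lborel) = 0" "(\<integral>s. ?r l' s - ?r l s \<partial>lborel) = 0"
      using I Bochner_Integration.integral_diff[OF d(1) d'(1)] Bochner_Integration.integral_diff[OF d'(1) d(1)] by auto
    have i: "integrable lborel (\<lambda>s. ?r l s - ?r l' s)" by (rule Bochner_Integration.integrable_diff[OF d(1) d'(1)])
    have i': "integrable lborel (\<lambda>s. ?r l' s - ?r l s)" by (rule Bochner_Integration.integrable_diff[OF d'(1) d(1)])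
    have l: "mono_on {0<..} l" "mono_on {0<..} l'" using histD(1) h by auto
    have "(\<forall>s>0. l s \<le> a \<longrightarrow> l' s \<le> a) \<or> (\<forall>s>0. l' s \<le> a \<longrightarrow> l s \<le> a)"
    proof (rule ccontr)
      assume "\<not> ?thesis"
      then obtain x y where xy: "x > 0" "l x \<le> a" "\<not> l' x \<le> a" "y > 0" "l' y \<le> a" "\<not> l y \<le> a" by auto
      show False
      proof (cases "x \<le> y")
        case True then show False using mono_onD[OF l(2), of x y] xy by auto
      next
        case False then show False using mono_onD[OF l(1), of y x] xy by auto
      qed
    qed
    then have "AE s in lborel. ?r l s - ?r l' s = 0"
    proof
      assume A: "\<forall>s>0. l s \<le> a \<longrightarrow> l' s \<le> a"
      have "AE s in lborel. 0 \<le> ?r l s - ?r l' s"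
        using A by (intro AE_I2) (auto simp: indicator_def diff_divide_distrib[symmetric])
      then show ?thesis using D(1) i by (subst integral_nonneg_eq_0_iff_AE[symmetric]) auto
    next
      assume A: "\<forall>s>0. l' s \<le> a \<longrightarrow> l s \<le> a"
      have "AE s in lborel. 0 \<le> ?r l' s - ?r l s"
        using A by (intro AE_I2) (auto simp: indicator_def diff_divide_distrib[symmetric])
      then have "AE s in lborel. ?r l' s - ?r l s = 0" using D(2) i' by (subst integral_nonneg_eq_0_iff_AE[symmetric]) auto
      then show ?thesis by eventually_elim simp
    qed
    then show ?thesis
    proof eventually_elim
      case (elim s)
      then show ?case by (auto simp: indicator_def diff_divide_distrib[symmetric] split: if_splits)
    qed
  qed
  have "AE s in lborel. \<forall>a\<in>{a::rat. a > 0}. s > 0 \<longrightarrow> (l s \<le> of_rat a \<longleftrightarrow> l' s \<le> of_rat a)"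
    by (subst AE_ball_countable) (auto intro: AEa)
  then show ?thesis
  proof eventually_elim
    case (elim s)
    show ?case
    proof (rule impI, rule ccontr)
      assume s: "s > 0" and ne: "l s \<noteq> l' s"
      have "min (l s) (l' s) < max (l s) (l' s)" using ne by (auto simp: min_def max_def)
      then obtain a where a: "min (l s) (l' s) < of_rat a" "of_rat a < max (l s) (l' s)" using of_rat_dense by blast
      have "0 < min (l s) (l' s)" using pos s by (simp add: min_def)
      then have "(0::real) < of_rat a" using a(1) by linarith
      then have "a > 0" by simp
      then show False using elim s a ne by (auto simp: min_def max_def split: if_splits)
    qed
  qed
qed

context clustering
begin

text \<open>\<open>Lam\<close> does not see null sets, so equality of the histories almost
  everywhere gives equality of the laws at every time.\<close>

lemma solves_unique:
  assumes S: "solves l F" "solves l' F'" and K: "\<And>q. q > 0 \<Longrightarrow> Kf l q = Kf l' q" and t: "t > 0"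
  shows "F t = F' t"
proof (rule laplace_uniqueness[OF solvesD(1)[OF S(1) t] solvesD(1)[OF S(2) t]])
  fix n :: nat assume "n \<ge> 1"
  then have q: "real n > 0" by simp
  have AE: "AE s in lborel. s > 0 \<longrightarrow> l s = l' s"
    by (rule history_unique[OF solves_hist[OF S(1)] solves_hist[OF S(2)] solvesD(3)[OF S(1)] solvesD(3)[OF S(2)] K])
  have "Lam l (real n) t = Lam l' (real n) t"
    unfolding Lam_def set_lebesgue_integral_def
  proof (rule integral_cong_AE)
    show "(\<lambda>s. indicator {t<..} s *\<^sub>R (exp (- real n * l s) / s)) \<in> borel_measurable lborel"
      using solvesD(4)[OF S(1) t q] by (simp add: set_integrable_def)
    show "(\<lambda>s. indicator {t<..} s *\<^sub>R (exp (- real n * l' s) / s)) \<in> borel_measurable lborel"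
      using solvesD(4)[OF S(2) t q] by (simp add: set_integrable_def)
    show "AE s in lborel. indicator {t<..} s *\<^sub>R (exp (- real n * l s) / s) = indicator {t<..} s *\<^sub>R (exp (- real n * l' s) / s)"
      using AE by eventually_elim (use t in \<open>auto simp: indicator_def\<close>)
  qed
  then show "lap (F t) (real n) = lap (F' t) (real n)" using solvesD(5)[OF S(1) t q] solvesD(5)[OF S(2) t q] by simp
qed

end

section \<open>Compactness of min histories\<close>

text \<open>Expresses the contribution of early times through \<open>Kf\<close> and
  \<open>Lam\<close>, which makes its limit along a sequence of histories computable.\<close>

lemma small_part_eq:
  assumes h: "hist l" and q: "q > 0" and d: "0 < d" "d \<le> 1"
  shows "(LBINT s:{0<..d}. (1 - exp (- q * l s)) / s) = Kf l q + Lam l q d + ln d"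
    "set_integrable lborel {0<..d} (\<lambda>s. (1 - exp (- q * l s)) / s)"
    "(LBINT s:{0<..d}. (1 - exp (- q * l s)) / s) \<le> Kf l q + Lam l q 1"
    "0 \<le> (LBINT s:{0<..d}. (1 - exp (- q * l s)) / s)"
proof -
  let ?f = "\<lambda>s. (1 - exp (- q * l s)) / s"
  note l = histD(1)[OF h] and p = histD(2)[OF h] and i = histD(4)[OF h q]
  have q0: "0 \<le> q" using q by simp
  show i1: "set_integrable lborel {0<..d} ?f" by (rule set_integrable_subset[OF i]) (use d in auto)
  have i2: "set_integrable lborel {d<..1} ?f" by (rule set_integrable_subset[OF i]) (use d in auto)
  have U: "{0<..1} = {0<..d} \<union> {d<..1}" using d by auto
  have A: "(LBINT s:{0<..1}. ?f s) = (LBINT s:{0<..d}. ?f s) + (LBINT s:{d<..1}. ?f s)"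
    unfolding U by (rule set_integral_Un[OF _ i1 i2]) auto
  have W: "Wint l q d 1 = - ln d - (LBINT s:{d<..1}. ?f s)" by (rule Wint_small[OF l p q0 d])
  have "Lam l q d = Wint l q d 1 + Lam l q 1" by (rule Lam_split(2)[OF l d q0 histD(3)[OF h q zero_less_one]])
  then show "(LBINT s:{0<..d}. ?f s) = Kf l q + Lam l q d + ln d" using A W Kf_eq(1)[OF h q] by simp
  have "(LBINT s:{0<..d}. ?f s) \<le> (LBINT s:{0<..1}. ?f s)"
    by (rule set_integral_subset_le[OF i]) (use p q d in auto)
  then show "(LBINT s:{0<..d}. ?f s) \<le> Kf l q + Lam l q 1" using Kf_eq(1)[OF h q] by simp
  show "0 \<le> (LBINT s:{0<..d}. ?f s)" unfolding set_lebesgue_integral_def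
    using p q by (intro integral_nonneg_AE AE_I2) (auto simp: indicator_def)
qed

lemma exp_difference: "exp (- q * x) - exp (- (2 * q) * x) = exp (- q * x) * (1 - exp (- q * x :: real))"
  by (simp add: right_diff_distrib exp_add[symmetric])

text \<open>A bound on \<open>Kf l q\<close> bounds only a difference of two nonnegative parts.
  Passing from \<open>q\<close> to \<open>2 * q\<close> increases the part near 0 and decreases
  \<open>Lam\<close>, so both changes are at most \<open>2 * B\<close>. If
  \<open>l 1 \<le> 1\<close>, the change controls the part near 0 up to the factor
  \<open>exp q\<close>; otherwise it controls \<open>Lam\<close> up to
  \<open>1 / (1 - exp (- q))\<close>. The other part follows from \<open>Kf\<close>.\<close>

lemma parts_bound:
  assumes h: "hist l" and q: "q > 0" and b1: "\<bar>Kf l q\<bar> \<le> B" and b2: "\<bar>Kf l (2 * q)\<bar> \<le> B"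
  shows "Lam l q 1 \<le> exp q * (2 * B) + 2 * B / (1 - exp (- q)) + B"
proof -
  let ?A = "\<lambda>q. LBINT s:{0<..1}. (1 - exp (- q * l s)) / s"
  note l = histD(1)[OF h] and p = histD(2)[OF h]
  have q2: "2 * q > 0" using q by simp
  note iA = histD(4)[OF h q] and iA2 = histD(4)[OF h q2] and iL = histD(3)[OF h q zero_less_one] and iL2 = histD(3)[OF h q2 zero_less_one]
  have B0: "0 \<le> B" using b1 by linarith
  have c: "0 < 1 - exp (- q)" using q by simp
  have D: "?A (2 * q) - ?A q + (Lam l q 1 - Lam l (2 * q) 1) \<le> 2 * B"
    using Kf_eq(1)[OF h q] Kf_eq(1)[OF h q2] b1 b2 by linarith
  have A0: "0 \<le> ?A (2 * q) - ?A q"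
  proof -
    have "?A q \<le> ?A (2 * q)"
    proof (rule set_integral_mono[OF iA iA2])
      fix s :: real assume s: "s \<in> {0<..1}"
      have "q * l s \<le> 2 * q * l s" using p[of s] s q by simp
      then show "(1 - exp (- q * l s)) / s \<le> (1 - exp (- (2 * q) * l s)) / s" using s by (intro divide_right_mono) auto
    qed
    then show ?thesis by simp
  qed
  have L0: "0 \<le> Lam l q 1 - Lam l (2 * q) 1"
    using Lam_antimono_q[OF l p _ zero_less_one iL iL2] q by simp
  have n1: "0 \<le> exp q * (2 * B)" "0 \<le> 2 * B / (1 - exp (- q))" using B0 c by auto
  show ?thesis
  proof (cases "l 1 \<le> 1")
    case True
    have "exp (- q) * ?A q = (LBINT s:{0<..1}. exp (- q) * ((1 - exp (- q * l s)) / s))" by (rule set_integral_mult_right[symmetric])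
    also have "\<dots> \<le> (LBINT s:{0<..1}. (1 - exp (- (2 * q) * l s)) / s - (1 - exp (- q * l s)) / s)"
    proof (rule set_integral_mono)
      show "set_integrable lborel {0<..1} (\<lambda>s. exp (- q) * ((1 - exp (- q * l s)) / s))" by (rule set_integrable_mult_right, rule iA)
      show "set_integrable lborel {0<..1} (\<lambda>s. (1 - exp (- (2 * q) * l s)) / s - (1 - exp (- q * l s)) / s)" by (rule set_integral_diff(1)[OF iA2 iA])
      fix s :: real assume s: "s \<in> {0<..1}"
      have "l s \<le> 1" using mono_onD[OF l, of s 1] s True by auto
      then have "q * l s \<le> q * 1" using q by (intro mult_left_mono) auto
      then have "exp (- q) \<le> exp (- q * l s)" by simp
      then have "exp (- q) * (1 - exp (- q * l s)) \<le> exp (- q * l s) * (1 - exp (- q * l s))"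
        using p[of s] s q by (intro mult_right_mono) auto
      also have "\<dots> = (1 - exp (- (2 * q) * l s)) - (1 - exp (- q * l s))" unfolding exp_difference[symmetric] by simp
      finally have "exp (- q) * (1 - exp (- q * l s)) / s \<le> ((1 - exp (- (2 * q) * l s)) - (1 - exp (- q * l s))) / s"
        using s by (intro divide_right_mono) auto
      then show "exp (- q) * ((1 - exp (- q * l s)) / s) \<le> (1 - exp (- (2 * q) * l s)) / s - (1 - exp (- q * l s)) / s"
        by (simp only: diff_divide_distrib[symmetric] times_divide_eq_right)
    qed
    also have "\<dots> = ?A (2 * q) - ?A q" by (rule set_integral_diff(2)[OF iA2 iA])
    finally have "exp (- q) * ?A q \<le> 2 * B" using D L0 by linarith
    then have "exp q * (exp (- q) * ?A q) \<le> exp q * (2 * B)" by (intro mult_left_mono) auto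
    moreover have "exp q * exp (- q) = 1" by (simp add: exp_add[symmetric])
    then have "exp q * (exp (- q) * ?A q) = ?A q" by (simp only: mult.assoc[symmetric] mult_1_left)
    ultimately have "?A q \<le> exp q * (2 * B)" by linarith
    then show ?thesis using Kf_eq(1)[OF h q] b1 n1 by linarith
  next
    case False
    have "(1 - exp (- q)) * Lam l q 1 = (LBINT s:{1<..}. (1 - exp (- q)) * (exp (- q * l s) / s))" unfolding Lam_def by (rule set_integral_mult_right[symmetric])
    also have "\<dots> \<le> (LBINT s:{1<..}. exp (- q * l s) / s - exp (- (2 * q) * l s) / s)"
    proof (rule set_integral_mono)
      show "set_integrable lborel {1<..} (\<lambda>s. (1 - exp (- q)) * (exp (- q * l s) / s))" by (rule set_integrable_mult_right, rule iL)
      show "set_integrable lborel {1<..} (\<lambda>s. exp (- q * l s) / s - exp (- (2 * q) * l s) / s)" by (rule set_integral_diff(1)[OF iL iL2])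
      fix s :: real assume s: "s \<in> {1<..}"
      have "1 \<le> l s" using mono_onD[OF l, of 1 s] s False by auto
      then have "q * 1 \<le> q * l s" using q by (intro mult_left_mono) auto
      then have "1 - exp (- q) \<le> 1 - exp (- q * l s)" by simp
      then have "exp (- q * l s) * (1 - exp (- q)) \<le> exp (- q * l s) * (1 - exp (- q * l s))" by (intro mult_left_mono) auto
      also have "\<dots> = exp (- q * l s) - exp (- (2 * q) * l s)" by (rule exp_difference[symmetric])
      finally have "exp (- q * l s) * (1 - exp (- q)) / s \<le> (exp (- q * l s) - exp (- (2 * q) * l s)) / s"
        using s by (intro divide_right_mono) auto
      then show "(1 - exp (- q)) * (exp (- q * l s) / s) \<le> exp (- q * l s) / s - exp (- (2 * q) * l s) / s"
        by (simp only: diff_divide_distrib[symmetric] times_divide_eq_right mult.commute)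
    qed
    also have "\<dots> = Lam l q 1 - Lam l (2 * q) 1" unfolding Lam_def by (rule set_integral_diff(2)[OF iL iL2])
    finally have "(1 - exp (- q)) * Lam l q 1 \<le> 2 * B" using D A0 by linarith
    then have "Lam l q 1 \<le> 2 * B / (1 - exp (- q))" using c by (simp add: pos_le_divide_eq mult.commute)
    then show ?thesis using n1 B0 by linarith
  qed
qed

text \<open>Half of the exponent is spent on a factor that is small when \<open>l t\<close> is
  large; the other half keeps the integral convergent.\<close>

lemma Lam_half_bound:
  assumes h: "hist l" and q: "q > 0" and t: "t > 0"
  shows "Lam l q t \<le> exp (- (q / 2) * l t) * Lam l (q / 2) t"
proof -
  have q2: "q / 2 > 0" using q by simp
  have "Lam l q t \<le> (LBINT s:{t<..}. exp (- (q / 2) * l t) * (exp (- (q / 2) * l s) / s))"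
    unfolding Lam_def
  proof (rule set_integral_mono[OF histD(3)[OF h q t]])
    show "set_integrable lborel {t<..} (\<lambda>s. exp (- (q / 2) * l t) * (exp (- (q / 2) * l s) / s))" by (rule set_integrable_mult_right, rule histD(3)[OF h q2 t])
    fix s assume s: "s \<in> {t<..}"
    have "l t \<le> l s" using mono_onD[OF histD(1)[OF h], of t s] s t by auto
    then have "(q / 2) * l t \<le> (q / 2) * l s" using q2 by (intro mult_left_mono) auto
    then have "exp (- q * l s) \<le> exp (- (q / 2) * l t) * exp (- (q / 2) * l s)" by (simp add: exp_add[symmetric])
    then have "exp (- q * l s) / s \<le> exp (- (q / 2) * l t) * exp (- (q / 2) * l s) / s" using s t by (intro divide_right_mono) auto
    then show "exp (- q * l s) / s \<le> exp (- (q / 2) * l t) * (exp (- (q / 2) * l s) / s)" by simp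
  qed
  also have "\<dots> = exp (- (q / 2) * l t) * Lam l (q / 2) t" unfolding Lam_def by (rule set_integral_mult_right)
  finally show ?thesis .
qed

lemma Lam_le_1_plus:
  assumes h: "hist l" and q: "q > 0" and t: "t > 0"
  shows "Lam l q t \<le> Lam l q 1 + \<bar>ln t\<bar>"
proof (cases "t \<le> 1")
  case True
  have q0: "0 \<le> q" using q by simp
  have "Lam l q t = Wint l q t 1 + Lam l q 1" by (rule Lam_split(2)[OF histD(1)[OF h] t True q0 histD(3)[OF h q zero_less_one]])
  moreover have "Wint l q t 1 \<le> exp (- q * l t) * ln (1 / t)" by (rule Wint_bounds(3)[OF histD(1)[OF h] t True q0])
  moreover have "exp (- q * l t) * ln (1 / t) \<le> 1 * ln (1 / t)" using histD(2)[OF h t] q t True by (intro mult_right_mono) auto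
  ultimately show ?thesis using t by (simp add: ln_div)
next
  case False
  then have "Lam l q 1 = Wint l q 1 t + Lam l q t"
    using q by (intro Lam_split(2)[OF histD(1)[OF h]] histD(3)[OF h q t]) auto
  then show ?thesis using Wint_nonneg[of 1 l q t] by simp
qed

text \<open>Formally the derivative in \<open>t\<close> is \<open>(1 - exp (- q * l t)) / t\<close>,
  which is nonnegative.\<close>

lemma Lam_plus_ln_mono:
  assumes h: "mono_on {0<..} (l :: real \<Rightarrow> real)" "\<And>s. s > 0 \<Longrightarrow> 0 \<le> l s" and q: "q > 0" and t: "0 < s" "s \<le> t"
    and i: "set_integrable lborel {t<..} (\<lambda>s. exp (- q * l s) / s)"
  shows "Lam l q s + ln s \<le> Lam l q t + ln t"
proof -
  have q0: "0 \<le> q" using q by simp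
  have "Lam l q s = Wint l q s t + Lam l q t" by (rule Lam_split(2)[OF h(1) t q0 i])
  moreover have "Wint l q s t \<le> exp (- q * l s) * ln (t / s)" by (rule Wint_bounds(3)[OF h(1) t q0])
  moreover have "exp (- q * l s) * ln (t / s) \<le> 1 * ln (t / s)" using h(2)[OF t(1)] q t by (intro mult_right_mono) auto
  ultimately show ?thesis using t by (simp add: ln_div)
qed

text \<open>\<open>Lam l q t + ln t\<close> increases in \<open>t\<close> and starts from the limit
  \<open>- Kf l q\<close> at 0.\<close>

lemma Kf_ge: assumes h: "hist l" and q: "q > 0" and t: "t > 0" shows "- Kf l q \<le> Lam l q t + ln t"
proof (rule tendsto_upperbound[OF Lam_Kf_limit[OF h q]])
  show "\<forall>\<^sub>F s in at_right 0. Lam l q s + ln s \<le> Lam l q t + ln t"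
    unfolding eventually_at_right_field
    by (intro exI[of _ t] conjI t allI impI Lam_plus_ln_mono[OF histD(1,2)[OF h] q _ _ histD(3)[OF h q t]]) auto
qed simp

lemma integrable_inverse_ln_squared: "set_integrable lborel {exp 1<..} (\<lambda>s. 1 / (s * (ln s)\<^sup>2) :: real)"
proof -
  have "(\<integral>\<^sup>+x\<in>{exp 1..}. ennreal (1 / (x * (ln x)\<^sup>2)) \<partial>lborel) = ennreal (0 - (- 1 / ln (exp 1)))"
  proof (rule nn_integral_FTC_atLeast)
    fix x :: real assume x: "exp 1 \<le> x"
    then have x0: "0 < x" using less_le_trans[OF exp_gt_zero] by blast
    have "1 \<le> ln x" using x x0 by (simp add: ln_ge_iff)
    then show "((\<lambda>x. - 1 / ln x) has_real_derivative 1 / (x * (ln x)\<^sup>2)) (at x)"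
      using x0 by (auto intro!: derivative_eq_intros simp: power2_eq_square field_simps)
    show "0 \<le> 1 / (x * (ln x)\<^sup>2)" using x0 by simp
  next
    show "((\<lambda>x::real. - 1 / ln x) \<longlongrightarrow> 0) at_top" by real_asymp
  qed measurable
  then have fin: "(\<integral>\<^sup>+x\<in>{exp 1..}. ennreal (1 / (x * (ln x)\<^sup>2)) \<partial>lborel) < \<infinity>" by simp
  have "integrable lborel (\<lambda>x. indicator {exp 1..} x *\<^sub>R (1 / (x * (ln x)\<^sup>2)) :: real)"
  proof (rule integrableI_bounded)
    have "(\<integral>\<^sup>+x. ennreal (norm (indicator {exp 1..} x *\<^sub>R (1 / (x * (ln x)\<^sup>2)) :: real)) \<partial>lborel) = (\<integral>\<^sup>+x\<in>{exp 1..}. ennreal (1 / (x * (ln x)\<^sup>2)) \<partial>lborel)"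
    proof (rule nn_integral_cong)
      fix x :: real
      have "0 < x" if "exp 1 \<le> x" using less_le_trans[OF exp_gt_zero that] .
      then show "ennreal (norm (indicator {exp 1..} x *\<^sub>R (1 / (x * (ln x)\<^sup>2)) :: real)) = ennreal (1 / (x * (ln x)\<^sup>2)) * indicator {exp 1..} x"
        by (auto simp: indicator_def)
    qed
    then show "(\<integral>\<^sup>+x. ennreal (norm (indicator {exp 1..} x *\<^sub>R (1 / (x * (ln x)\<^sup>2)) :: real)) \<partial>lborel) < \<infinity>" using fin by simp
  qed measurable
  then have "set_integrable lborel {exp 1..} (\<lambda>s. 1 / (s * (ln s)\<^sup>2) :: real)" by (simp add: set_integrable_def)
  then show ?thesis by (rule set_integrable_subset) auto
qed

text \<open>Up to time \<open>s\<close> the exponential is at least its value at \<open>s\<close>,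
  and \<open>ds / s\<close> gives the times between 1 and \<open>s\<close> the mass
  \<open>ln s\<close>.\<close>

lemma exp_le_inverse_ln:
  assumes h: "hist l" and q: "q > 0" and s: "s > 1"
  shows "exp (- q * l s) * ln s \<le> Lam l q 1"
proof -
  have q0: "0 \<le> q" and s1: "1 \<le> s" and s0: "0 < s" using q s by auto
  have "exp (- q * l s) * ln (s / 1) \<le> Wint l q 1 s" by (rule Wint_bounds(2)[OF histD(1)[OF h] zero_less_one s1 q0])
  moreover have "Lam l q 1 = Wint l q 1 s + Lam l q s"
    by (rule Lam_split(2)[OF histD(1)[OF h] zero_less_one s1 q0 histD(3)[OF h q s0]])
  moreover have "0 \<le> Lam l q s" using s0 by (intro Lam_nonneg) simp
  ultimately show ?thesis by simp
qed

text \<open>The available bound is \<open>exp (- (q / 2) * L n s) \<le> B / ln s\<close>. Divided by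
  \<open>s\<close> its first power is not integrable at infinity but its square is, which is why the
  hypothesis is placed at \<open>q / 2\<close>.\<close>

lemma Lam_dominated:
  assumes h: "\<And>n. hist (L n)" and q: "q > 0" and t: "t > 0" and B: "\<And>n. Lam (L n) (q / 2) 1 \<le> B"
    and l: "mono_on {0<..} (l :: real \<Rightarrow> real)" and lim: "AE s in lborel. s > 0 \<longrightarrow> (\<lambda>n. exp (- q * L n s)) \<longlonglongrightarrow> exp (- q * l s)"
  shows "set_integrable lborel {t<..} (\<lambda>s. exp (- q * l s) / s)" "(\<lambda>n. Lam (L n) q t) \<longlonglongrightarrow> Lam l q t"
proof -
  define w where "w s = indicator {t<..max t (exp 1)} s *\<^sub>R (1 / s) + indicator {exp 1<..} s *\<^sub>R (B\<^sup>2 * (1 / (s * (ln s)\<^sup>2)))" for s :: real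
  have "integrable lborel (\<lambda>s. indicator {t<..max t (exp 1)} s *\<^sub>R (1 / s) :: real)"
    using integral_inverse_Ioc(1)[OF t, of "max t (exp 1)"] by (simp add: set_integrable_def)
  moreover have "integrable lborel (\<lambda>s. indicator {exp 1<..} s *\<^sub>R (B\<^sup>2 * (1 / (s * (ln s)\<^sup>2))) :: real)"
    using set_integrable_mult_right[OF integrable_inverse_ln_squared, of "B\<^sup>2"] by (simp add: set_integrable_def)
  ultimately have iw: "integrable lborel w" unfolding w_def[abs_def] by (rule Bochner_Integration.integrable_add)
  have q2: "q / 2 > 0" using q by simp
  have bound: "norm (indicator {t<..} s *\<^sub>R (exp (- q * L n s) / s)) \<le> w s" for n s
  proof (cases "t < s")
    case True
    then have s0: "s > 0" using t by simp
    show ?thesis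
    proof (cases "s \<le> max t (exp 1)")
      case le: True
      have "exp (- q * L n s) / s \<le> 1 / s" using histD(2)[OF h s0, of n] q s0 by (intro divide_right_mono) auto
      moreover have "0 \<le> indicator {exp 1<..} s *\<^sub>R (B\<^sup>2 * (1 / (s * (ln s)\<^sup>2)))" using s0 by (simp add: indicator_def)
      ultimately show ?thesis using True le s0 by (simp add: w_def)
    next
      case False
      then have s1: "exp 1 < s" by simp
      have "1 < s" using s1 less_trans[of 1 "exp 1 :: real" s] by simp
      have ln0: "0 < ln s" using \<open>1 < s\<close> by simp
      have "exp (- (q / 2) * L n s) * ln s \<le> B" using exp_le_inverse_ln[OF h q2 \<open>1 < s\<close>, of n] B[of n] by linarith
      then have e: "exp (- (q / 2) * L n s) \<le> B / ln s" using ln0 by (simp add: pos_le_divide_eq)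
      have "exp (- q * L n s) = (exp (- (q / 2) * L n s))\<^sup>2" by (simp add: power2_eq_square exp_add[symmetric])
      also have "\<dots> \<le> (B / ln s)\<^sup>2" using e by (intro power_mono) auto
      finally have "exp (- q * L n s) / s \<le> (B / ln s)\<^sup>2 / s" using s0 by (intro divide_right_mono) auto
      also have "\<dots> = B\<^sup>2 * (1 / (s * (ln s)\<^sup>2))" by (simp add: power_divide)
      finally show ?thesis using True s1 False s0 by (simp add: w_def)
    qed
  next
    case False
    have "0 \<le> w s" unfolding w_def using t less_trans[OF exp_gt_zero, of 1 s] by (auto simp: indicator_def)
    then show ?thesis using False by simp
  qed
  have ml: "(\<lambda>s. indicator {t<..} s *\<^sub>R (exp (- q * l s) / s)) \<in> borel_measurable lborel"
    using Wint_measurable(2)[OF l t, of q] by (simp add: set_borel_measurable_def)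
  have mL: "(\<lambda>s. indicator {t<..} s *\<^sub>R (exp (- q * L n s) / s)) \<in> borel_measurable lborel" for n
    using histD(3)[OF h q t, of n] by (simp add: set_integrable_def)
  have conv: "AE s in lborel. (\<lambda>n. indicator {t<..} s *\<^sub>R (exp (- q * L n s) / s)) \<longlonglongrightarrow> indicator {t<..} s *\<^sub>R (exp (- q * l s) / s)"
    using lim
  proof eventually_elim
    case (elim s)
    show ?case
    proof (cases "t < s")
      case True
      then have "(\<lambda>n. exp (- q * L n s)) \<longlonglongrightarrow> exp (- q * l s)" using elim t by simp
      then have "(\<lambda>n. exp (- q * L n s) / s) \<longlonglongrightarrow> exp (- q * l s) / s" using True t by (intro tendsto_divide tendsto_const) auto
      then show ?thesis using True by simp
    qed simp
  qed
  show "set_integrable lborel {t<..} (\<lambda>s. exp (- q * l s) / s)"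
    unfolding set_integrable_def by (rule integrable_dominated_convergence[OF ml mL iw conv AE_I2[OF bound]])
  show "(\<lambda>n. Lam (L n) q t) \<longlonglongrightarrow> Lam l q t"
    unfolding Lam_def set_lebesgue_integral_def by (rule integral_dominated_convergence[OF ml mL iw conv AE_I2[OF bound]])
qed

text \<open>Helly's theorem yields a limit for which degenerations remain to be excluded:
  \<open>K0\<close> prevents it from being infinite, \<open>KC\<close> prevents a part of
  \<open>Kf\<close> from concentrating at time 0, and \<open>K1\<close> prevents it from vanishing
  on an initial interval. The identity \<open>Kf l q = K q\<close> is obtained from the limit of
  \<open>Lam l q t + ln t\<close> at 0.\<close>

lemma history_compactness:
  fixes L :: "nat \<Rightarrow> real \<Rightarrow> real" and K :: "real \<Rightarrow> real"
  assumes h: "\<And>n. hist (L n)" and rc: "\<And>n s. s > 0 \<Longrightarrow> continuous (at_right s) (L n)"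
    and K: "\<And>q. q > 0 \<Longrightarrow> (\<lambda>n. Kf (L n) q) \<longlonglongrightarrow> K q"
    and K0: "filterlim K at_bot (at_right 0)" and K1: "filterlim K at_top at_top"
    and KC: "C > 0" "\<And>q. q \<ge> 1 \<Longrightarrow> K q \<le> ln (C * q)"
  obtains r l where "strict_mono r" "hist l" "\<And>s. s > 0 \<Longrightarrow> 0 < l s" "\<And>s. s > 0 \<Longrightarrow> continuous (at_right s) l"
    "\<And>q t. q > 0 \<Longrightarrow> t > 0 \<Longrightarrow> (\<lambda>n. Lam (L (r n)) q t) \<longlonglongrightarrow> Lam l q t"
    "\<And>q. q > 0 \<Longrightarrow> Kf l q = K q"
proof -
  have bd: "\<exists>B. \<forall>n. Lam (L n) q 1 \<le> B" if q: "q > 0" for q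
  proof -
    have q2: "2 * q > 0" using q by simp
    have "Bseq (\<lambda>n. Kf (L n) q)" "Bseq (\<lambda>n. Kf (L n) (2 * q))"
      by (rule convergent_imp_Bseq, rule convergentI, rule K; use q in simp)+
    then obtain B1 B2 where "\<And>n. norm (Kf (L n) q) \<le> B1" "\<And>n. norm (Kf (L n) (2 * q)) \<le> B2" unfolding Bseq_def by auto
    then have b: "\<bar>Kf (L n) q\<bar> \<le> max B1 B2" "\<bar>Kf (L n) (2 * q)\<bar> \<le> max B1 B2" for n
      unfolding real_norm_def by (simp_all add: le_max_iff_disj)
    show ?thesis using parts_bound[OF h q b] by blast
  qed
  define Bd where "Bd q = (SOME B. \<forall>n. Lam (L n) q 1 \<le> B)" for q
  have Bd: "Lam (L n) q 1 \<le> Bd q" if "q > 0" for q n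
    using someI_ex[OF bd[OF that]] unfolding Bd_def by blast
  \<comment> \<open>Logarithmic time turns the half-line into the line, and
    \<open>1 - exp (- x)\<close> makes the histories bounded, as Helly's theorem requires.\<close>
  define u where "u n x = 1 - exp (- L n (exp x))" for n x
  have u01: "0 \<le> u n x" "u n x < 1" for n x using histD(2)[OF h[of n], of "exp x"] by (auto simp: u_def)
  have "\<exists>s. strict_mono s \<and> (\<exists>U. (\<forall>x. continuous (at_right x) U) \<and> mono U \<and> (\<forall>x. \<bar>U x\<bar> \<le> 1) \<and> (\<forall>x. continuous (at x) U \<longrightarrow> (\<lambda>n. u (s n) x) \<longlonglongrightarrow> U x))"
  proof (rule Helly_selection)
    show "\<bar>u n x\<bar> \<le> 1" for n x using u01[of n x] by simp
    show "mono (u n)" for n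
    proof (rule monoI)
      fix x y :: real assume "x \<le> y"
      then have "L n (exp x) \<le> L n (exp y)" using mono_onD[OF histD(1)[OF h[of n]], of "exp x" "exp y"] by simp
      then show "u n x \<le> u n y" by (simp add: u_def)
    qed
    show "continuous (at_right x) (u n)" for n x
    proof -
      have "(L n \<longlongrightarrow> L n (exp x)) (at_right (exp x))" using rc[of "exp x" n] by (simp add: continuous_within)
      moreover have "filterlim exp (at_right (exp x)) (at_right x)"
        unfolding filterlim_at
      proof
        show "\<forall>\<^sub>F y in at_right x. exp y \<in> {exp x<..} \<and> exp y \<noteq> exp x" by (auto simp: eventually_at_filter)
        show "(exp \<longlongrightarrow> exp x) (at_right x)" by (intro tendsto_intros)
      qed
      ultimately have "((\<lambda>y. L n (exp y)) \<longlongrightarrow> L n (exp x)) (at_right x)" by (rule filterlim_compose)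
      then show ?thesis unfolding continuous_within u_def by (intro tendsto_intros)
    qed
  qed
  then obtain r U where r: "strict_mono r" and Urc: "\<And>x. continuous (at_right x) U" and Um: "mono U"
    and Ub: "\<And>x. \<bar>U x\<bar> \<le> 1" and Uc: "\<And>x. isCont U x \<Longrightarrow> (\<lambda>n. u (r n) x) \<longlonglongrightarrow> U x" by blast
  have cD: "countable {x. \<not> isCont U x}" by (rule mono_ctble_discont[OF Um])
  have pick: "\<exists>z. x < z \<and> z < y \<and> isCont U z" if "x < y" for x y
  proof -
    have "uncountable {x<..<y}" using that by (simp add: uncountable_open_interval)
    then have "\<not> {x<..<y} \<subseteq> {x. \<not> isCont U x}" using cD countable_subset by blast
    then show ?thesis by auto
  qed
  have U0: "0 \<le> U x" for x
  proof -
    obtain z where z: "x - 1 < z" "z < x" "isCont U z" using pick[of "x - 1" x] by auto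
    have "0 \<le> U z" by (rule LIMSEQ_le_const[OF Uc[OF z(3)]]) (use u01 in auto)
    then show ?thesis using monoD[OF Um, of z x] z by simp
  qed
  have Kr: "(\<lambda>n. Kf (L (r n)) q) \<longlonglongrightarrow> K q" if "q > 0" for q
    using LIMSEQ_subseq_LIMSEQ[OF K[OF that] r] by (simp add: comp_def)
  \<comment> \<open>If \<open>U x = 1\<close>, the histories tend to infinity from some time
    \<open>exp z\<close> on, so \<open>Lam\<close> at that time tends to 0 for every
    \<open>q\<close>. Then \<open>- K q \<le> z\<close> for all \<open>q\<close>, against
    \<open>K0\<close>.\<close>
  have U1: "U x < 1" for x
  proof (rule ccontr)
    assume "\<not> U x < 1"
    then have Ux: "U x = 1" using Ub[of x] by simp
    obtain z where z: "x < z" "isCont U z" using pick[of x "x + 1"] by auto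
    have Uz: "U z = 1" using monoD[OF Um, of x z] z Ux Ub[of z] by simp
    let ?T = "exp z"
    have "(\<lambda>n. 1 - u (r n) z) \<longlonglongrightarrow> 1 - U z" by (intro tendsto_intros Uc z)
    then have e0: "(\<lambda>n. exp (- L (r n) ?T)) \<longlonglongrightarrow> 0" by (simp add: u_def Uz)
    have "- K q \<le> z" if q: "q > 0" for q
    proof -
      have q2: "q / 2 > 0" using q by simp
      have "(\<lambda>n. exp (- L (r n) ?T) powr (q / 2)) \<longlonglongrightarrow> 0" using tendsto_powr2[OF e0 tendsto_const[of "q/2"]] q2 by simp
      then have "(\<lambda>n. exp (- (q / 2) * L (r n) ?T)) \<longlonglongrightarrow> 0" by (simp add: powr_def mult.commute)
      then have lim: "(\<lambda>n. exp (- (q / 2) * L (r n) ?T) * (Bd (q / 2) + \<bar>z\<bar>) + z) \<longlonglongrightarrow> 0 * (Bd (q / 2) + \<bar>z\<bar>) + z" by (intro tendsto_intros)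
      have b: "- Kf (L (r n)) q \<le> exp (- (q / 2) * L (r n) ?T) * (Bd (q / 2) + \<bar>z\<bar>) + z" for n
      proof -
        have "- Kf (L (r n)) q \<le> Lam (L (r n)) q ?T + ln ?T" by (rule Kf_ge[OF h q]) simp
        also have "Lam (L (r n)) q ?T \<le> exp (- (q / 2) * L (r n) ?T) * Lam (L (r n)) (q / 2) ?T" by (rule Lam_half_bound[OF h q]) simp
        also have "\<dots> \<le> exp (- (q / 2) * L (r n) ?T) * (Bd (q / 2) + \<bar>z\<bar>)"
          using Lam_le_1_plus[OF h q2, of ?T "r n"] Bd[OF q2, of "r n"] by (intro mult_left_mono) auto
        finally show ?thesis by simp
      qed
      have "(\<lambda>n. - Kf (L (r n)) q) \<longlonglongrightarrow> - K q" by (intro tendsto_intros Kr q)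
      from LIMSEQ_le[OF this lim] show ?thesis using b by simp
    qed
    moreover have "\<forall>\<^sub>F q in at_right 0. K q \<le> - z - 1" using K0 by (simp add: filterlim_at_bot)
    from eventually_happens'[OF _ eventually_conj[OF eventually_unit_at_right this]]
    obtain q where "q > 0" "K q \<le> - z - 1" by auto
    ultimately show False using \<open>\<And>q. q > 0 \<Longrightarrow> - K q \<le> z\<close>[of q] by linarith
  qed
  define l where "l s = - ln (1 - U (ln s))" for s
  have el: "exp (- l s) = 1 - U (ln s)" for s using U1[of "ln s"] by (simp add: l_def)
  have l0: "0 \<le> l s" for s using U1[of "ln s"] U0[of "ln s"] by (simp add: l_def)
  have lm: "mono_on {0<..} l"
  proof (rule mono_onI)
    fix s t :: real assume st: "s \<in> {0<..}" "t \<in> {0<..}" "s \<le> t"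
    then have "U (ln s) \<le> U (ln t)" by (intro monoD[OF Um]) simp
    then have "ln (1 - U (ln t)) \<le> ln (1 - U (ln s))" using U1[of "ln t"] U1[of "ln s"] by simp
    then show "l s \<le> l t" by (simp add: l_def)
  qed
  have lrc: "continuous (at_right s) l" if s: "s > 0" for s
  proof -
    have "(U \<longlongrightarrow> U (ln s)) (at_right (ln s))" using Urc[of "ln s"] by (simp add: continuous_within)
    moreover have "filterlim ln (at_right (ln s)) (at_right s)"
      unfolding filterlim_at
    proof
      show "\<forall>\<^sub>F y in at_right s. ln y \<in> {ln s<..} \<and> ln y \<noteq> ln s" using s by (auto simp: eventually_at_filter)
      show "(ln \<longlongrightarrow> ln s) (at_right s)" using s by (intro tendsto_intros) auto
    qed
    ultimately have "((\<lambda>y. U (ln y)) \<longlongrightarrow> U (ln s)) (at_right s)" by (rule filterlim_compose)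
    then show ?thesis unfolding continuous_within l_def using U1[of "ln s"] by (intro tendsto_intros) auto
  qed
  have elim: "(\<lambda>n. exp (- L (r n) s)) \<longlonglongrightarrow> exp (- l s)" if "s > 0" "isCont U (ln s)" for s
  proof -
    have "(\<lambda>n. 1 - u (r n) (ln s)) \<longlonglongrightarrow> 1 - U (ln s)" by (intro tendsto_intros Uc that)
    then show ?thesis using that by (simp add: u_def el)
  qed
  have elimq: "(\<lambda>n. exp (- q * L (r n) s)) \<longlonglongrightarrow> exp (- q * l s)" if "s > 0" "isCont U (ln s)" for s q
  proof -
    have "(\<lambda>n. exp (- L (r n) s) powr q) \<longlonglongrightarrow> exp (- l s) powr q" by (intro tendsto_powr elim that tendsto_const) simp
    then show ?thesis by (simp add: powr_def mult.commute)
  qed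
  have AEc: "AE s in lborel. s > 0 \<longrightarrow> isCont U (ln s)"
  proof -
    have "countable (exp ` {x. \<not> isCont U x})" using cD by (rule countable_image)
    then have "exp ` {x. \<not> isCont U x} \<in> null_sets lborel" by (rule countable_imp_null_set_lborel)
    from AE_not_in[OF this] show ?thesis
    proof eventually_elim
      case (elim s)
      show ?case
      proof (intro impI, rule ccontr)
        assume "s > 0" "\<not> isCont U (ln s)"
        then have "exp (ln s) \<in> exp ` {x. \<not> isCont U x}" by blast
        then show False using elim \<open>s > 0\<close> by simp
      qed
    qed
  qed
  have AEq: "AE s in lborel. s > 0 \<longrightarrow> (\<lambda>n. exp (- q * L (r n) s)) \<longlonglongrightarrow> exp (- q * l s)" for q
    using AEc by eventually_elim (use elimq in blast)
  have Lc: "set_integrable lborel {t<..} (\<lambda>s. exp (- q * l s) / s)" "(\<lambda>n. Lam (L (r n)) q t) \<longlonglongrightarrow> Lam l q t" if q: "q > 0" and t: "t > 0" for q t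
  proof -
    have q2: "q / 2 > 0" using q by simp
    show "set_integrable lborel {t<..} (\<lambda>s. exp (- q * l s) / s)" "(\<lambda>n. Lam (L (r n)) q t) \<longlonglongrightarrow> Lam l q t"
      by (rule Lam_dominated[where L="\<lambda>n. L (r n)", OF h q t Bd[OF q2] lm AEq])+
  qed
  \<comment> \<open>\<open>P q d\<close> is the limit of the contributions of \<open>{0<..d}\<close>
    to \<open>Kf (L (r n)) q\<close>. That it vanishes as \<open>d\<close> tends to 0 means that
    nothing concentrates at time 0.\<close>
  define P where "P q d = K q + Lam l q d + ln d" for q d
  define Pn where "Pn n q d = (LBINT s:{0<..d}. (1 - exp (- q * L (r n) s)) / s)" for n q d
  have Plim: "(\<lambda>n. Pn n q d) \<longlonglongrightarrow> P q d" if "q > 0" "0 < d" "d \<le> 1" for q d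
    unfolding Pn_def P_def small_part_eq(1)[OF h that] by (intro tendsto_intros Kr Lc that)
  have P0: "0 \<le> P q d" if "q > 0" "0 < d" "d \<le> 1" for q d
    by (rule LIMSEQ_le_const[OF Plim[OF that]]) (use small_part_eq(4)[OF h that] in \<open>auto simp: Pn_def\<close>)
  have Pmono: "P q d \<le> P q d'" if "q > 0" "0 < d" "d \<le> d'" for q d d'
    unfolding P_def using Lam_plus_ln_mono[OF lm l0 that(1,2,3) Lc(1)[OF that(1)]] that by simp
  \<comment> \<open>The times between \<open>d\<close> and 1 contribute at least
    \<open>u (r n) (ln d) * ln (1 / d)\<close>; boundedness of the contribution forces
    \<open>U\<close> to be small at early times.\<close>
  have Ubound: "U (ln d) * ln (1 / d) \<le> K 1 + Bd 1" if d: "0 < d" "d < 1" "isCont U (ln d)" for d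
  proof -
    have b: "u (r n) (ln d) * ln (1 / d) \<le> Kf (L (r n)) 1 + Bd 1" for n
    proof -
      note hn = h[of "r n"]
      have "(1 - exp (- 1 * L (r n) d)) * ln (1 / d) \<le> (LBINT s:{d<..1}. (1 - exp (- 1 * L (r n) s)) / s)"
      proof (rule set_integral_over_id_between(1)[OF d(1) less_imp_le[OF d(2)] history_small_measurable[OF histD(1)[OF hn]], where B=1])
        fix s :: real assume "d < s"
        then have "L (r n) d \<le> L (r n) s" using mono_onD[OF histD(1)[OF hn], of d s] d by auto
        then show "1 - exp (- 1 * L (r n) d) \<le> 1 - exp (- 1 * L (r n) s)" by simp
      qed (use d in auto)
      also have "\<dots> \<le> (LBINT s:{0<..1}. (1 - exp (- 1 * L (r n) s)) / s)"
        by (rule set_integral_subset_le[OF histD(4)[OF hn]]) (use d histD(2)[OF hn] in auto)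
      also have "\<dots> \<le> Kf (L (r n)) 1 + Lam (L (r n)) 1 1" by (rule small_part_eq(3)[OF hn]) auto
      also have "\<dots> \<le> Kf (L (r n)) 1 + Bd 1" using Bd[of 1 "r n"] by simp
      finally show ?thesis using d by (simp add: u_def)
    qed
    have "(\<lambda>n. u (r n) (ln d) * ln (1 / d)) \<longlonglongrightarrow> U (ln d) * ln (1 / d)" "(\<lambda>n. Kf (L (r n)) 1 + Bd 1) \<longlonglongrightarrow> K 1 + Bd 1"
      by (intro tendsto_intros Uc d Kr; simp)+
    from LIMSEQ_le[OF this] show ?thesis using b by blast
  qed
  have small_l: "\<exists>d0>0. \<forall>d. 0 < d \<longrightarrow> d < d0 \<longrightarrow> l d \<le> e" if e: "e > 0" for e
  proof -
    \<comment> \<open>Large enough that \<open>U z * M \<le> \<bar>K 1 + Bd 1\<bar>\<close> yields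
      \<open>U z \<le> 1 - exp (- e)\<close>, that is, \<open>l \<le> e\<close> before the time
      \<open>exp z\<close>.\<close>
    define M where "M = \<bar>K 1 + Bd 1\<bar> / (1 - exp (- e)) + 1"
    have ce: "0 < 1 - exp (- e)" using e by simp
    have M0: "M > 0" using ce by (simp add: M_def add_nonneg_pos)
    obtain z where z: "- M - 1 < z" "z < - M" "isCont U z" using pick[of "- M - 1" "- M"] by auto
    have "U z * (- z) \<le> \<bar>K 1 + Bd 1\<bar>" using Ubound[of "exp z"] z M0 by (simp add: ln_div)
    moreover have "U z * M \<le> U z * (- z)" using z U0[of z] by (intro mult_left_mono) auto
    ultimately have "U z * M \<le> \<bar>K 1 + Bd 1\<bar>" by linarith
    also have "\<dots> \<le> (1 - exp (- e)) * M" using ce by (simp add: M_def distrib_left)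
    finally have Uz: "U z \<le> 1 - exp (- e)" using M0 by simp
    have "l d \<le> e" if d: "0 < d" "d < exp z" for d
    proof -
      have "ln d < ln (exp z)" using d by (subst ln_less_cancel_iff) auto
      then have "U (ln d) \<le> U z" by (intro monoD[OF Um]) simp
      then have "exp (- e) \<le> exp (- l d)" unfolding el using Uz by linarith
      then show ?thesis by simp
    qed
    then show ?thesis by (intro exI[of _ "exp z"]) auto
  qed
  \<comment> \<open>For a large auxiliary \<open>Q\<close> and \<open>d\<close> so small that
    \<open>Q * l d \<le> 1\<close>, the integrand at \<open>q\<close> is at most a constant times
    \<open>q / Q\<close> times the integrand at \<open>Q\<close>. By \<open>KC\<close> the
    contribution at \<open>Q\<close> is at most \<open>ln (C * Q)\<close> plus a constant, so the
    factor \<open>1 / Q\<close> wins.\<close>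
  have Psmall: "\<exists>d>0. d \<le> 1 \<and> P q d \<le> e" if q: "q > 0" and e: "e > 0" for q e
  proof -
    have "((\<lambda>Q. (q / Q) * (exp 1 * (ln (C * Q) + Bd 1))) \<longlongrightarrow> 0) at_top" using KC(1) q by real_asymp
    then have "\<forall>\<^sub>F Q in at_top. (q / Q) * (exp 1 * (ln (C * Q) + Bd 1)) < e" using e by (intro order_tendstoD(2)) auto
    from eventually_happens'[OF _ eventually_conj[OF this eventually_ge_at_top[of 1]]]
    obtain Q where Q: "(q / Q) * (exp 1 * (ln (C * Q) + Bd 1)) < e" "Q \<ge> 1" by auto
    have Q0: "Q > 0" using Q by simp
    obtain d0 where d0: "d0 > 0" "\<And>d. 0 < d \<Longrightarrow> d < d0 \<Longrightarrow> l d \<le> 1 / Q" using small_l[of "1 / Q"] Q0 by auto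
    obtain z where z: "ln (min d0 1) - 1 < z" "z < ln (min d0 1)" "isCont U z" using pick[of "ln (min d0 1) - 1" "ln (min d0 1)"] by auto
    define d where "d = exp z"
    have "exp z < exp (ln (min d0 1))" using z by simp
    then have d: "0 < d" "d < d0" "d \<le> 1" "isCont U (ln d)" using d0(1) z by (auto simp: d_def)
    have Qd: "Q * l d \<le> 1" using d0(2)[OF d(1,2)] Q0 by (simp add: field_simps)
    have b: "Pn n q d \<le> (q / Q) * (exp (Q * L (r n) d) * (Kf (L (r n)) Q + Bd 1))" for n
    proof -
      note hn = h[of "r n"]
      let ?c = "(q / Q) * exp (Q * L (r n) d)"
      have "Pn n q d \<le> (LBINT s:{0<..d}. ?c * ((1 - exp (- Q * L (r n) s)) / s))"
        unfolding Pn_def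
      proof (rule set_integral_mono)
        show "set_integrable lborel {0<..d} (\<lambda>s. (1 - exp (- q * L (r n) s)) / s)" by (rule small_part_eq(2)[OF hn q d(1,3)])
        show "set_integrable lborel {0<..d} (\<lambda>s. ?c * ((1 - exp (- Q * L (r n) s)) / s))" by (rule set_integrable_mult_right, rule small_part_eq(2)[OF hn Q0 d(1,3)])
        fix s assume s: "s \<in> {0<..d}"
        define x where "x = L (r n) s"
        have x0: "0 \<le> x" using histD(2)[OF hn] s by (simp add: x_def)
        have xd: "x \<le> L (r n) d" using mono_onD[OF histD(1)[OF hn], of s d] s d by (auto simp: x_def)
        have 1: "1 - exp (- q * x) \<le> (q / Q) * (Q * x)" using exp_ge_add_one_self[of "- q * x"] Q0 by simp
        have e: "exp (Q * x) * exp (- Q * x) = 1" by (simp add: exp_add[symmetric])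
        have "Q * x \<le> exp (Q * x) * (1 - exp (- Q * x))"
          using exp_ge_add_one_self[of "Q * x"] unfolding right_diff_distrib e by linarith
        also have "\<dots> \<le> exp (Q * L (r n) d) * (1 - exp (- Q * x))" using xd x0 Q0 by (intro mult_right_mono) auto
        finally have "(q / Q) * (Q * x) \<le> (q / Q) * (exp (Q * L (r n) d) * (1 - exp (- Q * x)))"
          using q Q0 by (intro mult_left_mono) auto
        with 1 have "1 - exp (- q * x) \<le> (q / Q) * (exp (Q * L (r n) d) * (1 - exp (- Q * x)))" by linarith
        then have "(1 - exp (- q * x)) / s \<le> (q / Q) * (exp (Q * L (r n) d) * (1 - exp (- Q * x))) / s" using s by (intro divide_right_mono) auto
        then show "(1 - exp (- q * L (r n) s)) / s \<le> ?c * ((1 - exp (- Q * L (r n) s)) / s)" by (simp add: x_def mult.assoc)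
      qed
      also have "\<dots> = ?c * Pn n Q d" unfolding Pn_def by (rule set_integral_mult_right)
      also have "\<dots> \<le> ?c * (Kf (L (r n)) Q + Bd 1)"
      proof (rule mult_left_mono)
        have "Pn n Q d \<le> Kf (L (r n)) Q + Lam (L (r n)) Q 1" unfolding Pn_def by (rule small_part_eq(3)[OF hn Q0 d(1,3)])
        moreover have "Lam (L (r n)) Q 1 \<le> Lam (L (r n)) 1 1"
          by (rule Lam_antimono_q[OF histD(1,2)[OF hn] Q(2) zero_less_one histD(3)[OF hn] histD(3)[OF hn]]) (use Q0 in auto)
        ultimately show "Pn n Q d \<le> Kf (L (r n)) Q + Bd 1" using Bd[of 1 "r n"] by simp
      qed (use q Q0 in auto)
      finally show ?thesis by (simp add: mult.assoc)
    qed
    have eQ: "(\<lambda>n. exp (Q * L (r n) d)) \<longlonglongrightarrow> exp (Q * l d)" using elimq[OF d(1,4), of "- Q"] by simp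
    have "(\<lambda>n. (q / Q) * (exp (Q * L (r n) d) * (Kf (L (r n)) Q + Bd 1))) \<longlonglongrightarrow> (q / Q) * (exp (Q * l d) * (K Q + Bd 1))"
      by (intro tendsto_intros eQ Kr Q0)
    from LIMSEQ_le[OF Plim[OF q d(1,3)] this] have Pb: "P q d \<le> (q / Q) * (exp (Q * l d) * (K Q + Bd 1))" using b by blast
    \<comment> \<open>Nonnegativity is needed to multiply the bounds for the two factors.\<close>
    have KQ: "0 \<le> K Q + Bd 1"
    proof (rule LIMSEQ_le_const[where X="\<lambda>n. Kf (L (r n)) Q + Bd 1"])
      show "(\<lambda>n. Kf (L (r n)) Q + Bd 1) \<longlonglongrightarrow> K Q + Bd 1" by (intro tendsto_intros Kr Q0)
      have "0 \<le> Kf (L (r n)) Q + Bd 1" for n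
      proof -
        note hn = h[of "r n"]
        have "0 \<le> Kf (L (r n)) Q + Lam (L (r n)) Q 1" using small_part_eq(3,4)[OF hn Q0, of 1] by simp
        moreover have "Lam (L (r n)) Q 1 \<le> Lam (L (r n)) 1 1"
          by (rule Lam_antimono_q[OF histD(1,2)[OF hn] Q(2) zero_less_one histD(3)[OF hn] histD(3)[OF hn]]) (use Q0 in auto)
        ultimately show ?thesis using Bd[of 1 "r n"] by simp
      qed
      then show "\<exists>N. \<forall>n\<ge>N. 0 \<le> Kf (L (r n)) Q + Bd 1" by blast
    qed
    have "exp (Q * l d) * (K Q + Bd 1) \<le> exp 1 * (ln (C * Q) + Bd 1)"
      using Qd KC(2)[OF Q(2)] KQ by (intro mult_mono) auto
    then have "(q / Q) * (exp (Q * l d) * (K Q + Bd 1)) \<le> (q / Q) * (exp 1 * (ln (C * Q) + Bd 1))" using q Q0 by (intro mult_left_mono) auto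
    then show ?thesis using Pb Q(1) d by (intro exI[of _ d]) auto
  qed
  have PL: "((\<lambda>t. Lam l q t + ln t) \<longlongrightarrow> - K q) (at_right 0)" if q: "q > 0" for q
  proof -
    have "((\<lambda>t. P q t) \<longlongrightarrow> 0) (at_right 0)"
    proof (rule tendstoI)
      fix e :: real assume "e > 0"
      then obtain d where d: "d > 0" "d \<le> 1" "P q d \<le> e / 2" using Psmall[OF q, of "e / 2"] by auto
      show "\<forall>\<^sub>F t in at_right 0. dist (P q t) 0 < e"
        unfolding eventually_at_right_field
      proof (intro exI[of _ d] conjI d allI impI)
        fix t assume t: "0 < t" "t < d"
        have "0 \<le> P q t" "P q t \<le> P q d" using P0[OF q t(1)] Pmono[OF q t(1), of d] t d by auto
        then show "dist (P q t) 0 < e" using d \<open>e > 0\<close> by (simp add: dist_real_def)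
      qed
    qed
    then have "((\<lambda>t. P q t - K q) \<longlongrightarrow> 0 - K q) (at_right 0)" by (intro tendsto_intros)
    then show ?thesis by (simp add: P_def)
  qed
  have hl: "hist l"
    unfolding hist_def
  proof (intro conjI allI impI lm l0)
    fix q :: real assume q: "q > 0"
    have q0: "0 \<le> q" using q by simp
    show "set_integrable lborel {1<..} (\<lambda>s. exp (- q * l s) / s)" by (rule Lc(1)[OF q zero_less_one])
    show "set_integrable lborel {0<..1} (\<lambda>s. (1 - exp (- q * l s)) / s)"
    proof (rule small_integrable_from_bound)
      show "set_borel_measurable lborel {0<..1} (\<lambda>s. (1 - exp (- q * l s)) / s)" by (rule history_small_measurable[OF lm]) simp
      show "set_integrable lborel {t<..1} (\<lambda>s. (1 - exp (- q * l s)) / s)" if "0 < t" for t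
        by (rule history_small_integrable[OF lm l0 q0 that])
      show "0 \<le> (1 - exp (- q * l s)) / s" if "0 < s" for s using l0[of s] q that by auto
      fix t :: real assume t: "0 < t"
      show "(LBINT s:{t<..1}. (1 - exp (- q * l s)) / s) \<le> \<bar>Lam l q 1 + K q\<bar>"
      proof (cases "t \<le> 1")
        case True
        have "Wint l q t 1 = - ln t - (LBINT s:{t<..1}. (1 - exp (- q * l s)) / s)" by (rule Wint_small[OF lm l0 q0 t True])
        moreover have "Lam l q t = Wint l q t 1 + Lam l q 1" by (rule Lam_split(2)[OF lm t True q0 Lc(1)[OF q zero_less_one]])
        ultimately show ?thesis using P0[OF q t True] by (simp add: P_def)
      next
        case False
        then have "{t<..1} = {}" by auto
        then show ?thesis by (simp add: set_lebesgue_integral_def)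
      qed
    qed
  qed
  have Keq: "Kf l q = K q" if q: "q > 0" for q
    using tendsto_unique[OF _ Lam_Kf_limit[OF hl q] PL[OF q]] by simp
  \<comment> \<open>A zero at \<open>T\<close> would be a zero at all earlier times by monotonicity,
    whence \<open>K q \<le> - ln T\<close> for every \<open>q\<close>, against
    \<open>K1\<close>.\<close>
  have lpos: "0 < l T" if T: "T > 0" for T
  proof (rule ccontr)
    assume "\<not> 0 < l T"
    then have lT: "l T = 0" using l0[of T] by simp
    have "ln T \<le> - K q" if q: "q > 0" for q
    proof (rule tendsto_lowerbound[OF PL[OF q]])
      show "\<forall>\<^sub>F t in at_right 0. ln T \<le> Lam l q t + ln t"
        unfolding eventually_at_right_field
      proof (intro exI[of _ T] conjI T allI impI)
        fix t assume t: "0 < t" "t < T"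
        have q0: "0 \<le> q" and tT: "t \<le> T" using q t by auto
        have "exp (- q * l T) * ln (T / t) \<le> Wint l q t T" by (rule Wint_bounds(2)[OF lm t(1) tT q0])
        moreover have "Lam l q t = Wint l q t T + Lam l q T" by (rule Lam_split(2)[OF lm t(1) tT q0 Lc(1)[OF q T]])
        moreover have "0 \<le> Lam l q T" using T by (intro Lam_nonneg) simp
        ultimately show "ln T \<le> Lam l q t + ln t" using t T by (simp add: lT ln_div)
      qed
    qed simp
    moreover have "\<forall>\<^sub>F q in at_top. - ln T + 1 \<le> K q" using K1 by (simp add: filterlim_at_top)
    from eventually_happens'[OF _ eventually_conj[OF this eventually_gt_at_top[of 0]]]
    obtain q where "- ln T + 1 \<le> K q" "q > 0" by auto
    ultimately show False using \<open>\<And>q. q > 0 \<Longrightarrow> ln T \<le> - K q\<close>[of q] by linarith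
  qed
  show ?thesis by (rule that[OF r hl lpos lrc Lc(2) Keq])
qed

section \<open>A clustering scheme on the lattice\<close>

definition gf :: "nat pmf \<Rightarrow> real \<Rightarrow> real" where
  "gf P z = (\<integral>x. z ^ x \<partial>measure_pmf P)"

lemma gf_integrable: assumes "0 \<le> z" "z \<le> 1" shows "integrable (measure_pmf P) (\<lambda>x::nat. z ^ x :: real)"
  by (rule measure_pmf.integrable_const_bound[where B=1]) (use assms in \<open>auto intro!: power_le_one\<close>)

lemma gf_bounds: assumes "0 \<le> z" "z \<le> 1" shows "0 \<le> gf P z" "gf P z \<le> 1"
proof -
  show "0 \<le> gf P z" unfolding gf_def using assms by (intro integral_nonneg_AE) auto
  show "gf P z \<le> 1" unfolding gf_def
    by (rule measure_pmf.integral_le_const[OF gf_integrable[OF assms]]) (use assms in \<open>auto intro!: power_le_one\<close>)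
qed

lemma ennreal_gf: assumes "0 \<le> z" "z \<le> 1" shows "ennreal (gf P z) = (\<integral>\<^sup>+x. ennreal (z ^ x) \<partial>measure_pmf P)"
  unfolding gf_def by (rule nn_integral_eq_integral[OF gf_integrable[OF assms], symmetric]) (use assms in auto)

lemma gf_bind: assumes z: "0 \<le> z" "z \<le> 1" shows "gf (bind_pmf P f) z = (\<integral>x. gf (f x) z \<partial>measure_pmf P)"
proof -
  have i: "integrable (measure_pmf P) (\<lambda>x. gf (f x) z)"
    by (rule measure_pmf.integrable_const_bound[where B=1]) (use gf_bounds[OF z] in auto)
  have "ennreal (gf (bind_pmf P f) z) = (\<integral>\<^sup>+x. ennreal (gf (f x) z) \<partial>measure_pmf P)"
    by (simp add: ennreal_gf[OF z])
  also have "\<dots> = ennreal (\<integral>x. gf (f x) z \<partial>measure_pmf P)"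
    by (rule nn_integral_eq_integral[OF i]) (use gf_bounds[OF z] in auto)
  finally show ?thesis using gf_bounds[OF z] by (subst (asm) ennreal_inj) (auto intro!: integral_nonneg_AE)
qed

lemma gf_return: "gf (return_pmf n) z = z ^ n" by (simp add: gf_def)

lemma gf_shift: "gf (map_pmf ((+) n) P) z = z ^ n * gf P z"
  by (simp add: gf_def power_add)

primrec nsum :: "nat \<Rightarrow> nat pmf \<Rightarrow> nat pmf" where
  "nsum 0 P = return_pmf 0"
| "nsum (Suc n) P = bind_pmf P (\<lambda>x. map_pmf ((+) x) (nsum n P))"

lemma gf_nsum: assumes z: "0 \<le> z" "z \<le> 1" shows "gf (nsum n P) z = gf P z ^ n"
proof (induction n)
  case (Suc n)
  have "gf (nsum (Suc n) P) z = (\<integral>x. z ^ x * gf P z ^ n \<partial>measure_pmf P)"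
    by (simp add: gf_bind[OF z] gf_shift Suc)
  also have "\<dots> = gf P z * gf P z ^ n" by (simp add: gf_def)
  finally show ?case by simp
qed (simp add: gf_return)

definition mini :: "nat pmf \<Rightarrow> nat" where "mini P = (LEAST j. j \<in> set_pmf P)"

lemma mini: "mini P \<in> set_pmf P" "j \<in> set_pmf P \<Longrightarrow> mini P \<le> j"
proof -
  obtain x where "x \<in> set_pmf P" using set_pmf_not_empty[of P] by blast
  then show "mini P \<in> set_pmf P" unfolding mini_def by (rule LeastI)
  show "j \<in> set_pmf P \<Longrightarrow> mini P \<le> j" unfolding mini_def by (rule Least_le)
qed

lemma gf_le_mini: assumes z: "0 \<le> z" "z \<le> 1" shows "gf P z \<le> z ^ mini P"
  unfolding gf_def
  by (rule measure_pmf.integral_le_const[OF gf_integrable[OF z]])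
     (use z in \<open>auto simp: AE_measure_pmf_iff intro!: power_decreasing mini(2)\<close>)

definition law :: "real \<Rightarrow> nat pmf \<Rightarrow> real measure" where
  "law h P = distr (measure_pmf P) borel (\<lambda>j. h * real j)"

lemma law: assumes h: "h > 0" shows "prob_Rplus (law h P)" "lap (law h P) q = gf P (exp (- q * h))"
proof -
  have m: "(\<lambda>j. h * real j) \<in> measurable (measure_pmf P) borel" by simp
  have "(\<lambda>j. h * real j) -` {..<0} = {}" using h by (auto simp: mult_less_0_iff)
  then have "emeasure (law h P) {..<0} = emeasure (measure_pmf P) {}"
    unfolding law_def by (subst emeasure_distr) auto
  then show "prob_Rplus (law h P)"
    using measure_pmf.prob_space_distr[OF m] by (simp add: prob_Rplus_def law_def)
  have "lap (law h P) q = (\<integral>j. exp (- q * (h * real j)) \<partial>measure_pmf P)"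
    unfolding lap_def law_def by (rule integral_distr[OF m]) simp
  also have "\<dots> = gf P (exp (- q * h))" unfolding gf_def
    by (intro Bochner_Integration.integral_cong refl) (simp add: exp_of_nat_mult[symmetric] algebra_simps)
  finally show "lap (law h P) q = gf P (exp (- q * h))" .
qed

section \<open>Generating functions of merging clusters and the single step\<close>

context clustering
begin

text \<open>Shifted by one: the weights are prescribed for \<open>k \<ge> 1\<close>, and the shift
  makes them a law on all natural numbers.\<close>

definition pS :: "nat pmf" where "pS = embed_pmf (\<lambda>k. p (Suc k))"

lemma pmf_pS: "pmf pS k = p (Suc k)"
  unfolding pS_def
proof (rule pmf_embed_pmf)
  show "0 \<le> p (Suc x)" for x by (rule p_nonneg)
  have "(\<integral>\<^sup>+x. ennreal (p (Suc x)) \<partial>count_space UNIV) = (\<Sum>x. ennreal (p (Suc x)))" by (rule nn_integral_count_space_nat)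
  also have "\<dots> = ennreal (\<Sum>x. p (Suc x))" by (rule suminf_ennreal2[OF p_nonneg sums_summable[OF p_sums]])
  also have "\<dots> = 1" using sums_unique[OF p_sums] by simp
  finally show "(\<integral>\<^sup>+x. ennreal (p (Suc x)) \<partial>count_space UNIV) = 1" .
qed

lemma pS_integral: assumes c: "0 \<le> c" "c \<le> 1" shows "(\<integral>k. c ^ Suc k \<partial>measure_pmf pS) = Qgen p c"
proof -
  have i: "integrable (measure_pmf pS) (\<lambda>k. c ^ Suc k)"
    by (rule measure_pmf.integrable_const_bound[where B=1]) (use c in \<open>auto intro!: power_le_one mult_le_one simp: abs_mult power_abs\<close>)
  note Qs = Q_sums[OF c]
  have nn: "0 \<le> p (Suc k) * c ^ Suc k" for k using p_nonneg[of k] c by simp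
  have "ennreal (\<integral>k. c ^ Suc k \<partial>measure_pmf pS) = (\<integral>\<^sup>+k. ennreal (c ^ Suc k) \<partial>measure_pmf pS)"
    by (rule nn_integral_eq_integral[OF i, symmetric]) (use c in auto)
  also have "\<dots> = (\<integral>\<^sup>+k. ennreal (p (Suc k) * c ^ Suc k) \<partial>count_space UNIV)"
    unfolding nn_integral_measure_pmf pmf_pS using p_nonneg by (intro nn_integral_cong) (simp add: ennreal_mult')
  also have "\<dots> = (\<Sum>k. ennreal (p (Suc k) * c ^ Suc k))" by (rule nn_integral_count_space_nat)
  also have "\<dots> = ennreal (\<Sum>k. p (Suc k) * c ^ Suc k)" by (rule suminf_ennreal2[OF nn sums_summable[OF Qs]])
  also have "\<dots> = ennreal (Qgen p c)" using sums_unique[OF Qs] by simp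
  finally show ?thesis using c Q_nonneg[OF c] by (subst (asm) ennreal_inj) (auto intro!: integral_nonneg_AE)
qed

definition qsum :: "nat pmf \<Rightarrow> nat pmf" where "qsum P = bind_pmf pS (\<lambda>k. nsum (Suc k) P)"

lemma gf_qsum: assumes z: "0 \<le> z" "z \<le> 1" shows "gf (qsum P) z = Qgen p (gf P z)"
  unfolding qsum_def gf_bind[OF z] gf_nsum[OF z] by (rule pS_integral[OF gf_bounds[OF z]])

lemma qsum_pos: assumes "0 \<notin> set_pmf P" "j \<in> set_pmf (qsum P)" shows "j \<ge> 1"
proof -
  obtain k x y where "x \<in> set_pmf P" "j = x + y" using assms(2) by (auto simp: qsum_def)
  then show ?thesis using assms(1) by (cases x) auto
qed

text \<open>A step moves mass at most \<open>e\<close>; when no more than that is left at the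
  minimum, all of it goes, so that the minimum advances.\<close>

definition rem :: "real \<Rightarrow> nat pmf \<Rightarrow> real" where "rem e P = min e (pmf P (mini P))"

text \<open>Each minimal cluster merges with the probability that makes the total merging mass
  \<open>rem e P\<close>. It keeps its own size and gains a \<open>qsum\<close>, as in the argument
  \<open>l + y_1 + ... + y_k\<close> of the weak equation.\<close>

definition step :: "real \<Rightarrow> nat pmf \<Rightarrow> nat pmf" where
  "step e P = bind_pmf P (\<lambda>x. if x = mini P
     then bind_pmf (bernoulli_pmf (rem e P / pmf P (mini P))) (\<lambda>b. if b then map_pmf ((+) (mini P)) (qsum P) else return_pmf x)
     else return_pmf x)"

lemma rem: assumes "e > 0" shows "0 < rem e P" "rem e P \<le> e" "rem e P \<le> pmf P (mini P)" "0 < pmf P (mini P)"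
  using assms pmf_positive[OF mini(1)[of P]] by (auto simp: rem_def)

text \<open>The Euler step for the equation satisfied by the transform, with \<open>rem e P\<close>
  in the place of \<open>ds / (Q1 p * s)\<close> and \<open>z ^ mini P\<close> in the place of
  \<open>exp (- q * l s)\<close>.\<close>

lemma gf_step:
  assumes e: "e > 0" and z: "0 \<le> z" "z \<le> 1"
  shows "gf (step e P) z = gf P z - rem e P * z ^ mini P * (1 - Qgen p (gf P z))"
proof -
  let ?l = "mini P" and ?Q = "Qgen p (gf P z)"
  define r where "r = rem e P / pmf P ?l"
  have r: "0 \<le> r" "r \<le> 1" using rem[OF e, of P] by (auto simp: r_def)
  have br: "gf (bind_pmf (bernoulli_pmf r) (\<lambda>b. if b then map_pmf ((+) ?l) (qsum P) else return_pmf ?l)) z = z ^ ?l - r * z ^ ?l * (1 - ?Q)"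
    unfolding gf_bind[OF z] by (subst integral_bernoulli_pmf[OF r]) (simp add: gf_shift gf_qsum[OF z] gf_return algebra_simps)
  have "gf (step e P) z = (\<integral>x. z ^ x - indicator {?l} x * (r * z ^ ?l * (1 - ?Q)) \<partial>measure_pmf P)"
    unfolding step_def r_def[symmetric] gf_bind[OF z]
  proof (intro Bochner_Integration.integral_cong refl)
    fix x
    show "gf (if x = ?l then bind_pmf (bernoulli_pmf r) (\<lambda>b. if b then map_pmf ((+) ?l) (qsum P) else return_pmf x) else return_pmf x) z
      = z ^ x - indicator {?l} x * (r * z ^ ?l * (1 - ?Q))"
    proof (cases "x = ?l")
      case True show ?thesis unfolding True using br by simp
    qed (simp add: gf_return)
  qed
  also have "\<dots> = gf P z - pmf P ?l * (r * z ^ ?l * (1 - ?Q))"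
  proof -
    have "integrable (measure_pmf P) (\<lambda>x. indicator {?l} x * (r * z ^ ?l * (1 - ?Q)))"
      by (intro integrable_mult_left integrable_real_indicator) (auto simp: measure_pmf.emeasure_eq_measure)
    then show ?thesis using gf_integrable[OF z, of P] by (simp add: gf_def measure_pmf_single)
  qed
  also have "pmf P ?l * (r * z ^ ?l * (1 - ?Q)) = rem e P * z ^ ?l * (1 - ?Q)" using rem(4)[OF e, of P] by (simp add: r_def)
  finally show ?thesis .
qed

lemma set_step: assumes "0 \<notin> set_pmf P" "j \<in> set_pmf (step e P)" shows "mini P \<le> j" "j \<noteq> 0"
proof -
  show "mini P \<le> j" using assms(2) mini(2)[of _ P] by (auto simp: step_def split: if_splits)
  moreover have "mini P \<noteq> 0" using mini(1)[of P] assms(1) by (cases "mini P") auto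
  ultimately show "j \<noteq> 0" by simp
qed

text \<open>Here the whole minimal mass merges, and merged clusters strictly exceed the old minimum
  because a \<open>qsum\<close> is at least 1.\<close>

lemma step_removes: assumes P: "0 \<notin> set_pmf P" and e: "e > 0" and le: "pmf P (mini P) \<le> e" shows "mini P \<notin> set_pmf (step e P)"
proof
  have "rem e P / pmf P (mini P) = 1" using le rem(4)[OF e, of P] by (simp add: rem_def min_absorb2)
  moreover have "False \<notin> set_pmf (bernoulli_pmf 1)" by (simp add: set_pmf_iff)
  moreover assume "mini P \<in> set_pmf (step e P)"
  ultimately obtain y where "y \<in> set_pmf (qsum P)" "mini P = mini P + y"
    by (auto simp: step_def split: if_splits)
  then show False using qsum_pos[OF P, of y] by simp
qed

text \<open>\<open>w\<close> is what the exact flow would subtract from \<open>g\<close>. The lower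
  bound loses the factor \<open>1 + Q1 p * e\<close>, because within one step
  \<open>1 - Qgen p\<close> grows by at most that factor.\<close>

lemma g_step:
  assumes P: "0 \<notin> set_pmf P" and e: "e > 0" and z: "0 < z" "z < 1"
  defines "w \<equiv> Q1 p * rem e P * z ^ mini P"
  shows "gf P z < 1" "w / (1 + Q1 p * e) \<le> g (gf P z) - g (gf (step e P) z)" "g (gf P z) - g (gf (step e P) z) \<le> w"
proof -
  have z': "0 \<le> z" "z \<le> 1" using z by auto
  let ?x = "gf P z" and ?y = "gf (step e P) z"
  obtain k where "mini P = Suc k" using mini(1)[of P] P by (cases "mini P") auto
  then have "z ^ mini P < 1" using power_Suc_less_one[OF z, of k] by simp
  then show x1: "?x < 1" using gf_le_mini[OF z', of P] by simp
  define m where "m = rem e P * z ^ mini P"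
  have m: "0 \<le> m" "m \<le> e"
  proof -
    show "0 \<le> m" using rem(1)[OF e, of P] z by (simp add: m_def)
    have "rem e P * z ^ mini P \<le> e * 1" using rem(1,2)[OF e, of P] z by (intro mult_mono power_le_one) auto
    then show "m \<le> e" by (simp add: m_def)
  qed
  have w: "w = Q1 p * m" by (simp add: w_def m_def)
  define a where "a = 1 - Qgen p ?x"
  have a: "0 < a" using Q_lt_1[of ?x] gf_bounds[OF z', of P] x1 by (simp add: a_def)
  have xy: "?x - ?y = m * a" unfolding gf_step[OF e z'] by (simp add: m_def a_def)
  have y0: "0 \<le> ?y" by (rule gf_bounds[OF z'])
  have "0 \<le> m * a" using m a by simp
  then have yx: "?y \<le> ?x" using xy by linarith
  have "g ?x - g ?y \<le> m * a * Q1 p / a" using g_diff_bounds(2)[OF y0 yx x1] xy by (simp add: a_def)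
  then show "g ?x - g ?y \<le> w" using a by (simp add: w mult.commute)
  have y1: "0 < 1 - Qgen p ?y" using Q_lt_1[OF y0] yx x1 by simp
  have "Qgen p ?x - Qgen p ?y \<le> Q1 p * (m * a)" using Q_diff_le[OF y0 yx] x1 xy by simp
  also have "\<dots> \<le> Q1 p * (e * a)" using m a Q1_ge_1 by (intro mult_left_mono mult_right_mono) auto
  finally have b: "1 - Qgen p ?y \<le> (1 + Q1 p * e) * a" by (simp add: a_def algebra_simps)
  have "w / (1 + Q1 p * e) = m * a * Q1 p / ((1 + Q1 p * e) * a)" using a by (simp add: w)
  also have "\<dots> \<le> m * a * Q1 p / (1 - Qgen p ?y)"
    using b y1 m a Q1_ge_1 e by (intro divide_left_mono mult_nonneg_nonneg mult_pos_pos) (auto simp: add_pos_nonneg)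
  also have "\<dots> \<le> g ?x - g ?y" using g_diff_bounds(1)[OF y0 yx x1] xy by simp
  finally show "w / (1 + Q1 p * e) \<le> g ?x - g ?y" .
qed

section \<open>Iterating the step: the minimum and the elapsed time are unbounded\<close>

definition iter :: "real \<Rightarrow> nat pmf \<Rightarrow> nat \<Rightarrow> nat pmf" where "iter e P n = (step e ^^ n) P"

lemma iter_simps: "iter e P 0 = P" "iter e P (Suc n) = step e (iter e P n)" by (simp_all add: iter_def)

lemma iter_pos: assumes "0 \<notin> set_pmf P" shows "0 \<notin> set_pmf (iter e P n)"
proof (induction n)
  case (Suc n) then show ?case using set_step(2)[OF Suc] by (auto simp: iter_simps)
qed (simp add: iter_simps assms)

lemma mini_mono: assumes P: "0 \<notin> set_pmf P" and "m \<le> n" shows "mini (iter e P m) \<le> mini (iter e P n)"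
proof (rule lift_Suc_mono_le[OF _ \<open>m \<le> n\<close>])
  fix n show "mini (iter e P n) \<le> mini (iter e P (Suc n))"
    unfolding iter_simps by (rule set_step(1)[OF iter_pos[OF P] mini(1)])
qed

text \<open>Telescoping of \<open>g_step\<close>; the sum \<open>S\<close> becomes the integral of a
  history once each step is assigned a length of time.\<close>

lemma iter_bounds:
  assumes P: "0 \<notin> set_pmf P" and e: "e > 0" and z: "0 < z" "z < 1" and jn: "j \<le> n"
  defines "S \<equiv> \<Sum>i=j..<n. Q1 p * rem e (iter e P i) * z ^ mini (iter e P i)"
  shows "S / (1 + Q1 p * e) \<le> g (gf (iter e P j) z) - g (gf (iter e P n) z)"
    "g (gf (iter e P j) z) - g (gf (iter e P n) z) \<le> S"
proof -
  let ?w = "\<lambda>i. Q1 p * rem e (iter e P i) * z ^ mini (iter e P i)" and ?g = "\<lambda>i. g (gf (iter e P i) z)"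
  have st: "?w i / (1 + Q1 p * e) \<le> ?g i - ?g (Suc i)" "?g i - ?g (Suc i) \<le> ?w i" for i
    using g_step(2,3)[OF iter_pos[OF P] e z, of e i] by (simp_all add: iter_simps)
  have t: "(\<Sum>i=j..<n. ?g i - ?g (Suc i)) = ?g j - ?g n" using sum_Suc_diff'[OF jn, of "\<lambda>i. - ?g i"] by simp
  have "(\<Sum>i=j..<n. ?g i - ?g (Suc i)) \<le> S" unfolding S_def by (intro sum_mono st)
  then show "?g j - ?g n \<le> S" by (simp add: t)
  have "S / (1 + Q1 p * e) \<le> (\<Sum>i=j..<n. ?g i - ?g (Suc i))" unfolding S_def sum_divide_distrib by (intro sum_mono st)
  then show "S / (1 + Q1 p * e) \<le> ?g j - ?g n" by (simp add: t)
qed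

text \<open>If the minimum stayed bounded, it would eventually be constant, every step would then
  move the full mass \<open>e\<close>, and \<open>g\<close> would fall by a fixed amount each time,
  which its nonnegativity forbids.\<close>

lemma mini_unbounded:
  assumes P: "0 \<notin> set_pmf P" and e: "e > 0" shows "\<exists>n. b < mini (iter e P n)"
proof (rule ccontr)
  assume "\<not> ?thesis"
  then have bd: "mini (iter e P n) \<le> b" for n by (simp add: not_less)
  define L where "L = Max (range (\<lambda>n. mini (iter e P n)))"
  have fin: "finite (range (\<lambda>n. mini (iter e P n)))" by (rule finite_subset[of _ "{..b}"]) (use bd in auto)
  have "L \<in> range (\<lambda>n. mini (iter e P n))" unfolding L_def by (rule Max_in[OF fin]) auto
  then obtain N where N: "mini (iter e P N) = L" by auto
  have le: "mini (iter e P n) \<le> L" for n unfolding L_def by (rule Max_ge[OF fin]) auto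
  have eqL: "mini (iter e P n) = L" if "N \<le> n" for n using le[of n] mini_mono[OF P that, of e] N by simp
  have big: "rem e (iter e P n) = e" if n: "N \<le> n" for n
  proof -
    have "\<not> pmf (iter e P n) (mini (iter e P n)) \<le> e"
    proof
      assume "pmf (iter e P n) (mini (iter e P n)) \<le> e"
      from step_removes[OF iter_pos[OF P] e this] have "L \<notin> set_pmf (iter e P (Suc n))" using eqL[OF n] by (simp add: iter_simps)
      moreover have "mini (iter e P (Suc n)) = L" using n by (intro eqL) simp
      ultimately show False using mini(1)[of "iter e P (Suc n)"] by simp
    qed
    then show ?thesis by (simp add: rem_def)
  qed
  define z :: real where "z = 1/2"
  have z: "0 < z" "z < 1" by (auto simp: z_def)
  define c where "c = Q1 p * e * z ^ L / (1 + Q1 p * e)"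
  have c: "c > 0" using Q1_ge_1 e z by (auto simp: c_def intro!: divide_pos_pos mult_pos_pos add_pos_nonneg)
  have "real k * c \<le> g (gf (iter e P N) z)" for k
  proof -
    have "(\<Sum>i=N..<N+k. Q1 p * rem e (iter e P i) * z ^ mini (iter e P i)) = (\<Sum>i=N..<N+k. Q1 p * e * z ^ L)"
      by (intro sum.cong refl) (auto simp: big eqL)
    then have "(\<Sum>i=N..<N+k. Q1 p * rem e (iter e P i) * z ^ mini (iter e P i)) / (1 + Q1 p * e) = real k * c" by (simp add: c_def)
    then have "real k * c \<le> g (gf (iter e P N) z) - g (gf (iter e P (N + k)) z)"
      using iter_bounds(1)[OF P e z, of N "N + k"] by simp
    moreover have "0 \<le> g (gf (iter e P (N + k)) z)"
      by (rule g_nonneg) (use gf_bounds[of z] g_step(1)[OF iter_pos[OF P] e z, of e] z in auto)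
    ultimately show ?thesis by linarith
  qed
  moreover obtain k where "g (gf (iter e P N) z) < real k * c" using reals_Archimedean3[OF c] by blast
  ultimately show False by (meson not_le)
qed

lemma gf_iter_tendsto_0:
  assumes P: "0 \<notin> set_pmf P" and e: "e > 0" and z: "0 < z" "z < 1"
  shows "(\<lambda>n. g (gf (iter e P n) z)) \<longlonglongrightarrow> 0"
proof -
  have z': "0 \<le> z" "z \<le> 1" using z by auto
  have top: "filterlim (\<lambda>n. mini (iter e P n)) at_top sequentially"
    unfolding filterlim_at_top
  proof
    fix b
    obtain N where "b < mini (iter e P N)" using mini_unbounded[OF P e] by blast
    then have "b \<le> mini (iter e P n)" if "N \<le> n" for n using mini_mono[OF P that, of e] by simp
    then show "\<forall>\<^sub>F n in sequentially. b \<le> mini (iter e P n)" by (rule eventually_sequentiallyI)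
  qed
  have "(\<lambda>n. z ^ mini (iter e P n)) \<longlonglongrightarrow> 0" by (rule filterlim_compose[OF LIMSEQ_realpow_zero[OF z'(1) z(2)] top])
  then have f0: "(\<lambda>n. gf (iter e P n) z) \<longlonglongrightarrow> 0"
    by (rule tendsto_sandwich[OF _ _ tendsto_const, rotated 2]) (use gf_bounds[OF z'] gf_le_mini[OF z'] in auto)
  have "\<forall>\<^sub>F n in sequentially. gf (iter e P n) z < 1/2" by (rule order_tendstoD(2)[OF f0]) simp
  then have ev: "\<forall>\<^sub>F n in sequentially. gf (iter e P n) z \<in> {0..1/2}" by eventually_elim (use gf_bounds[OF z'] in auto)
  have "(\<lambda>n. g (gf (iter e P n) z)) \<longlonglongrightarrow> g 0"
    by (rule continuous_on_tendsto_compose[OF g_continuous[of "1/2"] f0 _ ev]) auto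
  then show ?thesis by (simp add: g_0)
qed

text \<open>Ensures that the scheme runs for infinite time. A bounded total would bound
  \<open>g (gf P z)\<close> by \<open>Q1 p * B\<close> for all \<open>z < 1\<close>, but
  \<open>gf P z\<close> tends to 1 with \<open>z\<close>, and \<open>g\<close> is unbounded at
  1.\<close>

lemma rem_sum_unbounded:
  assumes P: "0 \<notin> set_pmf P" and e: "e > 0" shows "\<exists>n. B < (\<Sum>i<n. rem e (iter e P i))"
proof (rule ccontr)
  assume "\<not> ?thesis"
  then have bd: "(\<Sum>i<n. rem e (iter e P i)) \<le> B" for n by (simp add: not_less)
  have B0: "0 \<le> B" using bd[of 0] by simp
  have gb: "g (gf P z) \<le> Q1 p * B" if z: "0 < z" "z < 1" for z
  proof -
    have "g (gf P z) - g (gf (iter e P n) z) \<le> Q1 p * B" for n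
    proof -
      have "g (gf P z) - g (gf (iter e P n) z) \<le> (\<Sum>i=0..<n. Q1 p * rem e (iter e P i) * z ^ mini (iter e P i))"
        using iter_bounds(2)[OF P e z, of 0 n] by (simp add: iter_simps)
      also have "\<dots> \<le> (\<Sum>i=0..<n. Q1 p * rem e (iter e P i))"
      proof (rule sum_mono)
        fix i show "Q1 p * rem e (iter e P i) * z ^ mini (iter e P i) \<le> Q1 p * rem e (iter e P i)"
          using z rem(1)[OF e, of "iter e P i"] Q1_ge_1 by (intro mult_left_le power_le_one) auto
      qed
      also have "\<dots> = Q1 p * (\<Sum>i<n. rem e (iter e P i))" by (simp add: sum_distrib_left atLeast0LessThan)
      also have "\<dots> \<le> Q1 p * B" using bd[of n] Q1_ge_1 by (intro mult_left_mono) auto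
      finally show ?thesis .
    qed
    moreover have "(\<lambda>n. g (gf P z) - g (gf (iter e P n) z)) \<longlonglongrightarrow> g (gf P z) - 0"
      by (intro tendsto_intros gf_iter_tendsto_0[OF P e z])
    ultimately show ?thesis by (intro LIMSEQ_le_const2[of _ "g (gf P z)"]) auto
  qed
  define y where "y = ginv (Q1 p * B + 1)"
  have y: "0 \<le> y" "y < 1" "g y = Q1 p * B + 1" using ginv[of "Q1 p * B + 1"] Q1_ge_1 B0 by (auto simp: y_def)
  have "\<forall>\<^sub>F q in at_right 0. lap (law 1 P) q > y"
    by (rule order_tendstoD(1)[OF lap_tendsto_1[OF law(1)] y(2)]) simp
  from eventually_happens'[OF _ eventually_conj[OF this eventually_unit_at_right]]
  obtain q where q: "lap (law 1 P) q > y" "0 < q" by auto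
  define z where "z = exp (- q)"
  have z: "0 < z" "z < 1" using q by (auto simp: z_def)
  have "y \<le> gf P z" using q law(2)[of 1 P q] by (simp add: z_def)
  then have "g y \<le> g (gf P z)" using y g_step(1)[OF P e z] by (intro g_mono) auto
  then show False using gb[OF z] y by simp
qed

end

lemma Lam_from_bound:
  assumes l: "mono_on {0<..} (l :: real \<Rightarrow> real)" and t: "0 < t" and q: "0 \<le> q" and B: "\<And>u. t \<le> u \<Longrightarrow> Wint l q t u \<le> B"
  shows "set_integrable lborel {t<..} (\<lambda>r. exp (- q * l r) / r)" "Lam l q t \<le> B"
proof -
  have "Bseq (\<lambda>n. Wint l q t (t + real n))"
  proof (rule BseqI')
    fix n show "norm (Wint l q t (t + real n)) \<le> B" using B[of "t + real n"] Wint_nonneg[OF t, of l q "t + real n"] by simp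
  qed
  moreover have "mono (\<lambda>n. Wint l q t (t + real n))"
  proof (rule monoI)
    fix m n :: nat assume "m \<le> n"
    then show "Wint l q t (t + real m) \<le> Wint l q t (t + real n)"
      using Wint_add[OF l t, of "t + real m" "t + real n" q] Wint_nonneg[of "t + real m" l q] t q by simp
  qed
  ultimately obtain x where x: "(\<lambda>n. Wint l q t (t + real n)) \<longlonglongrightarrow> x"
    using Bseq_mono_convergent[of "\<lambda>n. Wint l q t (t + real n)"] by (auto simp: mono_def convergent_def)
  show "set_integrable lborel {t<..} (\<lambda>r. exp (- q * l r) / r)" by (rule Lam_from_limit(1)[OF l t q x])
  have "x \<le> B" by (rule LIMSEQ_le_const2[OF x]) (use B in auto)
  then show "Lam l q t \<le> B" using Lam_from_limit(2)[OF l t q x] by simp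
qed

lemma continuous_at_right_step:
  assumes "s < b" "\<And>u. s < u \<Longrightarrow> u < b \<Longrightarrow> l u = l (s::real)"
  shows "continuous (at_right s) (l :: real \<Rightarrow> real)"
  unfolding continuous_within
proof (rule tendsto_eventually)
  show "\<forall>\<^sub>F u in at_right s. l u = l s" unfolding eventually_at_right_field using assms by blast
qed

context clustering
begin

text \<open>Turns the scheme into a history by choosing the clock: step \<open>k\<close> occupies
  the times from \<open>T k\<close> to \<open>T (Suc k)\<close> with
  \<open>ln (T (Suc k) / T k) = Q1 p * a k\<close>, so that the integral of
  \<open>exp (- q * l s) / s\<close> over it equals the \<open>w\<close> of \<open>g_step\<close>.
  The last property supplies laws whose transforms almost solve the equation with this
  history.\<close>

lemma scheme_history:
  assumes P: "0 \<notin> set_pmf P" and e: "e > 0" and h: "h > 0" and t0: "0 < t0" "t0 \<le> 1"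
  obtains l where "hist l" "\<And>s. s > 0 \<Longrightarrow> continuous (at_right s) l"
    "\<And>q. q > 0 \<Longrightarrow> g (lap (law h P) q) \<le> Lam l q t0 \<and> Lam l q t0 \<le> (1 + Q1 p * e) * g (lap (law h P) q)"
    "\<And>q. q > 0 \<Longrightarrow> Kf l q = - (Lam l q t0 + ln t0)"
    "\<And>t. t \<ge> t0 \<Longrightarrow> \<exists>M. prob_Rplus M \<and> (\<forall>q>0. lap M q < 1 \<and> g (lap M q) \<le> Lam l q t + Q1 p * e \<and> Lam l q t \<le> (1 + Q1 p * e) * g (lap M q))"
proof -
  define a where "a i = rem e (iter e P i)" for i
  have a: "0 < a i" "a i \<le> e" for i using rem[OF e, of "iter e P i"] by (auto simp: a_def)
  define T where "T k = t0 * exp (Q1 p * (\<Sum>i<k. a i))" for k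
  have T0: "T 0 = t0" by (simp add: T_def)
  have Tpos: "0 < T k" for k using t0 by (simp add: T_def)
  have TS: "T (Suc k) = T k * exp (Q1 p * a k)" for k by (simp add: T_def distrib_left exp_add)
  have Tinc: "T k < T (Suc k)" for k using Tpos[of k] a(1)[of k] Q1_ge_1 by (simp add: TS)
  have Tmono: "T j \<le> T k" if "j \<le> k" for j k by (rule lift_Suc_mono_le[OF _ that]) (use Tinc in \<open>auto intro: less_imp_le\<close>)
  have Tunb: "\<exists>n. s < T n" for s
  proof (cases "s > 0")
    case True
    obtain n where n: "ln (s / t0) < (\<Sum>i<n. a i)" using rem_sum_unbounded[OF P e] unfolding a_def by blast
    have "0 \<le> (\<Sum>i<n. a i)" by (intro sum_nonneg less_imp_le a)
    then have "1 * (\<Sum>i<n. a i) \<le> Q1 p * (\<Sum>i<n. a i)" using Q1_ge_1 by (intro mult_right_mono) auto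
    then have "ln (s / t0) < Q1 p * (\<Sum>i<n. a i)" using n by linarith
    then have "exp (ln (s / t0)) < exp (Q1 p * (\<Sum>i<n. a i))" by simp
    then have "s < T n" using True t0 by (simp add: T_def field_simps)
    then show ?thesis by blast
  next
    case False then show ?thesis using Tpos[of 0] by (intro exI[of _ 0]) linarith
  qed
  define idx where "idx s = (LEAST k. s < T (Suc k))" for s
  have ex: "\<exists>k. s < T (Suc k)" for s using Tunb[of s] Tinc less_trans by blast
  have idx1: "s < T (Suc (idx s))" for s unfolding idx_def using ex by (rule LeastI_ex)
  have idx_le: "idx s \<le> k" if "s < T (Suc k)" for s k unfolding idx_def using that by (rule Least_le)
  have idx2: "T (idx s) \<le> s" if "t0 \<le> s" for s
  proof (cases "idx s")
    case 0 then show ?thesis using that T0 by simp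
  next
    case (Suc k)
    then have "\<not> s < T (Suc k)" using idx_le[of s k] by auto
    then show ?thesis using Suc by simp
  qed
  have idx_eq: "idx s = k" if "T k \<le> s" "s < T (Suc k)" for s k
  proof (rule antisym[OF idx_le[OF that(2)]])
    show "k \<le> idx s"
    proof (rule ccontr)
      assume "\<not> k \<le> idx s"
      then have "T (Suc (idx s)) \<le> T k" by (intro Tmono) simp
      then show False using idx1[of s] that by simp
    qed
  qed
  have idx_mono: "idx s \<le> idx t" if "s \<le> t" for s t using idx1[of t] that by (intro idx_le) simp
  define c where "c k = h * real (mini (iter e P k))" for k
  have c_mono: "c j \<le> c k" if "j \<le> k" for j k using mini_mono[OF P that, of e] h by (simp add: c_def)
  have c0: "0 \<le> c k" for k using h by (simp add: c_def)
  \<comment> \<open>With the value 0 before \<open>t0\<close>, \<open>Kf l q\<close> reduces to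
    \<open>- (Lam l q t0 + ln t0)\<close>.\<close>
  define l where "l s = (if s < t0 then 0 else c (idx s))" for s
  have lm: "mono_on {0<..} l" using c_mono[OF idx_mono] c0 by (intro mono_onI) (auto simp: l_def)
  have l0: "0 \<le> l s" for s using c0 by (simp add: l_def)
  have lk: "l s = c k" if "T k \<le> s" "s < T (Suc k)" for s k
    using idx_eq[OF that] Tmono[of 0 k] that T0 by (simp add: l_def)
  have rc: "continuous (at_right s) l" for s
  proof (cases "s < t0")
    case True
    show ?thesis by (rule continuous_at_right_step[OF True]) (use True in \<open>auto simp: l_def\<close>)
  next
    case False
    then have s: "T (idx s) \<le> s" "s < T (Suc (idx s))" using idx2[of s] idx1[of s] by auto
    show ?thesis
    proof (rule continuous_at_right_step[OF s(2)])
      fix u assume "s < u" "u < T (Suc (idx s))"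
      then show "l u = l s" using lk[of "idx s" u] lk[OF s] s by simp
    qed
  qed
  have Wk: "Wint l q (T k) (T (Suc k)) = Q1 p * a k * exp (- q * c k)" for q k
  proof -
    \<comment> \<open>\<open>l\<close> is constant on the interval closed at the left,
      \<open>Wint\<close> integrates over the one closed at the right; they differ by null
      endpoints.\<close>
    have "Wint l q (T k) (T (Suc k)) = (LBINT s:{T k<..T (Suc k)}. exp (- q * c k) * (1 / s))"
      unfolding Wint_def set_lebesgue_integral_def
    proof (rule integral_cong_AE)
      show "(\<lambda>s. indicator {T k<..T (Suc k)} s *\<^sub>R (exp (- q * l s) / s)) \<in> borel_measurable lborel"
        using Wint_measurable(1)[OF lm Tpos[of k]] by (simp add: set_borel_measurable_def)
      show "AE s in lborel. indicator {T k<..T (Suc k)} s *\<^sub>R (exp (- q * l s) / s) = indicator {T k<..T (Suc k)} s *\<^sub>R (exp (- q * c k) * (1 / s))"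
        using AE_lborel_singleton[of "T (Suc k)"] by eventually_elim (use lk[of k] in \<open>auto simp: indicator_def\<close>)
    qed measurable
    also have "\<dots> = exp (- q * c k) * (LBINT s:{T k<..T (Suc k)}. 1 / s)" by (rule set_integral_mult_right)
    also have "(LBINT s:{T k<..T (Suc k)}. 1 / s) = ln (T (Suc k) / T k)"
      by (rule integral_inverse_Ioc(2)[OF Tpos less_imp_le[OF Tinc]])
    also have "ln (T (Suc k) / T k) = Q1 p * a k" using Tpos[of k] by (simp add: TS)
    finally show ?thesis by (simp add: mult.commute)
  qed
  define f where "f q j = gf (iter e P j) (exp (- q * h))" for q j
  have zq: "0 < exp (- q * h)" "exp (- q * h) < 1" if "q > 0" for q using that h by auto
  have f01: "0 \<le> f q j" "f q j < 1" if "q > 0" for q j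
    using gf_bounds(1)[of "exp (- q * h)"] g_step(1)[OF iter_pos[OF P] e zq[OF that], of e j] zq[OF that] by (auto simp: f_def)
  have Wsum: "Wint l q (T j) (T n) = (\<Sum>i=j..<n. Q1 p * rem e (iter e P i) * exp (- q * h) ^ mini (iter e P i))" if q: "q > 0" and "j \<le> n" for q j n
    using \<open>j \<le> n\<close>
  proof (induction n rule: dec_induct)
    case base then show ?case by (simp add: Wint_def set_lebesgue_integral_def)
  next
    case (step n)
    have "Wint l q (T j) (T (Suc n)) = Wint l q (T j) (T n) + Wint l q (T n) (T (Suc n))"
      by (rule Wint_add[OF lm Tpos Tmono[OF step(1)] less_imp_le[OF Tinc]]) (use q in auto)
    moreover have "exp (- q * c n) = exp (- q * h) ^ mini (iter e P n)" by (simp add: c_def exp_of_nat_mult[symmetric] algebra_simps)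
    ultimately show ?case using step by (simp add: Wk a_def)
  qed
  define E where "E = 1 + Q1 p * e"
  have E: "E > 0" using Q1_ge_1 e by (simp add: E_def add_pos_nonneg)
  have gfn: "0 \<le> g (f q n)" if "q > 0" for q n by (rule g_nonneg[OF f01[OF that]])
  have Wb: "g (f q j) - g (f q n) \<le> Wint l q (T j) (T n)" "Wint l q (T j) (T n) \<le> E * g (f q j)" if q: "q > 0" and jn: "j \<le> n" for q j n
  proof -
    note ib = iter_bounds[OF P e zq[OF q] jn, folded Wsum[OF q jn] f_def E_def]
    show "g (f q j) - g (f q n) \<le> Wint l q (T j) (T n)" by (rule ib(2))
    have "Wint l q (T j) (T n) / E \<le> g (f q j)" using ib(1) gfn[OF q, of n] by linarith
    then show "Wint l q (T j) (T n) \<le> E * g (f q j)" using E by (simp add: pos_divide_le_eq mult.commute)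
  qed
  have Wt: "Wint l q (T j) u \<le> E * g (f q j)" if q: "q > 0" and u: "T j \<le> u" for q j u
  proof -
    obtain n where n: "u < T n" using Tunb by blast
    then have "j \<le> n" using Tmono[of n j] u by (cases "j \<le> n") auto
    have "Wint l q (T j) (T n) = Wint l q (T j) u + Wint l q u (T n)"
      by (rule Wint_add[OF lm Tpos u]) (use n q in auto)
    moreover have "0 \<le> Wint l q u (T n)" by (rule Wint_nonneg) (use u Tpos[of j] in linarith)
    ultimately show ?thesis using Wb(2)[OF q \<open>j \<le> n\<close>] by linarith
  qed
  have tail: "set_integrable lborel {T j<..} (\<lambda>r. exp (- q * l r) / r)" "Lam l q (T j) \<le> E * g (f q j)" if q: "q > 0" for q j
    using Lam_from_bound[OF lm Tpos[of j] less_imp_le[OF q] Wt[OF q]] by auto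
  have Lge: "g (f q j) \<le> Lam l q (T j)" if q: "q > 0" for q j
  proof -
    have "g (f q j) - g (f q n) \<le> Lam l q (T j)" if "j \<le> n" for n
      using Lam_split(2)[OF lm Tpos Tmono[OF that] less_imp_le[OF q] tail(1)[OF q]] Wb(1)[OF q that] Lam_nonneg[OF less_imp_le[OF Tpos[of n]], of l q] by linarith
    moreover have "(\<lambda>n. g (f q j) - g (f q n)) \<longlonglongrightarrow> g (f q j) - 0"
      unfolding f_def by (intro tendsto_intros gf_iter_tendsto_0[OF P e zq[OF q]])
    ultimately show ?thesis by (intro LIMSEQ_le_const2[of _ "g (f q j)"]) auto
  qed
  have int: "set_integrable lborel {t<..} (\<lambda>r. exp (- q * l r) / r)" if "q > 0" "t > 0" for q t
    by (rule Lam_integrable[OF lm that(2) Tpos[of 0] less_imp_le[OF that(1)] tail(1)[OF that(1)]])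
  have hl: "hist l"
    unfolding hist_def
  proof (intro conjI allI impI lm l0)
    fix q :: real assume q: "q > 0"
    show "set_integrable lborel {1<..} (\<lambda>s. exp (- q * l s) / s)" by (rule int[OF q]) simp
    \<comment> \<open>The cut is at \<open>t0 / 2\<close> so that the closed right end stays clear
      of the jump of \<open>l\<close> at \<open>t0\<close>.\<close>
    have "set_integrable lborel {0<..t0 / 2} (\<lambda>s. 0 :: real)" by (simp add: set_integrable_def)
    then have z: "set_integrable lborel {0<..t0 / 2} (\<lambda>s. (1 - exp (- q * l s)) / s)"
      by (rule set_integrable_cong[THEN iffD1, OF refl refl, rotated]) (use t0 in \<open>auto simp: l_def\<close>)
    have "set_integrable lborel {t0 / 2<..1} (\<lambda>s. (1 - exp (- q * l s)) / s)"
      by (rule history_small_integrable[OF lm l0]) (use q t0 in auto)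
    moreover have "{0<..1} = {0<..t0 / 2} \<union> {t0 / 2<..1}" using t0 by auto
    ultimately show "set_integrable lborel {0<..1} (\<lambda>s. (1 - exp (- q * l s)) / s)"
      using z by (simp only:) (rule set_integrable_Un, auto)
  qed
  have K: "Kf l q = - (Lam l q t0 + ln t0)" if q: "q > 0" for q
  proof -
    have "(LBINT s:{0<..t0}. (1 - exp (- q * l s)) / s) = (LBINT s:{0<..t0}. 0)"
      unfolding set_lebesgue_integral_def
    proof (rule integral_cong_AE)
      show "(\<lambda>s. indicator {0<..t0} s *\<^sub>R ((1 - exp (- q * l s)) / s)) \<in> borel_measurable lborel"
        using history_small_measurable[OF lm order_refl] by (simp add: set_borel_measurable_def)
      show "AE s in lborel. indicator {0<..t0} s *\<^sub>R ((1 - exp (- q * l s)) / s) = indicator {0<..t0} s *\<^sub>R 0"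
        using AE_lborel_singleton[of t0] by eventually_elim (auto simp: indicator_def l_def)
    qed simp
    then show ?thesis using small_part_eq(1)[OF hl q t0] by (simp add: set_lebesgue_integral_def)
  qed
  have lawj: "prob_Rplus (law h (iter e P j))" "lap (law h (iter e P j)) q = f q j" for j q
    using law[OF h] by (auto simp: f_def)
  show ?thesis
  proof (rule that[OF hl rc _ K])
    fix q :: real assume q: "q > 0"
    show "g (lap (law h P) q) \<le> Lam l q t0 \<and> Lam l q t0 \<le> (1 + Q1 p * e) * g (lap (law h P) q)"
      using Lge[OF q, of 0] tail(2)[OF q, of 0] lawj(2)[of 0 q] by (simp add: T0 iter_simps E_def)
  next
    fix t assume t: "t \<ge> t0"
    let ?j = "idx t"
    have tp: "0 < t" using t t0 by simp
    have "lap (law h (iter e P ?j)) q < 1 \<and> g (lap (law h (iter e P ?j)) q) \<le> Lam l q t + Q1 p * e \<and> Lam l q t \<le> (1 + Q1 p * e) * g (lap (law h (iter e P ?j)) q)"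
      if q: "q > 0" for q
    proof -
      \<comment> \<open>Between grid times \<open>Lam\<close> changes by at most the logarithmic
        length of a step, which is at most \<open>Q1 p * e\<close>.\<close>
      have sp: "Lam l q (T ?j) = Wint l q (T ?j) t + Lam l q t"
        by (rule Lam_split(2)[OF lm Tpos idx2[OF t] less_imp_le[OF q] int[OF q tp]])
      have "Wint l q (T ?j) t \<le> exp (- q * l (T ?j)) * ln (t / T ?j)" by (rule Wint_bounds(3)[OF lm Tpos idx2[OF t] less_imp_le[OF q]])
      also have "\<dots> \<le> 1 * ln (t / T ?j)" using l0[of "T ?j"] q idx2[OF t] Tpos[of ?j] by (intro mult_right_mono) auto
      also have "\<dots> \<le> ln (T (Suc ?j) / T ?j)"
        using idx1[of t] Tpos[of ?j] tp by (simp add: divide_right_mono less_imp_le)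
      also have "\<dots> = Q1 p * a ?j" using Tpos[of ?j] by (simp add: TS)
      also have "\<dots> \<le> Q1 p * e" using a(2)[of ?j] Q1_ge_1 by (intro mult_left_mono) auto
      finally have "Wint l q (T ?j) t \<le> Q1 p * e" .
      then show ?thesis
        using f01[OF q, of ?j] Lge[OF q, of ?j] tail(2)[OF q, of ?j] sp Wint_nonneg[OF Tpos[of ?j], of l q t] unfolding lawj E_def by linarith
    qed
    then show "\<exists>M. prob_Rplus M \<and> (\<forall>q>0. lap M q < 1 \<and> g (lap M q) \<le> Lam l q t + Q1 p * e \<and> Lam l q t \<le> (1 + Q1 p * e) * g (lap M q))"
      using lawj(1)[of ?j] by blast
  qed auto
qed

end

section \<open>Lattice approximation of a divergent generating measure\<close>

lemma kq_mono: assumes "x \<ge> 0" "q \<le> r" shows "kq q x \<le> kq r x"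
proof (cases "x = 0")
  case False
  have "q * x \<le> r * x" using assms by (intro mult_right_mono) auto
  then show ?thesis using False assms by (simp add: kq_def divide_right_mono)
qed (use assms in \<open>simp add: kq_def\<close>)

lemma kq_pos: assumes "x \<ge> 0" "q > 0" shows "kq q x > 0"
  using assms by (cases "x = 0") (auto simp: kq_def intro!: divide_pos_pos mult_pos_pos)

text \<open>An atom at 0 makes the integral of the inverse infinite by itself, so divergence becomes
  a single condition.\<close>

lemma divergent_inverse:
  assumes H: "generating_measure H" and D: "divergent H" shows "(\<integral>\<^sup>+ y. inverse (ennreal y) \<partial>H) = \<top>"
proof (cases "emeasure H {0} > 0")
  case True
  have "\<top> = \<top> * emeasure H {0}" using True by (simp add: ennreal_top_mult)
  also have "\<dots> = (\<integral>\<^sup>+ y. \<top> * indicator {0} y \<partial>H)" using generatingD(1)[OF H] by (simp add: nn_integral_cmult_indicator)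
  also have "\<dots> \<le> (\<integral>\<^sup>+ y. inverse (ennreal y) \<partial>H)" by (intro nn_integral_mono) (auto simp: indicator_def)
  finally show ?thesis by (simp add: top_unique)
qed (use D in \<open>simp add: divergent_def\<close>)

lemma generating_AE_not_False:
  assumes H: "generating_measure H" and D: "divergent H" shows "\<not> (AE x in H. False)"
proof
  assume "AE x in H. False"
  then have "(\<integral>\<^sup>+ y. inverse (ennreal y) \<partial>H) = (\<integral>\<^sup>+ y. 0 \<partial>H)" by (intro nn_integral_cong_AE) (auto elim: eventually_mono)
  then show False using divergent_inverse[OF H D] by simp
qed

lemma generating_integral_pos:
  assumes H: "generating_measure H" and D: "divergent H" and i: "integrable H f" and pos: "\<And>x. x \<ge> 0 \<Longrightarrow> f x > (0::real)"
  shows "integral\<^sup>L H f > 0"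
proof -
  have AE: "AE x in H. 0 \<le> f x" using generatingD(3)[OF H] by eventually_elim (use pos in \<open>auto intro: less_imp_le\<close>)
  then have "0 \<le> integral\<^sup>L H f" by (rule integral_nonneg_AE)
  moreover have "integral\<^sup>L H f \<noteq> 0"
  proof
    assume "integral\<^sup>L H f = 0"
    then have "AE x in H. f x = 0" using AE i by (subst (asm) integral_nonneg_eq_0_iff_AE) auto
    with generatingD(3)[OF H] have "AE x in H. False"
    proof eventually_elim
      case (elim x) then show False using pos[of x] by simp
    qed
    then show False using generating_AE_not_False[OF H D] by simp
  qed
  ultimately show ?thesis by linarith
qed

lemma laplace_exponent_pos:
  assumes "generating_measure H" "divergent H" "q > 0" shows "laplace_exponent H q > 0"
  unfolding laplace_exponent_kq
  by (rule generating_integral_pos[OF assms(1,2) kq_integrable[OF assms(1)]]) (use assms kq_pos in auto)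

lemma laplace_exponent_mono:
  assumes H: "generating_measure H" and q: "0 \<le> q" "q \<le> r" shows "laplace_exponent H q \<le> laplace_exponent H r"
  unfolding laplace_exponent_kq
proof (rule integral_mono_AE)
  show "integrable H (kq q)" "integrable H (kq r)" using kq_integrable[OF H] q by auto
  show "AE x in H. kq q x \<le> kq r x" using generatingD(3)[OF H] by eventually_elim (rule kq_mono[OF _ q(2)])
qed

text \<open>Linear growth supplies the constant \<open>C\<close> required by
  \<open>history_compactness\<close>.\<close>

lemma laplace_exponent_le:
  assumes H: "generating_measure H" and q: "1 \<le> q" shows "laplace_exponent H q \<le> (\<integral>x. mn x \<partial>H) * q"
proof -
  have "laplace_exponent H q \<le> (\<integral>x. q * mn x \<partial>H)"
    unfolding laplace_exponent_kq
  proof (rule integral_mono_AE)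
    show "integrable H (kq q)" using kq_integrable[OF H] q by auto
    show "integrable H (\<lambda>x. q * mn x)" using H by (simp add: generating_iff)
    show "AE x in H. kq q x \<le> q * mn x" using generatingD(3)[OF H]
      by eventually_elim (use kq_bound(2)[of q] q in \<open>simp add: max_def split: if_splits\<close>)
  qed
  then show ?thesis by (simp add: mult.commute)
qed

lemma laplace_exponent_at_0:
  assumes H: "generating_measure H" shows "(laplace_exponent H \<longlongrightarrow> 0) (at_right 0)"
proof (rule tendsto_at_right_sequentially[where b=1])
  fix S :: "nat \<Rightarrow> real" assume S: "\<And>n. 0 < S n" "\<And>n. S n < 1" "S \<longlonglongrightarrow> 0"
  have mH: "f \<in> borel_measurable H" if "f \<in> borel_measurable borel" for f :: "real \<Rightarrow> real"
    using that by (simp add: measurable_cong_sets[OF generatingD(1)[OF H] refl])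
  have "(\<lambda>n. integral\<^sup>L H (kq (S n))) \<longlonglongrightarrow> (\<integral>x. 0 \<partial>H)"
  proof (rule integral_dominated_convergence[where w=mn])
    show "integrable H mn" using H by (simp add: generating_iff)
    show "AE x in H. (\<lambda>n. kq (S n) x) \<longlonglongrightarrow> 0"
    proof (rule AE_I2)
      fix x
      have "(\<lambda>n. (1 - exp (- S n * x)) / x) \<longlonglongrightarrow> (1 - exp (- 0 * x)) / x" if "x \<noteq> 0"
        by (intro tendsto_intros S that)
      then show "(\<lambda>n. kq (S n) x) \<longlonglongrightarrow> 0" using S(3) by (cases "x = 0") (simp_all add: kq_def)
    qed
    show "AE x in H. norm (kq (S n) x) \<le> mn x" for n using generatingD(3)[OF H]
    proof eventually_elim
      case (elim x)
      then show ?case using kq_bound[of "S n" x] S(1,2)[of n] by (simp add: max_def)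
    qed
  qed (auto intro!: mH)
  then show "(\<lambda>n. laplace_exponent H (S n)) \<longlonglongrightarrow> 0" by (simp add: laplace_exponent_kq)
qed simp

text \<open>Fatou along integer \<open>q\<close>: the kernels converge to \<open>1 / y\<close>, and
  to infinity at \<open>y = 0\<close>, so a bounded exponent would contradict divergence.\<close>

lemma laplace_exponent_at_top:
  assumes H: "generating_measure H" and D: "divergent H" shows "filterlim (laplace_exponent H) at_top at_top"
  unfolding filterlim_at_top
proof
  fix Z :: real
  have "\<exists>n::nat. Z < laplace_exponent H (real n)"
  proof (rule ccontr)
    assume "\<not> ?thesis"
    then have bd: "laplace_exponent H (real n) \<le> Z" for n by (simp add: not_less)
    have mH: "f \<in> borel_measurable H" if "f \<in> borel_measurable borel" for f :: "real \<Rightarrow> real"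
      using that by (simp add: measurable_cong_sets[OF generatingD(1)[OF H] refl])
    have "(\<integral>\<^sup>+ y. inverse (ennreal y) \<partial>H) = (\<integral>\<^sup>+ y. liminf (\<lambda>n. ennreal (kq (real n) y)) \<partial>H)"
    proof (rule nn_integral_cong_AE)
      show "AE y in H. inverse (ennreal y) = liminf (\<lambda>n. ennreal (kq (real n) y))"
        using generatingD(3)[OF H]
      proof eventually_elim
        case (elim y)
        have "(\<lambda>n. ennreal (kq (real n) y)) \<longlonglongrightarrow> inverse (ennreal y)"
        proof (cases "y = 0")
          case True
          have "(\<lambda>n. ennreal (real n)) \<longlonglongrightarrow> \<top>" using of_nat_tendsto_top_ennreal by (simp only: ennreal_of_nat_eq_real_of_nat)
          then show ?thesis using True by (simp add: kq_def)
        next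
          case False
          then have y: "y > 0" using elim by simp
          have "(\<lambda>n. 1 * exp (- y * real n)) \<longlonglongrightarrow> 0" by (rule exp_decay[OF y])
          then have "(\<lambda>n. (1 - 1 * exp (- y * real n)) / y) \<longlonglongrightarrow> (1 - 0) / y" using y by (intro tendsto_intros) auto
          then have "(\<lambda>n. kq (real n) y) \<longlonglongrightarrow> 1 / y" using y by (simp add: kq_def mult.commute)
          from tendsto_ennrealI[OF this] show ?thesis using y by (simp add: inverse_ennreal_divide)
        qed
        then show ?case by (intro lim_imp_Liminf[symmetric]) auto
      qed
    qed
    also have "\<dots> \<le> liminf (\<lambda>n. \<integral>\<^sup>+ y. ennreal (kq (real n) y) \<partial>H)"
      by (rule nn_integral_liminf) (auto intro!: measurable_compose[OF mH measurable_ennreal])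
    also have "\<dots> \<le> liminf (\<lambda>n. ennreal Z)"
    proof (rule Liminf_mono, rule always_eventually, rule allI)
      fix n :: nat
      have "(\<integral>\<^sup>+ y. ennreal (kq (real n) y) \<partial>H) = ennreal (integral\<^sup>L H (kq (real n)))"
      proof (rule nn_integral_eq_integral[OF kq_integrable[OF H]])
        show "AE y in H. 0 \<le> kq (real n) y" using generatingD(3)[OF H] by eventually_elim (rule kq_bound(1), auto)
      qed simp
      also have "\<dots> \<le> ennreal Z" using bd[of n] by (intro ennreal_leI) (simp add: laplace_exponent_kq)
      finally show "(\<integral>\<^sup>+ y. ennreal (kq (real n) y) \<partial>H) \<le> ennreal Z" .
    qed
    also have "\<dots> = ennreal Z" by (rule Liminf_const) simp
    finally show False using divergent_inverse[OF H D] by (simp add: top_unique)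
  qed
  then obtain n :: nat where n: "Z < laplace_exponent H (real n)" by blast
  show "\<forall>\<^sub>F q in at_top. Z \<le> laplace_exponent H q"
    using eventually_ge_at_top[of "real n"]
  proof eventually_elim
    case (elim q)
    then show ?case using laplace_exponent_mono[OF H, of "real n" q] n by simp
  qed
qed

text \<open>Rounding up, and at least to 1, so that no cluster has size 0.\<close>

definition Jh :: "real \<Rightarrow> real \<Rightarrow> nat" where "Jh h x = max 1 (nat \<lceil>x / h\<rceil>)"

definition rh :: "real \<Rightarrow> real \<Rightarrow> real" where "rh h x = h * real (Jh h x)"

lemma rh: assumes "h > 0" "x \<ge> 0" shows "h \<le> rh h x" "x \<le> rh h x" "rh h x \<le> x + h"
proof -
  show "h \<le> rh h x" using assms by (simp add: rh_def Jh_def)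
  have y: "0 \<le> x / h" using assms by simp
  have "x / h \<le> real (nat \<lceil>x / h\<rceil>)" by (rule real_nat_ceiling_ge)
  then have "x / h \<le> real (Jh h x)" by (simp add: Jh_def)
  then show "x \<le> rh h x" using assms by (simp add: rh_def field_simps)
  have "real (Jh h x) \<le> x / h + 1" using y by (simp add: Jh_def) linarith
  then show "rh h x \<le> x + h" using assms mult_left_mono[of "real (Jh h x)" "x / h + 1" h] by (simp add: rh_def distrib_left)
qed

lemma Jh_measurable [measurable]: "Jh h \<in> measurable borel (count_space UNIV)"
  unfolding Jh_def[abs_def] by measurable

lemma rh_measurable [measurable]: "rh h \<in> borel_measurable borel"
  unfolding rh_def[abs_def] by measurable

lemma mn_antimono: "x \<le> y \<Longrightarrow> mn y \<le> mn x"
  by (auto simp: mn_def field_simps)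

lemma kq_rh_bound: assumes "h > 0" "x \<ge> 0" "q \<ge> 0" shows "0 \<le> kq q (rh h x)" "kq q (rh h x) \<le> max 1 q * mn x"
proof -
  have r: "0 \<le> rh h x" using rh[OF assms(1,2)] assms by linarith
  show "0 \<le> kq q (rh h x)" by (rule kq_bound(1)[OF assms(3) r])
  have "kq q (rh h x) \<le> max 1 q * mn (rh h x)" by (rule kq_bound(2)[OF assms(3) r])
  also have "\<dots> \<le> max 1 q * mn x" using rh(2)[OF assms(1,2)] by (intro mult_left_mono mn_antimono) auto
  finally show "kq q (rh h x) \<le> max 1 q * mn x" .
qed

text \<open>The integral of \<open>1 / x\<close> may diverge, but rounded sizes are at least
  \<open>h\<close>, which makes the normalising constant finite.\<close>

lemma inverse_rh_integrable:
  assumes H: "generating_measure H" and h: "h > 0" shows "integrable H (\<lambda>x. 1 / rh h x)"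
proof (rule generating_integrable[OF H, where B="max 1 (1 / h)"])
  fix x :: real assume x: "x \<ge> 0"
  note r = rh[OF h x]
  have r0: "rh h x > 0" using r(1) h by linarith
  show "\<bar>1 / rh h x\<bar> \<le> max 1 (1 / h) * mn x"
  proof (cases "x \<le> 1")
    case True
    have "1 / rh h x \<le> 1 / h" using r(1) h by (intro divide_left_mono) auto
    then show ?thesis using True r0 by (simp add: mn_def)
  next
    case False
    have "1 / rh h x \<le> 1 / x" using r(2) False by (intro divide_left_mono) auto
    also have "\<dots> \<le> max 1 (1 / h) * (1 / x)" using False by (simp add: divide_right_mono)
    finally show ?thesis using False r0 by (simp add: mn_def)
  qed
qed measurable

text \<open>The weight \<open>1 / rh h x\<close> matches the denominator of the kernel, so the
  normalised law of rounded sizes has a transform of the form 1 minus \<open>1 / N\<close> times the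
  Laplace exponent of the image of \<open>H\<close> under rounding.\<close>

lemma lattice_pmf:
  assumes H: "generating_measure H" and D: "divergent H" and h: "h > 0"
  defines "N \<equiv> \<integral>x. 1 / rh h x \<partial>H"
  shows "N > 0" "\<exists>P. 0 \<notin> set_pmf P \<and> (\<forall>q\<ge>0. lap (law h P) q = 1 - (\<integral>x. kq q (rh h x) \<partial>H) / N)"
proof -
  have r0: "rh h x > 0" for x using h by (simp add: rh_def Jh_def)
  note sH = generatingD(1)[OF H]
  have iN: "integrable H (\<lambda>x. 1 / rh h x)" by (rule inverse_rh_integrable[OF H h])
  show N: "N > 0" unfolding N_def by (rule generating_integral_pos[OF H D iN]) (use r0 in simp)
  define w where "w x = 1 / rh h x / N" for x
  have wm [measurable]: "w \<in> borel_measurable borel" unfolding w_def[abs_def] by measurable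
  have w0: "0 \<le> w x" for x using r0[of x] N by (simp add: w_def)
  have iw: "integrable H w" unfolding w_def by (rule integrable_divide) (rule iN)
  have ew: "integral\<^sup>L H w = 1" using N unfolding w_def integral_divide_zero by (simp only: N_def[symmetric]) simp
  define D where "D = density H (\<lambda>x. ennreal (w x))"
  have PD: "prob_Rplus D" unfolding D_def by (rule prob_Rplus_density[OF sH generatingD(3)[OF H] wm _ iw ew]) (use w0 in auto)
  note sD = prob_RplusD(2)[OF PD]
  have Jm: "Jh h \<in> measurable D (count_space UNIV)" by (simp add: measurable_cong_sets[OF sD refl])
  define M where "M = distr D (count_space UNIV) (Jh h)"
  interpret M: prob_space M unfolding M_def by (rule prob_space.prob_space_distr[OF prob_RplusD(1)[OF PD] Jm])
  have sM: "sets M = UNIV" by (simp add: M_def)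
  \<comment> \<open>A probability measure on all subsets of the natural numbers gives full mass to
    its atoms, which is the condition for being a \<open>pmf\<close>.\<close>
  have "(\<Union>x\<in>{x. measure M {x} = 0}. {x}) \<in> null_sets M"
    by (rule null_sets_UN') (auto simp: null_sets_def sM M.emeasure_eq_measure)
  then have "{x. measure M {x} = 0} \<in> null_sets M" by simp
  from AE_not_in[OF this] have AE: "AE x in M. measure M {x} \<noteq> 0" by simp
  define P where "P = Abs_pmf M"
  have PM: "measure_pmf P = M" unfolding P_def by (rule Abs_pmf_inverse) (use M.prob_space_axioms sM AE in auto)
  have "AE x in D. Jh h x \<noteq> 0" by (simp add: Jh_def)
  then have "AE x in measure_pmf P. x \<noteq> 0" unfolding PM M_def by (subst AE_distr_iff[OF Jm]) auto
  then have "0 \<notin> set_pmf P" by (auto simp: AE_measure_pmf_iff)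
  moreover have "lap (law h P) q = 1 - (\<integral>x. kq q (rh h x) \<partial>H) / N" if q: "q \<ge> 0" for q
  proof -
    have "lap (law h P) q = (\<integral>j. exp (- q * (h * real j)) \<partial>measure_pmf P)"
      unfolding lap_def law_def by (rule integral_distr) auto
    also have "\<dots> = (\<integral>x. exp (- q * rh h x) \<partial>D)"
      unfolding PM M_def rh_def by (rule integral_distr[OF Jm]) simp
    also have "\<dots> = (\<integral>x. w x *\<^sub>R exp (- q * rh h x) \<partial>H)"
      unfolding D_def by (intro integral_density) (simp_all add: measurable_cong_sets[OF sH refl] w0)
    also have "\<dots> = (\<integral>x. w x - kq q (rh h x) / N \<partial>H)"
    proof (intro Bochner_Integration.integral_cong refl)
      fix x
      show "w x *\<^sub>R exp (- q * rh h x) = w x - kq q (rh h x) / N"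
        using r0[of x] N by (simp add: w_def kq_def field_simps)
    qed
    also have "\<dots> = 1 - (\<integral>x. kq q (rh h x) \<partial>H) / N"
    proof -
      have "integrable H (\<lambda>x. kq q (rh h x))"
        by (rule generating_integrable[OF H, where B="max 1 q"]) (use kq_rh_bound[OF h _ q] in auto)
      then show ?thesis using iw ew by simp
    qed
    finally show ?thesis .
  qed
  ultimately show "\<exists>P. 0 \<notin> set_pmf P \<and> (\<forall>q\<ge>0. lap (law h P) q = 1 - (\<integral>x. kq q (rh h x) \<partial>H) / N)" by blast
qed

text \<open>Dominated convergence with a multiple of \<open>mn\<close>; the rounded sizes converge
  to \<open>x\<close> from above, and the kernel is continuous on the half-line including 0.\<close>

lemma kq_rh_limit:
  assumes H: "generating_measure H" and q: "q > 0" and h: "\<And>n. h n > 0" "h \<longlonglongrightarrow> 0"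
  shows "(\<lambda>n. \<integral>x. kq q (rh (h n) x) \<partial>H) \<longlonglongrightarrow> laplace_exponent H q"
  unfolding laplace_exponent_kq
proof (rule integral_dominated_convergence[where w="\<lambda>x. max 1 q * mn x"])
  note sH = generatingD(1)[OF H]
  show "kq q \<in> borel_measurable H" "(\<lambda>x. kq q (rh (h n) x)) \<in> borel_measurable H" for n
    by (simp_all add: measurable_cong_sets[OF sH refl])
  show "integrable H (\<lambda>x. max 1 q * mn x)" using H by (simp add: generating_iff)
  show "AE x in H. norm (kq q (rh (h n) x)) \<le> max 1 q * mn x" for n
    using generatingD(3)[OF H] by eventually_elim (use kq_rh_bound[OF h(1)] q in simp)
  show "AE x in H. (\<lambda>n. kq q (rh (h n) x)) \<longlonglongrightarrow> kq q x"
    using generatingD(3)[OF H]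
  proof eventually_elim
    case (elim x)
    have kr: "kq q y = rq q y / wt y" if "y \<ge> 0" for y using kq_rq[OF that, of q] wt_pos[of y] by (simp add: field_simps)
    have up: "(\<lambda>n. x + h n) \<longlonglongrightarrow> x + 0" by (intro tendsto_intros h)
    have rx: "(\<lambda>n. rh (h n) x) \<longlonglongrightarrow> x"
      by (rule tendsto_sandwich[OF _ _ tendsto_const up[simplified]]) (use rh(2,3)[OF h(1) elim] in auto)
    have "isCont (\<lambda>y. rq q y / wt y) x" using rq_isCont wt_isCont wt_pos[of x] by (intro continuous_intros) auto
    then have "(\<lambda>n. rq q (rh (h n) x) / wt (rh (h n) x)) \<longlonglongrightarrow> rq q x / wt x" by (rule isCont_tendsto_compose[OF _ rx])
    moreover have "0 \<le> rh (h n) x" for n using rh(2)[OF h(1) elim, of n] elim by linarith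
    ultimately show ?case using elim by (simp add: kr)
  qed
qed

context clustering
begin

text \<open>As the lattice is refined, \<open>N n\<close> tends to infinity and the starting laws
  tend to the point mass at 0. The starting time is synchronised with them by
  \<open>ln (t n) = - g (1 - 1 / N n)\<close>; with this choice \<open>Kf\<close> of the scheme
  tends to the logarithm of the Laplace exponent.\<close>

lemma solves_exists:
  assumes H: "generating_measure H" and D: "divergent H"
  obtains l F where "solves l F" "\<And>s. s > 0 \<Longrightarrow> continuous (at_right s) l" "\<And>q. q > 0 \<Longrightarrow> Kf l q = ln (laplace_exponent H q)"
proof -
  let ?eta = "laplace_exponent H"
  define h0 where "h0 n = 1 / real (Suc n)" for n
  have h0: "h0 n > 0" for n by (simp add: h0_def)
  have h0l: "h0 \<longlonglongrightarrow> 0" unfolding h0_def[abs_def] using LIMSEQ_inverse_real_of_nat by (simp add: inverse_eq_divide)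
  define N0 where "N0 n = (\<integral>x. 1 / rh (h0 n) x \<partial>H)" for n
  have N0top: "filterlim N0 at_top sequentially"
    unfolding filterlim_at_top
  proof
    fix Z :: real
    have "\<forall>\<^sub>F q in at_top. Z + 1 \<le> ?eta q" using laplace_exponent_at_top[OF H D] by (simp add: filterlim_at_top)
    from eventually_happens'[OF _ eventually_conj[OF this eventually_gt_at_top[of 0]]]
    obtain q where q: "Z + 1 \<le> ?eta q" "0 < q" by auto
    have "\<forall>\<^sub>F n in sequentially. Z < (\<integral>x. kq q (rh (h0 n) x) \<partial>H)"
      by (rule order_tendstoD(1)[OF kq_rh_limit[OF H q(2) h0 h0l]]) (use q in simp)
    then show "\<forall>\<^sub>F n in sequentially. Z \<le> N0 n"
    proof eventually_elim
      case (elim n)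
      have "(\<integral>x. kq q (rh (h0 n) x) \<partial>H) \<le> N0 n" unfolding N0_def
      proof (rule integral_mono)
        show "integrable H (\<lambda>x. 1 / rh (h0 n) x)" by (rule inverse_rh_integrable[OF H h0])
        show "integrable H (\<lambda>x. kq q (rh (h0 n) x))"
          by (rule generating_integrable[OF H, where B="max 1 q"]) (use kq_rh_bound[OF h0, of _ q] q in auto)
        fix x
        have "rh (h0 n) x > 0" using h0[of n] by (simp add: rh_def Jh_def)
        then show "kq q (rh (h0 n) x) \<le> 1 / rh (h0 n) x" by (simp add: kq_def divide_right_mono)
      qed
      then show ?case using elim by simp
    qed
  qed
  then have "\<forall>\<^sub>F n in sequentially. 2 \<le> N0 n" by (simp add: filterlim_at_top)
  then obtain n0 where n0: "\<And>n. n \<ge> n0 \<Longrightarrow> 2 \<le> N0 n" unfolding eventually_sequentially by blast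
  define h where "h n = h0 (n + n0)" for n
  define N where "N n = N0 (n + n0)" for n
  have h: "h n > 0" for n by (simp add: h_def h0)
  have hl: "h \<longlonglongrightarrow> 0" unfolding h_def using LIMSEQ_ignore_initial_segment[OF h0l] .
  have N2: "2 \<le> N n" for n unfolding N_def by (rule n0) simp
  have Nt: "filterlim N at_top sequentially" unfolding N_def
    by (rule filterlim_compose[OF N0top filterlim_add_const_nat_at_top])
  have Ninv: "(\<lambda>n. 1 / N n) \<longlonglongrightarrow> 0" by (rule tendsto_divide_0[OF tendsto_const filterlim_at_top_imp_at_infinity[OF Nt]])
  define X where "X n q = (\<integral>x. kq q (rh (h n) x) \<partial>H)" for n q
  have Xl: "(\<lambda>n. X n q) \<longlonglongrightarrow> ?eta q" if "q > 0" for q unfolding X_def by (rule kq_rh_limit[OF H that h hl])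
  have "\<exists>P. 0 \<notin> set_pmf P \<and> (\<forall>q\<ge>0. lap (law (h n) P) q = 1 - X n q / N n)" for n
    using lattice_pmf(2)[OF H D h[of n]] unfolding X_def N_def N0_def h_def .
  then obtain P where P: "\<And>n. 0 \<notin> set_pmf (P n)" "\<And>n q. q \<ge> 0 \<Longrightarrow> lap (law (h n) (P n)) q = 1 - X n q / N n" by metis
  define gN where "gN n = g (1 - 1 / N n)" for n
  have Nb: "0 \<le> 1 - 1 / N n" "1 - 1 / N n < 1" for n using N2[of n] by (auto simp: field_simps)
  have gN0: "0 \<le> gN n" for n unfolding gN_def by (rule g_nonneg[OF Nb])
  define t where "t n = exp (- gN n)" for n
  have t: "0 < t n" "t n \<le> 1" for n using gN0[of n] by (auto simp: t_def)
  have lnt: "ln (t n) = - gN n" for n by (simp add: t_def)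
  have tl: "t \<longlonglongrightarrow> 0"
  proof (rule tendsto_sandwich[OF _ _ tendsto_const Ninv])
    have "t n \<le> 1 / N n" for n
    proof -
      have "ln (N n) \<le> gN n" using g_diff_ge_ln[OF order_refl Nb[of n]] by (simp add: gN_def g_0)
      then have "exp (- gN n) \<le> exp (- ln (N n))" by simp
      then show ?thesis using N2[of n] by (simp add: t_def exp_minus inverse_eq_divide)
    qed
    then show "\<forall>\<^sub>F n in sequentially. t n \<le> 1 / N n" by simp
    show "\<forall>\<^sub>F n in sequentially. 0 \<le> t n" using t(1) by (intro always_eventually allI less_imp_le)
  qed
  \<comment> \<open>The relative error \<open>Q1 p * e n\<close> of the scheme multiplies
    \<open>g\<close> of the starting transform, which differs from \<open>gN n\<close> by a
    convergent amount; the step mass must therefore be small compared with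
    \<open>1 / gN n\<close>.\<close>
  define e where "e n = 1 / (real (Suc n) * (1 + gN n))" for n
  have e: "e n > 0" for n using gN0[of n] by (simp add: e_def add_pos_nonneg)
  have el: "e \<longlonglongrightarrow> 0"
  proof (rule tendsto_sandwich[OF _ _ tendsto_const h0l])
    have "e n \<le> h0 n" for n
    proof -
      have "real (Suc n) * 1 \<le> real (Suc n) * (1 + gN n)" using gN0[of n] by (intro mult_left_mono) auto
      then show ?thesis unfolding e_def h0_def by (intro divide_left_mono) (use gN0[of n] in \<open>auto simp: add_pos_nonneg\<close>)
    qed
    then show "\<forall>\<^sub>F n in sequentially. e n \<le> h0 n" by simp
    show "\<forall>\<^sub>F n in sequentially. 0 \<le> e n" using e by (intro always_eventually allI less_imp_le)
  qed
  have "\<exists>l. hist l \<and> (\<forall>s>0. continuous (at_right s) l) \<and>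
    (\<forall>q>0. g (lap (law (h n) (P n)) q) \<le> Lam l q (t n) \<and> Lam l q (t n) \<le> (1 + Q1 p * e n) * g (lap (law (h n) (P n)) q)) \<and>
    (\<forall>q>0. Kf l q = - (Lam l q (t n) + ln (t n))) \<and>
    (\<forall>s\<ge>t n. \<exists>M. prob_Rplus M \<and> (\<forall>q>0. lap M q < 1 \<and> g (lap M q) \<le> Lam l q s + Q1 p * e n \<and> Lam l q s \<le> (1 + Q1 p * e n) * g (lap M q)))" for n
    by (rule scheme_history[OF P(1)[of n] e[of n] h[of n] t[of n]], rule exI) blast
  then obtain L where L: "\<And>n. hist (L n)" "\<And>n s. s > 0 \<Longrightarrow> continuous (at_right s) (L n)"
    "\<And>n q. q > 0 \<Longrightarrow> g (lap (law (h n) (P n)) q) \<le> Lam (L n) q (t n) \<and> Lam (L n) q (t n) \<le> (1 + Q1 p * e n) * g (lap (law (h n) (P n)) q)"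
    "\<And>n q. q > 0 \<Longrightarrow> Kf (L n) q = - (Lam (L n) q (t n) + ln (t n))"
    "\<And>n s. s \<ge> t n \<Longrightarrow> \<exists>M. prob_Rplus M \<and> (\<forall>q>0. lap M q < 1 \<and> g (lap M q) \<le> Lam (L n) q s + Q1 p * e n \<and> Lam (L n) q s \<le> (1 + Q1 p * e n) * g (lap M q))"
    by metis
  \<comment> \<open>\<open>g_ratio_iff\<close> compares the starting transform
    \<open>1 - X n q / N n\<close> with \<open>1 - 1 / N n\<close>: the values of \<open>g\<close>
    differ in the limit by \<open>- ln (?eta q)\<close>, because \<open>X n q\<close> tends to
    \<open>?eta q\<close>.\<close>
  have KL: "(\<lambda>n. Kf (L n) q) \<longlonglongrightarrow> ln (?eta q)" if q: "q > 0" for q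
  proof -
    have eta0: "?eta q > 0" by (rule laplace_exponent_pos[OF H D q])
    define G where "G n = g (lap (law (h n) (P n)) q)" for n
    have lapX: "lap (law (h n) (P n)) q = 1 - X n q / N n" for n using P(2)[of q n] q by simp
    have "(\<lambda>n. X n q * (1 / N n)) \<longlonglongrightarrow> ?eta q * 0" by (intro tendsto_mult Xl[OF q] Ninv)
    then have X0: "(\<lambda>n. X n q / N n) \<longlonglongrightarrow> 0" by simp
    have Xp: "\<forall>\<^sub>F n in sequentially. X n q > 0" by (rule order_tendstoD(1)[OF Xl[OF q] eta0])
    have Xp': "\<forall>\<^sub>F n in sequentially. X n q / N n > 0" using Xp by eventually_elim (intro divide_pos_pos less_le_trans[OF zero_less_numeral N2])
    have Np: "\<forall>\<^sub>F n in sequentially. 1 / N n > 0" by (intro always_eventually allI divide_pos_pos zero_less_one less_le_trans[OF zero_less_numeral N2])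
    have "(\<lambda>n. ln (1 / X n q)) \<longlonglongrightarrow> ln (1 / ?eta q)" by (intro tendsto_ln tendsto_divide tendsto_const Xl[OF q]) (use eta0 in auto)
    then have "(\<lambda>n. ln ((1 / N n) / (X n q / N n))) \<longlonglongrightarrow> - ln (?eta q)"
    proof (rule Lim_transform_eventually[OF _ _, THEN tendsto_eq_rhs])
      show "\<forall>\<^sub>F n in sequentially. ln (1 / X n q) = ln ((1 / N n) / (X n q / N n))"
      proof (intro always_eventually allI)
        fix n have "N n \<noteq> 0" using N2[of n] by auto
        then show "ln (1 / X n q) = ln ((1 / N n) / (X n q / N n))" by simp
      qed
      show "ln (1 / ?eta q) = - ln (?eta q)" using eta0 by (simp add: ln_div)
    qed
    then have d: "(\<lambda>n. G n - gN n) \<longlonglongrightarrow> - ln (?eta q)"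
      unfolding G_def gN_def lapX by (subst g_ratio_iff[OF X0 Ninv Xp' Np])
    have "(\<lambda>n. Lam (L n) q (t n) - G n) \<longlonglongrightarrow> 0"
    proof (rule tendsto_sandwich[OF _ _ tendsto_const])
      show "\<forall>\<^sub>F n in sequentially. 0 \<le> Lam (L n) q (t n) - G n" using L(3)[OF q] by (simp add: G_def)
      have b: "Lam (L n) q (t n) - G n \<le> Q1 p * ((\<bar>G n - gN n\<bar> + 1) * h0 n)" for n
      proof -
        have "Lam (L n) q (t n) - G n \<le> Q1 p * (e n * G n)" using L(3)[OF q, of n] by (simp add: G_def algebra_simps)
        also have "\<dots> \<le> Q1 p * (e n * ((\<bar>G n - gN n\<bar> + 1) * (1 + gN n)))"
        proof (intro mult_left_mono)
          have "G n \<le> \<bar>G n - gN n\<bar> + gN n" by linarith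
          also have "\<dots> \<le> \<bar>G n - gN n\<bar> + gN n + (1 + \<bar>G n - gN n\<bar> * gN n)" using gN0[of n] by simp
          also have "\<dots> = (\<bar>G n - gN n\<bar> + 1) * (1 + gN n)" by (simp add: algebra_simps)
          finally show "G n \<le> (\<bar>G n - gN n\<bar> + 1) * (1 + gN n)" .
        qed (use e[of n] Q1_ge_1 in auto)
        also have "e n * ((\<bar>G n - gN n\<bar> + 1) * (1 + gN n)) = (\<bar>G n - gN n\<bar> + 1) * h0 n"
        proof -
          have "1 + gN n \<noteq> 0" using gN0[of n] by linarith
          then show ?thesis by (simp add: e_def h0_def)
        qed
        finally show ?thesis .
      qed
      then show "\<forall>\<^sub>F n in sequentially. Lam (L n) q (t n) - G n \<le> Q1 p * ((\<bar>G n - gN n\<bar> + 1) * h0 n)" by simp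
      have "(\<lambda>n. Q1 p * ((\<bar>G n - gN n\<bar> + 1) * h0 n)) \<longlonglongrightarrow> Q1 p * ((\<bar>- ln (?eta q)\<bar> + 1) * 0)"
        by (intro tendsto_intros d h0l)
      then show "(\<lambda>n. Q1 p * ((\<bar>G n - gN n\<bar> + 1) * h0 n)) \<longlonglongrightarrow> 0" by simp
    qed
    from tendsto_minus[OF tendsto_add[OF this d]] show ?thesis using L(4)[OF q] by (simp add: lnt)
  qed
  have K0: "filterlim (\<lambda>q. ln (?eta q)) at_bot (at_right 0)"
  proof (rule filterlim_compose[OF ln_at_0])
    show "filterlim ?eta (at_right 0) (at_right 0)"
      unfolding filterlim_at
    proof
      show "\<forall>\<^sub>F q in at_right 0. ?eta q \<in> {0<..} \<and> ?eta q \<noteq> 0"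
        using eventually_unit_at_right
      proof eventually_elim
        case (elim q) then show ?case using laplace_exponent_pos[OF H D, of q] by simp
      qed
      show "(?eta \<longlongrightarrow> 0) (at_right 0)" by (rule laplace_exponent_at_0[OF H])
    qed
  qed
  have K1: "filterlim (\<lambda>q. ln (?eta q)) at_top at_top" by (rule filterlim_compose[OF ln_at_top laplace_exponent_at_top[OF H D]])
  define C where "C = (\<integral>x. mn x \<partial>H)"
  have KC: "ln (?eta q) \<le> ln (C * q)" if "q \<ge> 1" for q
    using laplace_exponent_le[OF H that] laplace_exponent_pos[OF H D, of q] that by (simp add: C_def)
  have C0: "C > 0" using laplace_exponent_le[OF H order_refl] laplace_exponent_pos[OF H D, of 1] by (simp add: C_def)
  obtain r l where r: "strict_mono r" and hl: "hist l" and lp: "\<And>s. s > 0 \<Longrightarrow> 0 < l s" and rc: "\<And>s. s > 0 \<Longrightarrow> continuous (at_right s) l"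
    and LL: "\<And>q t. q > 0 \<Longrightarrow> t > 0 \<Longrightarrow> (\<lambda>n. Lam (L (r n)) q t) \<longlonglongrightarrow> Lam l q t" and Kl: "\<And>q. q > 0 \<Longrightarrow> Kf l q = ln (?eta q)"
    using history_compactness[OF L(1,2) KL K0 K1 C0 KC] by blast
  \<comment> \<open>The law at time \<open>s\<close> is the limit of the laws of the scheme at that
    time, which exist once \<open>t (r n) \<le> s\<close>.\<close>
  have "\<exists>M. prob_Rplus M \<and> (\<forall>q>0. lap M q = ginv (Lam l q s))" if s: "s > 0" for s
  proof -
    have tr: "(\<lambda>n. t (r n)) \<longlonglongrightarrow> 0" using LIMSEQ_subseq_LIMSEQ[OF tl r] by (simp add: comp_def)
    have er: "(\<lambda>n. e (r n)) \<longlonglongrightarrow> 0" using LIMSEQ_subseq_LIMSEQ[OF el r] by (simp add: comp_def)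
    obtain n1 where n1: "\<And>n. n \<ge> n1 \<Longrightarrow> t (r n) < s" using order_tendstoD(2)[OF tr s] unfolding eventually_sequentially by blast
    define k where "k n = r (n + n1)" for n
    have "t (k n) \<le> s" for n unfolding k_def by (rule less_imp_le, rule n1) simp
    note choice[OF allI, OF L(5)[OF this]]
    then have "\<exists>M. \<forall>n. prob_Rplus (M n) \<and> (\<forall>q>0. lap (M n) q < 1 \<and> g (lap (M n) q) \<le> Lam (L (k n)) q s + Q1 p * e (k n) \<and> Lam (L (k n)) q s \<le> (1 + Q1 p * e (k n)) * g (lap (M n) q))" .
    then obtain M where M0: "\<forall>n. prob_Rplus (M n) \<and> (\<forall>q>0. lap (M n) q < 1 \<and> g (lap (M n) q) \<le> Lam (L (k n)) q s + Q1 p * e (k n) \<and> Lam (L (k n)) q s \<le> (1 + Q1 p * e (k n)) * g (lap (M n) q))" by (rule exE)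
    have M: "prob_Rplus (M n)" for n using M0 by (rule allE[where x=n]) (erule conjunct1)
    have M2: "lap (M n) q < 1 \<and> g (lap (M n) q) \<le> Lam (L (k n)) q s + Q1 p * e (k n) \<and> Lam (L (k n)) q s \<le> (1 + Q1 p * e (k n)) * g (lap (M n) q)" if "q > 0" for n q
      using conjunct2[OF M0[rule_format, of n]] that by (elim allE impE)
    have ek: "(\<lambda>n. e (k n)) \<longlonglongrightarrow> 0" unfolding k_def by (rule LIMSEQ_ignore_initial_segment[OF er])
    have lim: "(\<lambda>n. lap (M n) q) \<longlonglongrightarrow> ginv (Lam l q s)" if q: "q > 0" for q
    proof -
      have Lk: "(\<lambda>n. Lam (L (k n)) q s) \<longlonglongrightarrow> Lam l q s" unfolding k_def by (rule LIMSEQ_ignore_initial_segment[OF LL[OF q s]])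
      have f: "0 \<le> lap (M n) q" "lap (M n) q < 1" for n using lap_pos[OF M] M2[OF q] q by (auto intro: less_imp_le)
      have gv: "(\<lambda>n. g (lap (M n) q)) \<longlonglongrightarrow> Lam l q s"
      proof (rule tendsto_sandwich)
        have "(\<lambda>n. Lam (L (k n)) q s / (1 + Q1 p * e (k n))) \<longlonglongrightarrow> Lam l q s / (1 + Q1 p * 0)" by (intro tendsto_intros Lk ek) simp
        then show "(\<lambda>n. Lam (L (k n)) q s / (1 + Q1 p * e (k n))) \<longlonglongrightarrow> Lam l q s" by simp
        have "(\<lambda>n. Lam (L (k n)) q s + Q1 p * e (k n)) \<longlonglongrightarrow> Lam l q s + Q1 p * 0" by (intro tendsto_intros Lk ek)
        then show "(\<lambda>n. Lam (L (k n)) q s + Q1 p * e (k n)) \<longlonglongrightarrow> Lam l q s" by simp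
        show "\<forall>\<^sub>F n in sequentially. g (lap (M n) q) \<le> Lam (L (k n)) q s + Q1 p * e (k n)" using M2[OF q] by simp
        show "\<forall>\<^sub>F n in sequentially. Lam (L (k n)) q s / (1 + Q1 p * e (k n)) \<le> g (lap (M n) q)"
        proof (intro always_eventually allI)
          fix n
          have "0 < 1 + Q1 p * e (k n)" using e[of "k n"] Q1_ge_1 by (simp add: add_pos_nonneg)
          then show "Lam (L (k n)) q s / (1 + Q1 p * e (k n)) \<le> g (lap (M n) q)" using M2[OF q, of n] by (simp add: pos_divide_le_eq mult.commute)
        qed
      qed
      have "(\<lambda>n. ginv (g (lap (M n) q))) \<longlonglongrightarrow> ginv (Lam l q s)"
        by (rule continuous_on_tendsto_compose[OF ginv_continuous gv]) (use g_nonneg[OF f] Lam_nonneg[of s l q] s in auto)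
      then show ?thesis by (simp add: ginv_g[OF f])
    qed
    \<comment> \<open>No mass escapes in this limit: \<open>Kf l q\<close> tends to minus infinity
      as \<open>q\<close> tends to 0, which makes \<open>Lam l q s\<close> tend to infinity and its
      \<open>ginv\<close> to 1.\<close>
    have "filterlim (\<lambda>q. Lam l q s) at_top (at_right 0)"
    proof (rule filterlim_at_top_mono)
      show "filterlim (\<lambda>q. - ln s + - Kf l q) at_top (at_right 0)"
        by (rule filterlim_tendsto_add_at_top[OF tendsto_const]) (use Kf_at_bot[OF hl] in \<open>simp add: filterlim_uminus_at_bot\<close>)
      show "\<forall>\<^sub>F q in at_right 0. - ln s + - Kf l q \<le> Lam l q s"
        using eventually_unit_at_right
      proof eventually_elim
        case (elim q) then show ?case using Kf_ge[OF hl _ s, of q] by simp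
      qed
    qed
    from filterlim_compose[OF ginv_at_top this] have w1: "((\<lambda>q. ginv (Lam l q s)) \<longlongrightarrow> 1) (at_right 0)" .
    obtain M' where "prob_Rplus M'" "\<And>q. q > 0 \<Longrightarrow> lap M' q = ginv (Lam l q s)"
      by (rule laplace_limit_exists[OF M lim w1], assumption, rule that)
    then show ?thesis by blast
  qed
  then obtain F where F: "\<And>s. s > 0 \<Longrightarrow> prob_Rplus (F s) \<and> (\<forall>q>0. lap (F s) q = ginv (Lam l q s))" by metis
  have "solves l F" unfolding solves_def
  proof (intro conjI allI impI)
    show "mono_on {0<..} l" by (rule histD(1)[OF hl])
    fix s :: real assume s: "0 < s"
    show "0 < l s" by (rule lp[OF s])
    show "prob_Rplus (F s)" by (rule conjunct1[OF F[OF s]])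
    fix q :: real assume q: "0 < q"
    show "set_integrable lborel {s<..} (\<lambda>x. exp (- q * l x) / x)" by (rule histD(3)[OF hl q s])
    show "lap (F s) q = ginv (Lam l q s)" using conjunct2[OF F[OF s]] q by (elim allE impE)
  qed
  from that[OF this rc Kl] show ?thesis .
qed

end

theorem theorem7p4:
  fixes p :: "nat \<Rightarrow> real" and ks :: "real \<Rightarrow> real"
  assumes p: "admissible_p p"
    and ks: "de_Bruijn_conjugate (kappa p) ks"
  shows
    "(\<forall>F. eternal_solution p F \<longrightarrow>
        (\<exists>H. generating_measure H \<and> divergent H
             \<and> gm_converges (Gt F ks) H (at_right 0)))
   \<and> (\<forall>H. generating_measure H \<and> divergent H \<longrightarrow>
        (\<exists>F. eternal_solution p F \<and> gm_converges (Gt F ks) H (at_right 0)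
           \<and> (\<forall>F'. eternal_solution p F' \<and> gm_converges (Gt F' ks) H (at_right 0)
                  \<longrightarrow> (\<forall>t>0. F' t = F t))))
   \<and> (\<forall>F H. eternal_solution p F \<and> generating_measure H
          \<and> gm_converges (Gt F ks) H (at_right 0) \<longrightarrow>
        (\<forall>q>0.
           set_integrable lborel {0<..1} (\<lambda>s. (1 - exp (- q * min_of (F s))) / s)
         \<and> set_integrable lborel {1..} (\<lambda>s. exp (- q * min_of (F s)) / s)
         \<and> ln (laplace_exponent H q) =
             (LBINT s:{0<..1}. (1 - exp (- q * min_of (F s))) / s)
           - (LBINT s:{1..}. exp (- q * min_of (F s)) / s)))"
proof -
  interpret clustering p by unfold_locales (rule p)
  define l where "l F t = min_of (F t)" for F :: "real \<Rightarrow> real measure" and t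
  have S: "solves (l F) F" if "eternal_solution p F" for F
    unfolding l_def by (rule eternal_solves[OF that])
  have a: "\<exists>H. generating_measure H \<and> divergent H \<and> gm_converges (Gt F ks) H (at_right 0)
      \<and> (\<forall>q>0. laplace_exponent H q = exp (Kf (l F) q))" if F: "eternal_solution p F" for F
  proof -
    obtain H where H: "generating_measure H" "divergent H" "\<And>q. q > 0 \<Longrightarrow> laplace_exponent H q = exp (Kf (l F) q)"
      by (rule solves_generating_exists[OF S[OF F] ks]) blast
    have "gm_converges (Gt F ks) H (at_right 0)" by (rule solves_gm_converges[OF S[OF F] ks H(1,3)])
    with H show ?thesis by blast
  qed
  \<comment> \<open>An arbitrary limit \<open>H\<close> of \<open>Gt F ks\<close> is identified with
    the one constructed from \<open>F\<close> by uniqueness of limits.\<close>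
  have K: "Kf (l F) q = ln (laplace_exponent H q)"
    if F: "eternal_solution p F" and H: "generating_measure H" "gm_converges (Gt F ks) H (at_right 0)" and q: "q > 0" for F H q
  proof -
    obtain H' where H': "generating_measure H'" "gm_converges (Gt F ks) H' (at_right 0)"
      "\<forall>q>0. laplace_exponent H' q = exp (Kf (l F) q)" using a[OF F] by blast
    have "H' = H" by (rule gm_converges_unique[OF H'(1) H(1) H'(2) H(2) trivial_limit_at_right_real])
    then show ?thesis using H'(3) q by simp
  qed
  have b: "\<exists>F. eternal_solution p F \<and> gm_converges (Gt F ks) H (at_right 0)
      \<and> (\<forall>F'. eternal_solution p F' \<and> gm_converges (Gt F' ks) H (at_right 0) \<longrightarrow> (\<forall>t>0. F' t = F t))"
    if H: "generating_measure H" "divergent H" for H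
  proof -
    obtain m F where mF: "solves m F" and rc: "\<And>s. s > 0 \<Longrightarrow> continuous (at_right s) m"
      and Km: "\<And>q. q > 0 \<Longrightarrow> Kf m q = ln (laplace_exponent H q)" by (rule solves_exists[OF H]) blast
    have gm: "gm_converges (Gt F ks) H (at_right 0)"
      by (rule solves_gm_converges[OF mF ks H(1)]) (simp add: Km laplace_exponent_pos[OF H])
    \<comment> \<open>Another solution with the same limit has the same \<open>Kf\<close>, hence the
      same history up to null sets.\<close>
    have "F' t = F t" if F': "eternal_solution p F'" "gm_converges (Gt F' ks) H (at_right 0)" and t: "t > 0" for F' t
      by (rule solves_unique[OF S[OF F'(1)] mF _ t]) (simp add: K[OF F'(1) H(1) F'(2)] Km)
    with gm solves_eternal(1)[OF mF rc] show ?thesis by blast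
  qed
  have c: "set_integrable lborel {0<..1} (\<lambda>s. (1 - exp (- q * min_of (F s))) / s)
      \<and> set_integrable lborel {1..} (\<lambda>s. exp (- q * min_of (F s)) / s)
      \<and> ln (laplace_exponent H q) = (LBINT s:{0<..1}. (1 - exp (- q * min_of (F s))) / s)
           - (LBINT s:{1..}. exp (- q * min_of (F s)) / s)"
    if F: "eternal_solution p F" and H: "generating_measure H" "gm_converges (Gt F ks) H (at_right 0)" and q: "q > 0" for F H q
  proof -
    note h = solves_hist[OF S[OF F]]
    show ?thesis using histD(4)[OF h q] Kf_eq(2)[OF h q] K[OF F H q, symmetric] unfolding Kf_def l_def by blast
  qed
  show ?thesis using a b c by blast
qed

end
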